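(* Let $M$ be a smooth compact surface (with a Riemannian metric) and let $h : M \to \mathbb{R}^n$ be a degree $1$ harmonic map. Let $\rho_1$ and $\rho_2$ denote the principal curvatures of the image $h(M)$, and let $di\,dj$ denote the area element of the image. Then $$\mathrm{Energy}(h)\ \geq\ \iint_{h(M)}\left(\sqrt{\frac{\rho_1}{\rho_2}}+\sqrt{\frac{\rho_2}{\rho_1}}\right)di\,dj\ \geq\ 2\,\mathrm{Area}(h(M)),$$ whenever the integral makes sense on the image, with the conventions $0/0=1$ and $a/0=\infty$ for $a>0$. Furthermore, when the pullbacks to the domain $M$ of the directions of principal curvature of the image are defined, equality holds in the left-hand inequality if and only if the pullbacks of the two directions of principal curvature are orthogonal in the domain. This orthogonality (and hence equality in the left-hand inequality) occurs when $h$ is radially symmetric.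
   Context: Energy: for $h=(h^1,\dots,h^n): M\to\mathbb{R}^n$, $\mathrm{Energy}(h)=\iint_M |dh|^2$, i.e. in local orthonormal coordinates $(u,v)$ on $M$ the integrand is $\sum_k \big((h^k_u)^2+(h^k_v)^2\big)\,du\,dv$ (there is no factor $1/2$, so a conformal map has energy equal to twice the area of its image). Harmonic: $h$ is harmonic if it is stationary for the energy under compactly supported smooth variations, equivalently each coordinate function $h^k$ is a harmonic function on $M$. The surface $M$ may have boundary. Degree $1$: $h$ covers its image once, so that (up to null sets) integrals over $M$ can be rewritten as integrals over the image $h(M)$ by change of variables. Principal curvatures: these are considered at regular points of the image and defined using the vector-valued second fundamental form $II$ of the image surface in $\mathbb{R}^n$. The directions of principal curvature at a point are an orthonormal pair $e_1,e_2$ of tangent vectors to the image with $II(e_1,e_2)=0$, and $\rho_1=|II(e_1,e_1)|$, $\rho_2=|II(e_2,e_2)|$. For $n=3$ these are the absolute values of the usual principal curvatures. (Thus $\rho_1,\rho_2\ge 0$ are magnitudes; on the image of a harmonic map the two principal curvatures bend to opposite sides, and $\rho_1=\rho_2$ corresponds to zero mean curvature.) In the planar case $\rho_1=\rho_2=0$, one uses $\sqrt{\rho_1/\rho_2}=1$. "The integral makes sense" means that the integrand, with the stated conventions, is defined almost everywhere on the image. Pullbacks of principal directions: at a regular point $p$ of $h$, the pullbacks of the principal directions $e_1,e_2$ at $h(p)$ are the directions in $T_pM$ mapped by $dh_p$ to the directions of $e_1$ and $e_2$; orthogonality is with respect to the metric of $M$. Radially symmetric: $h$ is radially symmetric if it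 has the form $h:(r,\phi)\mapsto(R,\Phi)$, where $(r,\phi)$ are polar (radial and angular) coordinates on the domain, $(R,\Phi)$ are the corresponding coordinates on a rotationally symmetric image surface ($R$ the position along the meridian, $\Phi$ the rotation angle), $R$ is a function of $r$ only and $\Phi$ is a function of $\phi$ only. *)

theory Defs
  imports "HOL-Analysis.Analysis"
begin

section \<open>Smooth maps on subsets of Euclidean spaces\<close>

primrec C_k_on :: "nat \<Rightarrow> ('a::euclidean_space \<Rightarrow> 'b::real_normed_vector) \<Rightarrow> 'a set \<Rightarrow> bool" where
  "C_k_on 0 f W \<longleftrightarrow> continuous_on W f"
| "C_k_on (Suc k) f W \<longleftrightarrow> (\<forall>x\<in>W. f differentiable (at x)) \<and>
     (\<forall>b\<in>Basis. C_k_on k (\<lambda>x. frechet_derivative f (at x) b) W)"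

text \<open>On a set that is not open (a chart image touching the boundary of the half plane),
  smoothness means that there is a smooth extension to an open neighbourhood.\<close>

definition smooth_on :: "'a::euclidean_space set \<Rightarrow> ('a \<Rightarrow> 'b::real_normed_vector) \<Rightarrow> bool" where
  "smooth_on V f \<longleftrightarrow>
     (\<exists>W F. open W \<and> V \<subseteq> W \<and> (\<forall>k. C_k_on k F W) \<and> (\<forall>x\<in>V. F x = f x))"

section \<open>Smooth surfaces with boundary and Riemannian metrics\<close>

text \<open>A chart is a domain together with a coordinate map into the closed upper half plane; the
  points sent to the open half plane are the interior points of the surface.\<close>

type_synonym 'a chart = "'a set \<times> ('a \<Rightarrow> real^2)"

definition half_plane :: "(real^2) set" where
  "half_plane = {z. 0 \<le> z $ 2}"

definition surface_chart :: "'a topology \<Rightarrow> 'a chart \<Rightarrow> bool" where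
  "surface_chart M = (\<lambda>(U, x). openin M U \<and> openin (top_of_set half_plane) (x ` U) \<and>
     homeomorphic_map (subtopology M U) (top_of_set (x ` U)) x)"

definition smooth_surface :: "'a topology \<Rightarrow> 'a chart set \<Rightarrow> bool" where
  "smooth_surface M A \<longleftrightarrow>
     Hausdorff_space M \<and> second_countable M \<and>
     (\<Union>c\<in>A. fst c) = topspace M \<and> (\<forall>c\<in>A. surface_chart M c) \<and>
     (\<forall>(U, x)\<in>A. \<forall>(V, y)\<in>A. smooth_on (x ` (U \<inter> V)) (y \<circ> inv_into U x))"

text \<open>A metric is given by its Gram matrix \<open>g c z\<close> in every chart \<open>c\<close>, as a function of the
  coordinates \<open>z\<close>; the last clause is the transformation law of a covariant 2-tensor.\<close>

definition riemannian_metric :: "'a chart set \<Rightarrow> ('a chart \<Rightarrow> real^2 \<Rightarrow> real^2^2) \<Rightarrow> bool" where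
  "riemannian_metric A g \<longleftrightarrow>
     (\<forall>(U, x)\<in>A. smooth_on (x ` U) (g (U, x)) \<and>
        (\<forall>z\<in>x ` U. transpose (g (U, x) z) = g (U, x) z \<and>
           (\<forall>a. a \<noteq> 0 \<longrightarrow> 0 < a \<bullet> (g (U, x) z *v a)))) \<and>
     (\<forall>(U, x)\<in>A. \<forall>(V, y)\<in>A. \<forall>p\<in>U \<inter> V. \<forall>a b.
        (let D = frechet_derivative (y \<circ> inv_into U x) (at (x p) within x ` (U \<inter> V))
         in a \<bullet> (g (U, x) (x p) *v b) = D a \<bullet> (g (V, y) (y p) *v D b)))"

definition riemannian_area ::
  "'a topology \<Rightarrow> 'a chart set \<Rightarrow> ('a chart \<Rightarrow> real^2 \<Rightarrow> real^2^2) \<Rightarrow> 'a measure" where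
  "riemannian_area M A g = (THE \<mu>. space \<mu> = topspace M \<and>
     sets \<mu> = sigma_sets (topspace M) {U. openin M U} \<and>
     (\<forall>(U, x)\<in>A. \<forall>B\<in>sets \<mu>. B \<subseteq> U \<longrightarrow>
        emeasure \<mu> B = (\<integral>\<^sup>+z\<in>x ` B. ennreal (sqrt (det (g (U, x) z))) \<partial>lborel)))"

text \<open>The tangent space of the surface at \<open>p\<close> is represented by the coordinate plane of one chart
  chosen at \<open>p\<close>. Tangent vectors, the metric and differentials are all expressed in that chart, so
  that the notions built from them below do not depend on the choice.\<close>

definition chart_at :: "'a chart set \<Rightarrow> 'a \<Rightarrow> 'a chart" where
  "chart_at A p = (SOME c. c \<in> A \<and> p \<in> fst c)"

definition metric_matrix ::
  "'a chart set \<Rightarrow> ('a chart \<Rightarrow> real^2 \<Rightarrow> real^2^2) \<Rightarrow> 'a \<Rightarrow> real^2^2" where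
  "metric_matrix A g p = g (chart_at A p) (snd (chart_at A p) p)"

definition metric_inner ::
  "'a chart set \<Rightarrow> ('a chart \<Rightarrow> real^2 \<Rightarrow> real^2^2) \<Rightarrow> 'a \<Rightarrow> real^2 \<Rightarrow> real^2 \<Rightarrow> real" where
  "metric_inner A g p a b = a \<bullet> (metric_matrix A g p *v b)"

definition differential ::
  "'a chart set \<Rightarrow> ('a \<Rightarrow> 'b::real_normed_vector) \<Rightarrow> 'a \<Rightarrow> real^2 \<Rightarrow> 'b" where
  "differential A h p = (let (U, x) = chart_at A p
     in frechet_derivative (h \<circ> inv_into U x) (at (x p) within x ` U))"

section \<open>Energy, harmonic maps and degree one\<close>

definition smooth_function :: "'a chart set \<Rightarrow> ('a \<Rightarrow> 'b::real_normed_vector) \<Rightarrow> bool" where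
  "smooth_function A f \<longleftrightarrow> (\<forall>(U, x)\<in>A. smooth_on (x ` U) (f \<circ> inv_into U x))"

text \<open>The squared norm of \<open>dh\<close> is the trace of the pulled back Euclidean metric with respect to the
  metric of the surface; there is no factor 1/2 in the energy.\<close>

definition energy_density ::
  "'a chart set \<Rightarrow> ('a chart \<Rightarrow> real^2 \<Rightarrow> real^2^2) \<Rightarrow> ('a \<Rightarrow> real^'n) \<Rightarrow> 'a \<Rightarrow> real" where
  "energy_density A g h p = (\<Sum>i\<in>UNIV. \<Sum>j\<in>UNIV. matrix_inv (metric_matrix A g p) $ i $ j *
     (differential A h p (axis i 1) \<bullet> differential A h p (axis j 1)))"

definition Energy ::
  "'a topology \<Rightarrow> 'a chart set \<Rightarrow> ('a chart \<Rightarrow> real^2 \<Rightarrow> real^2^2) \<Rightarrow> ('a \<Rightarrow> real^'n) \<Rightarrow> ennreal" where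
  "Energy M A g h = (\<integral>\<^sup>+p. ennreal (energy_density A g h p) \<partial>riemannian_area M A g)"

text \<open>The Laplace-Beltrami operator in coordinates, for a Gram matrix field \<open>G\<close>.\<close>

definition laplace_beltrami :: "(real^2 \<Rightarrow> real^2^2) \<Rightarrow> (real^2 \<Rightarrow> real) \<Rightarrow> real^2 \<Rightarrow> real" where
  "laplace_beltrami G f z = 1 / sqrt (det (G z)) *
     (\<Sum>i\<in>UNIV. frechet_derivative
        (\<lambda>y. sqrt (det (G y)) *
           (\<Sum>j\<in>UNIV. matrix_inv (G y) $ i $ j * frechet_derivative f (at y) (axis j 1)))
        (at z) (axis i 1))"

definition harmonic_function ::
  "'a chart set \<Rightarrow> ('a chart \<Rightarrow> real^2 \<Rightarrow> real^2^2) \<Rightarrow> ('a \<Rightarrow> real) \<Rightarrow> bool" where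
  "harmonic_function A g f \<longleftrightarrow> smooth_function A f \<and>
     (\<forall>(U, x)\<in>A. \<forall>z\<in>x ` U. 0 < z $ 2 \<longrightarrow>
        laplace_beltrami (g (U, x)) (f \<circ> inv_into U x) z = 0)"

definition harmonic_map ::
  "'a chart set \<Rightarrow> ('a chart \<Rightarrow> real^2 \<Rightarrow> real^2^2) \<Rightarrow> ('a \<Rightarrow> real^'n) \<Rightarrow> bool" where
  "harmonic_map A g h \<longleftrightarrow> (\<forall>k. harmonic_function A g (\<lambda>p. h p $ k))"

text \<open>Away from a null set, the map is injective and an immersion. The immersion clause is what
  allows the energy, and not only the area, to be rewritten as an integral over the image. For a
  harmonic map it is a consequence of the injectivity off a null set, by unique continuation.\<close>

definition degree_one ::
  "'a topology \<Rightarrow> 'a chart set \<Rightarrow> ('a chart \<Rightarrow> real^2 \<Rightarrow> real^2^2) \<Rightarrow> ('a \<Rightarrow> real^'n) \<Rightarrow> bool" where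
  "degree_one M A g h \<longleftrightarrow> (\<exists>N\<in>null_sets (riemannian_area M A g).
     inj_on h (topspace M - N) \<and> (\<forall>p\<in>topspace M - N. inj (differential A h p)))"

section \<open>Surface area on subsets of Euclidean space\<close>

text \<open>The two-dimensional Hausdorff measure, normalised so that a unit square has area 1, that is,
  so that it agrees with Lebesgue measure in the plane.\<close>

definition hausdorff2_delta :: "real \<Rightarrow> 'a::metric_space set \<Rightarrow> ennreal" where
  "hausdorff2_delta \<delta> S =
     (INF C\<in>{C :: nat \<Rightarrow> 'a set. S \<subseteq> (\<Union>i. C i) \<and> (\<forall>i. bounded (C i) \<and> diameter (C i) \<le> \<delta>)}.
        \<Sum>i. ennreal ((diameter (C i))\<^sup>2))"

definition hausdorff2_raw :: "'a::metric_space set \<Rightarrow> ennreal" where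
  "hausdorff2_raw S = (SUP \<delta>\<in>{0<..}. hausdorff2_delta \<delta> S)"

definition hausdorff2 :: "'a::metric_space measure" where
  "hausdorff2 = measure_of UNIV (sets borel)
     (\<lambda>S. hausdorff2_raw S / hausdorff2_raw (cbox 0 1 :: (real^2) set))"

section \<open>Second fundamental form and principal curvatures\<close>

text \<open>\<open>regular_patch S q \<phi> U z\<close>: near \<open>q = \<phi> z\<close> the set \<open>S\<close> is an embedded smooth surface, with
  local parametrisation \<open>\<phi>\<close> on the open set \<open>U\<close>.\<close>

definition regular_patch ::
  "(real^'n) set \<Rightarrow> real^'n \<Rightarrow> (real^2 \<Rightarrow> real^'n) \<Rightarrow> (real^2) set \<Rightarrow> real^2 \<Rightarrow> bool" where
  "regular_patch S q \<phi> U z \<longleftrightarrow> open U \<and> z \<in> U \<and> \<phi> z = q \<and> smooth_on U \<phi> \<and>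
     (\<forall>y\<in>U. inj (frechet_derivative \<phi> (at y))) \<and>
     (\<exists>W \<psi>. open W \<and> homeomorphism U (S \<inter> W) \<phi> \<psi>)"

definition tangent_plane :: "(real^'n) set \<Rightarrow> real^'n \<Rightarrow> (real^'n) set" where
  "tangent_plane S q =
     {v. \<exists>\<phi> U z a. regular_patch S q \<phi> U z \<and> v = frechet_derivative \<phi> (at z) a}"

definition normal_part :: "'b::euclidean_space set \<Rightarrow> 'b \<Rightarrow> 'b" where
  "normal_part T v = (THE k. v - k \<in> T \<and> (\<forall>w\<in>T. w \<bullet> k = 0))"

definition second_derivative ::
  "('a::real_normed_vector \<Rightarrow> 'b::real_normed_vector) \<Rightarrow> 'a \<Rightarrow> 'a \<Rightarrow> 'a \<Rightarrow> 'b" where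
  "second_derivative \<phi> z a b =
     frechet_derivative (\<lambda>y. frechet_derivative \<phi> (at y) a) (at z) b"

definition second_fundamental_form ::
  "(real^'n) set \<Rightarrow> real^'n \<Rightarrow> real^'n \<Rightarrow> real^'n \<Rightarrow> real^'n" where
  "second_fundamental_form S q v w = (THE k. \<exists>\<phi> U z a b. regular_patch S q \<phi> U z \<and>
     v = frechet_derivative \<phi> (at z) a \<and> w = frechet_derivative \<phi> (at z) b \<and>
     k = normal_part (tangent_plane S q) (second_derivative \<phi> z a b))"

definition principal_directions :: "(real^'n) set \<Rightarrow> real^'n \<Rightarrow> real^'n \<Rightarrow> real^'n \<Rightarrow> bool" where
  "principal_directions S q e1 e2 \<longleftrightarrow>
     e1 \<in> tangent_plane S q \<and> e2 \<in> tangent_plane S q \<and>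
     norm e1 = 1 \<and> norm e2 = 1 \<and> e1 \<bullet> e2 = 0 \<and> second_fundamental_form S q e1 e2 = 0"

definition principal_curvature :: "(real^'n) set \<Rightarrow> real^'n \<Rightarrow> real^'n \<Rightarrow> real" where
  "principal_curvature S q e = norm (second_fundamental_form S q e e)"

text \<open>The square root of \<open>a / b\<close> for \<open>a, b \<ge> 0\<close>, with \<open>0 / 0 = 1\<close> and \<open>a / 0 = \<infinity>\<close> for \<open>a > 0\<close>.\<close>

definition sqrt_ratio :: "real \<Rightarrow> real \<Rightarrow> ennreal" where
  "sqrt_ratio a b =
     (if b = 0 then (if a = 0 then 1 else \<infinity>) else ennreal (sqrt (a / b)))"

text \<open>Meaningful at points with principal directions; different choices of the pair
  give the same value.\<close>

definition curvature_integrand :: "(real^'n) set \<Rightarrow> real^'n \<Rightarrow> ennreal" where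
  "curvature_integrand S q =
     (let (e1, e2) = (SOME (e1, e2). principal_directions S q e1 e2);
          \<rho>1 = principal_curvature S q e1;
          \<rho>2 = principal_curvature S q e2
      in sqrt_ratio \<rho>1 \<rho>2 + sqrt_ratio \<rho>2 \<rho>1)"

definition integrand_defined :: "(real^'n) set \<Rightarrow> bool" where
  "integrand_defined S \<longleftrightarrow>
     (AE q in hausdorff2. q \<in> S \<longrightarrow> (\<exists>e1 e2. principal_directions S q e1 e2))"

text \<open>Almost everywhere there is exactly one pair of principal directions, up to order and signs.
  (At a point where the second fundamental form vanishes every orthonormal tangent pair qualifies,
  and no particular directions are singled out.)\<close>

definition directions_determined :: "(real^'n) set \<Rightarrow> bool" where
  "directions_determined S \<longleftrightarrow>
     (AE q in hausdorff2. q \<in> S \<longrightarrow> (\<exists>e1 e2. principal_directions S q e1 e2 \<and>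
        (\<forall>f1 f2. principal_directions S q f1 f2 \<longrightarrow> f1 \<in> {e1, - e1, e2, - e2})))"

definition pullbacks_orthogonal ::
  "'a topology \<Rightarrow> 'a chart set \<Rightarrow> ('a chart \<Rightarrow> real^2 \<Rightarrow> real^2^2) \<Rightarrow> ('a \<Rightarrow> real^'n) \<Rightarrow> bool" where
  "pullbacks_orthogonal M A g h \<longleftrightarrow> (AE p in riemannian_area M A g.
     \<forall>e1 e2. principal_directions (h ` topspace M) (h p) e1 e2 \<longrightarrow>
       (\<exists>a b. differential A h p a = e1 \<and> differential A h p b = e2 \<and>
          metric_inner A g p a b = 0))"

section \<open>Radially symmetric maps\<close>

text \<open>Polar coordinates \<open>(r, \<phi>)\<close> covering the surface up to a null set (poles and a cut ray), given
  by the inverse of the coordinate map. As for geodesic polar coordinates, the line element has the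
  form \<open>dr\<^sup>2 + f\<^sup>2 d\<phi>\<^sup>2\<close>; \<open>f\<close> may depend on both coordinates.\<close>

definition polar_coordinates ::
  "'a topology \<Rightarrow> 'a chart set \<Rightarrow> ('a chart \<Rightarrow> real^2 \<Rightarrow> real^2^2) \<Rightarrow>
     (real \<times> real) set \<Rightarrow> (real \<times> real \<Rightarrow> 'a) \<Rightarrow> bool" where
  "polar_coordinates M A g D \<psi> \<longleftrightarrow>
     open D \<and> D \<subseteq> {0<..} \<times> {0<..<2 * pi} \<and>
     continuous_map (top_of_set D) M \<psi> \<and> inj_on \<psi> D \<and>
     topspace M - \<psi> ` D \<in> null_sets (riemannian_area M A g) \<and>
     (\<forall>(U, x)\<in>A. smooth_on (D \<inter> \<psi> -` U) (x \<circ> \<psi>)) \<and>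
     (\<forall>z\<in>D. let d = frechet_derivative (snd (chart_at A (\<psi> z)) \<circ> \<psi>) (at z)
        in metric_inner A g (\<psi> z) (d (1, 0)) (d (1, 0)) = 1 \<and>
           metric_inner A g (\<psi> z) (d (1, 0)) (d (0, 1)) = 0 \<and>
           0 < metric_inner A g (\<psi> z) (d (0, 1)) (d (0, 1)))"

text \<open>The image surface arises by rotating the meridian \<open>s \<mapsto> c + \<gamma> s + \<sigma> s *\<^sub>R w1\<close> in the plane of
  \<open>w1, w2\<close>, leaving the orthogonal complement of that plane through \<open>c\<close> fixed (for \<open>n = 3\<close>, a surface
  of revolution).\<close>

definition radially_symmetric ::
  "'a topology \<Rightarrow> 'a chart set \<Rightarrow> ('a chart \<Rightarrow> real^2 \<Rightarrow> real^2^2) \<Rightarrow> ('a \<Rightarrow> real^'n) \<Rightarrow> bool" where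
  "radially_symmetric M A g h \<longleftrightarrow>
     (\<exists>D \<psi> c w1 w2 (J :: real set) \<gamma> \<sigma> R \<Phi>.
        polar_coordinates M A g D \<psi> \<and>
        norm w1 = 1 \<and> norm w2 = 1 \<and> w1 \<bullet> w2 = 0 \<and>
        open J \<and> smooth_on J \<gamma> \<and> smooth_on J \<sigma> \<and>
        (\<forall>s\<in>J. \<gamma> s \<bullet> w1 = 0 \<and> \<gamma> s \<bullet> w2 = 0) \<and>
        smooth_on (fst ` D) R \<and> smooth_on (snd ` D) \<Phi> \<and> R ` fst ` D \<subseteq> J \<and>
        (\<forall>(r, \<phi>)\<in>D. h (\<psi> (r, \<phi>)) = c + \<gamma> (R r) +
           \<sigma> (R r) *\<^sub>R (cos (\<Phi> \<phi>) *\<^sub>R w1 + sin (\<Phi> \<phi>) *\<^sub>R w2)))"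

end

theory Submission
  imports Defs
begin

text \<open>The proof compares the energy with the area of the image point by point. At a regular point let
\<open>L\<close> be the differential of \<open>h\<close>, let \<open>g\<close> be the metric, and let \<open>a\<close>, \<open>b\<close> be the tangent vectors
that \<open>L\<close> maps to an orthonormal pair \<open>e1\<close>, \<open>e2\<close> of principal directions. Written in the basis
\<open>a\<close>, \<open>b\<close>, the energy density is \<open>(g a a + g b b) / \<Delta>\<close> and the Jacobian of \<open>h\<close> is \<open>1 / sqrt \<Delta>\<close>, where
\<open>\<Delta> = g a a * g b b - (g a b)\<^sup>2\<close>. The energy per unit of image area is therefore
\<open>(g a a + g b b) / sqrt \<Delta>\<close>; this quotient is called the dilation below.

Harmonicity enters through a single identity. The Laplace-Beltrami operator applied to \<open>h\<close> is the
trace, with respect to \<open>g\<close>, of the second derivatives of \<open>h\<close>, plus first order terms that are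
tangent to the image. Its vanishing makes the \<open>g\<close>-trace of the pulled back second fundamental form
vanish (lemma \<open>second_fundamental_form_chart\<close>). In the basis \<open>a\<close>, \<open>b\<close>, in which the second
fundamental form is diagonal, this says \<open>g b b *\<^sub>R II e1 e1 + g a a *\<^sub>R II e2 e2 = 0\<close>, so that
\<open>\<rho>1 / \<rho>2 = g a a / g b b\<close> and the curvature integrand equals \<open>(g a a + g b b) / sqrt (g a a * g b b)\<close>.
The left-hand inequality amounts to dropping the square of \<open>g a b\<close> in \<open>\<Delta>\<close>, with equality exactly when
\<open>g a b = 0\<close>; the right-hand one is the inequality between the arithmetic and the geometric mean. Where
both curvatures vanish the integrand is 2 and every orthonormal tangent pair is principal; equality
then forces \<open>L\<close> to be conformal. This is \<open>harmonic_pointwise\<close>, based on the locale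
\<open>minimal_trace_data\<close>.

Three things separate the pointwise statement from the integrated one.

First, the area of the image is a Hausdorff measure. It is shown to be a Borel measure and to agree
with Lebesgue measure in the plane (\<open>hausdorff2_plane\<close>); an injective immersion is locally almost
a linear map, which gives the area formula \<open>area_formula_integral\<close>. The area formula also shows that
the Riemannian area exists, because the contributions of two charts agree on their overlap. As \<open>h\<close> is
injective off a null set, the energy becomes the integral of the dilation over the image
(\<open>dilation_transfer_exists\<close>), and null sets can be moved in both directions.

Second, the second fundamental form of the image is defined through local parametrisations, and \<open>h\<close>
read in a chart need not be one of them: other parts of \<open>M\<close> may be mapped near the same point.
The identity above needs the form along \<open>h\<close> itself. A twice differentiable curve in a surface has an
acceleration whose normal part depends on its velocity only (\<open>regular_patch_curve\<close>), and by
polarisation every smooth map into the surface computes the form (\<open>second_fundamental_form_map\<close>).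

Third, nothing guarantees that the curvature integrand is measurable, so its integral is a lower
integral. The inequalities survive, and since the energy is finite, equality of the integrals still
forces equality almost everywhere (\<open>AE_eq_if_nn_integral_eq\<close>).

For a radially symmetric map, the coordinate directions of the polar coordinates are orthogonal in
\<open>M\<close>. They are mapped to the directions of a meridian and of a parallel of a surface of revolution,
which are orthogonal, and the mixed second derivative of the parametrisation points along the
parallel, so it has no normal part. These directions are therefore principal, and where the principal
directions are determined they are the only ones.\<close>

section \<open>Metric outer measures and Hausdorff measure\<close>

lemma hausdorff2_delta_le_cover:
  assumes "S \<subseteq> (\<Union>i. C i)" "\<And>i. bounded (C i)" "\<And>i. diameter (C i) \<le> \<delta>"
  shows "hausdorff2_delta \<delta> S \<le> (\<Sum>i. ennreal ((diameter (C i))\<^sup>2))"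
  unfolding hausdorff2_delta_def by (rule INF_lower) (use assms in auto)

lemma hausdorff2_delta_mono: "S \<subseteq> T \<Longrightarrow> hausdorff2_delta \<delta> S \<le> hausdorff2_delta \<delta> T"
  unfolding hausdorff2_delta_def by (rule INF_superset_mono) auto

lemma hausdorff2_delta_antimono: "\<delta> \<le> \<epsilon> \<Longrightarrow> hausdorff2_delta \<epsilon> S \<le> hausdorff2_delta \<delta> S"
  unfolding hausdorff2_delta_def by (rule INF_superset_mono) (auto intro: order_trans)

lemma hausdorff2_delta_empty: "0 \<le> \<delta> \<Longrightarrow> hausdorff2_delta \<delta> {} = 0"
  using hausdorff2_delta_le_cover[of "{}" "\<lambda>_. {}" \<delta>] by simp

text \<open>Near-optimal covers of the sets \<open>S n\<close>, with the error \<open>e\<close>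
  divided into a geometric series, are enumerated along the diagonal into one cover of the
  union.\<close>

lemma hausdorff2_delta_subadditive:
  "hausdorff2_delta \<delta> (\<Union>n::nat. S n) \<le> (\<Sum>n. hausdorff2_delta \<delta> (S n))"
proof (cases "(\<Sum>n. hausdorff2_delta \<delta> (S n)) = \<infinity>")
  case False
  have fin: "hausdorff2_delta \<delta> (S n) \<noteq> \<infinity>" for n
    using False ennreal_suminf_lessD[of "\<lambda>n. hausdorff2_delta \<delta> (S n)" \<infinity> n] by (auto simp: less_top)
  show ?thesis
  proof (rule ennreal_le_epsilon)
    fix e :: real assume "0 < e"
    have "\<exists>C. S n \<subseteq> (\<Union>i::nat. C i) \<and> (\<forall>i. bounded (C i) \<and> diameter (C i) \<le> \<delta>) \<and>
       (\<Sum>i. ennreal ((diameter (C i))\<^sup>2)) < hausdorff2_delta \<delta> (S n) + ennreal (e * (1/2)^Suc n)" for n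
    proof -
      have "0 < e * (1/2)^Suc n" using \<open>0 < e\<close> by simp
      from INF_approx_ennreal[OF this hausdorff2_delta_def[of \<delta> "S n"]] fin[of n]
      show ?thesis by blast
    qed
    then obtain C where C: "\<And>n. S n \<subseteq> (\<Union>i::nat. C n i)" "\<And>n i. bounded (C n i)"
      "\<And>n i. diameter (C n i) \<le> \<delta>"
      "\<And>n. (\<Sum>i. ennreal ((diameter (C n i))\<^sup>2)) < hausdorff2_delta \<delta> (S n) + ennreal (e * (1/2)^Suc n)"
      by metis
    define B where "B = (\<lambda>k. C (fst (prod_decode k)) (snd (prod_decode k)))"
    have cov: "(\<Union>n. S n) \<subseteq> (\<Union>k. B k)"
    proof
      fix x assume "x \<in> (\<Union>n. S n)"
      then obtain n i where "x \<in> C n i" using C(1) by blast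
      then have "x \<in> B (prod_encode (n, i))" by (simp add: B_def)
      then show "x \<in> (\<Union>k. B k)" by blast
    qed
    have "hausdorff2_delta \<delta> (\<Union>n. S n) \<le> (\<Sum>k. ennreal ((diameter (B k))\<^sup>2))"
      by (rule hausdorff2_delta_le_cover) (use cov C in \<open>auto simp: B_def\<close>)
    also have "\<dots> = (\<Sum>n. \<Sum>i. ennreal ((diameter (C n i))\<^sup>2))"
      using suminf_ennreal_2dimen[OF refl, of "\<lambda>p. ennreal ((diameter (C (fst p) (snd p)))\<^sup>2)"]
      by (simp add: B_def)
    also have "\<dots> \<le> (\<Sum>n. hausdorff2_delta \<delta> (S n) + ennreal (e * (1/2)^Suc n))"
      by (rule suminf_le) (use C(4) less_imp_le in auto)
    also have "\<dots> = (\<Sum>n. hausdorff2_delta \<delta> (S n)) + (\<Sum>n. ennreal (e * (1/2)^Suc n))"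
      by (rule suminf_add[symmetric]) auto
    also have "(\<Sum>n. ennreal (e * (1/2)^Suc n)) = ennreal e"
    proof (rule suminf_ennreal_eq)
      show "0 \<le> e * (1/2)^Suc n" for n using \<open>0 < e\<close> by simp
      show "(\<lambda>n. e * (1/2)^Suc n) sums e"
        using sums_mult[OF power_half_series, of e] by simp
    qed
    finally show "hausdorff2_delta \<delta> (\<Union>n. S n) \<le> (\<Sum>n. hausdorff2_delta \<delta> (S n)) + ennreal e" .
  qed
qed simp

lemma hausdorff2_raw_mono: "S \<subseteq> T \<Longrightarrow> hausdorff2_raw S \<le> hausdorff2_raw T"
  unfolding hausdorff2_raw_def by (intro SUP_mono) (use hausdorff2_delta_mono in blast)

lemma hausdorff2_raw_empty [simp]: "hausdorff2_raw {} = 0"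
proof -
  have "hausdorff2_raw ({} :: 'a set) \<le> 0"
    unfolding hausdorff2_raw_def by (rule SUP_least) (simp add: hausdorff2_delta_empty)
  then show ?thesis by simp
qed

lemma hausdorff2_raw_subadditive:
  "hausdorff2_raw (\<Union>n::nat. S n) \<le> (\<Sum>n. hausdorff2_raw (S n))"
  unfolding hausdorff2_raw_def[of "\<Union>n::nat. S n"]
proof (rule SUP_least)
  fix \<delta> :: real assume "\<delta> \<in> {0<..}"
  then show "hausdorff2_delta \<delta> (\<Union>n. S n) \<le> (\<Sum>n. hausdorff2_raw (S n))"
    by (intro order_trans[OF hausdorff2_delta_subadditive] suminf_le)
       (auto simp: hausdorff2_raw_def intro!: SUP_upper)
qed

text \<open>The defining supremum is a limit along the meshes \<open>1 / (n + 1)\<close>, so that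
  inequalities between covers of small mesh pass to \<open>hausdorff2_raw\<close>.\<close>

lemma hausdorff2_raw_limit: "(\<lambda>n. hausdorff2_delta (1 / real (Suc n)) S) \<longlonglongrightarrow> hausdorff2_raw S"
proof -
  have inc: "incseq (\<lambda>n. hausdorff2_delta (1 / real (Suc n)) S)"
    by (intro incseq_SucI hausdorff2_delta_antimono) (auto simp: field_simps)
  have "hausdorff2_raw S = (SUP n. hausdorff2_delta (1 / real (Suc n)) S)"
    unfolding hausdorff2_raw_def
  proof (rule antisym)
    show "(SUP \<delta>\<in>{0<..}. hausdorff2_delta \<delta> S) \<le> (SUP n. hausdorff2_delta (1 / real (Suc n)) S)"
    proof (rule SUP_mono)
      fix \<delta> :: real assume "\<delta> \<in> {0<..}"
      then obtain n where "1 / real (Suc n) < \<delta>" using reals_Archimedean[of \<delta>] by (auto simp: inverse_eq_divide)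
      then show "\<exists>n\<in>UNIV. hausdorff2_delta \<delta> S \<le> hausdorff2_delta (1 / real (Suc n)) S"
        by (intro bexI[of _ n] hausdorff2_delta_antimono) auto
    qed
    show "(SUP n. hausdorff2_delta (1 / real (Suc n)) S) \<le> (SUP \<delta>\<in>{0<..}. hausdorff2_delta \<delta> S)"
      by (rule SUP_least) (rule SUP_upper, auto)
  qed
  then show ?thesis using LIMSEQ_SUP[OF inc] by simp
qed

lemma diameter_sq_separated_split:
  fixes S T C :: "'a::metric_space set"
  assumes "\<And>x y. x \<in> S \<Longrightarrow> y \<in> T \<Longrightarrow> d \<le> dist x y" "bounded C" "diameter C < d"
  shows "ennreal ((diameter (C \<inter> S))\<^sup>2) + ennreal ((diameter (C \<inter> T))\<^sup>2) \<le> ennreal ((diameter C)\<^sup>2)"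
proof -
  have "C \<inter> S = {} \<or> C \<inter> T = {}"
    using assms diameter_bounded_bound[OF assms(2)] by force
  moreover have "diameter (C \<inter> X) \<le> diameter C" for X
    by (rule diameter_subset) (use assms in auto)
  then have "ennreal ((diameter (C \<inter> X))\<^sup>2) \<le> ennreal ((diameter C)\<^sup>2)" for X
    by (intro ennreal_leI power_mono diameter_ge_0 bounded_subset[OF assms(2)]) auto
  ultimately show ?thesis by auto
qed

text \<open>A cover of mesh less than \<open>d\<close> splits: each of its members meets at most one
  of two sets at distance \<open>d\<close>.\<close>

lemma hausdorff2_raw_separated:
  fixes S T :: "'a::metric_space set"
  assumes "\<And>x y. x \<in> S \<Longrightarrow> y \<in> T \<Longrightarrow> d \<le> dist x y" "0 < d"
  shows "hausdorff2_raw S + hausdorff2_raw T \<le> hausdorff2_raw (S \<union> T)"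
proof -
  have *: "hausdorff2_delta \<delta> S + hausdorff2_delta \<delta> T \<le> hausdorff2_delta \<delta> (S \<union> T)"
    if "\<delta> < d" for \<delta>
    unfolding hausdorff2_delta_def[of \<delta> "S \<union> T"]
  proof (rule INF_greatest, clarify)
    fix C :: "nat \<Rightarrow> 'a set"
    assume C: "S \<union> T \<subseteq> (\<Union>i. C i)" "\<forall>i. bounded (C i) \<and> diameter (C i) \<le> \<delta>"
    have sub: "diameter (C i \<inter> X) \<le> \<delta>" for i X
      using diameter_subset[of "C i \<inter> X" "C i"] C(2) by (meson Int_lower1 order_trans)
    have "hausdorff2_delta \<delta> S + hausdorff2_delta \<delta> T
      \<le> (\<Sum>i. ennreal ((diameter (C i \<inter> S))\<^sup>2)) + (\<Sum>i. ennreal ((diameter (C i \<inter> T))\<^sup>2))"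
      by (intro add_mono hausdorff2_delta_le_cover) (use C sub in \<open>auto intro: bounded_subset\<close>)
    also have "\<dots> = (\<Sum>i. ennreal ((diameter (C i \<inter> S))\<^sup>2) + ennreal ((diameter (C i \<inter> T))\<^sup>2))"
      by (rule suminf_add) auto
    also have "\<dots> \<le> (\<Sum>i. ennreal ((diameter (C i))\<^sup>2))"
      by (intro suminf_le diameter_sq_separated_split[OF assms(1)]) (use C that in \<open>auto intro: le_less_trans\<close>)
    finally show "hausdorff2_delta \<delta> S + hausdorff2_delta \<delta> T \<le> (\<Sum>i. ennreal ((diameter (C i))\<^sup>2))" .
  qed
  obtain N where N: "1 / real (Suc N) < d" using reals_Archimedean[OF \<open>0 < d\<close>] by (auto simp: inverse_eq_divide)
  show ?thesis
  proof (rule LIMSEQ_le[OF tendsto_add[OF hausdorff2_raw_limit hausdorff2_raw_limit] hausdorff2_raw_limit])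
    show "\<exists>N. \<forall>n\<ge>N. hausdorff2_delta (1 / real (Suc n)) S + hausdorff2_delta (1 / real (Suc n)) T
        \<le> hausdorff2_delta (1 / real (Suc n)) (S \<union> T)"
    proof (intro exI[of _ N] allI impI *)
      fix n assume "N \<le> n"
      then have "1 / real (Suc n) \<le> 1 / real (Suc N)" by (simp add: field_simps)
      then show "1 / real (Suc n) < d" using N by linarith
    qed
  qed
qed

text \<open>The sets \<open>D k\<close> lie in consecutive annuli around \<open>F\<close>. Annuli of
  equal parity are separated by the annulus between them, so the outer measure adds up over every
  second one.\<close>

lemma annuli_same_parity_superadditive:
  fixes f :: "'a::metric_space set \<Rightarrow> ennreal" and D :: "nat \<Rightarrow> 'a set"
  assumes emp: "f {} = 0" and mono: "\<And>S T. S \<subseteq> T \<Longrightarrow> f S \<le> f T"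
    and sep: "\<And>S T d. 0 < d \<Longrightarrow> (\<And>x y. x \<in> S \<Longrightarrow> y \<in> T \<Longrightarrow> d \<le> dist x y) \<Longrightarrow> f S + f T \<le> f (S \<union> T)"
    and ann: "\<And>k x. x \<in> D k \<Longrightarrow> 1 / real (k + 2) \<le> infdist x F \<and> infdist x F < 1 / real (k + 1)"
  shows "(\<Sum>k<m. f (D (2 * k + c))) \<le> f (\<Union>k<m. D (2 * k + c))"
proof (induction m)
  case (Suc m)
  define e where "e = 1 / real (2 * m + c) - 1 / real (2 * m + c + 1)"
  have "(\<Sum>k<Suc m. f (D (2 * k + c))) \<le> f (\<Union>k<m. D (2 * k + c)) + f (D (2 * m + c))"
    using Suc by (simp add: add_right_mono)
  also have "\<dots> \<le> f ((\<Union>k<m. D (2 * k + c)) \<union> D (2 * m + c))"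
  proof (cases "m = 0")
    case False
    then have "1 / real (2 * m + c + 1) < 1 / real (2 * m + c)" by (intro divide_strict_left_mono) auto
    then have "0 < e" by (simp add: e_def)
    then show ?thesis
    proof (rule sep)
      fix x y assume "x \<in> (\<Union>k<m. D (2 * k + c))" and y: "y \<in> D (2 * m + c)"
      then obtain k where k: "k < m" "x \<in> D (2 * k + c)" by auto
      have "1 / real (2 * m + c) \<le> 1 / real (2 * k + c + 2)" using k(1) by (simp add: field_simps)
      then have "1 / real (2 * m + c) \<le> infdist x F" using ann[OF k(2)] by linarith
      moreover have "infdist x F \<le> infdist y F + dist x y" by (rule infdist_triangle)
      moreover have "infdist y F < 1 / real (2 * m + c + 1)" using ann[OF y] by simp
      ultimately show "e \<le> dist x y" unfolding e_def by linarith
    qed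
  qed (simp add: emp)
  also have "\<dots> \<le> f (\<Union>k<Suc m. D (2 * k + c))" by (rule mono) (auto simp: lessThan_Suc)
  finally show ?case .
qed (simp add: emp)

lemma sum_two_parities: "(\<Sum>k<2 * m. f k) = (\<Sum>k<m. f (2 * k)) + (\<Sum>k<m. f (2 * k + 1))"
  for f :: "nat \<Rightarrow> ennreal"
  by (induction m) (auto simp: algebra_simps)

text \<open>Caratheodory's criterion for closed sets. The part of \<open>A\<close> at distance at
  least \<open>1 / (n + 1)\<close> from \<open>F\<close> is separated from \<open>F\<close>, and
  what remains of \<open>A - F\<close> is covered by a tail of the annuli \<open>D k\<close>, which
  is small because the annuli of each parity have total measure at most \<open>f A\<close>.\<close>

lemma metric_outer_measure_closed_split:
  fixes f :: "'a::metric_space set \<Rightarrow> ennreal"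
  assumes emp: "f {} = 0" and mono: "\<And>S T. S \<subseteq> T \<Longrightarrow> f S \<le> f T"
    and subadd: "\<And>S :: nat \<Rightarrow> 'a set. f (\<Union>n. S n) \<le> (\<Sum>n. f (S n))"
    and sep: "\<And>S T d. 0 < d \<Longrightarrow> (\<And>x y. x \<in> S \<Longrightarrow> y \<in> T \<Longrightarrow> d \<le> dist x y) \<Longrightarrow> f S + f T \<le> f (S \<union> T)"
    and F: "closed F"
  shows "f (A \<inter> F) + f (A - F) \<le> f A"
proof (cases "F = {} \<or> f A = \<infinity>")
  case True then show ?thesis by (auto simp: emp)
next
  case False
  define B where "B n = {x \<in> A. 1 / real (n + 1) \<le> infdist x F}" for n
  define D where "D n = {x \<in> A. 1 / real (n + 2) \<le> infdist x F \<and> infdist x F < 1 / real (n + 1)}" for n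
  have un: "A - F = B n \<union> (\<Union>k. D (k + n))" for n
  proof (intro equalityI subsetI)
    fix x assume x: "x \<in> A - F"
    then have pos: "0 < infdist x F" 
    proof -
      have "infdist x F \<noteq> 0" using x False in_closed_iff_infdist_zero[OF F, of x] by simp
      then show ?thesis using infdist_nonneg[of x F] by linarith
    qed
    show "x \<in> B n \<union> (\<Union>k. D (k + n))"
    proof (cases "x \<in> B n")
      case nB: False
      \<comment> \<open>the largest radius \<open>1 / (m + 1)\<close> within the distance of
        \<open>x\<close> from \<open>F\<close> determines its annulus\<close>
      define m where "m = (LEAST m. 1 / real (m + 1) \<le> infdist x F)"
      obtain m' where m': "1 / real (Suc m') < infdist x F"
        using reals_Archimedean[OF pos] by (auto simp: inverse_eq_divide)
      have m: "1 / real (m + 1) \<le> infdist x F" unfolding m_def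
        by (rule LeastI[of _ m']) (use m' in simp)
      have "n < m"
      proof (rule ccontr)
        assume "\<not> n < m"
        then have "1 / real (n + 1) \<le> 1 / real (m + 1)" by (simp add: field_simps)
        then show False using m nB x by (auto simp: B_def)
      qed
      then obtain j where j: "m = Suc (j + n)" by (metis add.commute less_natE)
      have "\<not> (1 / real ((j + n) + 1) \<le> infdist x F)"
        using not_less_Least[of "j + n" "\<lambda>m. 1 / real (m + 1) \<le> infdist x F"] j m_def by auto
      then have "x \<in> D (j + n)" using x m j by (simp add: D_def not_le)
      then show ?thesis by blast
    qed simp
  next
    fix x assume x: "x \<in> B n \<union> (\<Union>k. D (k + n))"
    then obtain k where "1 / real (k + 1) \<le> infdist x F" "x \<in> A"
    proof
      assume "x \<in> (\<Union>k. D (k + n))"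
      then obtain k where "x \<in> D (k + n)" by blast
      then show ?thesis using that[of "k + n + 1"] by (auto simp: D_def)
    qed (auto simp: B_def)
    moreover have "x \<notin> F"
    proof
      assume "x \<in> F"
      then have "infdist x F = 0" by simp
      then show False using calculation(1) by simp
    qed
    ultimately show "x \<in> A - F" by simp
  qed
  have par: "(\<Sum>k<m. f (D (2 * k + c))) \<le> f A" for m c
    by (rule order_trans[OF annuli_same_parity_superadditive[where F = F and f = f and D = D, OF emp mono sep]])
       (auto simp: D_def intro!: mono)
  have "(\<Sum>k<m. f (D k)) \<le> 2 * f A" for m
  proof -
    have "(\<Sum>k<m. f (D k)) \<le> (\<Sum>k<2 * m. f (D k))" by (rule sum_mono2) auto
    also have "\<dots> \<le> f A + f A" unfolding sum_two_parities
      using par[of 0 m] par[of 1 m] par[of m 0] par[of m 1] by (intro add_mono) auto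
    finally show ?thesis by (simp add: mult_2)
  qed
  then have "(\<Sum>k. f (D k)) \<le> 2 * f A" by (simp add: suminf_le_const)
  moreover have "2 * f A < top" using False by (simp add: ennreal_mult_less_top less_top)
  ultimately have fin: "(\<Sum>k. f (D k)) \<noteq> top" by (auto simp: less_top)
  have main: "f (A \<inter> F) + f (A - F) \<le> f A + (\<Sum>k. f (D (k + n)))" for n
  proof -
    have "f (A - F) \<le> f (B n) + (\<Sum>k. f (D (k + n)))"
    proof -
      have "f (B n \<union> (\<Union>k. D (k + n))) \<le> f (\<Union>i. binaryset (B n) (\<Union>k. D (k + n)) i)"
        by (simp add: UN_binaryset_eq)
      also have "\<dots> \<le> (\<Sum>i. f (binaryset (B n) (\<Union>k. D (k + n)) i))" by (rule subadd)
      also have "\<dots> = f (B n) + f (\<Union>k. D (k + n))" by (simp add: suminf_binaryset_eq emp)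
      also have "\<dots> \<le> f (B n) + (\<Sum>k. f (D (k + n)))" by (intro add_left_mono subadd)
      finally show ?thesis unfolding un[of n] .
    qed
    then have "f (A \<inter> F) + f (A - F) \<le> f (A \<inter> F) + f (B n) + (\<Sum>k. f (D (k + n)))"
      by (simp add: add.assoc add_left_mono)
    also have "f (A \<inter> F) + f (B n) \<le> f (A \<inter> F \<union> B n)"
    proof (rule sep[of "1 / real (n + 1)"])
      fix x y assume "x \<in> A \<inter> F" "y \<in> B n"
      then show "1 / real (n + 1) \<le> dist x y"
        using infdist_le[of x F y] by (auto simp: B_def dist_commute)
    qed simp
    also have "\<dots> \<le> f A" by (rule mono) (auto simp: B_def)
    finally show ?thesis by (simp add: add_right_mono)
  qed
  \<comment> \<open>the tail of a convergent series; finiteness of the total is needed to subtract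
    in the extended reals\<close>
  have tail: "(\<lambda>n. \<Sum>k. f (D (k + n))) \<longlonglongrightarrow> 0"
  proof -
    have "(\<lambda>n. (\<Sum>k. f (D k)) - (\<Sum>k<n. f (D k))) \<longlonglongrightarrow> (\<Sum>k. f (D k)) - (\<Sum>k. f (D k))"
      by (intro tendsto_diff_ennreal tendsto_const summable_LIMSEQ) (use fin in auto)
    moreover have "(\<Sum>k. f (D k)) - (\<Sum>k<n. f (D k)) = (\<Sum>k. f (D (k + n)))" for n
    proof -
      have "(\<Sum>k. f (D k)) = (\<Sum>k. f (D (k + n))) + (\<Sum>k<n. f (D k))"
        by (rule suminf_offset) simp
      moreover have "(\<Sum>k<n. f (D k)) \<noteq> top"
        using fin sum_le_suminf[of "\<lambda>k. f (D k)" "{..<n}"] by (metis finite_lessThan summableI top.extremum_unique zero_le)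
      ultimately show ?thesis by (simp add: ennreal_add_diff_cancel_right)
    qed
    ultimately show ?thesis using fin by simp
  qed
  have "(\<lambda>n. f A + (\<Sum>k. f (D (k + n)))) \<longlonglongrightarrow> f A + 0"
    by (intro tendsto_add tendsto_const tail)
  then show ?thesis using LIMSEQ_le_const[of _ "f A" "f (A \<inter> F) + f (A - F)"] main by auto
qed

theorem metric_outer_measure_borel:
  fixes f :: "'a::metric_space set \<Rightarrow> ennreal"
  assumes emp: "f {} = 0" and mono: "\<And>S T. S \<subseteq> T \<Longrightarrow> f S \<le> f T"
    and subadd: "\<And>S :: nat \<Rightarrow> 'a set. f (\<Union>n. S n) \<le> (\<Sum>n. f (S n))"
    and sep: "\<And>S T d. 0 < d \<Longrightarrow> (\<And>x y. x \<in> S \<Longrightarrow> y \<in> T \<Longrightarrow> d \<le> dist x y) \<Longrightarrow> f S + f T \<le> f (S \<union> T)"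
  shows "measure_space UNIV (sets borel) f"
proof -
  interpret sigma_algebra "UNIV :: 'a set" UNIV by (use sigma_algebra_Pow[of "UNIV :: 'a set"] in simp) 
  let ?L = "lambda_system UNIV UNIV f"
  have outer: "outer_measure_space UNIV f"
    using emp mono subadd by (auto simp: outer_measure_space_def positive_def increasing_def countably_subadditive_def)
  have ms: "measure_space UNIV ?L f"
    by (rule caratheodory_lemma[OF outer])
  have "closed F \<Longrightarrow> F \<in> ?L" for F
  proof -
    assume F: "closed F"
    have "f (A \<inter> F) + f (A - F) = f A" for A
    proof (rule antisym)
      show "f (A \<inter> F) + f (A - F) \<le> f A" by (rule metric_outer_measure_closed_split[where f = f, OF emp mono subadd sep F])
      have "f A \<le> (\<Sum>i. f (binaryset (A \<inter> F) (A - F) i))"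
        using subadd[of "binaryset (A \<inter> F) (A - F)"] by (simp add: UN_binaryset_eq Int_Diff_Un)
      then show "f A \<le> f (A \<inter> F) + f (A - F)" by (simp add: suminf_binaryset_eq emp)
    qed
    then show ?thesis by (simp add: lambda_system_eq)
  qed
  moreover have "sigma_algebra UNIV ?L" using ms by (simp add: measure_space_def)
  ultimately have "sets borel \<subseteq> ?L"
    unfolding borel_eq_closed 
    by (simp add: sets_measure_of) (rule sigma_algebra.sigma_sets_subset, auto)
  then show ?thesis
    using ms sets.sigma_algebra_axioms[of "borel :: 'a measure"]
    by (auto simp: measure_space_def positive_def countably_additive_def)
qed

section \<open>The Hausdorff measure of the plane is Lebesgue measure\<close>

lemma measure_space_hausdorff2:
  "measure_space UNIV (sets borel)
     (\<lambda>S :: 'a::metric_space set. hausdorff2_raw S / hausdorff2_raw (cbox 0 1 :: (real^2) set))"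
proof -
  have "measure_space UNIV (sets borel) (hausdorff2_raw :: 'a set \<Rightarrow> ennreal)"
    by (rule metric_outer_measure_borel)
       (auto intro: hausdorff2_raw_mono hausdorff2_raw_subadditive hausdorff2_raw_separated)
  then show ?thesis
    by (auto simp: measure_space_def positive_def countably_additive_def divide_ennreal_def)
qed

lemma sets_hausdorff2 [simp, measurable_cong]: "sets hausdorff2 = sets borel"
  and space_hausdorff2 [simp]: "space hausdorff2 = UNIV"
  unfolding hausdorff2_def using sets.sigma_sets_eq[of borel] by (auto simp: space_measure_of_conv)

lemma emeasure_hausdorff2:
  "S \<in> sets borel \<Longrightarrow> emeasure hausdorff2 S = hausdorff2_raw S / hausdorff2_raw (cbox 0 1 :: (real^2) set)"
  unfolding hausdorff2_def using measure_space_hausdorff2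
  by (subst emeasure_measure_of_sigma) (auto simp: measure_space_def)

text \<open>Stated for two maps out of a common index set, so that it applies to a Lipschitz map, to
  its inverse, and to the comparison of a map with its linear approximation.\<close>

lemma hausdorff2_raw_lipschitz:
  fixes u :: "'c \<Rightarrow> 'a::metric_space" and v :: "'c \<Rightarrow> 'b::metric_space"
  assumes L: "0 < L" "\<And>x y. x \<in> B \<Longrightarrow> y \<in> B \<Longrightarrow> dist (u x) (u y) \<le> L * dist (v x) (v y)"
  shows "hausdorff2_raw (u ` B) \<le> ennreal (L\<^sup>2) * hausdorff2_raw (v ` B)"
proof -
  have step: "hausdorff2_delta (L * \<delta>) (u ` B) \<le> ennreal (L\<^sup>2) * hausdorff2_delta \<delta> (v ` B)" for \<delta>
  proof -
    have "ennreal (1 / L\<^sup>2) * hausdorff2_delta (L * \<delta>) (u ` B) \<le> hausdorff2_delta \<delta> (v ` B)"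
      unfolding hausdorff2_delta_def[of \<delta>]
    proof (rule INF_greatest, clarify)
      fix C :: "nat \<Rightarrow> 'b set"
      assume C: "v ` B \<subseteq> (\<Union>i. C i)" "\<forall>i. bounded (C i) \<and> diameter (C i) \<le> \<delta>"
      define D where "D i = u ` {x \<in> B. v x \<in> C i}" for i
      have d: "dist x y \<le> L * diameter (C i)" if "x \<in> D i" "y \<in> D i" for x y i
        using that L C(2) diameter_bounded_bound[of "C i"]
        by (auto simp: D_def intro!: order_trans[OF L(2)] mult_left_mono)
      have bd: "bounded (D i)" for i
      proof (cases "D i = {}")
        case False
        then obtain x where "x \<in> D i" by blast
        then show ?thesis unfolding bounded_def using d by (intro exI[of _ x]) blast
      qed simp
      have dd: "diameter (D i) \<le> L * diameter (C i)" for i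
      proof (cases "D i = {}")
        case False
        then show ?thesis using d diameter_def[of "D i"] by (auto intro!: cSUP_least)
      next
        case True then show ?thesis using L C(2) diameter_ge_0[of "C i"] by simp
      qed
      have "hausdorff2_delta (L * \<delta>) (u ` B) \<le> (\<Sum>i. ennreal ((diameter (D i))\<^sup>2))"
      proof (rule hausdorff2_delta_le_cover)
        show "u ` B \<subseteq> (\<Union>i. D i)" using C(1) by (fastforce simp: D_def)
        show "diameter (D i) \<le> L * \<delta>" for i
          using dd[of i] C(2) L by (meson less_imp_le mult_left_mono order_trans)
      qed (use bd in auto)
      also have "\<dots> \<le> (\<Sum>i. ennreal (L\<^sup>2) * ennreal ((diameter (C i))\<^sup>2))"
      proof (rule suminf_le)
        fix i
        have "(diameter (D i))\<^sup>2 \<le> (L * diameter (C i))\<^sup>2"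
          by (rule power_mono[OF dd diameter_ge_0[OF bd]])
        then show "ennreal ((diameter (D i))\<^sup>2) \<le> ennreal (L\<^sup>2) * ennreal ((diameter (C i))\<^sup>2)"
          by (simp add: power_mult_distrib ennreal_mult[symmetric] ennreal_leI)
      qed auto
      also have "\<dots> = ennreal (L\<^sup>2) * (\<Sum>i. ennreal ((diameter (C i))\<^sup>2))" by simp
      finally have "ennreal (1 / L\<^sup>2) * hausdorff2_delta (L * \<delta>) (u ` B)
          \<le> ennreal (1 / L\<^sup>2) * (ennreal (L\<^sup>2) * (\<Sum>i. ennreal ((diameter (C i))\<^sup>2)))"
        by (rule mult_left_mono) simp
      also have "\<dots> = (\<Sum>i. ennreal ((diameter (C i))\<^sup>2))"
        using L by (simp add: mult.assoc[symmetric] ennreal_mult[symmetric])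
      finally show "ennreal (1 / L\<^sup>2) * hausdorff2_delta (L * \<delta>) (u ` B) \<le> (\<Sum>i. ennreal ((diameter (C i))\<^sup>2))" .
    qed
    then have "ennreal (L\<^sup>2) * (ennreal (1 / L\<^sup>2) * hausdorff2_delta (L * \<delta>) (u ` B))
       \<le> ennreal (L\<^sup>2) * hausdorff2_delta \<delta> (v ` B)" by (rule mult_left_mono) simp
    then show ?thesis using L by (simp add: mult.assoc[symmetric] ennreal_mult[symmetric])
  qed
  show ?thesis unfolding hausdorff2_raw_def[of "u ` B"]
  proof (rule SUP_least)
    fix \<delta> :: real assume "\<delta> \<in> {0<..}"
    then have "hausdorff2_delta \<delta> (u ` B) \<le> ennreal (L\<^sup>2) * hausdorff2_delta (\<delta> / L) (v ` B)"
      using step[of "\<delta> / L"] L by simp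
    also have "\<dots> \<le> ennreal (L\<^sup>2) * hausdorff2_raw (v ` B)"
      unfolding hausdorff2_raw_def using L \<open>\<delta> \<in> {0<..}\<close> by (intro mult_left_mono SUP_upper) auto
    finally show "hausdorff2_delta \<delta> (u ` B) \<le> ennreal (L\<^sup>2) * hausdorff2_raw (v ` B)" .
  qed
qed

lemma hausdorff2_raw_isometry:
  assumes "\<And>x y. x \<in> B \<Longrightarrow> y \<in> B \<Longrightarrow> dist (u x) (u y) = dist (v x) (v y)"
  shows "hausdorff2_raw (u ` B) = hausdorff2_raw (v ` B)"
  using hausdorff2_raw_lipschitz[of 1 B u v] hausdorff2_raw_lipschitz[of 1 B v u] assms
  by (auto intro: antisym)

lemma emeasure_lborel_cube:
  fixes x :: "real^2"
  assumes "0 \<le> d"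
  shows "emeasure lborel (cbox (x - vec d) (x + vec d)) = ennreal (4 * d\<^sup>2)"
proof -
  have "emeasure lborel (cbox (x - vec d) (x + vec d)) = (\<Prod>b\<in>Basis. ((x + vec d) - (x - vec d)) \<bullet> b)"
    by (rule emeasure_lborel_cbox) (use assms in \<open>auto simp: Basis_vec_def inner_axis inner_diff_left inner_add_left\<close>)
  also have "(\<Prod>b\<in>(Basis :: (real^2) set). ((x + vec d) - (x - vec d)) \<bullet> b) = (\<Prod>b\<in>(Basis :: (real^2) set). 2 * d)"
    by (rule prod.cong) (auto simp: Basis_vec_def inner_axis inner_diff_left inner_add_left)
  also have "\<dots> = 4 * d\<^sup>2" by (simp add: power_mult_distrib)
  finally show ?thesis .
qed

text \<open>A set of diameter \<open>d\<close> lies in a square of side \<open>2 * d\<close>, so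
  that the squared diameters of a cover sum up to at least a quarter of the Lebesgue
  measure.\<close>

lemma hausdorff2_raw_unit_square_pos: "0 < hausdorff2_raw (cbox 0 1 :: (real^2) set)"
proof -
  have "1 / 4 \<le> hausdorff2_delta 1 (cbox 0 1 :: (real^2) set)"
    unfolding hausdorff2_delta_def
  proof (rule INF_greatest, clarify)
    fix C :: "nat \<Rightarrow> (real^2) set"
    assume C: "cbox 0 1 \<subseteq> (\<Union>i. C i)" "\<forall>i. bounded (C i) \<and> diameter (C i) \<le> 1"
    define x where "x i = (SOME z. z \<in> C i)" for i
    define K where "K i = cbox (x i - vec (diameter (C i))) (x i + vec (diameter (C i)))" for i
    have sub: "C i \<subseteq> K i" for i
    proof
      fix z assume z: "z \<in> C i"
      then have "x i \<in> C i" unfolding x_def by (rule someI)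
      then have "norm (z - x i) \<le> diameter (C i)"
        using diameter_bounded_bound[of "C i" z "x i"] C(2) z by (simp add: dist_norm)
      then have "\<bar>(z - x i) $ k\<bar> \<le> diameter (C i)" for k
        using component_le_norm_cart[of "z - x i" k] by linarith
      then show "z \<in> K i" unfolding K_def mem_box_cart by (auto simp: abs_le_iff) (smt (verit))+
    qed
    have "(1 :: real^2) = 1 + 0" "cbox 0 (1 :: real^2) = cbox (vec (1/2) - vec (1/2)) (vec (1/2) + vec (1/2))"
      by (auto simp: vec_eq_iff intro!: arg_cong2[where f = cbox])
    then have "1 = emeasure lborel (cbox 0 1 :: (real^2) set)"
      using emeasure_lborel_cube[of "1/2" "vec (1/2)"] by (simp add: power2_eq_square)
    also have "\<dots> \<le> emeasure lborel (\<Union>i. K i)"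
    proof (rule emeasure_mono)
      show "cbox 0 1 \<subseteq> (\<Union>i. K i)" using C(1) sub by blast
    qed (simp add: K_def)
    also have "\<dots> \<le> (\<Sum>i. emeasure lborel (K i))"
      by (rule emeasure_subadditive_countably) (auto simp: K_def)
    also have "\<dots> = (\<Sum>i. 4 * ennreal ((diameter (C i))\<^sup>2))"
    proof -
      have "emeasure lborel (K i) = 4 * ennreal ((diameter (C i))\<^sup>2)" for i
        unfolding K_def using emeasure_lborel_cube[OF diameter_ge_0[of "C i"], of "x i"] C(2)
        by (simp add: ennreal_mult)
      then show ?thesis by simp
    qed
    also have "\<dots> = 4 * (\<Sum>i. ennreal ((diameter (C i))\<^sup>2))" by simp
    finally have "1 / 4 \<le> 4 * (\<Sum>i. ennreal ((diameter (C i))\<^sup>2)) / 4" by (rule divide_right_mono_ennreal)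
    then show "1 / 4 \<le> (\<Sum>i. ennreal ((diameter (C i))\<^sup>2))"
      by (simp add: mult.commute[of 4] ennreal_mult_divide_eq)
  qed
  also have "\<dots> \<le> hausdorff2_raw (cbox 0 1 :: (real^2) set)"
    unfolding hausdorff2_raw_def by (rule SUP_upper) simp
  finally show ?thesis by (rule less_le_trans[rotated]) (simp add: ennreal_zero_less_divide)
qed

text \<open>The grid of \<open>n * n\<close> squares of side \<open>1 / n\<close> is a cover with
  squared diameters at most \<open>(2 / n)\<^sup>2\<close>.\<close>

lemma hausdorff2_raw_unit_square_finite: "hausdorff2_raw (cbox 0 1 :: (real^2) set) < \<infinity>"
proof -
  have grid: "hausdorff2_delta (2 / real n) (cbox 0 1 :: (real^2) set) \<le> 4" if n: "0 < n" for n :: nat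
  proof -
    define l :: "nat \<Rightarrow> real^2" where "l k = vector [real (k mod n) / n, real (k div n) / n]" for k
    define C where "C k = (if k < n * n then cbox (l k) (l k + vec (1 / n)) else {})" for k
    have diam: "diameter (C k) \<le> 2 / n" for k
    proof (cases "k < n * n")
      case True
      have "diameter (C k) = dist (l k) (l k + vec (1 / n))"
        using True by (auto simp: C_def Basis_vec_def inner_axis intro!: diameter_cbox)
      also have "\<dots> = norm (vec (1 / n) :: real^2)" by (simp add: dist_norm)
      also have "\<dots> \<le> (\<Sum>i\<in>UNIV. \<bar>(vec (1 / n) :: real^2) $ i\<bar>)" by (rule norm_le_l1_cart)
      also have "\<dots> = 2 / n" by simp
      finally show ?thesis .
    qed (simp add: C_def)
    have idx: "\<exists>i<n. real i / n \<le> t \<and> t \<le> real i / n + 1 / n" if t: "0 \<le> t" "t \<le> 1" for t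
    proof (cases "t = 1")
      case True
      then show ?thesis using n by (intro exI[of _ "n - 1"]) (auto simp: field_simps of_nat_diff)
    next
      case False
      define i where "i = nat \<lfloor>t * n\<rfloor>"
      have i: "real i \<le> t * n" "t * n < real i + 1" using t by (auto simp: i_def)
      have "t * real n < 1 * real n" using False t n by (intro mult_strict_right_mono) auto
      then have "i < n" using i by (simp add: i_def)
      then show ?thesis using i n by (intro exI[of _ i]) (auto simp: field_simps)
    qed
    have "hausdorff2_delta (2 / real n) (cbox 0 1 :: (real^2) set) \<le> (\<Sum>k. ennreal ((diameter (C k))\<^sup>2))"
    proof (rule hausdorff2_delta_le_cover)
      show "cbox 0 1 \<subseteq> (\<Union>k. C k)"
      proof
        fix z :: "real^2" assume "z \<in> cbox 0 1"
        then have z: "0 \<le> z $ 1" "z $ 1 \<le> 1" "0 \<le> z $ 2" "z $ 2 \<le> 1" by (auto simp: mem_box_cart)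
        obtain i j where i: "i < n" "real i / n \<le> z $ 1" "z $ 1 \<le> real i / n + 1 / n"
          and j: "j < n" "real j / n \<le> z $ 2" "z $ 2 \<le> real j / n + 1 / n"
          using idx[OF z(1,2)] idx[OF z(3,4)] by blast
        have "j * n + i < j * n + n" using i by simp
        also have "\<dots> \<le> n * n" using j mult_le_mono1[of "Suc j" n n] by simp
        finally have "j * n + i < n * n" .
        moreover have "(j * n + i) mod n = i" "(j * n + i) div n = j" using i by auto
        ultimately have "z \<in> C (j * n + i)" using i j
          by (auto simp: C_def l_def mem_box_cart forall_2)
        then show "z \<in> (\<Union>k. C k)" by blast
      qed
      show "diameter (C k) \<le> 2 / real n" for k by (rule diam)
    qed (auto simp: C_def)
    also have "\<dots> = (\<Sum>k<n * n. ennreal ((diameter (C k))\<^sup>2))"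
      by (rule suminf_finite) (auto simp: C_def)
    also have "\<dots> \<le> (\<Sum>k<n * n. ennreal ((2 / n)\<^sup>2))"
      by (intro sum_mono ennreal_leI power_mono diam diameter_ge_0) (auto simp: C_def)
    also have "\<dots> = ennreal (real (n * n) * (2 / n)\<^sup>2)"
      by (simp add: ennreal_mult ennreal_of_nat_eq_real_of_nat)
    also have "real (n * n) * (2 / n)\<^sup>2 = 4" using n by (simp add: power2_eq_square)
    finally show ?thesis by simp
  qed
  have "hausdorff2_raw (cbox 0 1 :: (real^2) set) \<le> 4"
    unfolding hausdorff2_raw_def
  proof (rule SUP_least)
    fix \<delta> :: real assume "\<delta> \<in> {0<..}"
    then obtain n where "1 / real (Suc n) < \<delta> / 2" using reals_Archimedean[of "\<delta> / 2"] by (auto simp: inverse_eq_divide)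
    then have "2 / real (Suc n) \<le> \<delta>" by (simp add: field_simps)
    then show "hausdorff2_delta \<delta> (cbox 0 1 :: (real^2) set) \<le> 4"
      using grid[of "Suc n"] hausdorff2_delta_antimono order_trans by blast
  qed
  then show ?thesis by (auto simp: less_top intro: le_less_trans)
qed

text \<open>Uniqueness of Haar measure by Fubini's theorem: the measure of pairs \<open>(x,
  y)\<close> with \<open>y\<close> in the unit cube and \<open>x + y\<close> in \<open>B\<close>,
  computed in both orders.\<close>

theorem translation_invariant_eq_lborel:
  fixes \<mu> :: "'a::euclidean_space measure"
  assumes [measurable_cong, simp]: "sets \<mu> = sets borel" and "sigma_finite_measure \<mu>"
    and inv: "\<And>a B. B \<in> sets borel \<Longrightarrow> emeasure \<mu> ((+) a ` B) = emeasure \<mu> B"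
    and B[measurable]: "B \<in> sets borel"
  shows "emeasure \<mu> B = emeasure lborel B * emeasure \<mu> (cbox 0 One)"
proof -
  interpret m: sigma_finite_measure \<mu> by fact
  interpret P: pair_sigma_finite \<mu> "lborel :: 'a measure" ..
  have sp: "space \<mu> = UNIV" using sets_eq_imp_space_eq[OF assms(1)] by simp
  let ?Q = "cbox 0 One :: 'a set"
  have tr: "(+) a ` B \<in> sets borel" if "B \<in> sets borel" for a and B :: "'a set"
  proof -
    have "(+) a ` B = (\<lambda>x. x - a) -` B \<inter> space borel" by (auto intro!: image_eqI[where x = "_ - a"])
    moreover have "(\<lambda>x. x - a) -` B \<inter> space borel \<in> sets borel"
      by (rule measurable_sets[OF _ that]) measurable
    ultimately show ?thesis by simp
  qed
  have "emeasure \<mu> B = (\<integral>\<^sup>+y. indicator ?Q y * emeasure \<mu> B \<partial>lborel)"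
    by (simp add: nn_integral_multc emeasure_lborel_cbox)
  also have "\<dots> = (\<integral>\<^sup>+y. (\<integral>\<^sup>+x. indicator ?Q y * indicator B (x + y) \<partial>\<mu>) \<partial>lborel)"
  proof (rule nn_integral_cong)
    fix y :: 'a
    define B' where "B' = (+) (- y) ` B"
    have B': "B' \<in> sets borel" "emeasure \<mu> B' = emeasure \<mu> B"
      unfolding B'_def by (rule tr[OF B], rule inv[OF B])
    have "indicator B (x + y) = (indicator B' x :: ennreal)" for x
      by (auto simp: indicator_def B'_def image_iff algebra_simps)
    then show "indicator ?Q y * emeasure \<mu> B = (\<integral>\<^sup>+x. indicator ?Q y * indicator B (x + y) \<partial>\<mu>)"
      using B' by (simp add: nn_integral_cmult)
  qed
  also have "\<dots> = (\<integral>\<^sup>+x. (\<integral>\<^sup>+y. indicator ?Q y * indicator B (x + y) \<partial>lborel) \<partial>\<mu>)"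
    by (rule P.Fubini') measurable
  also have "\<dots> = (\<integral>\<^sup>+x. (\<integral>\<^sup>+y. indicator ?Q (y - x) * indicator B y \<partial>lborel) \<partial>\<mu>)"
  proof (rule nn_integral_cong)
    fix x :: 'a
    have "(\<integral>\<^sup>+y. indicator ?Q (y - x) * indicator B y \<partial>lborel)
        = (\<integral>\<^sup>+y. indicator ?Q (y - x) * indicator B y \<partial>distr lborel borel ((+) x))"
      by (simp add: lborel_distr_plus)
    also have "\<dots> = (\<integral>\<^sup>+y. indicator ?Q y * indicator B (x + y) \<partial>lborel)"
      by (subst nn_integral_distr) auto
    finally show "(\<integral>\<^sup>+y. indicator ?Q y * indicator B (x + y) \<partial>lborel)
        = (\<integral>\<^sup>+y. indicator ?Q (y - x) * indicator B y \<partial>lborel)" by simp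
  qed
  also have "\<dots> = (\<integral>\<^sup>+y. (\<integral>\<^sup>+x. indicator ?Q (y - x) * indicator B y \<partial>\<mu>) \<partial>lborel)"
    by (rule P.Fubini'[symmetric]) measurable
  also have "\<dots> = (\<integral>\<^sup>+y. indicator B y * emeasure \<mu> ?Q \<partial>lborel)"
  proof (rule nn_integral_cong)
    fix y :: 'a
    \<comment> \<open>the cube reflected in its centre is the cube itself, so the reflection
      \<open>y - x\<close> turns into a translation\<close>
    define Q' where "Q' = (+) (y - One) ` ?Q"
    have Q': "Q' \<in> sets borel" "emeasure \<mu> Q' = emeasure \<mu> ?Q"
      unfolding Q'_def by (rule tr, simp, rule inv, simp)
    have "indicator ?Q (y - x) = (indicator Q' x :: ennreal)" for x
    proof -
      have "x \<in> Q' \<longleftrightarrow> x - (y - One) \<in> ?Q" unfolding Q'_def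
        by (auto intro!: image_eqI[where x = "_ - (_ - _)"])
      also have "\<dots> \<longleftrightarrow> y - x \<in> ?Q" by (auto simp: mem_box algebra_simps)
      finally show ?thesis by (simp add: indicator_def)
    qed
    then show "(\<integral>\<^sup>+x. indicator ?Q (y - x) * indicator B y \<partial>\<mu>) = indicator B y * emeasure \<mu> ?Q"
      using Q' nn_integral_multc[of "indicator Q'" \<mu> "indicator B y"] by (simp add: mult.commute)
  qed
  also have "\<dots> = emeasure lborel B * emeasure \<mu> ?Q" by (simp add: nn_integral_multc)
  finally show ?thesis .
qed

text \<open>Finiteness on the unit square carries over to the squares \<open>K n\<close>, which are
  Lipschitz images of it and exhaust the plane.\<close>

lemma sigma_finite_hausdorff2_plane: "sigma_finite_measure (hausdorff2 :: (real^2) measure)"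
proof
  define K where "K n = (\<lambda>x::real^2. real (Suc n) *\<^sub>R (2 *\<^sub>R x - 1)) ` cbox 0 1" for n
  have comp: "compact (K n)" for n
    unfolding K_def by (intro compact_continuous_image continuous_intros) auto
  have bK: "K n \<in> sets borel" for n using comp by (simp add: borel_compact)
  have fin: "emeasure hausdorff2 (K n) \<noteq> \<infinity>" for n
  proof -
    have "hausdorff2_raw (K n) \<le> ennreal ((2 * real (Suc n))\<^sup>2) * hausdorff2_raw ((\<lambda>x. x) ` cbox 0 (1::real^2))"
      unfolding K_def by (rule hausdorff2_raw_lipschitz)
        (auto simp: dist_norm scaleR_diff_right[symmetric] simp del: of_nat_Suc)
    also have "\<dots> < \<infinity>" using hausdorff2_raw_unit_square_finite by (simp add: ennreal_mult_less_top)
    finally show ?thesis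
      using hausdorff2_raw_unit_square_pos bK by (simp add: emeasure_hausdorff2 ennreal_divide_eq_top_iff less_top zero_less_iff_neq_zero)
  qed
  have cov: "(\<Union>n. K n) = UNIV"
  proof (intro equalityI subsetI UNIV_I)
    fix z :: "real^2"
    obtain n where n: "norm z < real (Suc n)" by (metis less_SucI of_nat_less_iff order_less_trans reals_Archimedean2 lessI)
    define x where "x = (1/2) *\<^sub>R ((1 / real (Suc n)) *\<^sub>R z + 1)"
    have "\<bar>z $ i\<bar> < real (Suc n)" for i using component_le_norm_cart[of z i] n by linarith
    then have 1: "\<bar>z $ i / real (Suc n)\<bar> < 1" for i by (simp add: abs_divide del: of_nat_Suc)
    then have 2: "- 1 < z $ i / real (Suc n) \<and> z $ i / real (Suc n) < 1" for i using 1[of i] by linarith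
    have half: "0 \<le> (q + 1) / 2 \<and> (q + 1) / 2 \<le> 1" if "- 1 < q \<and> q < 1" for q :: real
      using that by simp
    have "0 \<le> (z $ i / real (Suc n) + 1) / 2 \<and> (z $ i / real (Suc n) + 1) / 2 \<le> 1" for i
      by (rule half[OF 2])
    then have "x \<in> cbox 0 1" by (simp add: x_def mem_box_cart del: of_nat_Suc)
    moreover have "z = real (Suc n) *\<^sub>R (2 *\<^sub>R x - 1)" by (simp add: x_def vec_eq_iff del: of_nat_Suc)
    ultimately show "z \<in> (\<Union>n. K n)" by (auto simp: K_def)
  qed
  show "\<exists>A. countable A \<and> A \<subseteq> sets hausdorff2 \<and> \<Union> A = space (hausdorff2 :: (real^2) measure) \<and>
      (\<forall>a\<in>A. emeasure hausdorff2 a \<noteq> \<infinity>)"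
    by (intro exI[of _ "range K"]) (use bK fin cov in auto)
qed

text \<open>Hausdorff measure is invariant under isometries, in particular under translations, and
  the normalisation gives the unit square measure 1.\<close>

theorem hausdorff2_plane: "(hausdorff2 :: (real^2) measure) = lborel"
proof (rule measure_eqI)
  fix B :: "(real^2) set" assume "B \<in> sets hausdorff2"
  then have B: "B \<in> sets borel" by simp
  have one: "(One :: real^2) = 1"
  proof -
    have "(One :: real^2) $ i = 1 $ i" for i
      unfolding cart_eq_inner_axis[of One] by (auto simp: inner_sum_left inner_Basis axis_in_Basis_iff)
    then show ?thesis by (simp only: vec_eq_iff) simp
  qed
  have "emeasure hausdorff2 ((+) a ` B) = emeasure hausdorff2 B" if "B \<in> sets borel" for a and B :: "(real^2) set"
  proof -
    have "(+) a ` B = (\<lambda>x. x - a) -` B \<inter> space borel" by (auto intro!: image_eqI[where x = "_ - a"])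
    moreover have "(\<lambda>x. x - a) -` B \<inter> space borel \<in> sets borel"
      by (rule measurable_sets[OF _ that]) measurable
    ultimately have "(+) a ` B \<in> sets borel" by simp
    then show ?thesis using that hausdorff2_raw_isometry[of B "(+) a" "\<lambda>x. x"] by (simp add: emeasure_hausdorff2)
  qed
  from translation_invariant_eq_lborel[OF sets_hausdorff2 sigma_finite_hausdorff2_plane this B]
  show "emeasure hausdorff2 B = emeasure lborel B"
    using hausdorff2_raw_unit_square_pos hausdorff2_raw_unit_square_finite
    by (simp add: one emeasure_hausdorff2 ennreal_divide_self)
qed simp

section \<open>The area formula\<close>

lemma sum_axis_2: "(x :: real^2) = x $ 1 *\<^sub>R axis 1 1 + x $ 2 *\<^sub>R axis 2 1"
  by (simp add: vec_eq_iff forall_2 axis_def)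

lemma linear_axis_2:
  assumes "linear L"
  shows "L (x :: real^2) = x $ 1 *\<^sub>R L (axis 1 1) + x $ 2 *\<^sub>R L (axis 2 1)"
  by (subst sum_axis_2[of x]) (simp add: linear_add[OF assms] linear_scale[OF assms])

text \<open>The square root of the Gram determinant of the images of the unit vectors: the factor by
  which \<open>L\<close> scales area.\<close>

definition area_factor :: "(real^2 \<Rightarrow> 'b::real_inner) \<Rightarrow> real" where
  "area_factor L = sqrt ((L (axis 1 1) \<bullet> L (axis 1 1)) * (L (axis 2 1) \<bullet> L (axis 2 1)) - (L (axis 1 1) \<bullet> L (axis 2 1))\<^sup>2)"

lemma area_factor_nonneg [simp]: "0 \<le> area_factor L"
  unfolding area_factor_def using Cauchy_Schwarz_ineq[of "L (axis 1 1)" "L (axis 2 1)"] by simp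

text \<open>Gram-Schmidt: up to an isometry, an injective linear map into a Euclidean space of any
  dimension is a map of the plane to itself, for which the scaling of Lebesgue measure is
  known.\<close>

lemma area_factor_linear_isometry:
  fixes L :: "real^2 \<Rightarrow> 'b::real_inner"
  assumes "linear L" "inj L"
  obtains A :: "real^2 \<Rightarrow> real^2" where "linear A" "\<And>x. norm (A x) = norm (L x)" "\<bar>det (matrix A)\<bar> = area_factor L"
proof -
  define u v where "u = L (axis 1 1)" and "v = L (axis 2 1)"
  have "u \<noteq> 0" unfolding u_def using assms by (metis axis_eq_0_iff linear_injective_0 zero_neq_one)
  define p where "p = norm u"
  define q where "q = (u \<bullet> v) / p"
  define r where "r = sqrt ((v \<bullet> v) - q\<^sup>2)"
  have p: "0 < p" "p\<^sup>2 = u \<bullet> u" using \<open>u \<noteq> 0\<close> by (auto simp: p_def power2_norm_eq_inner)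
  have pq: "p * q = u \<bullet> v" using p by (simp add: q_def)
  have "(u \<bullet> v)\<^sup>2 \<le> (u \<bullet> u) * (v \<bullet> v)" by (rule Cauchy_Schwarz_ineq)
  then have "p\<^sup>2 * q\<^sup>2 \<le> p\<^sup>2 * (v \<bullet> v)" using pq p(2) by (metis power_mult_distrib)
  then have "q\<^sup>2 \<le> v \<bullet> v" by (simp only: mult_le_cancel_left_pos[OF zero_less_power[OF p(1)]])
  then have r: "0 \<le> r" "r\<^sup>2 = (v \<bullet> v) - q\<^sup>2" by (auto simp: r_def)
  \<comment> \<open>\<open>p\<close>, \<open>q\<close>, \<open>r\<close> are the entries of the
    triangular factor of the matrix with columns \<open>u\<close>, \<open>v\<close>\<close>
  define A :: "real^2 \<Rightarrow> real^2" where "A x = vector [p * x $ 1 + q * x $ 2, r * x $ 2]" for x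
  have "linear A" by (rule linearI) (auto simp: A_def vec_eq_iff forall_2 algebra_simps)
  moreover have "norm (A x) = norm (L x)" for x
  proof -
    have "(norm (A x))\<^sup>2 = p\<^sup>2 * (x $ 1)\<^sup>2 + 2 * (p * q) * (x $ 1 * x $ 2) + (q\<^sup>2 + r\<^sup>2) * (x $ 2)\<^sup>2"
      unfolding power2_norm_eq_inner by (simp add: inner_vec_def sum_2 A_def power2_eq_square algebra_simps)
    also have "\<dots> = (u \<bullet> u) * (x $ 1)\<^sup>2 + 2 * (u \<bullet> v) * (x $ 1 * x $ 2) + (v \<bullet> v) * (x $ 2)\<^sup>2"
      using p r pq by simp
    also have "\<dots> = (norm (L x))\<^sup>2"
      unfolding power2_norm_eq_inner linear_axis_2[OF assms(1), of x] u_def[symmetric] v_def[symmetric]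
      by (simp add: inner_add_left inner_add_right power2_eq_square inner_commute algebra_simps)
    finally show ?thesis by (simp add: power2_eq_iff_nonneg)
  qed
  moreover have "\<bar>det (matrix A)\<bar> = area_factor L"
  proof -
    have "det (matrix A) = p * r" by (simp add: det_2 matrix_def A_def axis_def)
    moreover have "p * r = sqrt (p\<^sup>2 * r\<^sup>2)" using p(1) r(1) by (simp add: real_sqrt_mult)
    moreover have "p\<^sup>2 * r\<^sup>2 = (u \<bullet> u) * (v \<bullet> v) - (u \<bullet> v)\<^sup>2"
      using p r pq by (metis (no_types, lifting) power_mult_distrib right_diff_distrib)
    ultimately show ?thesis using p r unfolding area_factor_def u_def[symmetric] v_def[symmetric]
      by (smt (verit) mult_nonneg_nonneg)
  qed
  ultimately show ?thesis by (rule that)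
qed

lemma area_factor_pos:
  fixes L :: "real^2 \<Rightarrow> 'b::real_inner"
  assumes "linear L" "inj L"
  shows "0 < area_factor L"
proof -
  obtain A :: "real^2 \<Rightarrow> real^2" where A: "linear A" "\<And>x. norm (A x) = norm (L x)" "\<bar>det (matrix A)\<bar> = area_factor L"
    using area_factor_linear_isometry[OF assms] by blast
  have "inj A" using A(1,2) assms by (metis linear_injective_0 norm_eq_zero)
  then show ?thesis using A det_nz_iff_inj[OF A(1)] by linarith
qed

lemma hausdorff2_raw_linear_image:
  fixes L :: "real^2 \<Rightarrow> 'b::real_inner"
  assumes L: "linear L" "inj L" and B: "B \<in> sets borel" "bounded B"
  shows "hausdorff2_raw (L ` B) / hausdorff2_raw (cbox 0 1 :: (real^2) set) = ennreal (area_factor L) * emeasure lborel B"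
proof -
  obtain A :: "real^2 \<Rightarrow> real^2" where A: "linear A" "\<And>x. norm (A x) = norm (L x)" "\<bar>det (matrix A)\<bar> = area_factor L"
    using area_factor_linear_isometry[OF L] by blast
  have injA: "inj A" using A(1,2) L by (metis linear_injective_0 norm_eq_zero)
  have iso: "dist (L x) (L y) = dist (A x) (A y)" for x y
    using A(2)[of "x - y"] by (simp add: dist_norm linear_diff[OF A(1)] linear_diff[OF L(1)])
  obtain A' where A': "linear A'" "\<And>x. A' (A x) = x" "\<And>x. A (A' x) = x"
    using linear_injective_isomorphism[OF A(1) injA] by blast
  have "A ` B = A' -` B \<inter> space borel" using A' by (auto intro!: image_eqI[where x = "A' _"])
  moreover have "A' \<in> borel_measurable borel"
    using A'(1) by (intro borel_measurable_continuous_onI linear_continuous_on) (simp add: linear_linear)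
  ultimately have AB: "A ` B \<in> sets borel" using measurable_sets[OF _ B(1)] by metis
  have fin: "emeasure lborel B < \<infinity>" by (rule emeasure_bounded_finite[OF B(2)])
  then have lm: "B \<in> lmeasurable"
    using B by (intro fmeasurableI) (auto simp: emeasure_completion)
  have bAB: "bounded (A ` B)" using B(2) A(1) by (intro bounded_linear_image) (auto simp: linear_linear)
  have "emeasure lborel (A ` B) = emeasure lebesgue (A ` B)" using AB by simp
  also have "\<dots> = ennreal (measure lebesgue (A ` B))"
    using measurable_linear_image[OF A(1) lm] by (simp add: emeasure_eq_measure2 fmeasurableD2)
  also have "\<dots> = ennreal (area_factor L * measure lebesgue B)"
    using measure_linear_image[OF A(1) lm] A(3) by simp
  also have "\<dots> = ennreal (area_factor L) * emeasure lborel B"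
  proof -
    have "emeasure lborel B = emeasure lebesgue B" using B by simp
    also have "\<dots> = ennreal (measure lebesgue B)" using lm by (simp add: emeasure_eq_measure2 fmeasurableD2)
    finally show ?thesis by (simp add: ennreal_mult)
  qed
  finally have "emeasure hausdorff2 (A ` B) = ennreal (area_factor L) * emeasure lborel B"
    by (simp add: hausdorff2_plane)
  moreover have "hausdorff2_raw (L ` B) = hausdorff2_raw (A ` B)"
    by (rule hausdorff2_raw_isometry) (rule iso)
  ultimately show ?thesis using AB by (simp add: emeasure_hausdorff2)
qed

text \<open>The derivative is a parameter so that it can be given in closed form; its continuity is
  stated vector by vector, which suffices in finite dimensions.\<close>

definition C1_map_on :: "(real^2) set \<Rightarrow> (real^2 \<Rightarrow> 'b::real_normed_vector) \<Rightarrow> (real^2 \<Rightarrow> real^2 \<Rightarrow> 'b) \<Rightarrow> bool" where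
  "C1_map_on W f f' \<longleftrightarrow> open W \<and> (\<forall>x\<in>W. (f has_derivative f' x) (at x)) \<and> (\<forall>v. continuous_on W (\<lambda>x. f' x v))"

lemma C1_map_onD:
  assumes "C1_map_on W f f'"
  shows "open W" "\<And>x. x \<in> W \<Longrightarrow> (f has_derivative f' x) (at x)" "\<And>x. x \<in> W \<Longrightarrow> linear (f' x)"
    "\<And>v. continuous_on W (\<lambda>x. f' x v)" "continuous_on W f"
  using assms unfolding C1_map_on_def
  by (auto intro: has_derivative_linear has_derivative_continuous continuous_at_imp_continuous_on)

text \<open>Strict differentiability: the mean value inequality applied to \<open>f\<close> minus
  its derivative at \<open>z\<close>.\<close>

lemma C1_map_almost_linear:
  fixes f :: "real^2 \<Rightarrow> 'b::real_normed_vector"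
  assumes C: "C1_map_on W f f'" and z: "z \<in> W" and e: "0 < e"
  obtains d where "0 < d" "ball z d \<subseteq> W"
    "\<forall>x\<in>ball z d. \<forall>y\<in>ball z d. norm (f x - f y - f' z (x - y)) \<le> e * norm (x - y)"
proof -
  note W = C1_map_onD[OF C]
  have "\<exists>d>0. \<forall>x\<in>W. dist x z < d \<longrightarrow> dist (f' x v) (f' z v) < e / 2" for v
    using W(4)[of v] z e unfolding continuous_on_iff by (metis half_gt_zero)
  then obtain d1 d2 where d1: "d1 > 0" "\<And>x. x \<in> W \<Longrightarrow> dist x z < d1 \<Longrightarrow> dist (f' x (axis 1 1)) (f' z (axis 1 1)) < e / 2"
    and d2: "d2 > 0" "\<And>x. x \<in> W \<Longrightarrow> dist x z < d2 \<Longrightarrow> dist (f' x (axis 2 1)) (f' z (axis 2 1)) < e / 2" by metis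
  obtain d0 where d0: "d0 > 0" "ball z d0 \<subseteq> W" using W(1) z by (meson openE)
  define d where "d = min d0 (min d1 d2)"
  have d: "0 < d" "ball z d \<subseteq> W" using d0 d1 d2 by (auto simp: d_def)
  have *: "norm (f' x v - f' z v) \<le> e * norm v" if "x \<in> ball z d" for x v
  proof -
    have x: "x \<in> W" "dist x z < d1" "dist x z < d2" using that d by (auto simp: d_def dist_commute)
    have "f' x v - f' z v = v $ 1 *\<^sub>R (f' x (axis 1 1) - f' z (axis 1 1)) + v $ 2 *\<^sub>R (f' x (axis 2 1) - f' z (axis 2 1))"
      using linear_axis_2[OF W(3)[OF x(1)], of v] linear_axis_2[OF W(3)[OF z], of v] by (simp add: algebra_simps)
    also have "norm \<dots> \<le> \<bar>v $ 1\<bar> * norm (f' x (axis 1 1) - f' z (axis 1 1)) + \<bar>v $ 2\<bar> * norm (f' x (axis 2 1) - f' z (axis 2 1))"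
      by (rule norm_triangle_le) simp
    also have "\<dots> \<le> norm v * (e / 2) + norm v * (e / 2)"
      using d1(2)[OF x(1,2)] d2(2)[OF x(1,3)]
      by (intro add_mono mult_mono component_le_norm_cart) (auto simp: dist_norm)
    finally show ?thesis by (simp add: mult.commute)
  qed
  have "norm (f x - f y - f' z (x - y)) \<le> e * norm (x - y)" if xy: "x \<in> ball z d" "y \<in> ball z d" for x y
  proof -
    have lz: "linear (f' z)" using W(3)[OF z] .
    have "norm ((\<lambda>x. f x - f' z x) x - (\<lambda>x. f x - f' z x) y) \<le> e * norm (x - y)"
    proof (rule differentiable_bound[OF convex_ball _ _ xy])
      fix w assume w: "w \<in> ball z d"
      then have "w \<in> W" using d by auto
      then show "((\<lambda>x. f x - f' z x) has_derivative (\<lambda>h. f' w h - f' z h)) (at w within ball z d)"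
        by (intro has_derivative_diff has_derivative_at_withinI[OF W(2)] linear_imp_has_derivative lz)
      show "onorm (\<lambda>h. f' w h - f' z h) \<le> e" by (rule onorm_bound) (use e *[OF w] in auto)
    qed
    then show ?thesis by (simp add: linear_diff[OF lz] algebra_simps)
  qed
  then show ?thesis using that d by blast
qed

lemma C1_map_area_factor_continuous:
  assumes "C1_map_on W f f'"
  shows "continuous_on W (\<lambda>x. area_factor (f' x))"
  unfolding area_factor_def by (intro continuous_intros C1_map_onD(4)[OF assms])

lemma area_factor_indicator_measurable:
  assumes C: "C1_map_on W f f'" and S: "S \<in> sets borel" "S \<subseteq> W"
  shows "(\<lambda>x. ennreal (area_factor (f' x)) * indicator S x) \<in> borel_measurable lborel"
proof -
  have eq: "(\<lambda>x. ennreal (area_factor (f' x)) * indicator S x) = (\<lambda>x. ennreal (indicator S x *\<^sub>R area_factor (f' x)))"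
    by (auto simp: indicator_def)
  have "(\<lambda>x. indicator S x *\<^sub>R area_factor (f' x)) \<in> borel_measurable borel"
    by (rule borel_measurable_continuous_on_indicator[OF S(1) continuous_on_subset[OF C1_map_area_factor_continuous[OF C] S(2)]])
  then show ?thesis unfolding eq measurable_lborel2 by (rule measurable_compose[OF _ measurable_ennreal])
qed

text \<open>Near \<open>z\<close>, distances and area factors agree with those of the derivative at
  \<open>z\<close> up to a factor \<open>t\<close> arbitrarily close to 1. This is what the area
  formula needs: the errors on small balls do not accumulate, because both sides are
  additive.\<close>

lemma C1_immersion_bilipschitz:
  fixes f :: "real^2 \<Rightarrow> 'b::euclidean_space"
  assumes C: "C1_map_on W f f'" and z: "z \<in> W" "inj (f' z)" and t: "1 < t"
  obtains d where "0 < d" "ball z d \<subseteq> W"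
    "\<forall>x\<in>ball z d. \<forall>y\<in>ball z d. dist (f x) (f y) \<le> t * dist (f' z x) (f' z y) \<and>
       dist (f' z x) (f' z y) \<le> t * dist (f x) (f y)"
    "\<forall>x\<in>ball z d. area_factor (f' x) \<le> t * area_factor (f' z) \<and> area_factor (f' z) \<le> t * area_factor (f' x)"
proof -
  note W = C1_map_onD[OF C]
  have lz: "linear (f' z)" using W(3)[OF z(1)] .
  obtain m where m: "m > 0" "\<And>v. m * norm v \<le> norm (f' z v)" using linear_inj_bounded_below_pos[OF lz z(2)] by blast
  \<comment> \<open>\<open>m\<close> bounds the derivative from below, so an error \<open>e * norm
    (x - y)\<close> is at most the fraction \<open>1 - 1 / t\<close> of the distance of the linear
    images; this fraction serves both the upper and the lower estimate\<close>
  define e where "e = m * (1 - 1 / t)"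
  have e: "0 < e" using m t by (simp add: e_def)
  obtain d1 where d1: "0 < d1" "ball z d1 \<subseteq> W"
    "\<forall>x\<in>ball z d1. \<forall>y\<in>ball z d1. norm (f x - f y - f' z (x - y)) \<le> e * norm (x - y)"
    by (rule C1_map_almost_linear[OF C z(1) e])
  define a where "a = area_factor (f' z)"
  have a: "0 < a" unfolding a_def by (rule area_factor_pos[OF lz z(2)])
  define b where "b = a * (1 - 1 / t)"
  have b: "0 < b" using a t by (simp add: b_def)
  obtain d2 where d2: "0 < d2" "\<And>x. x \<in> W \<Longrightarrow> dist x z < d2 \<Longrightarrow> dist (area_factor (f' x)) a < b"
  proof -
    have "\<exists>d>0. \<forall>x\<in>W. dist x z < d \<longrightarrow> dist (area_factor (f' x)) (area_factor (f' z)) < b"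
      using C1_map_area_factor_continuous[OF C] z(1) b unfolding continuous_on_iff by blast
    then show ?thesis using that unfolding a_def by blast
  qed
  define d where "d = min d1 d2"
  have d: "0 < d" "ball z d \<subseteq> ball z d1" using d1 d2 by (auto simp: d_def)
  have t1: "1 - 1 / t \<le> t - 1"
  proof -
    have "0 \<le> (t - 1)\<^sup>2 / t" using t by simp
    also have "(t - 1)\<^sup>2 / t = t - 2 + 1 / t" using t by (simp add: power2_eq_square field_simps)
    finally show ?thesis by simp
  qed
  have dist_est: "dist (f x) (f y) \<le> t * dist (f' z x) (f' z y) \<and> dist (f' z x) (f' z y) \<le> t * dist (f x) (f y)"
    if xy: "x \<in> ball z d" "y \<in> ball z d" for x y
  proof
    define N where "N = dist (f' z x) (f' z y)"
    have N: "N = norm (f' z (x - y))" by (simp add: N_def dist_norm linear_diff[OF lz])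
    have "norm (f x - f y - f' z (x - y)) \<le> e * norm (x - y)" using d1(3) xy d by blast
    also have "\<dots> = (1 - 1 / t) * (m * norm (x - y))" by (simp add: e_def)
    also have "\<dots> \<le> (1 - 1 / t) * N" unfolding N using m t by (intro mult_left_mono) auto
    finally have *: "norm (f x - f y - f' z (x - y)) \<le> (1 - 1 / t) * N" .
    have "dist (f x) (f y) \<le> N + (1 - 1 / t) * N"
      unfolding dist_norm using * N norm_triangle_sub[of "f x - f y" "f' z (x - y)"] by linarith
    also have "\<dots> \<le> N + (t - 1) * N" using t1 by (intro add_left_mono mult_right_mono) (auto simp: N)
    finally show "dist (f x) (f y) \<le> t * dist (f' z x) (f' z y)" unfolding N_def by (simp add: algebra_simps)
    have "N \<le> dist (f x) (f y) + (1 - 1 / t) * N"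
      unfolding dist_norm using * N norm_triangle_sub[of "f' z (x - y)" "f x - f y"] by (simp add: norm_minus_commute)
    then have "N / t \<le> dist (f x) (f y)" by (simp add: algebra_simps)
    then show "dist (f' z x) (f' z y) \<le> t * dist (f x) (f y)" using t unfolding N_def by (simp add: field_simps)
  qed
  have area_est: "area_factor (f' x) \<le> t * area_factor (f' z) \<and> area_factor (f' z) \<le> t * area_factor (f' x)"
    if "x \<in> ball z d" for x
  proof
    have "dist (area_factor (f' x)) a < b" using that d1 by (intro d2) (auto simp: d_def dist_commute)
    then have ab: "area_factor (f' x) < a + a * (1 - 1 / t)" "a - a * (1 - 1 / t) < area_factor (f' x)"
      by (auto simp: dist_real_def b_def abs_less_iff)
    have "area_factor (f' x) \<le> a + a * (t - 1)"
      using ab(1) t1 a mult_left_mono[of "1 - 1 / t" "t - 1" a] by linarith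
    then show "area_factor (f' x) \<le> t * area_factor (f' z)" by (simp add: a_def algebra_simps)
    have "a / t \<le> area_factor (f' x)" using ab(2) by (simp add: algebra_simps)
    then show "area_factor (f' z) \<le> t * area_factor (f' x)" using t by (simp add: a_def field_simps)
  qed
  show ?thesis using that[of d] d d1(2) dist_est area_est by blast
qed

lemma countable_ball_cover:
  fixes W :: "'a::euclidean_space set"
  assumes "\<And>z. z \<in> W \<Longrightarrow> 0 < d z" "W \<noteq> {}"
  obtains s :: "nat \<Rightarrow> 'a" where "range s \<subseteq> W" "W \<subseteq> (\<Union>i. ball (s i) (d (s i)))"
proof -
  obtain F where F: "F \<subseteq> (\<lambda>z. ball z (d z)) ` W" "countable F" "\<Union>F = \<Union>((\<lambda>z. ball z (d z)) ` W)"
    by (rule Lindelof[of "(\<lambda>z. ball z (d z)) ` W"]) auto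
  have "\<exists>T. countable T \<and> T \<subseteq> W \<and> F = (\<lambda>z. ball z (d z)) ` T"
    using F(1,2) countable_subset_image[of F "\<lambda>z. ball z (d z)" W] by blast
  then obtain T where T: "countable T" "T \<subseteq> W" "F = (\<lambda>z. ball z (d z)) ` T" by blast
  have cov: "W \<subseteq> (\<Union>z\<in>T. ball z (d z))" using F(3) T(3) assms(1) by fastforce
  then have "T \<noteq> {}" using assms(2) by auto
  show ?thesis
  proof (rule that[of "from_nat_into T"])
    show "range (from_nat_into T) \<subseteq> W" using T(2) \<open>T \<noteq> {}\<close> by (meson from_nat_into image_subsetI subset_iff)
    show "W \<subseteq> (\<Union>i. ball (from_nat_into T i) (d (from_nat_into T i)))"
    proof
      fix x assume "x \<in> W"
      then obtain z where "z \<in> T" "x \<in> ball z (d z)" using cov by blast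
      moreover obtain i where "from_nat_into T i = z" using \<open>z \<in> T\<close> T(1) from_nat_into_surj by metis
      ultimately show "x \<in> (\<Union>i. ball (from_nat_into T i) (d (from_nat_into T i)))" by blast
    qed
  qed
qed

text \<open>On each compact piece the map is a homeomorphism onto a compact image, so that it maps
  Borel sets to Borel sets.\<close>

lemma injective_image_sigma_compact_borel:
  fixes f :: "'a::t2_space \<Rightarrow> 'b::t2_space"
  assumes f: "continuous_on Q f" "inj_on f Q" and Q: "Q = (\<Union>n::nat. K n)" "\<And>n. compact (K n)"
    and B: "B \<in> sets borel" "B \<subseteq> Q"
  shows "f ` B \<in> sets borel"
proof -
  have "f ` (B \<inter> K n) \<in> sets borel" for n
  proof -
    have "K n \<subseteq> Q" unfolding Q(1) by blast
    then have cK: "continuous_on (K n) f" "inj_on f (K n)"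
      by (rule continuous_on_subset[OF f(1)], rule inj_on_subset[OF f(2)])
    have cg: "continuous_on (f ` K n) (the_inv_into (K n) f)"
      by (rule continuous_on_inv_into[OF cK(1) Q(2) cK(2)])
    have fK: "f ` K n \<in> sets borel" using compact_continuous_image[OF cK(1) Q(2)] by (rule borel_compact)
    have "(the_inv_into (K n) f) -` B \<inter> space (restrict_space borel (f ` K n)) \<in> sets (restrict_space borel (f ` K n))"
      by (rule measurable_sets[OF borel_measurable_continuous_on_restrict[OF cg] B(1)])
    then have "(the_inv_into (K n) f) -` B \<inter> f ` K n \<in> sets borel"
      using fK by (simp add: space_restrict_space sets_restrict_space_iff)
    moreover have "(the_inv_into (K n) f) -` B \<inter> f ` K n = f ` (B \<inter> K n)"
      by (auto simp: the_inv_into_f_f[OF cK(2)])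
    ultimately show ?thesis by simp
  qed
  then have "(\<Union>n. f ` (B \<inter> K n)) \<in> sets borel" by blast
  moreover have "B = (\<Union>n. B \<inter> K n)" using Q B by auto
  then have "(\<Union>n. f ` (B \<inter> K n)) = f ` B" by (metis image_UN)
  ultimately show ?thesis by simp
qed

text \<open>Two factors \<open>t\<close> come from the Lipschitz constants, squared by the Hausdorff
  measure, and a third one from the area factors.\<close>

lemma C1_immersion_local_area:
  fixes f :: "real^2 \<Rightarrow> 'b::euclidean_space"
  assumes C: "C1_map_on W f f'" and z: "z \<in> W" "inj (f' z)" and t: "1 < t"
  obtains d where "0 < d" "ball z d \<subseteq> W"
    "\<And>B. B \<in> sets borel \<Longrightarrow> B \<subseteq> ball z d \<Longrightarrow> f ` B \<in> sets borel \<Longrightarrow>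
       emeasure hausdorff2 (f ` B) \<le> ennreal (t ^ 3) * (\<integral>\<^sup>+x\<in>B. ennreal (area_factor (f' x)) \<partial>lborel) \<and>
       (\<integral>\<^sup>+x\<in>B. ennreal (area_factor (f' x)) \<partial>lborel) \<le> ennreal (t ^ 3) * emeasure hausdorff2 (f ` B)"
proof -
  note W = C1_map_onD[OF C]
  have lz: "linear (f' z)" using W(3)[OF z(1)] .
  obtain d where d: "0 < d" "ball z d \<subseteq> W"
    "\<forall>x\<in>ball z d. \<forall>y\<in>ball z d. dist (f x) (f y) \<le> t * dist (f' z x) (f' z y) \<and>
       dist (f' z x) (f' z y) \<le> t * dist (f x) (f y)"
    "\<forall>x\<in>ball z d. area_factor (f' x) \<le> t * area_factor (f' z) \<and> area_factor (f' z) \<le> t * area_factor (f' x)"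
    by (rule C1_immersion_bilipschitz[OF C z t])
  define a where "a = area_factor (f' z)"
  show ?thesis
  proof (rule that[OF d(1,2)])
    fix B assume B: "B \<in> sets borel" "B \<subseteq> ball z d" "f ` B \<in> sets borel"
    let ?c = "hausdorff2_raw (cbox 0 1 :: (real^2) set)"
    let ?I = "\<integral>\<^sup>+x\<in>B. ennreal (area_factor (f' x)) \<partial>lborel"
    let ?H = "emeasure hausdorff2 (f ` B)"
    have bB: "bounded B" using B(2) bounded_ball bounded_subset by blast
    have lin: "hausdorff2_raw (f' z ` B) / ?c = ennreal a * emeasure lborel B"
      unfolding a_def by (rule hausdorff2_raw_linear_image[OF lz z(2) B(1) bB])
    have "hausdorff2_raw (f ` B) \<le> ennreal (t\<^sup>2) * hausdorff2_raw (f' z ` B)"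
      
    proof (rule hausdorff2_raw_lipschitz)
      show "0 < t" using t by simp
    qed (use d(3) subsetD[OF B(2)] in blast)
    from divide_right_mono_ennreal[OF this, of ?c]
    have H1: "?H \<le> ennreal (t\<^sup>2) * (ennreal a * emeasure lborel B)"
      using lin B(3) by (simp add: emeasure_hausdorff2 ennreal_times_divide[symmetric])
    have "hausdorff2_raw (f' z ` B) \<le> ennreal (t\<^sup>2) * hausdorff2_raw (f ` B)"
      
    proof (rule hausdorff2_raw_lipschitz)
      show "0 < t" using t by simp
    qed (use d(3) subsetD[OF B(2)] in blast)
    from divide_right_mono_ennreal[OF this, of ?c]
    have H2: "ennreal a * emeasure lborel B \<le> ennreal (t\<^sup>2) * ?H"
      using lin B(3) by (simp add: emeasure_hausdorff2 ennreal_times_divide[symmetric])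
    have I1: "ennreal a * emeasure lborel B \<le> ennreal t * ?I"
    proof -
      have "ennreal a * emeasure lborel B = (\<integral>\<^sup>+x\<in>B. ennreal a \<partial>lborel)"
        using B(1) by (simp add: nn_integral_cmult_indicator)
      also have "\<dots> \<le> (\<integral>\<^sup>+x. ennreal t * (ennreal (area_factor (f' x)) * indicator B x) \<partial>lborel)"
        using d(4) subsetD[OF B(2)] t by (intro nn_integral_mono) (auto simp: indicator_def a_def ennreal_mult[symmetric] intro!: ennreal_leI)
      also have "\<dots> = ennreal t * ?I"
      proof (rule nn_integral_cmult)
        show "(\<lambda>x. ennreal (area_factor (f' x)) * indicator B x) \<in> borel_measurable lborel"
          by (rule area_factor_indicator_measurable[OF C B(1)]) (use B(2) d(2) in blast)
      qed
      finally show ?thesis .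
    qed
    have I2: "?I \<le> ennreal t * (ennreal a * emeasure lborel B)"
    proof -
      have "?I \<le> (\<integral>\<^sup>+x\<in>B. ennreal (t * a) \<partial>lborel)"
        using d(4) subsetD[OF B(2)] by (intro nn_integral_mono) (auto simp: indicator_def a_def intro!: ennreal_leI)
      also have "\<dots> = ennreal t * (ennreal a * emeasure lborel B)"
        using B(1) t by (simp add: nn_integral_cmult_indicator) (simp add: ennreal_mult a_def mult.assoc)
      finally show ?thesis .
    qed
    have t3: "ennreal (t ^ 3) = ennreal (t\<^sup>2) * ennreal t" "ennreal (t ^ 3) = ennreal t * ennreal (t\<^sup>2)"
      using t by (auto simp: ennreal_mult[symmetric] power3_eq_cube power2_eq_square)
    have "?H \<le> ennreal (t\<^sup>2) * (ennreal t * ?I)" by (rule order_trans[OF H1 mult_left_mono[OF I1]]) simp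
    moreover have "?I \<le> ennreal t * (ennreal (t\<^sup>2) * ?H)" by (rule order_trans[OF I2 mult_left_mono[OF H2]]) simp
    ultimately show "?H \<le> ennreal (t ^ 3) * ?I \<and> ?I \<le> ennreal (t ^ 3) * ?H"
      unfolding t3(1) by (simp add: mult.assoc) (simp add: mult.left_commute)
  qed
qed

lemma ennreal_le_if_le_power3:
  assumes "\<And>t. 1 < t \<Longrightarrow> x \<le> ennreal (t ^ 3) * y"
  shows "x \<le> y"
proof (rule tendsto_lowerbound)
  have "((\<lambda>t::real. ennreal (t ^ 3) * y) \<longlongrightarrow> ennreal (1 ^ 3) * y) (at_right 1)"
    by (intro tendsto_mult_ennreal tendsto_ennrealI tendsto_intros) auto
  then show "((\<lambda>t::real. ennreal (t ^ 3) * y) \<longlongrightarrow> y) (at_right 1)" by simp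
  show "\<forall>\<^sub>F t in at_right 1. x \<le> ennreal (t ^ 3) * y"
    unfolding eventually_at_right_field using assms by (intro exI[of _ 2]) auto
qed simp

text \<open>Cover the domain by countably many balls on which the formula holds up to the factor
  \<open>t ^ 3\<close>, add over the disjointed pieces, and let \<open>t\<close> tend to 1. As
  \<open>Q\<close> is \<open>\<sigma>\<close>-compact, the images of its Borel subsets are
  Borel.\<close>

theorem area_formula_measure:
  fixes f :: "real^2 \<Rightarrow> 'b::euclidean_space"
  assumes C: "C1_map_on W f f'" and inj: "inj_on f Q" "\<And>x. x \<in> Q \<Longrightarrow> inj (f' x)"
    and Q: "Q = (\<Union>n::nat. K n)" "\<And>n. compact (K n)" "Q \<subseteq> W"
    and B: "B \<in> sets borel" "B \<subseteq> Q"
  shows "emeasure hausdorff2 (f ` B) = (\<integral>\<^sup>+x\<in>B. ennreal (area_factor (f' x)) \<partial>lborel)"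
proof (cases "Q = {}")
  case False
  note W = C1_map_onD[OF C]
  have cQ: "continuous_on Q f" using W(5) Q(3) continuous_on_subset by blast
  have im: "f ` S \<in> sets borel" if "S \<in> sets borel" "S \<subseteq> Q" for S
    by (rule injective_image_sigma_compact_borel[OF cQ inj(1) Q(1,2) that])
  have meas: "(\<lambda>x. ennreal (area_factor (f' x)) * indicator S x) \<in> borel_measurable lborel"
    if "S \<in> sets borel" "S \<subseteq> Q" for S
    by (rule area_factor_indicator_measurable[OF C that(1)]) (use that(2) Q(3) in blast)
  define m1 where "m1 S = emeasure hausdorff2 (f ` S)" for S
  define m2 where "m2 S = (\<integral>\<^sup>+x\<in>S. ennreal (area_factor (f' x)) \<partial>lborel)" for S
  have main: "m1 B \<le> ennreal (t ^ 3) * m2 B \<and> m2 B \<le> ennreal (t ^ 3) * m1 B" if t: "1 < t" for t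
  proof -
    define good where "good z d \<longleftrightarrow> 0 < d \<and> (\<forall>S. S \<in> sets borel \<longrightarrow> S \<subseteq> ball z d \<longrightarrow> f ` S \<in> sets borel \<longrightarrow>
       m1 S \<le> ennreal (t ^ 3) * m2 S \<and> m2 S \<le> ennreal (t ^ 3) * m1 S)" for z d
    have "\<exists>d. good z d" if zQ: "z \<in> Q" for z
    proof (rule C1_immersion_local_area[OF C _ inj(2)[OF zQ] t, folded m1_def m2_def])
      show "z \<in> W" using zQ Q(3) by blast
    next
      fix d assume "0 < d" "\<And>B. B \<in> sets borel \<Longrightarrow> B \<subseteq> ball z d \<Longrightarrow> f ` B \<in> sets borel \<Longrightarrow>
         m1 B \<le> ennreal (t ^ 3) * m2 B \<and> m2 B \<le> ennreal (t ^ 3) * m1 B"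
      then have "good z d" by (simp add: good_def)
      then show "\<exists>d. good z d" by blast
    qed
    then obtain d where good: "\<And>z. z \<in> Q \<Longrightarrow> good z (d z)" by metis
    have d: "\<And>z. z \<in> Q \<Longrightarrow> 0 < d z"
      "\<And>z S. z \<in> Q \<Longrightarrow> S \<in> sets borel \<Longrightarrow> S \<subseteq> ball z (d z) \<Longrightarrow> f ` S \<in> sets borel \<Longrightarrow>
       m1 S \<le> ennreal (t ^ 3) * m2 S \<and> m2 S \<le> ennreal (t ^ 3) * m1 S"
      using good by (auto simp: good_def)
    obtain s :: "nat \<Rightarrow> real^2" where s: "range s \<subseteq> Q" "Q \<subseteq> (\<Union>i. ball (s i) (d (s i)))"
      using countable_ball_cover[of Q d, OF d(1) False] by blast
    define D where "D = disjointed (\<lambda>i. ball (s i) (d (s i)))"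
    have Dun: "(\<Union>i. D i) = (\<Union>i. ball (s i) (d (s i)))" unfolding D_def by (rule UN_disjointed_eq)
    have Dsub: "D i \<subseteq> ball (s i) (d (s i))" for i unfolding D_def by (rule disjointed_subset)
    have Ddis: "disjoint_family D" unfolding D_def by (rule disjoint_family_disjointed)
    have "range D \<subseteq> sets borel" unfolding D_def by (rule sets.range_disjointed_sets) auto
    then have Dm: "D i \<in> sets borel" for i by blast
    define P where "P i = B \<inter> D i" for i
    have P: "P i \<in> sets borel" "P i \<subseteq> Q" "P i \<subseteq> ball (s i) (d (s i))" "s i \<in> Q" for i
      using B Dm Dsub s(1) by (auto simp: P_def)
    have BP: "B = (\<Union>i. P i)" using B(2) s(2) Dun by (auto simp: P_def)
    have dP: "disjoint_family P" using Ddis by (auto simp: P_def disjoint_family_on_def)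
    have dfP: "disjoint_family (\<lambda>i. f ` P i)"
      unfolding disjoint_family_on_def
    proof (intro ballI impI)
      fix i j :: nat assume "i \<noteq> j"
      then have "P i \<inter> P j = {}" using dP by (auto simp: disjoint_family_on_def)
      then show "f ` P i \<inter> f ` P j = {}" using inj_on_image_Int[OF inj(1) P(2) P(2), of i j] by simp
    qed
    have s1: "m1 B = (\<Sum>i. m1 (P i))"
    proof -
      have "f ` B = (\<Union>i. f ` P i)" by (subst BP) (rule image_UN)
      moreover have "(\<Sum>i. emeasure hausdorff2 (f ` P i)) = emeasure hausdorff2 (\<Union>i. f ` P i)"
        by (rule suminf_emeasure[OF _ dfP]) (use im[OF P(1,2)] in auto)
      ultimately show ?thesis unfolding m1_def by simp
    qed
    have s2: "m2 B = (\<Sum>i. m2 (P i))"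
    proof -
      have "m2 B = (\<integral>\<^sup>+x. (\<Sum>i. ennreal (area_factor (f' x)) * indicator (P i) x) \<partial>lborel)"
      proof -
        have "(\<Sum>i. ennreal (area_factor (f' x)) * indicator (P i) x) = ennreal (area_factor (f' x)) * indicator B x" for x
          unfolding ennreal_suminf_cmult suminf_indicator[OF dP] BP[symmetric] ..
        then show ?thesis unfolding m2_def by simp
      qed
      also have "\<dots> = (\<Sum>i. m2 (P i))" unfolding m2_def by (rule nn_integral_suminf) (rule meas[OF P(1,2)])
      finally show ?thesis .
    qed
    have loc: "m1 (P i) \<le> ennreal (t ^ 3) * m2 (P i) \<and> m2 (P i) \<le> ennreal (t ^ 3) * m1 (P i)" for i
      using P by (intro d(2)[of "s i"] im) auto
    show ?thesis unfolding s1 s2 ennreal_suminf_cmult[symmetric] by (intro conjI suminf_le) (use loc in auto)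
  qed
  have "m1 B \<le> m2 B" "m2 B \<le> m1 B" using main by (auto intro: ennreal_le_if_le_power3)
  then show ?thesis unfolding m1_def m2_def by (rule antisym)
qed (use B in auto)

text \<open>The set version says that pushing the weighted Lebesgue measure forward gives the
  Hausdorff measure on the image; integrating a function against both is the change of variables
  formula.\<close>

theorem area_formula_integral:
  fixes f :: "real^2 \<Rightarrow> 'b::euclidean_space"
  assumes C: "C1_map_on W f f'" and inj: "inj_on f Q" "\<And>x. x \<in> Q \<Longrightarrow> inj (f' x)"
    and Q: "Q = (\<Union>n::nat. K n)" "\<And>n. compact (K n)" "Q \<subseteq> W"
    and \<phi>[measurable]: "\<phi> \<in> borel_measurable borel"
  shows "(\<integral>\<^sup>+q\<in>f ` Q. \<phi> q \<partial>hausdorff2) = (\<integral>\<^sup>+z\<in>Q. (\<phi> (f z) * ennreal (area_factor (f' z))) \<partial>lborel)"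
proof -
  note W = C1_map_onD[OF C]
  have cQ: "continuous_on Q f" using W(5) Q(3) continuous_on_subset by blast
  have bQ [measurable]: "Q \<in> sets borel" unfolding Q(1) using Q(2) by (auto intro: borel_compact)
  have bfQ [measurable]: "f ` Q \<in> sets borel"
    by (rule injective_image_sigma_compact_borel[OF cQ inj(1) Q(1,2) bQ order_refl])
  define J where "J z = ennreal (area_factor (f' z)) * indicator Q z" for z
  have J [measurable]: "J \<in> borel_measurable lborel"
    unfolding J_def by (rule area_factor_indicator_measurable[OF C bQ Q(3)])
  \<comment> \<open>\<open>f\<close> is continuous on \<open>Q\<close> only; extended by 0 it is
    Borel on the whole plane, and the density vanishes off \<open>Q\<close>\<close>
  define F where "F z = indicator Q z *\<^sub>R f z" for z
  have F: "F \<in> borel_measurable borel"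
    unfolding F_def by (rule borel_measurable_continuous_on_indicator[OF bQ cQ])
  then have F' [measurable]: "F \<in> measurable (density lborel J) borel" by simp
  have "distr (density lborel J) borel F = density hausdorff2 (indicator (f ` Q))"
  proof (rule measure_eqI)
    fix C assume "C \<in> sets (distr (density lborel J) borel F)"
    then have bC [measurable]: "C \<in> sets borel" by simp
    have pre: "F -` C \<in> sets borel" using measurable_sets[OF F bC] by simp
    have "emeasure (distr (density lborel J) borel F) C = emeasure (density lborel J) (F -` C)"
      by (subst emeasure_distr[OF F' bC]) simp
    also have "\<dots> = (\<integral>\<^sup>+z. J z * indicator (F -` C) z \<partial>lborel)"
      using pre by (intro emeasure_density) auto
    also have "\<dots> = (\<integral>\<^sup>+z\<in>(Q \<inter> F -` C). ennreal (area_factor (f' z)) \<partial>lborel)"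
      by (intro nn_integral_cong) (auto simp: J_def indicator_def)
    also have "\<dots> = emeasure hausdorff2 (f ` (Q \<inter> F -` C))"
      by (rule area_formula_measure[OF C inj Q, symmetric]) (use pre bQ in auto)
    also have "f ` (Q \<inter> F -` C) = f ` Q \<inter> C" by (auto simp: F_def)
    also have "emeasure hausdorff2 (f ` Q \<inter> C) = (\<integral>\<^sup>+q. indicator (f ` Q) q * indicator C q \<partial>hausdorff2)"
      by (simp add: nn_integral_indicator[symmetric] indicator_inter_arith)
    also have "\<dots> = emeasure (density hausdorff2 (indicator (f ` Q))) C"
      by (rule emeasure_density[symmetric]) auto
    finally show "emeasure (distr (density lborel J) borel F) C = emeasure (density hausdorff2 (indicator (f ` Q))) C" .
  qed simp
  then have "(\<integral>\<^sup>+q. \<phi> q \<partial>distr (density lborel J) borel F) = (\<integral>\<^sup>+q. \<phi> q \<partial>density hausdorff2 (indicator (f ` Q)))"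
    by simp
  also have "\<dots> = (\<integral>\<^sup>+q\<in>f ` Q. \<phi> q \<partial>hausdorff2)"
    by (subst nn_integral_density) (auto simp: mult.commute)
  also have "(\<integral>\<^sup>+q. \<phi> q \<partial>distr (density lborel J) borel F) = (\<integral>\<^sup>+z. J z * \<phi> (F z) \<partial>lborel)"
    by (subst nn_integral_distr[OF F'], simp, subst nn_integral_density) (use F in auto)
  also have "\<dots> = (\<integral>\<^sup>+z\<in>Q. (\<phi> (f z) * ennreal (area_factor (f' z))) \<partial>lborel)"
    by (intro nn_integral_cong) (auto simp: J_def F_def indicator_def mult.commute)
  finally show ?thesis by simp
qed

text \<open>The set \<open>S\<close> need not be Borel, but it is covered by a countable
  intersection of unions of closed sets, and closures do not enlarge diameters.\<close>

lemma hausdorff2_raw_null_cover: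
  fixes S :: "'a::metric_space set"
  assumes "hausdorff2_raw S = 0"
  obtains Z where "Z \<in> null_sets hausdorff2" "S \<subseteq> Z"
proof -
  have "\<exists>C. S \<subseteq> (\<Union>i::nat. C i) \<and> (\<forall>i. bounded (C i) \<and> diameter (C i) \<le> 1 / real (Suc n)) \<and>
       (\<Sum>i. ennreal ((diameter (C i))\<^sup>2)) < ennreal (1 / real (Suc n))" for n
  proof -
    have "hausdorff2_delta (1 / real (Suc n)) S \<le> hausdorff2_raw S"
      unfolding hausdorff2_raw_def by (rule SUP_upper) simp
    then have "hausdorff2_delta (1 / real (Suc n)) S < ennreal (1 / real (Suc n))"
      using assms by (simp add: le_zero_eq del: of_nat_Suc)
    then show ?thesis unfolding hausdorff2_delta_def INF_less_iff by blast
  qed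
  then obtain C where C: "\<And>n. S \<subseteq> (\<Union>i::nat. C n i)" "\<And>n i. bounded (C n i)"
    "\<And>n i. diameter (C n i) \<le> 1 / real (Suc n)"
    "\<And>n. (\<Sum>i. ennreal ((diameter (C n i))\<^sup>2)) < ennreal (1 / real (Suc n))" by metis
  define Z where "Z = (\<Inter>n. \<Union>i. closure (C n i))"
  have SZ: "S \<subseteq> Z"
  proof
    fix x assume x: "x \<in> S"
    have "x \<in> (\<Union>i. closure (C n i))" for n
      using C(1)[of n] x closure_subset by blast
    then show "x \<in> Z" by (simp add: Z_def)
  qed
  have bZ: "Z \<in> sets borel" unfolding Z_def by measurable
  have "hausdorff2_delta (1 / real (Suc n)) Z \<le> ennreal (1 / real (Suc n))" for n
  proof -
    have "hausdorff2_delta (1 / real (Suc n)) Z \<le> (\<Sum>i. ennreal ((diameter (closure (C n i)))\<^sup>2))"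
      by (rule hausdorff2_delta_le_cover) (use C in \<open>auto simp: Z_def diameter_closure\<close>)
    also have "\<dots> \<le> ennreal (1 / real (Suc n))" using C(2) C(4)[of n] by (simp add: diameter_closure)
    finally show ?thesis .
  qed
  then have "hausdorff2_raw Z \<le> 0"
  proof (intro LIMSEQ_le[OF hausdorff2_raw_limit, of _ 0] exI allI impI)
    have "(\<lambda>n. ennreal (1 / real (Suc n))) \<longlonglongrightarrow> ennreal 0"
      by (intro tendsto_ennrealI LIMSEQ_Suc lim_1_over_n)
    then show "(\<lambda>n. ennreal (1 / real (Suc n))) \<longlonglongrightarrow> 0" by simp
  qed
  then have "Z \<in> null_sets hausdorff2" using bZ by (simp add: null_sets_def emeasure_hausdorff2)
  then show ?thesis using SZ that by blast
qed

lemma hausdorff2_raw_null_set_plane: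
  fixes N :: "(real^2) set"
  assumes "N \<in> null_sets lborel"
  shows "hausdorff2_raw N = 0"
proof -
  have "N \<in> sets borel" "emeasure hausdorff2 N = 0" using assms by (auto simp: hausdorff2_plane null_sets_def)
  then show ?thesis using hausdorff2_raw_unit_square_finite
    by (auto simp: emeasure_hausdorff2 ennreal_divide_eq_0_iff)
qed

text \<open>A continuously differentiable map is locally Lipschitz. The outer measure is used
  because the image of a null set need not be Borel.\<close>

lemma hausdorff2_raw_C1_image_null:
  fixes f :: "real^2 \<Rightarrow> 'b::euclidean_space"
  assumes C: "C1_map_on W f f'" and N: "N \<subseteq> W" "N \<subseteq> N'" "N' \<in> null_sets lborel"
  shows "hausdorff2_raw (f ` N) = 0"
proof (cases "W = {}")
  case False
  note W = C1_map_onD[OF C]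
  define good where "good z d \<longleftrightarrow> 0 < d \<and> hausdorff2_raw (f ` (N \<inter> ball z d)) = 0" for z d
  have "\<exists>d. good z d" if z: "z \<in> W" for z
  proof -
    obtain d where d: "0 < d" "ball z d \<subseteq> W"
      "\<forall>x\<in>ball z d. \<forall>y\<in>ball z d. norm (f x - f y - f' z (x - y)) \<le> 1 * norm (x - y)"
      by (rule C1_map_almost_linear[OF C z zero_less_one])
    obtain K where K: "K > 0" "\<And>v. norm (f' z v) \<le> norm v * K"
      using bounded_linear.pos_bounded[of "f' z"] W(3)[OF z] linear_linear by blast
    have "hausdorff2_raw (f ` (N \<inter> ball z d)) \<le> ennreal ((1 + K)\<^sup>2) * hausdorff2_raw ((\<lambda>x. x) ` (N \<inter> ball z d))"
    proof (rule hausdorff2_raw_lipschitz)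
      fix x y assume "x \<in> N \<inter> ball z d" "y \<in> N \<inter> ball z d"
      then have "norm (f x - f y - f' z (x - y)) \<le> norm (x - y)" using d(3) by auto
      then have "norm (f x - f y) \<le> norm (x - y) + norm (x - y) * K"
        using K(2)[of "x - y"] norm_triangle_sub[of "f x - f y" "f' z (x - y)"] by linarith
      then show "dist (f x) (f y) \<le> (1 + K) * dist x y" by (simp add: dist_norm algebra_simps)
    qed (use K in simp)
    also have "hausdorff2_raw ((\<lambda>x. x) ` (N \<inter> ball z d)) = 0"
      using hausdorff2_raw_mono[of "N \<inter> ball z d" N'] hausdorff2_raw_null_set_plane[OF N(3)] N(2)
      by (simp add: le_infI1)
    finally show ?thesis using d(1) by (auto simp: good_def)
  qed
  then obtain d where good: "\<And>z. z \<in> W \<Longrightarrow> good z (d z)" by metis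
  then have "\<And>z. z \<in> W \<Longrightarrow> 0 < d z" by (simp add: good_def)
  then obtain s :: "nat \<Rightarrow> real^2" where s: "range s \<subseteq> W" "W \<subseteq> (\<Union>i. ball (s i) (d (s i)))"
    using countable_ball_cover[of W d] False by blast
  have "f ` N \<subseteq> (\<Union>i. f ` (N \<inter> ball (s i) (d (s i))))"
  proof
    fix y assume "y \<in> f ` N"
    then obtain x where x: "x \<in> N" "y = f x" by blast
    then obtain i where "x \<in> ball (s i) (d (s i))" using N(1) s(2) by blast
    then show "y \<in> (\<Union>i. f ` (N \<inter> ball (s i) (d (s i))))" using x by blast
  qed
  then have "hausdorff2_raw (f ` N) \<le> (\<Sum>i. hausdorff2_raw (f ` (N \<inter> ball (s i) (d (s i)))))"
    using hausdorff2_raw_mono hausdorff2_raw_subadditive order_trans by blast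
  also have "\<dots> = 0" using good s(1) by (simp add: good_def image_subset_iff)
  finally show ?thesis by simp
qed (use N in simp)

section \<open>Second derivatives\<close>

lemma has_derivative_linear_iff:
  fixes f :: "'a::euclidean_space \<Rightarrow> 'b::real_normed_vector"
  assumes "linear L"
  shows "(f has_derivative L) (at x) \<longleftrightarrow> (\<forall>e>0. \<exists>d>0. \<forall>y. norm (y - x) < d \<longrightarrow> norm (f y - f x - L (y - x)) \<le> e * norm (y - x))"
  using assms by (simp add: has_derivative_at_alt linear_linear)

lemma C_k_on_SucD:
  assumes "C_k_on (Suc k) f W" "x \<in> W"
  shows "(f has_derivative frechet_derivative f (at x)) (at x)" "linear (frechet_derivative f (at x))"
  using assms by (auto simp: frechet_derivative_works[symmetric] linear_frechet_derivative)

lemma C_k_on_continuous: "C_k_on k f W \<Longrightarrow> continuous_on W f"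
  by (cases k) (auto intro!: continuous_at_imp_continuous_on differentiable_imp_continuous_within)

lemma linear_basis_expansion:
  fixes L :: "'a::euclidean_space \<Rightarrow> 'b::real_normed_vector"
  assumes "linear L"
  shows "L v = (\<Sum>b\<in>Basis. (v \<bullet> b) *\<^sub>R L b)"
  by (subst euclidean_representation[of v, symmetric]) (simp add: linear_sum[OF assms] linear_scale[OF assms])

lemma C_k_on_imp_C1_map:
  fixes f :: "real^2 \<Rightarrow> 'b::real_normed_vector"
  assumes "open W" "C_k_on (Suc k) f W"
  shows "C1_map_on W f (\<lambda>x. frechet_derivative f (at x))"
proof -
  have "continuous_on W (\<lambda>x. \<Sum>b\<in>Basis. (v \<bullet> b) *\<^sub>R frechet_derivative f (at x) b)" for v
    using assms(2) by (intro continuous_intros) (auto intro: C_k_on_continuous)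
  then have "continuous_on W (\<lambda>x. frechet_derivative f (at x) v)" for v
    by (rule continuous_on_eq) (rule linear_basis_expansion[OF C_k_on_SucD(2)[OF assms(2)], symmetric])
  then show ?thesis using assms(1) C_k_on_SucD[OF assms(2)] by (auto simp: C1_map_on_def)
qed

text \<open>Partial derivatives are differentiable by definition of \<open>C_k_on\<close>; other
  directions \<open>a\<close> follow by expanding \<open>a\<close> in the basis.\<close>

lemma second_derivative_works:
  fixes f :: "'a::euclidean_space \<Rightarrow> 'b::real_normed_vector"
  assumes "open W" "C_k_on (Suc (Suc k)) f W" "x \<in> W"
  shows "((\<lambda>y. frechet_derivative f (at y) a) has_derivative second_derivative f x a) (at x)"
proof -
  have "((\<lambda>y. \<Sum>b\<in>Basis. (a \<bullet> b) *\<^sub>R frechet_derivative f (at y) b) has_derivative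
      (\<lambda>v. \<Sum>b\<in>Basis. (a \<bullet> b) *\<^sub>R frechet_derivative (\<lambda>y. frechet_derivative f (at y) b) (at x) v)) (at x)"
    using assms by (intro has_derivative_sum has_derivative_scaleR_right) (auto simp: frechet_derivative_works[symmetric])
  then have "((\<lambda>y. frechet_derivative f (at y) a) has_derivative
      (\<lambda>v. \<Sum>b\<in>Basis. (a \<bullet> b) *\<^sub>R frechet_derivative (\<lambda>y. frechet_derivative f (at y) b) (at x) v)) (at x)"
    by (rule has_derivative_transform_within_open[OF _ assms(1,3)])
       (rule linear_basis_expansion[OF C_k_on_SucD(2)[OF assms(2)], symmetric])
  moreover have "second_derivative f x a = frechet_derivative (\<lambda>y. frechet_derivative f (at y) a) (at x)"
    by (rule ext) (simp add: second_derivative_def)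
  ultimately show ?thesis by (simp add: frechet_derivative_at[symmetric])
qed

lemma second_derivative_linear_right:
  assumes "open W" "C_k_on (Suc (Suc k)) f W" "x \<in> W"
  shows "linear (second_derivative f x a)"
  using has_derivative_linear[OF second_derivative_works[OF assms]] .

lemma second_derivative_linear_left:
  fixes f :: "'a::euclidean_space \<Rightarrow> 'b::real_normed_vector"
  assumes "open W" "C_k_on (Suc (Suc k)) f W" "x \<in> W"
  shows "linear (\<lambda>a. second_derivative f x a b)"
proof (rule linearI)
  note lin = C_k_on_SucD(2)[OF assms(2)]
  fix a c :: 'a and r :: real
  have "((\<lambda>y. frechet_derivative f (at y) a + frechet_derivative f (at y) c) has_derivative
      (\<lambda>v. second_derivative f x a v + second_derivative f x c v)) (at x)"
    by (intro has_derivative_add second_derivative_works[OF assms])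
  then have "((\<lambda>y. frechet_derivative f (at y) (a + c)) has_derivative
      (\<lambda>v. second_derivative f x a v + second_derivative f x c v)) (at x)"
    by (rule has_derivative_transform_within_open[OF _ assms(1,3)]) (simp add: linear_add[OF lin])
  from fun_cong[OF has_derivative_unique[OF second_derivative_works[OF assms, of "a + c"] this], of b]
  show "second_derivative f x (a + c) b = second_derivative f x a b + second_derivative f x c b"
    by simp
  have "((\<lambda>y. r *\<^sub>R frechet_derivative f (at y) a) has_derivative (\<lambda>v. r *\<^sub>R second_derivative f x a v)) (at x)"
    by (intro has_derivative_scaleR_right second_derivative_works[OF assms])
  then have "((\<lambda>y. frechet_derivative f (at y) (r *\<^sub>R a)) has_derivative (\<lambda>v. r *\<^sub>R second_derivative f x a v)) (at x)"
    by (rule has_derivative_transform_within_open[OF _ assms(1,3)]) (simp add: linear_scale[OF lin])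
  from fun_cong[OF has_derivative_unique[OF second_derivative_works[OF assms, of "r *\<^sub>R a"] this], of b]
  show "second_derivative f x (r *\<^sub>R a) b = r *\<^sub>R second_derivative f x a b"
    by simp
qed

text \<open>The second difference along \<open>a\<close> and \<open>b\<close> is an increment of
  \<open>G\<close>, whose derivative is controlled by the differentiability of the directional
  derivative along \<open>a\<close>. Since the difference is symmetric in \<open>a\<close> and
  \<open>b\<close> while the estimate singles out \<open>a\<close>, symmetry of the second
  derivative follows.\<close>

lemma second_difference_limit:
  fixes f :: "'a::euclidean_space \<Rightarrow> 'b::real_normed_vector"
  assumes "open W" "C_k_on (Suc (Suc k)) f W" "x \<in> W" "0 < e"
  obtains d where "0 < d" "\<forall>t. 0 < t \<and> t < d \<longrightarrow>
    norm (f (x + t *\<^sub>R a + t *\<^sub>R b) - f (x + t *\<^sub>R a) - f (x + t *\<^sub>R b) + f x - (t * t) *\<^sub>R second_derivative f x a b) \<le> e * (t * t)"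
proof -
  define D where "D = second_derivative f x a"
  define n where "n = norm a + norm b + 1"
  have n: "0 < n" "norm a \<le> n" "norm b \<le> n" "norm a + norm b \<le> n" unfolding n_def by (auto simp: add_nonneg_pos)
  define e' where "e' = e / (2 * n)"
  have e': "0 < e'" using n assms(4) by (simp add: e'_def)
  have linD: "linear D" unfolding D_def by (rule second_derivative_linear_right[OF assms(1-3)])
  obtain d1 where d1: "0 < d1" "\<forall>y. norm (y - x) < d1 \<longrightarrow>
      norm (frechet_derivative f (at y) a - frechet_derivative f (at x) a - D (y - x)) \<le> e' * norm (y - x)"
    using second_derivative_works[OF assms(1-3), of a] e' linD
    unfolding has_derivative_linear_iff[OF second_derivative_linear_right[OF assms(1-3)]] D_def by blast
  obtain d2 where d2: "0 < d2" "ball x d2 \<subseteq> W" using assms(1,3) openE by blast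
  define d where "d = min d1 d2 / n"
  have d: "0 < d" using d1 d2 n by (simp add: d_def)
  have main: "norm (f (x + t *\<^sub>R a + t *\<^sub>R b) - f (x + t *\<^sub>R a) - f (x + t *\<^sub>R b) + f x - (t * t) *\<^sub>R D b) \<le> e * (t * t)"
    if t: "0 < t" "t < d" for t
  proof -
    define G where "G s = f (x + s *\<^sub>R a + t *\<^sub>R b) - f (x + s *\<^sub>R a) - (s * t) *\<^sub>R D b" for s
    define G' where "G' s = frechet_derivative f (at (x + s *\<^sub>R a + t *\<^sub>R b)) a - frechet_derivative f (at (x + s *\<^sub>R a)) a - t *\<^sub>R D b" for s
    have tn: "t * n < min d1 d2" using t(2) n by (simp add: d_def field_simps)
    have small: "norm (s *\<^sub>R a + r *\<^sub>R b) \<le> t * n" if "0 \<le> s" "s \<le> t" "0 \<le> r" "r \<le> t" for s r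
    proof -
      have "norm (s *\<^sub>R a + r *\<^sub>R b) \<le> s * norm a + r * norm b" using that by (intro norm_triangle_le) simp
      also have "\<dots> \<le> t * norm a + t * norm b" using that by (intro add_mono mult_right_mono) auto
      also have "\<dots> = t * (norm a + norm b)" by (simp add: algebra_simps)
      also have "\<dots> \<le> t * n" using t n by (intro mult_left_mono) auto
      finally show ?thesis .
    qed
    have inW: "x + s *\<^sub>R a + r *\<^sub>R b \<in> W" if "0 \<le> s" "s \<le> t" "0 \<le> r" "r \<le> t" for s r
    proof -
      have "norm (s *\<^sub>R a + r *\<^sub>R b) < d2" using small[OF that] tn by simp
      then have "x + s *\<^sub>R a + r *\<^sub>R b \<in> ball x d2"
        unfolding mem_ball dist_norm by (metis add.assoc add_diff_cancel_left' norm_minus_commute)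
      then show ?thesis using d2 by blast
    qed
    have est: "norm (frechet_derivative f (at (x + s *\<^sub>R a + r *\<^sub>R b)) a - frechet_derivative f (at x) a - D (s *\<^sub>R a + r *\<^sub>R b)) \<le> e' * (t * n)"
      if "0 \<le> s" "s \<le> t" "0 \<le> r" "r \<le> t" for s r
    proof -
      have "norm ((x + s *\<^sub>R a + r *\<^sub>R b) - x) < d1" using small[OF that] tn by (simp add: add.assoc)
      then have "norm (frechet_derivative f (at (x + s *\<^sub>R a + r *\<^sub>R b)) a - frechet_derivative f (at x) a - D (x + s *\<^sub>R a + r *\<^sub>R b - x)) \<le> e' * norm ((x + s *\<^sub>R a + r *\<^sub>R b) - x)"
        using d1(2) by blast
      also have "\<dots> \<le> e' * (t * n)" using small[OF that] e' by (intro mult_left_mono) (auto simp: add.assoc)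
      finally show ?thesis by (simp add: add.assoc)
    qed
    have dG: "(G has_derivative (\<lambda>h. h *\<^sub>R G' s)) (at s within {0..t})" if s: "s \<in> {0..t}" for s
    proof -
      have 1: "((\<lambda>s. f (x + s *\<^sub>R a + r *\<^sub>R b)) has_derivative
          (\<lambda>h. frechet_derivative f (at (x + s *\<^sub>R a + r *\<^sub>R b)) (h *\<^sub>R a))) (at s within {0..t})"
        if r: "0 \<le> r" "r \<le> t" for r
      proof (rule has_derivative_compose[of "\<lambda>s. x + s *\<^sub>R a + r *\<^sub>R b" "\<lambda>h. h *\<^sub>R a" s _ f])
        show "((\<lambda>s. x + s *\<^sub>R a + r *\<^sub>R b) has_derivative (\<lambda>h. h *\<^sub>R a)) (at s within {0..t})"
          by (auto intro!: derivative_eq_intros)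
        show "(f has_derivative frechet_derivative f (at (x + s *\<^sub>R a + r *\<^sub>R b))) (at (x + s *\<^sub>R a + r *\<^sub>R b))"
          using s r by (intro C_k_on_SucD(1)[OF assms(2) inW[of s r]]) auto
      qed
      have lin: "linear (frechet_derivative f (at (x + s *\<^sub>R a + r *\<^sub>R b)))" if r: "0 \<le> r" "r \<le> t" for r
        using s r by (intro C_k_on_SucD(2)[OF assms(2) inW]) auto
      have 0: "((\<lambda>s. (s * t) *\<^sub>R D b) has_derivative (\<lambda>h. (h * t) *\<^sub>R D b)) (at s within {0..t})"
        by (auto intro!: derivative_eq_intros)
      show ?thesis unfolding G_def G'_def
        using has_derivative_diff[OF has_derivative_diff[OF 1[of t] 1[of 0]] 0] t(1)
        by (simp add: linear_scale[OF lin[of t]] linear_scale[OF lin[of 0, simplified]] scaleR_diff_right)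
    qed
    have bG: "onorm (\<lambda>h. h *\<^sub>R G' s) \<le> e * t" if s: "s \<in> {0..t}" for s
    proof -
      \<comment> \<open>two evaluations of the linear approximation, one at \<open>s *\<^sub>R a + t
        *\<^sub>R b\<close> and one at \<open>s *\<^sub>R a\<close>, whose difference isolates
        \<open>D b\<close>\<close>
      have "G' s = (frechet_derivative f (at (x + s *\<^sub>R a + t *\<^sub>R b)) a - frechet_derivative f (at x) a - D (s *\<^sub>R a + t *\<^sub>R b))
        - (frechet_derivative f (at (x + s *\<^sub>R a + 0 *\<^sub>R b)) a - frechet_derivative f (at x) a - D (s *\<^sub>R a + 0 *\<^sub>R b))"
        by (simp add: G'_def linear_add[OF linD] linear_scale[OF linD])
      also have "norm \<dots> \<le> e' * (t * n) + e' * (t * n)"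
        using s t by (intro order_trans[OF norm_triangle_ineq4] add_mono est) auto
      also have "\<dots> = e * t" using n by (simp add: e'_def field_simps)
      finally have "norm (G' s) \<le> e * t" .
      then show ?thesis using assms(4) t by (intro onorm_bound) (auto simp: mult.commute mult_left_mono)
    qed
    have "norm (G t - G 0) \<le> (e * t) * norm (t - 0)"
      by (rule differentiable_bound[OF _ dG bG]) (use t in auto)
    then show ?thesis using t by (simp add: G_def algebra_simps)
  qed
  show ?thesis using that[OF d] main unfolding D_def by blast
qed

lemma second_derivative_symmetric:
  fixes f :: "'a::euclidean_space \<Rightarrow> 'b::real_normed_vector"
  assumes "open W" "C_k_on (Suc (Suc k)) f W" "x \<in> W"
  shows "second_derivative f x a b = second_derivative f x b a"
proof (rule ccontr)
  define A B where "A = second_derivative f x a b" and "B = second_derivative f x b a"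
  assume "second_derivative f x a b \<noteq> second_derivative f x b a"
  then have e: "0 < norm (A - B) / 3" by (simp add: A_def B_def)
  obtain d1 where d1: "0 < d1" "\<forall>t. 0 < t \<and> t < d1 \<longrightarrow>
    norm (f (x + t *\<^sub>R a + t *\<^sub>R b) - f (x + t *\<^sub>R a) - f (x + t *\<^sub>R b) + f x - (t * t) *\<^sub>R A) \<le> norm (A - B) / 3 * (t * t)"
    unfolding A_def[of] by (rule second_difference_limit[OF assms e[unfolded A_def]])
  obtain d2 where d2: "0 < d2" "\<forall>t. 0 < t \<and> t < d2 \<longrightarrow>
    norm (f (x + t *\<^sub>R b + t *\<^sub>R a) - f (x + t *\<^sub>R b) - f (x + t *\<^sub>R a) + f x - (t * t) *\<^sub>R B) \<le> norm (A - B) / 3 * (t * t)"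
    unfolding B_def[of] by (rule second_difference_limit[OF assms e[unfolded B_def]])
  define t where "t = min d1 d2 / 2"
  have t: "0 < t" "t < d1" "t < d2" using d1 d2 by (auto simp: t_def)
  define P where "P = f (x + t *\<^sub>R a + t *\<^sub>R b) - f (x + t *\<^sub>R a) - f (x + t *\<^sub>R b) + f x"
  have 1: "norm (P - (t * t) *\<^sub>R A) \<le> norm (A - B) / 3 * (t * t)" using d1(2) t by (auto simp: P_def)
  have "norm (f (x + t *\<^sub>R b + t *\<^sub>R a) - f (x + t *\<^sub>R b) - f (x + t *\<^sub>R a) + f x - (t * t) *\<^sub>R B) \<le> norm (A - B) / 3 * (t * t)"
    using d2(2) t by blast
  then have 2: "norm (P - (t * t) *\<^sub>R B) \<le> norm (A - B) / 3 * (t * t)" by (simp add: P_def algebra_simps)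
  have "(t * t) * norm (A - B) = norm ((P - (t * t) *\<^sub>R B) - (P - (t * t) *\<^sub>R A))"
    using t by (simp add: scaleR_diff_right[symmetric])
  also have "\<dots> \<le> norm (A - B) / 3 * (t * t) + norm (A - B) / 3 * (t * t)"
    by (rule order_trans[OF norm_triangle_ineq4 add_mono[OF 2 1]])
  finally have "(t * t) * norm (A - B) \<le> (t * t) * (2 / 3 * norm (A - B))" by (simp add: algebra_simps)
  then have "norm (A - B) \<le> 2 / 3 * norm (A - B)" using t by (subst (asm) mult_le_cancel_left_pos) auto
  then show False using e by simp
qed

text \<open>The remainder \<open>R\<close> has a derivative of order \<open>o(norm (w - x))\<close>;
  the symmetry of the second derivative is what makes the derivative of the quadratic term equal to
  \<open>D h (w - x)\<close>.\<close>

lemma second_order_taylor: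
  fixes f :: "'a::euclidean_space \<Rightarrow> 'b::real_normed_vector"
  assumes "open W" "C_k_on (Suc (Suc k)) f W" "x \<in> W" "0 < e"
  obtains d where "0 < d" "\<forall>y. norm (y - x) < d \<longrightarrow>
    norm (f y - f x - frechet_derivative f (at x) (y - x) - (1/2) *\<^sub>R second_derivative f x (y - x) (y - x)) \<le> e * (norm (y - x))\<^sup>2"
proof -
  define D where "D = second_derivative f x"
  define L where "L = frechet_derivative f (at x)"
  note sym = second_derivative_symmetric[OF assms(1-3), folded D_def]
  have linr: "linear (D a)" for a unfolding D_def by (rule second_derivative_linear_right[OF assms(1-3)])
  have linl: "linear (\<lambda>a. D a b)" for b unfolding D_def by (rule second_derivative_linear_left[OF assms(1-3)])
  have linL: "linear L" unfolding L_def by (rule C_k_on_SucD(2)[OF assms(2,3)])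
  have bb: "bounded_bilinear D"
    using bilinear_conv_bounded_bilinear linl linr by (auto simp: bilinear_def)
  define e' where "e' = e / DIM('a)"
  have e': "0 < e'" using assms(4) by (simp add: e'_def)
  have "\<exists>d>0. \<forall>y. norm (y - x) < d \<longrightarrow> norm (frechet_derivative f (at y) b - L b - D b (y - x)) \<le> e' * norm (y - x)" for b
    using second_derivative_works[OF assms(1-3), of b] e'
    unfolding has_derivative_linear_iff[OF second_derivative_linear_right[OF assms(1-3)]] D_def L_def by blast
  then obtain \<delta> where \<delta>: "\<And>b. 0 < \<delta> b" "\<And>b y. norm (y - x) < \<delta> b \<Longrightarrow> norm (frechet_derivative f (at y) b - L b - D b (y - x)) \<le> e' * norm (y - x)"
    by metis
  obtain d2 where d2: "0 < d2" "ball x d2 \<subseteq> W" using assms(1,3) openE by blast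
  define d where "d = Min (insert d2 (\<delta> ` Basis))"
  have d: "0 < d" using \<delta>(1) d2(1) by (simp add: d_def)
  have "c \<in> insert d2 (\<delta> ` Basis) \<Longrightarrow> d \<le> c" for c unfolding d_def by (rule Min_le) auto
  then have d': "d \<le> d2" "\<And>b. b \<in> Basis \<Longrightarrow> d \<le> \<delta> b" by auto
  have main: "norm (f y - f x - L (y - x) - (1/2) *\<^sub>R D (y - x) (y - x)) \<le> e * (norm (y - x))\<^sup>2" if y: "norm (y - x) < d" for y
  proof -
    define r where "r = norm (y - x)"
    define R where "R w = f w - L (w - x) - (1/2) *\<^sub>R D (w - x) (w - x)" for w
    have "norm (R y - R x) \<le> (e * r) * norm (y - x)"
    proof (rule differentiable_bound[of "cball x r" R "\<lambda>w h. frechet_derivative f (at w) h - L h - D h (w - x)"])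
      fix w assume w: "w \<in> cball x r"
      then have wr: "norm (w - x) \<le> r" by (simp add: dist_norm norm_minus_commute)
      have "w \<in> ball x d2" using w y d'(1) by (auto simp: r_def)
      then have wW: "w \<in> W" using d2 by blast
      have dL: "((\<lambda>w. L (w - x)) has_derivative L) (at w within cball x r)"
      proof -
        have "((\<lambda>w. w - x) has_derivative (\<lambda>h. h)) (at w within cball x r)" by (auto intro!: derivative_eq_intros)
        from has_derivative_compose[OF this linear_imp_has_derivative[OF linL]] show ?thesis .
      qed
      have "((\<lambda>w. D (w - x) (w - x)) has_derivative (\<lambda>h. D (w - x) h + D h (w - x))) (at w within cball x r)"
        by (rule bounded_bilinear.FDERIV[OF bb]) (auto intro!: derivative_eq_intros)
      then have "((\<lambda>w. (1/2) *\<^sub>R D (w - x) (w - x)) has_derivative (\<lambda>h. (1/2) *\<^sub>R (D (w - x) h + D h (w - x)))) (at w within cball x r)"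
        by (rule has_derivative_scaleR_right)
      moreover have "(\<lambda>h. (1/2) *\<^sub>R (D (w - x) h + D h (w - x))) = (\<lambda>h. D h (w - x))"
        using sym[of "w - x"] by (auto simp: scaleR_add_left[symmetric] scaleR_add_right fun_eq_iff)
      ultimately have "((\<lambda>w. (1/2) *\<^sub>R D (w - x) (w - x)) has_derivative (\<lambda>h. D h (w - x))) (at w within cball x r)" by simp
      then show "(R has_derivative (\<lambda>h. frechet_derivative f (at w) h - L h - D h (w - x))) (at w within cball x r)"
        unfolding R_def by (intro has_derivative_diff dL has_derivative_at_withinI[OF C_k_on_SucD(1)[OF assms(2) wW]])
      show "onorm (\<lambda>h. frechet_derivative f (at w) h - L h - D h (w - x)) \<le> e * r"
      proof (rule onorm_bound)
        show "0 \<le> e * r" using assms(4) by (simp add: r_def)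
        fix h
        have lin: "linear (\<lambda>h. frechet_derivative f (at w) h - L h - D h (w - x))"
          by (intro linear_compose_sub linL linl C_k_on_SucD(2)[OF assms(2) wW])
        have "norm (frechet_derivative f (at w) h - L h - D h (w - x))
            = norm (\<Sum>b\<in>Basis. (h \<bullet> b) *\<^sub>R (frechet_derivative f (at w) b - L b - D b (w - x)))"
          by (subst linear_basis_expansion[OF lin]) simp
        also have "\<dots> \<le> (\<Sum>b\<in>(Basis :: 'a set). norm h * (e' * r))"
        proof (rule sum_norm_le)
          fix b :: 'a assume b: "b \<in> Basis"
          have "norm (frechet_derivative f (at w) b - L b - D b (w - x)) \<le> e' * norm (w - x)"
            using wr y d'(2)[OF b] by (intro \<delta>(2)) (simp add: r_def)
          also have "\<dots> \<le> e' * r" using wr e' by (intro mult_left_mono) auto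
          finally show "norm ((h \<bullet> b) *\<^sub>R (frechet_derivative f (at w) b - L b - D b (w - x))) \<le> norm h * (e' * r)"
            using Basis_le_norm[OF b, of h] by (auto intro!: mult_mono)
        qed
        also have "\<dots> = e * r * norm h" by (simp add: e'_def)
        finally show "norm (frechet_derivative f (at w) h - L h - D h (w - x)) \<le> e * r * norm h" .
      qed
    qed (auto simp: r_def dist_norm norm_minus_commute)
    moreover have "R y - R x = f y - f x - L (y - x) - (1/2) *\<^sub>R D (y - x) (y - x)"
      using linear_0[OF linL] linear_0[OF linr[of 0]] by (simp add: R_def algebra_simps)
    ultimately show ?thesis by (simp add: r_def power2_eq_square)
  qed
  show ?thesis using that[OF d] main unfolding D_def L_def by blast
qed

section \<open>The second fundamental form seen through a map into the surface\<close>

lemma normal_part_unique: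
  assumes T: "subspace T" and k: "v - k \<in> T" "\<forall>w\<in>T. w \<bullet> k = 0"
  shows "normal_part T v = k"
  unfolding normal_part_def
proof (rule the_equality)
  fix l assume l: "v - l \<in> T \<and> (\<forall>w\<in>T. w \<bullet> l = 0)"
  have "(v - k) - (v - l) \<in> T" using subspace_diff[OF T k(1), of "v - l"] l by blast
  then have "l - k \<in> T" by simp
  then have "(l - k) \<bullet> k = 0" "(l - k) \<bullet> l = 0" using k(2) l by auto
  then have "(l - k) \<bullet> (l - k) = 0" by (simp add: inner_diff_right)
  then show "l = k" by simp
qed (use k in auto)

lemma normal_part_works:
  assumes T: "subspace T"
  shows "v - normal_part T v \<in> T" "w \<in> T \<Longrightarrow> w \<bullet> normal_part T v = 0"
proof -
  obtain y z where yz: "y \<in> span T" "\<And>w. w \<in> span T \<Longrightarrow> orthogonal z w" "v = y + z"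
    using orthogonal_subspace_decomp_exists[of T v] by blast
  have sT: "span T = T" using T by (simp only: span_eq_iff)
  note yz = yz[unfolded sT]
  have "normal_part T v = z"
    by (rule normal_part_unique[OF T]) (use yz in \<open>auto simp: orthogonal_def inner_commute\<close>)
  then show "v - normal_part T v \<in> T" "w \<in> T \<Longrightarrow> w \<bullet> normal_part T v = 0"
    using yz by (auto simp: orthogonal_def inner_commute)
qed

lemma linear_normal_part:
  assumes T: "subspace T"
  shows "linear (normal_part T)"
proof (rule linearI)
  fix x y and r :: real
  note w = normal_part_works[OF T]
  have "(x - normal_part T x) + (y - normal_part T y) \<in> T" by (intro subspace_add T w)
  then show "normal_part T (x + y) = normal_part T x + normal_part T y"
    by (intro normal_part_unique[OF T]) (auto simp: algebra_simps inner_add_right w)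
  have "r *\<^sub>R (x - normal_part T x) \<in> T" by (intro subspace_scale T w)
  then show "normal_part T (r *\<^sub>R x) = r *\<^sub>R normal_part T x"
    by (intro normal_part_unique[OF T]) (auto simp: algebra_simps w)
qed

lemma normal_part_tangent: "subspace T \<Longrightarrow> v \<in> T \<Longrightarrow> normal_part T v = 0"
  by (rule normal_part_unique) auto

lemma C_k_on_transform:
  fixes f :: "'a::euclidean_space \<Rightarrow> 'b::real_normed_vector"
  assumes "open U" "U \<subseteq> W" "C_k_on k f W" "\<And>x. x \<in> U \<Longrightarrow> f x = g x"
  shows "C_k_on k g U"
  using assms(3,4)
proof (induction k arbitrary: f g)
  case 0
  then have "continuous_on W f" by simp
  then have "continuous_on U f" by (rule continuous_on_subset[OF _ assms(2)])
  then have "continuous_on U g" by (rule continuous_on_eq) (rule 0(2))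
  then show ?case by simp
next
  case (Suc k)
  have d: "f differentiable (at x)" if "x \<in> U" for x using Suc.prems(1) that assms(2) by auto
  have eq: "frechet_derivative f (at x) = frechet_derivative g (at x)" if "x \<in> U" for x
    by (rule frechet_derivative_transform_within_open[OF d[OF that] assms(1) that Suc.prems(2)])
  have "g differentiable (at x)" if "x \<in> U" for x
  proof -
    have "(f has_derivative frechet_derivative f (at x)) (at x)" using d[OF that] by (simp add: frechet_derivative_works[symmetric])
    then have "(g has_derivative frechet_derivative f (at x)) (at x)"
      by (rule has_derivative_transform_within_open[OF _ assms(1) that Suc.prems(2)])
    then show ?thesis by (auto simp: differentiable_def)
  qed
  moreover have "C_k_on k (\<lambda>x. frechet_derivative g (at x) b) U" if "b \<in> Basis" for b
    using Suc.prems(1) that by (intro Suc.IH[of "\<lambda>x. frechet_derivative f (at x) b"]) (auto simp: eq)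
  ultimately show ?case by simp
qed

lemma smooth_on_open_C_k:
  fixes f :: "'a::euclidean_space \<Rightarrow> 'b::real_normed_vector"
  assumes "open U" "smooth_on U f"
  shows "C_k_on k f U"
proof -
  obtain W F where W: "open W" "U \<subseteq> W" "\<forall>k. C_k_on k F W" "\<forall>x\<in>U. F x = f x"
    using assms(2) unfolding smooth_on_def by blast
  show ?thesis by (rule C_k_on_transform[OF assms(1) W(2), of k F]) (use W in auto)
qed

text \<open>Polarisation.\<close>

lemma symmetric_bilinear_eqI:
  fixes B1 B2 :: "'a::real_vector \<Rightarrow> 'a \<Rightarrow> 'b::real_vector"
  assumes "\<And>b. linear (\<lambda>a. B1 a b)" "\<And>a. linear (B1 a)" "\<And>a b. B1 a b = B1 b a"
    and "\<And>b. linear (\<lambda>a. B2 a b)" "\<And>a. linear (B2 a)" "\<And>a b. B2 a b = B2 b a"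
    and eq: "\<And>a. B1 a a = B2 a a"
  shows "B1 a b = B2 a b"
proof -
  have "B1 (a + b) (a + b) = B1 a a + 2 *\<^sub>R B1 a b + B1 b b"
    using assms(3)[of b a] by (simp add: linear_add[OF assms(1)] linear_add[OF assms(2)] scaleR_2)
  moreover have "B2 (a + b) (a + b) = B2 a a + 2 *\<^sub>R B2 a b + B2 b b"
    using assms(6)[of b a] by (simp add: linear_add[OF assms(4)] linear_add[OF assms(5)] scaleR_2)
  ultimately have "2 *\<^sub>R B1 a b = 2 *\<^sub>R B2 a b" using eq[of a] eq[of b] eq[of "a + b"] by simp
  then show ?thesis by simp
qed

lemma regular_patchD:
  assumes "regular_patch S q \<phi> U z"
  shows "open U" "z \<in> U" "\<phi> z = q" "C_k_on k \<phi> U" "inj (frechet_derivative \<phi> (at z))" "linear (frechet_derivative \<phi> (at z))"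
    "\<And>y. y \<in> U \<Longrightarrow> \<phi> y \<in> S"
proof -
  show C: "open U" "z \<in> U" "\<phi> z = q" "C_k_on k \<phi> U" "inj (frechet_derivative \<phi> (at z))" for k
    using assms smooth_on_open_C_k unfolding regular_patch_def by auto
  show "linear (frechet_derivative \<phi> (at z))" using C_k_on_SucD(2)[OF C(4) C(2)] .
  fix y assume "y \<in> U"
  then show "\<phi> y \<in> S" using assms unfolding regular_patch_def homeomorphism_def by blast
qed

text \<open>In the chart \<open>\<phi>\<close> the curve \<open>\<alpha>\<close> becomes
  \<open>u\<close>, and \<open>\<alpha> - q = L u + D u u / 2 + o(t\<^sup>2)\<close> by Taylor's
  formula. The homeomorphism gives continuity of \<open>u\<close> only, so its size
  \<open>O(t)\<close> and then the convergence of \<open>u / t\<close> have to be derived from the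
  expansion of \<open>\<alpha>\<close>, with the help of a left inverse of \<open>L\<close>. In the
  normal component the terms with \<open>L\<close> disappear, and comparison of the quadratic terms
  gives the claim.\<close>

lemma regular_patch_curve:
  fixes \<alpha> :: "real \<Rightarrow> real^'n"
  assumes patch: "regular_patch S q \<phi> U z"
    and \<alpha>S: "\<forall>\<^sub>F t in at 0. \<alpha> t \<in> S"
    and exp: "((\<lambda>t. (1 / t\<^sup>2) *\<^sub>R (\<alpha> t - q - t *\<^sub>R v - (t\<^sup>2 / 2) *\<^sub>R w)) \<longlongrightarrow> 0) (at 0)"
  shows "\<exists>a. v = frechet_derivative \<phi> (at z) a \<and>
    normal_part (range (frechet_derivative \<phi> (at z))) w =
    normal_part (range (frechet_derivative \<phi> (at z))) (second_derivative \<phi> z a a)"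
proof -
  note P = regular_patchD[OF patch]
  define L where "L = frechet_derivative \<phi> (at z)"
  define D where "D = second_derivative \<phi> z"
  define N where "N = normal_part (range L)"
  have linL: "linear L" and injL: "inj L" using P by (auto simp: L_def)
  have bL: "bounded_linear L" using linL by (simp add: linear_linear)
  have subT: "subspace (range L)" using linear_subspace_image[OF linL subspace_UNIV] .
  have bN: "bounded_linear N" using linear_normal_part[OF subT] by (simp add: N_def linear_linear)
  have NL: "N (L a) = 0" for a unfolding N_def by (rule normal_part_tangent[OF subT]) simp
  have bb: "bounded_bilinear D"
    using second_derivative_linear_left[OF P(1) P(4) P(2)] second_derivative_linear_right[OF P(1) P(4) P(2)]
    by (auto simp: bilinear_conv_bounded_bilinear[symmetric] bilinear_def D_def)
  obtain m where m: "m > 0" "\<And>x. m * norm x \<le> norm (L x)" using linear_inj_bounded_below_pos[OF linL injL] by blast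
  obtain K where K: "K > 0" "\<And>a b. norm (D a b) \<le> norm a * norm b * K" using bounded_bilinear.pos_bounded[OF bb] by blast
  obtain M where M: "linear M" "M \<circ> L = id" using linear_injective_left_inverse[OF linL injL] by blast
  have bM: "bounded_linear M" using M by (simp add: linear_linear)
  obtain W \<psi> where W: "open W" "homeomorphism U (S \<inter> W) \<phi> \<psi>" using patch unfolding regular_patch_def by blast
  define \<rho> where "\<rho> t = (1 / t\<^sup>2) *\<^sub>R (\<alpha> t - q - t *\<^sub>R v - (t\<^sup>2 / 2) *\<^sub>R w)" for t
  have \<rho>0: "(\<rho> \<longlongrightarrow> 0) (at 0)" using exp unfolding \<rho>_def .
  have \<alpha>: "\<alpha> t = q + t *\<^sub>R v + (t\<^sup>2 / 2) *\<^sub>R w + t\<^sup>2 *\<^sub>R \<rho> t" if "t \<noteq> 0" for t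
    using that by (simp add: \<rho>_def)
  have nz: "\<forall>\<^sub>F t in at 0. t \<noteq> (0::real)" by (simp add: eventually_at_filter)
  have id0: "((\<lambda>t. t) \<longlongrightarrow> (0::real)) (at 0)" by (rule tendsto_ident_at)
  have \<alpha>q: "(\<alpha> \<longlongrightarrow> q) (at 0)"
  proof -
    have "((\<lambda>t. q + t *\<^sub>R v + (t\<^sup>2 / 2) *\<^sub>R w + t\<^sup>2 *\<^sub>R \<rho> t) \<longlongrightarrow> q + 0 *\<^sub>R v + (0\<^sup>2 / 2) *\<^sub>R w + 0\<^sup>2 *\<^sub>R 0) (at 0)"
      by (intro tendsto_intros id0 \<rho>0) simp
    then have "((\<lambda>t. q + t *\<^sub>R v + (t\<^sup>2 / 2) *\<^sub>R w + t\<^sup>2 *\<^sub>R \<rho> t) \<longlongrightarrow> q) (at 0)" by simp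
    then show ?thesis by (rule Lim_transform_eventually) (use nz in \<open>eventually_elim, simp add: \<alpha>\<close>)
  qed
  have qSW: "q \<in> S \<inter> W" using W(2) P(2,3) by (auto simp: homeomorphism_def)
  have \<alpha>SW: "\<forall>\<^sub>F t in at 0. \<alpha> t \<in> S \<inter> W"
    using \<alpha>S topological_tendstoD[OF \<alpha>q W(1)] qSW by (simp add: eventually_conj_iff)
  define u where "u t = \<psi> (\<alpha> t) - z" for t
  have u0: "(u \<longlongrightarrow> 0) (at 0)"
  proof -
    have "((\<lambda>t. \<psi> (\<alpha> t)) \<longlongrightarrow> \<psi> q) (at 0)"
      using W(2) by (intro continuous_on_tendsto_compose[OF _ \<alpha>q qSW \<alpha>SW]) (simp add: homeomorphism_def)
    moreover have "\<psi> q = z" using W(2) P(2,3) by (auto simp: homeomorphism_def)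
    ultimately show ?thesis unfolding u_def by (simp add: LIM_zero)
  qed
  have \<phi>u: "\<forall>\<^sub>F t in at 0. \<phi> (z + u t) = \<alpha> t"
    using \<alpha>SW by eventually_elim (use W(2) in \<open>auto simp: u_def homeomorphism_def\<close>)
  have taylor: "\<forall>\<^sub>F t in at 0. norm (\<alpha> t - q - L (u t) - (1/2) *\<^sub>R D (u t) (u t)) \<le> e * (norm (u t))\<^sup>2" if e0: "0 < e" for e
  proof -
    obtain d where d: "0 < d" "\<forall>y. norm (y - z) < d \<longrightarrow>
      norm (\<phi> y - \<phi> z - L (y - z) - (1/2) *\<^sub>R D (y - z) (y - z)) \<le> e * (norm (y - z))\<^sup>2"
      unfolding L_def D_def by (rule second_order_taylor[OF P(1) P(4) P(2) e0])
    have "\<forall>\<^sub>F t in at 0. norm (u t) < d" using tendstoD[OF u0 d(1)] by simp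
    then show ?thesis using \<phi>u
    proof eventually_elim
      case (elim t)
      have "norm (\<phi> (z + u t) - \<phi> z - L (u t) - (1/2) *\<^sub>R D (u t) (u t)) \<le> e * (norm (u t))\<^sup>2"
        using d(2)[rule_format, of "z + u t"] elim(1) by simp
      then show ?case unfolding elim(2) P(3) .
    qed
  qed
  define \<beta> where "\<beta> t = (1 / t) *\<^sub>R (\<alpha> t - q)" for t
  have \<beta>v: "(\<beta> \<longlongrightarrow> v) (at 0)"
  proof -
    have "((\<lambda>t. v + (t / 2) *\<^sub>R w + t *\<^sub>R \<rho> t) \<longlongrightarrow> v + (0 / 2) *\<^sub>R w + 0 *\<^sub>R 0) (at 0)"
      by (intro tendsto_intros id0 \<rho>0) simp
    then have "((\<lambda>t. v + (t / 2) *\<^sub>R w + t *\<^sub>R \<rho> t) \<longlongrightarrow> v) (at 0)" by simp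
    then show ?thesis
      by (rule Lim_transform_eventually) (use nz in \<open>eventually_elim, simp add: \<alpha> \<beta>_def algebra_simps power2_eq_square\<close>)
  qed
  define C where "C = 2 * (norm v + 1) / m"
  have C: "0 < C" using m by (simp add: C_def add_nonneg_pos)
  have uC: "\<forall>\<^sub>F t in at 0. norm (u t) \<le> C * \<bar>t\<bar>"
  proof -
    define k where "k = K / 2 + 1"
    have k: "0 < k" using K by (simp add: k_def)
    have "\<forall>\<^sub>F t in at 0. norm (u t) < m / (2 * k)" using tendstoD[OF u0, of "m / (2 * k)"] m k by simp
    moreover have "\<forall>\<^sub>F t in at 0. norm (\<beta> t) < norm v + 1"
      using order_tendstoD(2)[OF tendsto_norm[OF \<beta>v]] by simp
    ultimately show ?thesis using taylor[OF zero_less_one] nz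
    proof eventually_elim
      case (elim t)
      have "m * norm (u t) \<le> norm (L (u t))" by (rule m)
      also have "\<dots> \<le> norm (\<alpha> t - q) + norm (\<alpha> t - q - L (u t))"
        using norm_triangle_sub[of "L (u t)" "\<alpha> t - q"] by (simp add: norm_minus_commute)
      also have "norm (\<alpha> t - q - L (u t)) \<le> norm ((1/2) *\<^sub>R D (u t) (u t)) + (norm (u t))\<^sup>2"
        using elim(3) norm_triangle_sub[of "\<alpha> t - q - L (u t)" "(1/2) *\<^sub>R D (u t) (u t)"] by linarith
      also have "norm ((1/2) *\<^sub>R D (u t) (u t)) \<le> K / 2 * (norm (u t))\<^sup>2"
        using K(2)[of "u t" "u t"] by (simp add: power2_eq_square algebra_simps)
      finally have 1: "m * norm (u t) \<le> norm (\<alpha> t - q) + k * norm (u t) * norm (u t)"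
        by (simp add: k_def algebra_simps power2_eq_square)
      have "k * norm (u t) \<le> m / 2" using elim(1) k by (simp add: field_simps)
      then have "k * norm (u t) * norm (u t) \<le> m / 2 * norm (u t)" by (rule mult_right_mono) simp
      with 1 have 2: "m / 2 * norm (u t) \<le> norm (\<alpha> t - q)" by simp
      have "\<alpha> t - q = t *\<^sub>R \<beta> t" using elim(4) by (simp add: \<beta>_def)
      then have "norm (\<alpha> t - q) = \<bar>t\<bar> * norm (\<beta> t)" by simp
      also have "\<dots> \<le> \<bar>t\<bar> * (norm v + 1)" using elim(2) by (intro mult_left_mono) auto
      finally have "m / 2 * norm (u t) \<le> \<bar>t\<bar> * (norm v + 1)" using 2 by simp
      then show ?case using m by (simp add: C_def field_simps)
    qed
  qed
  define s where "s t = (1 / t) *\<^sub>R u t" for t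
  have sC: "\<forall>\<^sub>F t in at 0. norm (s t) \<le> C" using uC nz by eventually_elim (simp add: s_def field_simps)
  define r where "r t = (1 / t\<^sup>2) *\<^sub>R (\<alpha> t - q - L (u t) - (1/2) *\<^sub>R D (u t) (u t))" for t
  have r0: "(r \<longlongrightarrow> 0) (at 0)"
  proof (rule tendstoI)
    fix e :: real assume e: "0 < e"
    define e' where "e' = e / (2 * C\<^sup>2)"
    have e': "0 < e'" using e C by (simp add: e'_def)
    show "\<forall>\<^sub>F t in at 0. dist (r t) 0 < e"
      using taylor[OF e'] uC nz
    proof eventually_elim
      case (elim t)
      have "norm (r t) = (1 / t\<^sup>2) * norm (\<alpha> t - q - L (u t) - (1/2) *\<^sub>R D (u t) (u t))" by (simp add: r_def)
      also have "\<dots> \<le> (1 / t\<^sup>2) * (e' * (C * \<bar>t\<bar>)\<^sup>2)"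
        using elim e' by (intro mult_left_mono order_trans[OF elim(1)] power_mono) auto
      also have "\<dots> = e / 2" using elim(3) C by (simp add: e'_def power_mult_distrib)
      finally show ?case using e by simp
    qed
  qed
  have Ls: "((\<lambda>t. L (s t)) \<longlongrightarrow> v) (at 0)"
  proof -
    have small: "((\<lambda>t. t *\<^sub>R ((1/2) *\<^sub>R D (s t) (s t))) \<longlongrightarrow> 0) (at 0)"
    proof (rule tendsto_norm_zero_cancel, rule tendsto_sandwich[OF _ _ tendsto_const])
      show "\<forall>\<^sub>F t in at 0. 0 \<le> norm (t *\<^sub>R ((1/2) *\<^sub>R D (s t) (s t)))" by simp
      show "\<forall>\<^sub>F t in at 0. norm (t *\<^sub>R ((1/2) *\<^sub>R D (s t) (s t))) \<le> \<bar>t\<bar> * (C * C * K)"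
        using sC
      proof eventually_elim
        case (elim t)
        have "norm (D (s t) (s t)) \<le> norm (s t) * norm (s t) * K" by (rule K)
        also have "\<dots> \<le> C * C * K" using elim K C by (intro mult_right_mono mult_mono) auto
        finally have "norm (D (s t) (s t)) \<le> C * C * K" .
        moreover have "norm ((1/2) *\<^sub>R D (s t) (s t)) = norm (D (s t) (s t)) / 2" by simp
        ultimately have "norm ((1/2) *\<^sub>R D (s t) (s t)) \<le> C * C * K"
          using norm_ge_zero[of "D (s t) (s t)"] by linarith
        then show ?case by (simp only: norm_scaleR) (rule mult_left_mono, auto)
      qed
      have "((\<lambda>t::real. \<bar>t\<bar> * (C * C * K)) \<longlongrightarrow> \<bar>0\<bar> * (C * C * K)) (at 0)" by (intro tendsto_intros id0)
      then show "((\<lambda>t::real. \<bar>t\<bar> * (C * C * K)) \<longlongrightarrow> 0) (at 0)" by simp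
    qed
    have "((\<lambda>t. \<beta> t - t *\<^sub>R ((1/2) *\<^sub>R D (s t) (s t)) - t *\<^sub>R r t) \<longlongrightarrow> v - 0 - 0 *\<^sub>R 0) (at 0)"
      by (intro tendsto_diff tendsto_scaleR small \<beta>v r0 id0)
    then have "((\<lambda>t. \<beta> t - t *\<^sub>R ((1/2) *\<^sub>R D (s t) (s t)) - t *\<^sub>R r t) \<longlongrightarrow> v) (at 0)" by simp
    then show ?thesis
    proof (rule Lim_transform_eventually)
      show "\<forall>\<^sub>F t in at 0. \<beta> t - t *\<^sub>R ((1/2) *\<^sub>R D (s t) (s t)) - t *\<^sub>R r t = L (s t)"
        using nz by eventually_elim
          (simp add: \<beta>_def s_def r_def linear_scale[OF linL] bounded_bilinear.scaleR_left[OF bb]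
             bounded_bilinear.scaleR_right[OF bb] algebra_simps power2_eq_square)
    qed
  qed
  define a where "a = M v"
  have sa: "(s \<longlongrightarrow> a) (at 0)"
  proof -
    have "((\<lambda>t. M (L (s t))) \<longlongrightarrow> M v) (at 0)" by (rule bounded_linear.tendsto[OF bM Ls])
    moreover have "M (L x) = x" for x using M(2) by (metis comp_apply id_apply)
    ultimately show ?thesis by (simp add: a_def)
  qed
  have va: "v = L a" by (rule tendsto_unique[OF _ Ls bounded_linear.tendsto[OF bL sa]]) simp
  have 1: "((\<lambda>t. N ((1/2) *\<^sub>R w + \<rho> t)) \<longlongrightarrow> N ((1/2) *\<^sub>R w + 0)) (at 0)"
    by (intro bounded_linear.tendsto[OF bN] tendsto_intros \<rho>0)
  have 2: "((\<lambda>t. N ((1/2) *\<^sub>R D (s t) (s t) + r t)) \<longlongrightarrow> N ((1/2) *\<^sub>R D a a + 0)) (at 0)"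
    by (intro bounded_linear.tendsto[OF bN] tendsto_intros bounded_bilinear.tendsto[OF bb] sa r0)
  have "\<forall>\<^sub>F t in at 0. N ((1/2) *\<^sub>R w + \<rho> t) = N ((1/2) *\<^sub>R D (s t) (s t) + r t)"
    using nz
  proof eventually_elim
    case (elim t)
    have "(1/2) *\<^sub>R w + \<rho> t + (1 / t) *\<^sub>R L a = (1 / t\<^sup>2) *\<^sub>R (\<alpha> t - q)"
      using elim by (simp add: \<alpha> va algebra_simps power2_eq_square)
    moreover have "(1/2) *\<^sub>R D (s t) (s t) + r t + (1 / t\<^sup>2) *\<^sub>R L (u t) = (1 / t\<^sup>2) *\<^sub>R (\<alpha> t - q)"
      using elim by (simp add: r_def s_def bounded_bilinear.scaleR_left[OF bb]
             bounded_bilinear.scaleR_right[OF bb] algebra_simps power2_eq_square)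
    ultimately have "N ((1/2) *\<^sub>R w + \<rho> t + (1 / t) *\<^sub>R L a) = N ((1/2) *\<^sub>R D (s t) (s t) + r t + (1 / t\<^sup>2) *\<^sub>R L (u t))" by simp
    then show ?case
      unfolding linear_add[OF bounded_linear.linear[OF bN]] linear_scale[OF bounded_linear.linear[OF bN]] NL by simp
  qed
  then have "N ((1/2) *\<^sub>R w + 0) = N ((1/2) *\<^sub>R D a a + 0)"
    using tendsto_unique[OF _ Lim_transform_eventually[OF 1] 2] by simp
  then have "N w = N (D a a)" by (simp add: linear_scale[OF bounded_linear.linear[OF bN]])
  then show ?thesis using va unfolding L_def D_def N_def by blast
qed

text \<open>Supplies the hypothesis of \<open>regular_patch_curve\<close> for the image of a
  straight line.\<close>

lemma C2_line_expansion:
  fixes f :: "'a::euclidean_space \<Rightarrow> 'b::real_normed_vector"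
  assumes "open W" "C_k_on (Suc (Suc k)) f W" "x \<in> W"
  shows "((\<lambda>t. (1 / t\<^sup>2) *\<^sub>R (f (x + t *\<^sub>R a) - f x - t *\<^sub>R frechet_derivative f (at x) a
            - (t\<^sup>2 / 2) *\<^sub>R second_derivative f x a a)) \<longlongrightarrow> 0) (at 0)"
proof (rule tendstoI)
  fix e :: real assume e: "0 < e"
  define n where "n = (norm a)\<^sup>2 + 1"
  define e' where "e' = e / (2 * n)"
  have pos: "0 < n" by (simp add: n_def add_nonneg_pos)
  have e': "0 < e'" using e pos by (simp add: e'_def)
  obtain d where d: "0 < d" "\<forall>y. norm (y - x) < d \<longrightarrow>
    norm (f y - f x - frechet_derivative f (at x) (y - x) - (1/2) *\<^sub>R second_derivative f x (y - x) (y - x)) \<le> e' * (norm (y - x))\<^sup>2"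
    by (rule second_order_taylor[OF assms e'])
  have "((\<lambda>t. norm (t *\<^sub>R a)) \<longlongrightarrow> norm (0 *\<^sub>R a)) (at 0)" by (intro tendsto_intros)
  then have "\<forall>\<^sub>F t in at 0. norm (t *\<^sub>R a) < d" using d(1) order_tendstoD(2) by fastforce
  moreover have "\<forall>\<^sub>F t in at 0. t \<noteq> (0::real)" by (simp add: eventually_at_filter)
  ultimately show "\<forall>\<^sub>F t in at 0. dist ((1 / t\<^sup>2) *\<^sub>R (f (x + t *\<^sub>R a) - f x - t *\<^sub>R frechet_derivative f (at x) a
            - (t\<^sup>2 / 2) *\<^sub>R second_derivative f x a a)) 0 < e"
  proof eventually_elim
    case (elim t)
    have "norm (f (x + t *\<^sub>R a) - f x - frechet_derivative f (at x) (t *\<^sub>R a) - (1/2) *\<^sub>R second_derivative f x (t *\<^sub>R a) (t *\<^sub>R a)) \<le> e' * (norm (t *\<^sub>R a))\<^sup>2"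
      using d(2)[rule_format, of "x + t *\<^sub>R a"] elim(1) by simp
    then have *: "norm (f (x + t *\<^sub>R a) - f x - t *\<^sub>R frechet_derivative f (at x) a - (t\<^sup>2 / 2) *\<^sub>R second_derivative f x a a) \<le> e' * (t\<^sup>2 * (norm a)\<^sup>2)"
      by (simp add: linear_scale[OF C_k_on_SucD(2)[OF assms(2,3)]] linear_scale[OF second_derivative_linear_right[OF assms]]
         linear_scale[OF second_derivative_linear_left[OF assms]] power_mult_distrib power2_eq_square[of t])
    have "norm ((1 / t\<^sup>2) *\<^sub>R (f (x + t *\<^sub>R a) - f x - t *\<^sub>R frechet_derivative f (at x) a
            - (t\<^sup>2 / 2) *\<^sub>R second_derivative f x a a)) \<le> (1 / t\<^sup>2) * (e' * (t\<^sup>2 * (norm a)\<^sup>2))"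
      unfolding norm_scaleR using mult_left_mono[OF *, of "1 / t\<^sup>2"] by simp
    also have "\<dots> = e' * (norm a)\<^sup>2" using elim(2) by simp
    also have "\<dots> \<le> e' * n" using e' by (intro mult_left_mono) (auto simp: n_def)
    also have "\<dots> = e / 2" using pos by (simp add: e'_def)
    finally show ?case using e unfolding dist_norm diff_zero by linarith
  qed
qed

text \<open>Apply \<open>regular_patch_curve\<close> to the images of straight lines; this
  determines the quadratic forms, and polarisation the bilinear ones.\<close>

lemma regular_patch_map:
  fixes f :: "'a::euclidean_space \<Rightarrow> real^'n"
  assumes patch: "regular_patch S q \<phi> U z"
    and f: "open W" "C_k_on (Suc (Suc k)) f W" "x \<in> W" "f x = q" "f ` W \<subseteq> S"
  shows "range (frechet_derivative f (at x)) \<subseteq> range (frechet_derivative \<phi> (at z))"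
    and "frechet_derivative f (at x) a = frechet_derivative \<phi> (at z) c \<Longrightarrow>
         frechet_derivative f (at x) b = frechet_derivative \<phi> (at z) d \<Longrightarrow>
       normal_part (range (frechet_derivative \<phi> (at z))) (second_derivative f x a b) =
       normal_part (range (frechet_derivative \<phi> (at z))) (second_derivative \<phi> z c d)"
proof -
  note P = regular_patchD[OF patch]
  define L where "L = frechet_derivative \<phi> (at z)"
  define F where "F = frechet_derivative f (at x)"
  define N where "N = normal_part (range L)"
  have linL: "linear L" and injL: "inj L" using P by (auto simp: L_def)
  have linF: "linear F" unfolding F_def by (rule C_k_on_SucD(2)[OF f(2,3)])
  have linN: "linear N" unfolding N_def by (intro linear_normal_part linear_subspace_image[OF linL subspace_UNIV])
  obtain M where M: "linear M" "M \<circ> L = id" using linear_injective_left_inverse[OF linL injL] by blast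
  then have MoL: "M (L x) = x" for x by (metis comp_apply id_apply)
  have key: "\<exists>c. F a = L c \<and> N (second_derivative f x a a) = N (second_derivative \<phi> z c c)" for a
    unfolding F_def L_def N_def
  proof (rule regular_patch_curve[OF patch])
    have "((\<lambda>t. x + t *\<^sub>R a) \<longlongrightarrow> x + 0 *\<^sub>R a) (at 0)" by (intro tendsto_intros)
    then have "\<forall>\<^sub>F t in at 0. x + t *\<^sub>R a \<in> W" using topological_tendstoD[OF _ f(1)] f(3) by fastforce
    then show "\<forall>\<^sub>F t in at 0. f (x + t *\<^sub>R a) \<in> S" by eventually_elim (use f(5) in auto)
    show "((\<lambda>t. (1 / t\<^sup>2) *\<^sub>R (f (x + t *\<^sub>R a) - q - t *\<^sub>R frechet_derivative f (at x) a
            - (t\<^sup>2 / 2) *\<^sub>R second_derivative f x a a)) \<longlongrightarrow> 0) (at 0)"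
      using C2_line_expansion[OF f(1-3), of a] f(4) by simp
  qed
  show "range (frechet_derivative f (at x)) \<subseteq> range (frechet_derivative \<phi> (at z))"
    using key unfolding F_def L_def by blast
  have LM: "L (M (F a)) = F a" for a using key[of a] MoL by auto
  have diag: "N (second_derivative f x a a) = N (second_derivative \<phi> z (M (F a)) (M (F a)))" for a
    using key[of a] MoL by auto
  have "N (second_derivative f x a b) = N (second_derivative \<phi> z (M (F a)) (M (F b)))" for a b
  proof (rule symmetric_bilinear_eqI[of "\<lambda>a b. N (second_derivative f x a b)" "\<lambda>a b. N (second_derivative \<phi> z (M (F a)) (M (F b)))"])
    note rules = linear_compose[OF _ linN, unfolded o_def]
    have MF: "linear (\<lambda>a. M (F a))" using linear_compose[OF linF M(1)] by (simp add: o_def)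
    show "linear (\<lambda>a. N (second_derivative f x a b))" "linear (\<lambda>b. N (second_derivative f x a b))" for a b
      by (intro rules second_derivative_linear_left[OF f(1-3)] second_derivative_linear_right[OF f(1-3)])+
    show "linear (\<lambda>a. N (second_derivative \<phi> z (M (F a)) (M (F b))))" for b
      by (intro rules linear_compose[OF MF second_derivative_linear_left[OF P(1) P(4) P(2)], unfolded o_def])
    show "linear (\<lambda>b. N (second_derivative \<phi> z (M (F a)) (M (F b))))" for a
      by (intro rules linear_compose[OF MF second_derivative_linear_right[OF P(1) P(4) P(2)], unfolded o_def])
    show "N (second_derivative f x a b) = N (second_derivative f x b a)" for a b
      by (simp add: second_derivative_symmetric[OF f(1-3), of a b])
    show "N (second_derivative \<phi> z (M (F a)) (M (F b))) = N (second_derivative \<phi> z (M (F b)) (M (F a)))" for a b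
      by (simp add: second_derivative_symmetric[OF P(1) P(4) P(2), of "M (F a)"])
  qed (rule diag)
  moreover assume "frechet_derivative f (at x) a = frechet_derivative \<phi> (at z) c"
    "frechet_derivative f (at x) b = frechet_derivative \<phi> (at z) d"
  ultimately show "normal_part (range (frechet_derivative \<phi> (at z))) (second_derivative f x a b) =
       normal_part (range (frechet_derivative \<phi> (at z))) (second_derivative \<phi> z c d)"
    unfolding N_def[symmetric] L_def[symmetric] F_def[symmetric] by (simp add: MoL)
qed

text \<open>The tangent plane is a union over all parametrisations; one parametrisation gives all of
  it, because any other is a smooth map into the surface.\<close>

lemma tangent_plane_regular_patch:
  assumes patch: "regular_patch S q \<phi> U z"
  shows "tangent_plane S q = range (frechet_derivative \<phi> (at z))"
proof
  show "range (frechet_derivative \<phi> (at z)) \<subseteq> tangent_plane S q"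
    using patch unfolding tangent_plane_def by blast
  show "tangent_plane S q \<subseteq> range (frechet_derivative \<phi> (at z))"
  proof
    fix v assume "v \<in> tangent_plane S q"
    then obtain \<phi>2 U2 z2 a where 2: "regular_patch S q \<phi>2 U2 z2" "v = frechet_derivative \<phi>2 (at z2) a"
      unfolding tangent_plane_def by blast
    note P = regular_patchD[OF 2(1)]
    have "range (frechet_derivative \<phi>2 (at z2)) \<subseteq> range (frechet_derivative \<phi> (at z))"
      by (rule regular_patch_map(1)[OF patch P(1) P(4) P(2,3)]) (use P(7) in auto)
    then show "v \<in> range (frechet_derivative \<phi> (at z))" using 2(2) by blast
  qed
qed

lemma second_fundamental_form_regular_patch:
  assumes patch: "regular_patch S q \<phi> U z"
  shows "second_fundamental_form S q (frechet_derivative \<phi> (at z) a) (frechet_derivative \<phi> (at z) b)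
    = normal_part (tangent_plane S q) (second_derivative \<phi> z a b)"
  unfolding second_fundamental_form_def
proof (rule the_equality)
  fix k assume "\<exists>\<phi>' U' z' a' b'. regular_patch S q \<phi>' U' z' \<and> frechet_derivative \<phi> (at z) a = frechet_derivative \<phi>' (at z') a' \<and>
     frechet_derivative \<phi> (at z) b = frechet_derivative \<phi>' (at z') b' \<and> k = normal_part (tangent_plane S q) (second_derivative \<phi>' z' a' b')"
  then obtain \<phi>' U' z' a' b' where 2: "regular_patch S q \<phi>' U' z'" "frechet_derivative \<phi> (at z) a = frechet_derivative \<phi>' (at z') a'"
    "frechet_derivative \<phi> (at z) b = frechet_derivative \<phi>' (at z') b'" "k = normal_part (tangent_plane S q) (second_derivative \<phi>' z' a' b')"
    by blast
  note P = regular_patchD[OF 2(1)]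
  show "k = normal_part (tangent_plane S q) (second_derivative \<phi> z a b)"
    unfolding 2(4) tangent_plane_regular_patch[OF patch]
    by (rule regular_patch_map(2)[OF patch P(1) P(4) P(2,3)]) (use P(7) 2(2,3) in auto)
qed (use patch in blast)

text \<open>This frees the second fundamental form from the parametrisations in its definition. It
  will be applied to \<open>h\<close> read in a chart, and to a parametrisation by polar
  coordinates.\<close>

theorem second_fundamental_form_map:
  fixes f :: "'a::euclidean_space \<Rightarrow> real^'n"
  assumes patch: "regular_patch S q \<phi> U z"
    and f: "open W" "C_k_on (Suc (Suc k)) f W" "x \<in> W" "f x = q" "f ` W \<subseteq> S"
  shows "frechet_derivative f (at x) a \<in> tangent_plane S q"
    and "second_fundamental_form S q (frechet_derivative f (at x) a) (frechet_derivative f (at x) b)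
      = normal_part (tangent_plane S q) (second_derivative f x a b)"
proof -
  note T = tangent_plane_regular_patch[OF patch]
  have sub: "range (frechet_derivative f (at x)) \<subseteq> range (frechet_derivative \<phi> (at z))"
    by (rule regular_patch_map(1)[OF patch f])
  then show "frechet_derivative f (at x) a \<in> tangent_plane S q" unfolding T by blast
  obtain c d where cd: "frechet_derivative f (at x) a = frechet_derivative \<phi> (at z) c"
    "frechet_derivative f (at x) b = frechet_derivative \<phi> (at z) d" using sub by blast
  show "second_fundamental_form S q (frechet_derivative f (at x) a) (frechet_derivative f (at x) b)
      = normal_part (tangent_plane S q) (second_derivative f x a b)"
    unfolding cd second_fundamental_form_regular_patch[OF patch]
    unfolding T regular_patch_map(2)[OF patch f cd] ..
qed

lemma subspace_tangent_plane: "regular_patch S q \<phi> U z \<Longrightarrow> subspace (tangent_plane S q)"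
  by (simp add: tangent_plane_regular_patch linear_subspace_image regular_patchD(6))

lemma tangent_plane_eq_range_immersion:
  fixes L :: "real^2 \<Rightarrow> real^'n"
  assumes patch: "regular_patch S q \<phi> U z" and L: "linear L" "inj L" "range L \<subseteq> tangent_plane S q"
  shows "range L = tangent_plane S q"
proof (rule subspace_dim_equal[OF _ subspace_tangent_plane[OF patch] L(3)])
  show "subspace (range L)" by (rule linear_subspace_image[OF L(1) subspace_UNIV])
  have "dim (range L) = dim (UNIV :: (real^2) set)" by (rule dim_image_eq[OF L(1)]) (use L(2) in simp)
  moreover have "dim (tangent_plane S q) = dim (UNIV :: (real^2) set)"
    unfolding tangent_plane_regular_patch[OF patch]
    by (rule dim_image_eq) (use regular_patchD(5,6)[OF patch] in simp_all)
  ultimately show "dim (tangent_plane S q) \<le> dim (range L)" by simp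
qed

section \<open>Bilinear forms in the plane and the pointwise inequality\<close>

definition form_det :: "(real^2 \<Rightarrow> real^2 \<Rightarrow> real) \<Rightarrow> real" where
  "form_det \<beta> = \<beta> (axis 1 1) (axis 1 1) * \<beta> (axis 2 1) (axis 2 1) - (\<beta> (axis 1 1) (axis 2 1))\<^sup>2"

text \<open>The trace of \<open>Q\<close> with respect to \<open>\<beta>\<close> times the
  determinant of \<open>\<beta>\<close>. Multiplying by the determinant keeps the expression
  polynomial, which makes the change of basis a polynomial identity.\<close>

definition form_trace :: "(real^2 \<Rightarrow> real^2 \<Rightarrow> real) \<Rightarrow> (real^2 \<Rightarrow> real^2 \<Rightarrow> 'b::real_vector) \<Rightarrow> 'b" where
  "form_trace \<beta> Q = \<beta> (axis 2 1) (axis 2 1) *\<^sub>R Q (axis 1 1) (axis 1 1)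
     - \<beta> (axis 1 1) (axis 2 1) *\<^sub>R (Q (axis 1 1) (axis 2 1) + Q (axis 2 1) (axis 1 1))
     + \<beta> (axis 1 1) (axis 1 1) *\<^sub>R Q (axis 2 1) (axis 2 1)"

lemma bilinear_axis_2:
  assumes "bilinear Q"
  shows "Q (a :: real^2) (b :: real^2) = (a $ 1 * b $ 1) *\<^sub>R Q (axis 1 1) (axis 1 1) + (a $ 1 * b $ 2) *\<^sub>R Q (axis 1 1) (axis 2 1)
    + (a $ 2 * b $ 1) *\<^sub>R Q (axis 2 1) (axis 1 1) + (a $ 2 * b $ 2) *\<^sub>R Q (axis 2 1) (axis 2 1)"
proof -
  have 1: "linear (\<lambda>a. Q a b)" for b using assms by (simp add: bilinear_def)
  have 2: "linear (Q a)" for a using assms by (simp add: bilinear_def)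
  have "Q a b = a $ 1 *\<^sub>R Q (axis 1 1) b + a $ 2 *\<^sub>R Q (axis 2 1) b" by (rule linear_axis_2[OF 1])
  then show ?thesis unfolding linear_axis_2[OF 2, of "axis 1 1" b] linear_axis_2[OF 2, of "axis 2 1" b]
    by (simp add: scaleR_add_right)
qed

lemma form_det_change:
  assumes "bilinear \<beta>" "\<And>a b. \<beta> a b = \<beta> b a"
  shows "\<beta> a a * \<beta> b b - (\<beta> a b)\<^sup>2 = (a $ 1 * b $ 2 - a $ 2 * b $ 1)\<^sup>2 * form_det \<beta>"
proof -
  have s: "\<beta> (axis 2 1) (axis 1 1) = \<beta> (axis 1 1) (axis 2 1)" by (rule assms(2))
  show ?thesis unfolding bilinear_axis_2[OF assms(1), of a a] bilinear_axis_2[OF assms(1), of a b]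
    bilinear_axis_2[OF assms(1), of b b] s form_det_def
    by (simp add: power2_eq_square algebra_simps)
qed

lemma form_trace_change:
  fixes Q :: "real^2 \<Rightarrow> real^2 \<Rightarrow> 'b::real_inner"
  assumes "bilinear \<beta>" "\<And>a b. \<beta> a b = \<beta> b a" "bilinear Q"
  shows "\<beta> b b *\<^sub>R Q a a - \<beta> a b *\<^sub>R (Q a b + Q b a) + \<beta> a a *\<^sub>R Q b b
    = (a $ 1 * b $ 2 - a $ 2 * b $ 1)\<^sup>2 *\<^sub>R form_trace \<beta> Q"
proof (rule vector_eq_rdot[THEN iffD1], rule allI)
  fix v
  have s: "\<beta> (axis 2 1) (axis 1 1) = \<beta> (axis 1 1) (axis 2 1)" by (rule assms(2))
  show "(\<beta> b b *\<^sub>R Q a a - \<beta> a b *\<^sub>R (Q a b + Q b a) + \<beta> a a *\<^sub>R Q b b) \<bullet> v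
    = ((a $ 1 * b $ 2 - a $ 2 * b $ 1)\<^sup>2 *\<^sub>R form_trace \<beta> Q) \<bullet> v"
    unfolding bilinear_axis_2[OF assms(1), of a a] bilinear_axis_2[OF assms(1), of a b]
      bilinear_axis_2[OF assms(1), of b b] bilinear_axis_2[OF assms(3), of a a] bilinear_axis_2[OF assms(3), of a b]
      bilinear_axis_2[OF assms(3), of b a] bilinear_axis_2[OF assms(3), of b b] s form_trace_def
    by (simp add: power2_eq_square inner_add_left inner_diff_left inner_scaleR_left algebra_simps)
qed

lemma form_det_pos:
  assumes "bilinear \<beta>" "\<And>a b. \<beta> a b = \<beta> b a" "\<And>a. a \<noteq> 0 \<Longrightarrow> 0 < \<beta> a a"
  shows "0 < form_det \<beta>"
proof -
  let ?a = "axis 1 1 :: real^2" and ?b = "axis 2 1 :: real^2"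
  have p: "0 < \<beta> ?a ?a" by (rule assms(3)) (simp add: axis_eq_0_iff)
  define c where "c = \<beta> ?a ?a *\<^sub>R ?b - \<beta> ?a ?b *\<^sub>R ?a"
  have c: "c $ 1 = - \<beta> ?a ?b" "c $ 2 = \<beta> ?a ?a" by (auto simp: c_def axis_def)
  have "c \<noteq> 0" using c(2) p by (metis zero_index less_irrefl)
  then have "0 < \<beta> c c" by (rule assms(3))
  also have "\<beta> c c = \<beta> ?a ?a * form_det \<beta>"
    unfolding bilinear_axis_2[OF assms(1), of c c] c assms(2)[of ?b ?a] form_det_def
    by (simp add: power2_eq_square algebra_simps)
  finally show ?thesis using p by (simp add: zero_less_mult_iff)
qed

lemma area_factor_form_det: "area_factor L = sqrt (form_det (\<lambda>a b. L a \<bullet> L b))"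
  by (simp add: area_factor_def form_det_def)

lemma bilinear_inner_linear: "linear L \<Longrightarrow> bilinear (\<lambda>a b. L a \<bullet> L b)"
  unfolding bilinear_def
  by (auto intro!: linearI simp: linear_add linear_scale inner_add_left inner_add_right)

lemma bilinear_matrix_form: "bilinear (\<lambda>a b. a \<bullet> (G *v b))" for G :: "real^'n^'n"
  unfolding bilinear_def
  by (auto intro!: linearI simp: inner_add_left inner_add_right matrix_vector_right_distrib matrix_vector_mult_scaleR)

lemma matrix_form_axis: "axis i 1 \<bullet> (G *v axis j 1) = G $ i $ j" for G :: "real^'n^'n"
  by (simp add: matrix_vector_mult_basis column_def inner_axis')

lemma matrix_form_symmetric:
  fixes G :: "real^'n^'n"
  assumes "transpose G = G" shows "a \<bullet> (G *v b) = b \<bullet> (G *v a)"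
  by (metis assms dot_lmul_matrix inner_commute matrix_transpose_mul transpose_matrix_vector)

lemma matrix_inv_2:
  fixes G :: "real^2^2"
  assumes "det G \<noteq> 0"
  shows "matrix_inv G $ 1 $ 1 = G $ 2 $ 2 / det G" "matrix_inv G $ 1 $ 2 = - G $ 1 $ 2 / det G"
    "matrix_inv G $ 2 $ 1 = - G $ 2 $ 1 / det G" "matrix_inv G $ 2 $ 2 = G $ 1 $ 1 / det G"
proof -
  define H :: "real^2^2" where "H = vector [vector [G $ 2 $ 2 / det G, - G $ 1 $ 2 / det G], vector [- G $ 2 $ 1 / det G, G $ 1 $ 1 / det G]]"
  have d: "G $ 1 $ 1 * G $ 2 $ 2 - G $ 1 $ 2 * G $ 2 $ 1 = det G" by (simp add: det_2)
  have "G ** H = mat 1" using assms d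
    by (simp add: vec_eq_iff forall_2 matrix_matrix_mult_def sum_2 mat_def H_def add_divide_distrib[symmetric] diff_divide_distrib[symmetric] algebra_simps)
  moreover have "H ** G = mat 1" using assms d
    by (simp add: vec_eq_iff forall_2 matrix_matrix_mult_def sum_2 mat_def H_def add_divide_distrib[symmetric] diff_divide_distrib[symmetric] algebra_simps)
  ultimately have GH: "G ** H = mat 1" and ex: "\<exists>H. G ** H = mat 1 \<and> H ** G = mat 1" by auto
  have "G ** matrix_inv G = mat 1 \<and> matrix_inv G ** G = mat 1" unfolding matrix_inv_def by (rule someI_ex[OF ex])
  then have "matrix_inv G ** G = mat 1" by blast
  then have "matrix_inv G = H" by (metis GH matrix_mul_assoc matrix_mul_lid matrix_mul_rid)
  then show "matrix_inv G $ 1 $ 1 = G $ 2 $ 2 / det G" "matrix_inv G $ 1 $ 2 = - G $ 1 $ 2 / det G"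
    "matrix_inv G $ 2 $ 1 = - G $ 2 $ 1 / det G" "matrix_inv G $ 2 $ 2 = G $ 1 $ 1 / det G"
    by (auto simp: H_def)
qed

lemma matrix_form_det:
  fixes G :: "real^2^2"
  assumes "transpose G = G"
  shows "form_det (\<lambda>a b. a \<bullet> (G *v b)) = det G"
proof -
  have "G $ 2 $ 1 = G $ 1 $ 2" using arg_cong[OF assms, of "\<lambda>M. M $ 1 $ 2"] by (simp add: transpose_def)
  then show ?thesis by (simp add: form_det_def matrix_form_axis det_2 power2_eq_square)
qed

lemma matrix_inv_form_trace:
  fixes G :: "real^2^2" and Q :: "real^2 \<Rightarrow> real^2 \<Rightarrow> 'b::real_vector"
  assumes "transpose G = G" "det G \<noteq> 0"
  shows "(\<Sum>i\<in>UNIV. \<Sum>j\<in>UNIV. matrix_inv G $ i $ j *\<^sub>R Q (axis i 1) (axis j 1))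
    = (1 / det G) *\<^sub>R form_trace (\<lambda>a b. a \<bullet> (G *v b)) Q"
proof -
  have "G $ 2 $ 1 = G $ 1 $ 2" using arg_cong[OF assms(1), of "\<lambda>M. M $ 1 $ 2"] by (simp add: transpose_def)
  then show ?thesis
    unfolding sum_2 matrix_inv_2[OF assms(2)] form_trace_def matrix_form_axis
    by (simp add: scaleR_diff_right scaleR_add_right algebra_simps)
qed

text \<open>The energy density and the Jacobian in the basis \<open>a\<close>, \<open>b\<close>, in
  which the pulled back Euclidean metric is the identity matrix. Numerators and denominators acquire
  the same factor \<open>P\<close>, the squared determinant of the base change.\<close>

lemma orthonormal_pair_energy:
  assumes \<beta>: "bilinear \<beta>" "\<And>a b. \<beta> a b = \<beta> b a" "\<And>a. a \<noteq> 0 \<Longrightarrow> 0 < \<beta> a a"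
    and L: "linear L" and ab: "norm (L a) = 1" "norm (L b) = 1" "L a \<bullet> L b = 0"
  shows "0 < \<beta> a a" "0 < \<beta> b b" "0 < \<beta> a a * \<beta> b b - (\<beta> a b)\<^sup>2"
    "form_trace \<beta> (\<lambda>a b. L a \<bullet> L b) / form_det \<beta> = (\<beta> a a + \<beta> b b) / (\<beta> a a * \<beta> b b - (\<beta> a b)\<^sup>2)"
    "area_factor L / sqrt (form_det \<beta>) = 1 / sqrt (\<beta> a a * \<beta> b b - (\<beta> a b)\<^sup>2)"
proof -
  define P where "P = (a $ 1 * b $ 2 - a $ 2 * b $ 1)\<^sup>2"
  have nz: "a \<noteq> 0" "b \<noteq> 0" using ab(1,2) linear_0[OF L] by auto
  then show pos: "0 < \<beta> a a" "0 < \<beta> b b" by (auto intro: \<beta>(3))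
  have inn: "L a \<bullet> L a = 1" "L b \<bullet> L b = 1" using ab by (auto simp: norm_eq_1)
  have 1: "1 = P * form_det (\<lambda>a b. L a \<bullet> L b)"
    using form_det_change[OF bilinear_inner_linear[OF L], of a b] inn ab(3) by (simp add: P_def inner_commute)
  have P: "0 < P" using 1 by (metis P_def less_eq_real_def mult_zero_left zero_le_power2 zero_neq_one)
  have D: "0 < form_det \<beta>" by (rule form_det_pos[OF \<beta>])
  have 2: "\<beta> a a * \<beta> b b - (\<beta> a b)\<^sup>2 = P * form_det \<beta>" unfolding P_def by (rule form_det_change[OF \<beta>(1,2)])
  show "0 < \<beta> a a * \<beta> b b - (\<beta> a b)\<^sup>2" unfolding 2 using P D by simp
  have 3: "\<beta> a a + \<beta> b b = P * form_trace \<beta> (\<lambda>a b. L a \<bullet> L b)"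
    using form_trace_change[OF \<beta>(1,2) bilinear_inner_linear[OF L], of b a] inn ab(3) by (simp add: P_def inner_commute)
  show "form_trace \<beta> (\<lambda>a b. L a \<bullet> L b) / form_det \<beta> = (\<beta> a a + \<beta> b b) / (\<beta> a a * \<beta> b b - (\<beta> a b)\<^sup>2)"
    unfolding 2 3 using P by simp
  have "form_det (\<lambda>a b. L a \<bullet> L b) = 1 / P" using 1 P by (simp add: field_simps)
  then show "area_factor L / sqrt (form_det \<beta>) = 1 / sqrt (\<beta> a a * \<beta> b b - (\<beta> a b)\<^sup>2)"
    unfolding 2 area_factor_form_det by (simp add: real_sqrt_mult real_sqrt_divide)
qed

lemma sqrt_ratio_sum:
  assumes "0 < \<alpha>" "0 < \<beta>" "0 \<le> \<rho>1" "0 \<le> \<rho>2" "\<beta> * \<rho>1 = \<alpha> * \<rho>2"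
  shows "sqrt_ratio \<rho>1 \<rho>2 + sqrt_ratio \<rho>2 \<rho>1 = ennreal (if \<rho>1 = 0 then 2 else (\<alpha> + \<beta>) / sqrt (\<alpha> * \<beta>))"
proof (cases "\<rho>1 = 0")
  case True
  then have "\<rho>2 = 0" using assms by simp
  then show ?thesis using True by (simp add: sqrt_ratio_def)
next
  case False
  then have "\<rho>2 \<noteq> 0" using assms by auto
  have 1: "\<rho>1 / \<rho>2 = \<alpha> / \<beta>" "\<rho>2 / \<rho>1 = \<beta> / \<alpha>" using assms False \<open>\<rho>2 \<noteq> 0\<close> by (auto simp: field_simps)
  have "sqrt (\<alpha> / \<beta>) + sqrt (\<beta> / \<alpha>) = (\<alpha> + \<beta>) / sqrt (\<alpha> * \<beta>)"
    using assms(1,2) by (simp add: real_sqrt_divide real_sqrt_mult field_simps)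
  then show ?thesis using False \<open>\<rho>2 \<noteq> 0\<close> assms(1,2)
    by (simp add: sqrt_ratio_def 1 ennreal_plus[symmetric] del: ennreal_plus)
qed

text \<open>The difference of the two radicands is \<open>\<gamma>\<^sup>2\<close>, and
  \<open>(\<alpha> + \<beta>) / sqrt (\<alpha> * \<beta>) - 2\<close> is a square divided by
  \<open>sqrt (\<alpha> * \<beta>)\<close>.\<close>

lemma skew_energy_bound:
  fixes \<alpha> \<beta> \<gamma> :: real
  assumes "0 < \<alpha>" "0 < \<beta>" "0 < \<alpha> * \<beta> - \<gamma>\<^sup>2"
  shows "(\<alpha> + \<beta>) / sqrt (\<alpha> * \<beta>) \<le> (\<alpha> + \<beta>) / sqrt (\<alpha> * \<beta> - \<gamma>\<^sup>2)"
    and "(\<alpha> + \<beta>) / sqrt (\<alpha> * \<beta>) = (\<alpha> + \<beta>) / sqrt (\<alpha> * \<beta> - \<gamma>\<^sup>2) \<longleftrightarrow> \<gamma> = 0"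
    and "2 \<le> (\<alpha> + \<beta>) / sqrt (\<alpha> * \<beta>)" and "2 = (\<alpha> + \<beta>) / sqrt (\<alpha> * \<beta>) \<longleftrightarrow> \<alpha> = \<beta>"
proof -
  have p: "0 < \<alpha> + \<beta>" "0 < \<alpha> * \<beta>" using assms by auto
  show "(\<alpha> + \<beta>) / sqrt (\<alpha> * \<beta>) \<le> (\<alpha> + \<beta>) / sqrt (\<alpha> * \<beta> - \<gamma>\<^sup>2)"
    using p assms by (intro divide_left_mono) auto
  have "(\<alpha> + \<beta>) / sqrt (\<alpha> * \<beta>) = (\<alpha> + \<beta>) / sqrt (\<alpha> * \<beta> - \<gamma>\<^sup>2) \<longleftrightarrow> sqrt (\<alpha> * \<beta>) = sqrt (\<alpha> * \<beta> - \<gamma>\<^sup>2)"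
    using p assms by (auto simp: field_simps)
  then show "(\<alpha> + \<beta>) / sqrt (\<alpha> * \<beta>) = (\<alpha> + \<beta>) / sqrt (\<alpha> * \<beta> - \<gamma>\<^sup>2) \<longleftrightarrow> \<gamma> = 0" by simp
  define x y where "x = sqrt \<alpha>" and "y = sqrt \<beta>"
  have xy: "0 < x" "0 < y" "\<alpha> = x\<^sup>2" "\<beta> = y\<^sup>2" "sqrt (\<alpha> * \<beta>) = x * y" using assms by (auto simp: x_def y_def real_sqrt_mult)
  have eq: "(\<alpha> + \<beta>) / sqrt (\<alpha> * \<beta>) - 2 = (x - y)\<^sup>2 / (x * y)"
    unfolding xy(5) using xy(1,2) by (simp add: xy(3,4) power2_eq_square field_simps)
  have "0 \<le> (x - y)\<^sup>2 / (x * y)" using xy(1,2) by simp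
  then show "2 \<le> (\<alpha> + \<beta>) / sqrt (\<alpha> * \<beta>)" using eq by linarith
  have "2 = (\<alpha> + \<beta>) / sqrt (\<alpha> * \<beta>) \<longleftrightarrow> (x - y)\<^sup>2 / (x * y) = 0" using eq by linarith
  also have "\<dots> \<longleftrightarrow> x = y" using xy(1,2) by simp
  also have "\<dots> \<longleftrightarrow> \<alpha> = \<beta>" using xy by simp
  finally show "2 = (\<alpha> + \<beta>) / sqrt (\<alpha> * \<beta>) \<longleftrightarrow> \<alpha> = \<beta>" .
qed

text \<open>The linear algebra at one point: \<open>\<beta>\<close> is the metric of the domain,
  \<open>L\<close> the differential and \<open>II\<close> the second fundamental form of the image.
  Bilinearity and symmetry of \<open>II\<close> are required only on the range of \<open>L\<close>,
  which is all that the definition of the second fundamental form can give.\<close>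

locale minimal_trace_data =
  fixes \<beta> :: "real^2 \<Rightarrow> real^2 \<Rightarrow> real" and L :: "real^2 \<Rightarrow> real^'n" and II :: "real^'n \<Rightarrow> real^'n \<Rightarrow> real^'n"
  assumes \<beta>_bilinear: "bilinear \<beta>" and \<beta>_sym: "\<beta> a b = \<beta> b a" and \<beta>_pos: "a \<noteq> 0 \<Longrightarrow> 0 < \<beta> a a"
    and L_linear: "linear L" and L_inj: "inj L"
    and II_bilinear: "bilinear (\<lambda>a b. II (L a) (L b))" and II_sym: "II (L a) (L b) = II (L b) (L a)"
    and II_trace: "form_trace \<beta> (\<lambda>a b. II (L a) (L b)) = 0"
begin

definition principal :: "real^'n \<Rightarrow> real^'n \<Rightarrow> bool" where
  "principal e1 e2 \<longleftrightarrow> e1 \<in> range L \<and> e2 \<in> range L \<and> norm e1 = 1 \<and> norm e2 = 1 \<and> e1 \<bullet> e2 = 0 \<and> II e1 e2 = 0"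

definition dilation :: real where
  "dilation = form_trace \<beta> (\<lambda>a b. L a \<bullet> L b) / form_det \<beta> / (area_factor L / sqrt (form_det \<beta>))"

lemma II_linear: "II (L (x *\<^sub>R a + y *\<^sub>R b)) (L (z *\<^sub>R a + w *\<^sub>R b)) =
   (x * z) *\<^sub>R II (L a) (L a) + (x * w + y * z) *\<^sub>R II (L a) (L b) + (y * w) *\<^sub>R II (L b) (L b)"
proof -
  note [simp] = bilinear_ladd[OF II_bilinear] bilinear_radd[OF II_bilinear] bilinear_lmul[OF II_bilinear] bilinear_rmul[OF II_bilinear]
  show ?thesis using II_sym[of b a] by (simp add: algebra_simps)
qed

lemma \<beta>_linear: "\<beta> (x *\<^sub>R a + y *\<^sub>R b) (z *\<^sub>R a + w *\<^sub>R b) = x * z * \<beta> a a + (x * w + y * z) * \<beta> a b + y * w * \<beta> b b"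
proof -
  note [simp] = bilinear_ladd[OF \<beta>_bilinear] bilinear_radd[OF \<beta>_bilinear] bilinear_lmul[OF \<beta>_bilinear] bilinear_rmul[OF \<beta>_bilinear]
  show ?thesis using \<beta>_sym[of b a] by (simp add: algebra_simps)
qed

text \<open>The trace condition in a basis that diagonalises \<open>II\<close>: the two curvature
  vectors point in opposite directions, with lengths in the ratio of \<open>\<beta> a a\<close> to
  \<open>\<beta> b b\<close>.\<close>

lemma trace_pair:
  assumes "II (L a) (L b) = 0"
  shows "\<beta> b b *\<^sub>R II (L a) (L a) + \<beta> a a *\<^sub>R II (L b) (L b) = 0"
  using form_trace_change[OF \<beta>_bilinear \<beta>_sym II_bilinear, of b a] assms II_sym[of b a] II_trace by simp

lemma pair_value:
  assumes "principal (L a) (L b)"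
  shows "dilation = (\<beta> a a + \<beta> b b) / sqrt (\<beta> a a * \<beta> b b - (\<beta> a b)\<^sup>2)"
    and "0 < \<beta> a a" "0 < \<beta> b b" "0 < \<beta> a a * \<beta> b b - (\<beta> a b)\<^sup>2"
    and "sqrt_ratio (norm (II (L a) (L a))) (norm (II (L b) (L b))) + sqrt_ratio (norm (II (L b) (L b))) (norm (II (L a) (L a)))
      = ennreal (if II (L a) (L a) = 0 then 2 else (\<beta> a a + \<beta> b b) / sqrt (\<beta> a a * \<beta> b b))"
    and "II (L a) (L a) = 0 \<longleftrightarrow> II (L b) (L b) = 0"
proof -
  have ab: "norm (L a) = 1" "norm (L b) = 1" "L a \<bullet> L b = 0" "II (L a) (L b) = 0" using assms by (auto simp: principal_def)
  have E: "0 < \<beta> a a" "0 < \<beta> b b" "0 < \<beta> a a * \<beta> b b - (\<beta> a b)\<^sup>2"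
    "form_trace \<beta> (\<lambda>a b. L a \<bullet> L b) / form_det \<beta> = (\<beta> a a + \<beta> b b) / (\<beta> a a * \<beta> b b - (\<beta> a b)\<^sup>2)"
    "area_factor L / sqrt (form_det \<beta>) = 1 / sqrt (\<beta> a a * \<beta> b b - (\<beta> a b)\<^sup>2)"
    using orthonormal_pair_energy[OF \<beta>_bilinear \<beta>_sym \<beta>_pos L_linear ab(1-3)] by blast+
  show pos: "0 < \<beta> a a" "0 < \<beta> b b" "0 < \<beta> a a * \<beta> b b - (\<beta> a b)\<^sup>2" using E(1,2,3) by blast+
  define \<Delta> where "\<Delta> = \<beta> a a * \<beta> b b - (\<beta> a b)\<^sup>2"
  have \<Delta>: "0 < \<Delta>" using pos(3) by (simp add: \<Delta>_def)
  have "dilation = (\<beta> a a + \<beta> b b) / \<Delta> / (1 / sqrt \<Delta>)" unfolding dilation_def \<Delta>_def using E(4,5) by (simp only:)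
  also have "\<dots> = (\<beta> a a + \<beta> b b) / (sqrt \<Delta> * sqrt \<Delta>) * sqrt \<Delta>" using \<Delta> by simp
  also have "\<dots> = (\<beta> a a + \<beta> b b) / sqrt \<Delta>" using \<Delta> by (simp del: real_sqrt_mult_self)
  finally show "dilation = (\<beta> a a + \<beta> b b) / sqrt (\<beta> a a * \<beta> b b - (\<beta> a b)\<^sup>2)" unfolding \<Delta>_def .
  have "\<beta> b b *\<^sub>R II (L a) (L a) = - (\<beta> a a *\<^sub>R II (L b) (L b))"
    using trace_pair[OF ab(4)] by (simp add: eq_neg_iff_add_eq_0)
  then have "norm (\<beta> b b *\<^sub>R II (L a) (L a)) = norm (\<beta> a a *\<^sub>R II (L b) (L b))" by simp
  then have n: "\<beta> b b * norm (II (L a) (L a)) = \<beta> a a * norm (II (L b) (L b))" using pos by simp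
  from sqrt_ratio_sum[OF pos(1,2) norm_ge_zero norm_ge_zero n]
  show "sqrt_ratio (norm (II (L a) (L a))) (norm (II (L b) (L b))) + sqrt_ratio (norm (II (L b) (L b))) (norm (II (L a) (L a)))
      = ennreal (if II (L a) (L a) = 0 then 2 else (\<beta> a a + \<beta> b b) / sqrt (\<beta> a a * \<beta> b b))" by simp
  show "II (L a) (L a) = 0 \<longleftrightarrow> II (L b) (L b) = 0" using n pos by (metis mult_eq_0_iff norm_eq_zero less_irrefl)
qed

definition curvature_value :: ennreal where
  "curvature_value = (let (e1, e2) = (SOME (e1, e2). principal e1 e2) in
     sqrt_ratio (norm (II e1 e1)) (norm (II e2 e2)) + sqrt_ratio (norm (II e2 e2)) (norm (II e1 e1)))"

lemma curvature_value_pair: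
  assumes "\<exists>e1 e2. principal e1 e2"
  obtains a b where "principal (L a) (L b)"
    "curvature_value = ennreal (if II (L a) (L a) = 0 then 2 else (\<beta> a a + \<beta> b b) / sqrt (\<beta> a a * \<beta> b b))"
proof -
  define p where "p = (SOME (e1, e2). principal e1 e2)"
  have "\<exists>p. case p of (e1, e2) \<Rightarrow> principal e1 e2" using assms by auto
  then have "case p of (e1, e2) \<Rightarrow> principal e1 e2" unfolding p_def by (rule someI_ex)
  then obtain e1 e2 where p: "p = (e1, e2)" "principal e1 e2" by (cases p) auto
  then obtain a b where ab: "e1 = L a" "e2 = L b" unfolding principal_def by blast
  have "curvature_value = sqrt_ratio (norm (II e1 e1)) (norm (II e2 e2)) + sqrt_ratio (norm (II e2 e2)) (norm (II e1 e1))"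
    unfolding curvature_value_def p_def[symmetric] p(1) by simp
  then show ?thesis using that[of a b] pair_value(5)[of a b] p(2) ab by simp
qed

lemma curvature_value_ge_2:
  assumes "\<exists>e1 e2. principal e1 e2"
  shows "2 \<le> curvature_value"
proof -
  obtain a b where ab: "principal (L a) (L b)"
    "curvature_value = ennreal (if II (L a) (L a) = 0 then 2 else (\<beta> a a + \<beta> b b) / sqrt (\<beta> a a * \<beta> b b))"
    by (rule curvature_value_pair[OF assms])
  have "ennreal 2 \<le> curvature_value"
    unfolding ab(2) using skew_energy_bound(3)[OF pair_value(2,3,4)[OF ab(1)]] by (intro ennreal_leI) auto
  then show ?thesis by simp
qed

lemma curvature_value_le_dilation:
  assumes "\<exists>e1 e2. principal e1 e2"
  shows "curvature_value \<le> ennreal dilation"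
proof -
  obtain a b where ab: "principal (L a) (L b)"
    "curvature_value = ennreal (if II (L a) (L a) = 0 then 2 else (\<beta> a a + \<beta> b b) / sqrt (\<beta> a a * \<beta> b b))"
    by (rule curvature_value_pair[OF assms])
  show ?thesis unfolding ab(2) pair_value(1)[OF ab(1)]
    using skew_energy_bound(1,3)[OF pair_value(2,3,4)[OF ab(1)]] by (intro ennreal_leI) auto
qed

lemma orthonormal_expansion:
  assumes "principal (L a) (L b)" "principal (L c) (L d)"
  obtains x y z w where "c = x *\<^sub>R a + y *\<^sub>R b" "d = z *\<^sub>R a + w *\<^sub>R b" "x * z + y * w = 0" "x\<^sup>2 + y\<^sup>2 = 1" "z\<^sup>2 + w\<^sup>2 = 1"
proof -
  have ab: "L a \<bullet> L a = 1" "L b \<bullet> L b = 1" "L a \<bullet> L b = 0" "L b \<bullet> L a = 0"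
    and cd: "L c \<bullet> L c = 1" "L d \<bullet> L d = 1" "L c \<bullet> L d = 0" using assms by (auto simp: principal_def norm_eq_1 inner_commute)
  define P where "P = a $ 1 * b $ 2 - a $ 2 * b $ 1"
  have "1 = P\<^sup>2 * form_det (\<lambda>a b. L a \<bullet> L b)"
    using form_det_change[OF bilinear_inner_linear[OF L_linear], of a b] ab by (simp add: P_def inner_commute)
  then have P: "P \<noteq> 0" by auto
  have span: "\<exists>x y. e = x *\<^sub>R a + y *\<^sub>R b" for e :: "real^2"
    by (intro exI[of _ "(e $ 1 * b $ 2 - e $ 2 * b $ 1) / P"] exI[of _ "(a $ 1 * e $ 2 - a $ 2 * e $ 1) / P"])
       (use P in \<open>simp add: vec_eq_iff forall_2 field_simps, simp add: P_def algebra_simps\<close>)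
  obtain x y z w where e: "c = x *\<^sub>R a + y *\<^sub>R b" "d = z *\<^sub>R a + w *\<^sub>R b" using span[of c] span[of d] by blast
  have *: "L (x *\<^sub>R a + y *\<^sub>R b) \<bullet> L (z *\<^sub>R a + w *\<^sub>R b) = x * z + y * w" for x y z w
    by (simp add: linear_add[OF L_linear] linear_scale[OF L_linear] inner_add_left inner_add_right ab)
  show ?thesis using that[OF e] cd unfolding e * by (simp add: power2_eq_square)
qed

text \<open>If \<open>II\<close> does not vanish, its eigendirections are unique up to order and
  sign, because the two curvature vectors point in opposite directions and hence differ; then the
  pullbacks of all principal pairs are orthogonal as soon as those of one pair are. If
  \<open>II\<close> vanishes, every orthonormal pair is principal, and both sides say that
  \<open>L\<close> is conformal.\<close>

lemma equality_iff_orthogonal: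
  assumes ex: "\<exists>e1 e2. principal e1 e2"
  shows "curvature_value = ennreal dilation \<longleftrightarrow>
    (\<forall>e1 e2. principal e1 e2 \<longrightarrow> (\<exists>a b. L a = e1 \<and> L b = e2 \<and> \<beta> a b = 0))"
proof -
  obtain a b where ab: "principal (L a) (L b)"
    "curvature_value = ennreal (if II (L a) (L a) = 0 then 2 else (\<beta> a a + \<beta> b b) / sqrt (\<beta> a a * \<beta> b b))"
    by (rule curvature_value_pair[OF ex])
  note V = pair_value[OF ab(1)] and S = skew_energy_bound[OF pair_value(2,3,4)[OF ab(1)]]
  have II0: "II (L a) (L b) = 0" using ab(1) by (simp add: principal_def)
  have inj: "L x = L y \<longleftrightarrow> x = y" for x y using L_inj by (auto dest: injD)
  define q where "q = (if II (L a) (L a) = 0 then 2 else (\<beta> a a + \<beta> b b) / sqrt (\<beta> a a * \<beta> b b))"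
  have q: "0 \<le> q" "q \<le> dilation" using S(1,3) V(1) by (auto simp: q_def)
  have eq: "curvature_value = ennreal dilation \<longleftrightarrow> q = dilation"
    unfolding ab(2) q_def[symmetric] using q by (intro ennreal_inj) auto
  have eq0: "q = dilation \<longleftrightarrow> \<beta> a b = 0 \<and> (II (L a) (L a) = 0 \<longrightarrow> \<beta> a a = \<beta> b b)"
  proof (cases "II (L a) (L a) = 0")
    case True
    then have "q = dilation \<longleftrightarrow> 2 = (\<beta> a a + \<beta> b b) / sqrt (\<beta> a a * \<beta> b b) \<and>
       (\<beta> a a + \<beta> b b) / sqrt (\<beta> a a * \<beta> b b) = (\<beta> a a + \<beta> b b) / sqrt (\<beta> a a * \<beta> b b - (\<beta> a b)\<^sup>2)"
    proof -
      have "X \<le> Y \<Longrightarrow> 2 \<le> X \<Longrightarrow> (2 = Y \<longleftrightarrow> 2 = X \<and> X = Y)" for X Y :: real by auto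
      from this[OF S(1,3)] show ?thesis using V(1) True by (simp add: q_def)
    qed
    then show ?thesis using S(2,4) True by blast
  next
    case False
    then have "q = dilation \<longleftrightarrow> (\<beta> a a + \<beta> b b) / sqrt (\<beta> a a * \<beta> b b) = (\<beta> a a + \<beta> b b) / sqrt (\<beta> a a * \<beta> b b - (\<beta> a b)\<^sup>2)"
      using V(1) by (simp add: q_def)
    then show ?thesis using S(2) False by simp
  qed
  have orth_iff: "(\<exists>c d. L c = L c' \<and> L d = L d' \<and> \<beta> c d = 0) \<longleftrightarrow> \<beta> c' d' = 0" for c' d' by (auto simp: inj)
  have "(\<forall>e1 e2. principal e1 e2 \<longrightarrow> (\<exists>a b. L a = e1 \<and> L b = e2 \<and> \<beta> a b = 0)) \<longleftrightarrow>
    (\<forall>c d. principal (L c) (L d) \<longrightarrow> \<beta> c d = 0)"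
    using orth_iff unfolding principal_def by blast
  also have "\<dots> \<longleftrightarrow> \<beta> a b = 0 \<and> (II (L a) (L a) = 0 \<longrightarrow> \<beta> a a = \<beta> b b)"
  proof (intro iffI conjI impI allI)
    assume all: "\<forall>c d. principal (L c) (L d) \<longrightarrow> \<beta> c d = 0"
    show "\<beta> a b = 0" using all ab(1) by blast
    assume flat: "II (L a) (L a) = 0"
    \<comment> \<open>the pair \<open>e1\<close>, \<open>e2\<close> rotated by 45 degrees is again
      principal; orthogonality of both pairs forces \<open>\<beta> a a = \<beta> b b\<close>\<close>
    define r where "r = 1 / sqrt 2"
    have r: "r * r = 1 / 2" by (simp add: r_def)
    define c d where "c = r *\<^sub>R a + r *\<^sub>R b" and "d = r *\<^sub>R a + (- r) *\<^sub>R b"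
    have abL: "L a \<bullet> L a = 1" "L b \<bullet> L b = 1" "L a \<bullet> L b = 0" "L b \<bullet> L a = 0"
      using ab(1) by (auto simp: principal_def norm_eq_1 inner_commute)
    have *: "L (x *\<^sub>R a + y *\<^sub>R b) \<bullet> L (z *\<^sub>R a + w *\<^sub>R b) = x * z + y * w" for x y z w
      by (simp add: linear_add[OF L_linear] linear_scale[OF L_linear] inner_add_left inner_add_right abL)
    have "II (L c) (L d) = 0" unfolding c_def d_def II_linear using flat V(6) II0 by simp
    then have "principal (L c) (L d)" unfolding principal_def norm_eq_1 unfolding c_def d_def * using r by simp
    then have "\<beta> c d = 0" using all by blast
    then have "r * r * \<beta> a a - r * r * \<beta> b b = 0" unfolding c_def d_def \<beta>_linear by simp
    then show "\<beta> a a = \<beta> b b" using r by simp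
  next
    fix c d assume o: "\<beta> a b = 0 \<and> (II (L a) (L a) = 0 \<longrightarrow> \<beta> a a = \<beta> b b)" and cd: "principal (L c) (L d)"
    obtain x y z w where e: "c = x *\<^sub>R a + y *\<^sub>R b" "d = z *\<^sub>R a + w *\<^sub>R b" "x * z + y * w = 0" "x\<^sup>2 + y\<^sup>2 = 1" "z\<^sup>2 + w\<^sup>2 = 1"
      by (rule orthonormal_expansion[OF ab(1) cd])
    have \<beta>cd: "\<beta> c d = x * z * \<beta> a a + y * w * \<beta> b b" unfolding e(1,2) \<beta>_linear using o by simp
    show "\<beta> c d = 0"
    proof (cases "II (L a) (L a) = 0")
      case True
      then have "\<beta> c d = (x * z + y * w) * \<beta> a a" using o \<beta>cd by (simp add: algebra_simps)
      then show ?thesis using e(3) by simp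
    next
      case False
      have "II (L c) (L d) = 0" using cd by (simp add: principal_def)
      then have 0: "(x * z) *\<^sub>R II (L a) (L a) + (y * w) *\<^sub>R II (L b) (L b) = 0" unfolding e(1,2) II_linear using II0 by simp
      \<comment> \<open>as both pairs are orthonormal, the condition \<open>II (L c) (L d) =
        0\<close> becomes the product of \<open>x * z\<close> with the difference of the curvature
        vectors\<close>
      have yw: "y * w = - (x * z)" using e(3) by linarith
      have "(x * z) *\<^sub>R (II (L a) (L a) - II (L b) (L b)) = 0" using 0 unfolding yw by (simp add: algebra_simps)
      moreover have "II (L a) (L a) \<noteq> II (L b) (L b)"
      proof
        assume "II (L a) (L a) = II (L b) (L b)"
        then have "(\<beta> b b + \<beta> a a) *\<^sub>R II (L a) (L a) = 0" using trace_pair[OF II0] by (simp add: algebra_simps)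
        then show False using V(2,3) False by (simp add: add_eq_0_iff)
      qed
      ultimately have "x * z = 0" by simp
      then show ?thesis unfolding \<beta>cd yw by simp
    qed
  qed
  finally show ?thesis using eq eq0 by blast
qed

end

section \<open>The Riemannian area of a compact surface\<close>

lemma form_det_inner_plane:
  fixes D :: "real^2 \<Rightarrow> real^2"
  shows "form_det (\<lambda>a b. D a \<bullet> D b) = (D (axis 1 1) $ 1 * D (axis 2 1) $ 2 - D (axis 1 1) $ 2 * D (axis 2 1) $ 1)\<^sup>2"
  by (simp add: form_det_def inner_vec_def sum_2 power2_eq_square algebra_simps)

lemma form_det_compose:
  fixes D :: "real^2 \<Rightarrow> real^2"
  assumes "linear D" "bilinear \<beta>" "\<And>a b. \<beta> a b = \<beta> b a"
  shows "form_det (\<lambda>a b. \<beta> (D a) (D b)) = (area_factor D)\<^sup>2 * form_det \<beta>"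
  using form_det_change[OF assms(2,3), of "D (axis 1 1)" "D (axis 2 1)"]
  unfolding area_factor_form_det form_det_inner_plane by (simp add: form_det_def)

lemma form_trace_compose:
  fixes D :: "real^2 \<Rightarrow> real^2" and Q :: "real^2 \<Rightarrow> real^2 \<Rightarrow> 'b::real_inner"
  assumes "linear D" "bilinear \<beta>" "\<And>a b. \<beta> a b = \<beta> b a" "bilinear Q"
  shows "form_trace (\<lambda>a b. \<beta> (D a) (D b)) (\<lambda>a b. Q (D a) (D b)) = (area_factor D)\<^sup>2 *\<^sub>R form_trace \<beta> Q"
  using form_trace_change[OF assms(2,3,4), of "D (axis 2 1)" "D (axis 1 1)"]
  unfolding area_factor_form_det form_det_inner_plane by (simp add: form_trace_def)

lemma area_factor_compose:
  fixes D :: "real^2 \<Rightarrow> real^2" and L :: "real^2 \<Rightarrow> 'b::real_inner"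
  assumes "linear D" "linear L"
  shows "area_factor (\<lambda>v. L (D v)) = area_factor D * area_factor L"
proof -
  have "form_det (\<lambda>a b. L (D a) \<bullet> L (D b)) = (area_factor D)\<^sup>2 * form_det (\<lambda>a b. L a \<bullet> L b)"
    by (rule form_det_compose[OF assms(1) bilinear_inner_linear[OF assms(2)] inner_commute])
  then show ?thesis by (simp add: area_factor_form_det[of L] area_factor_form_det[of "\<lambda>v. L (D v)"] real_sqrt_mult)
qed

lemma closed_half_plane: "closed half_plane"
  unfolding half_plane_def by (rule closed_halfspace_component_ge_cart)

lemma half_plane_relopenE:
  assumes "openin (top_of_set half_plane) V"
  obtains T where "open T" "V = T \<inter> half_plane"
  using assms by (auto simp: openin_open)

text \<open>At boundary points of the half plane the derivative is still unique, since the positive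
  coordinate directions stay inside.\<close>

lemma half_plane_derivative_unique:
  fixes f :: "real^2 \<Rightarrow> 'b::real_normed_vector"
  assumes V: "openin (top_of_set half_plane) V" "z \<in> V"
    and "(f has_derivative D1) (at z within V)" "(f has_derivative D2) (at z within V)"
  shows "D1 = D2"
proof (rule frechet_derivative_unique_within[OF assms(3,4)])
  fix i :: "real^2" and e :: real assume i: "i \<in> Basis" and e: "0 < e"
  obtain T where T: "open T" "V = T \<inter> half_plane" using half_plane_relopenE[OF V(1)] .
  obtain r where r: "0 < r" "ball z r \<subseteq> T" using T V(2) by (meson IntD1 openE)
  define d where "d = min (e / 2) (r / 2)"
  have d: "0 < d" "d < e" "d < r" using e r by (auto simp: d_def)
  have "z + d *\<^sub>R i \<in> ball z r" using d i by (simp add: dist_norm)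
  moreover have "z + d *\<^sub>R i \<in> half_plane"
  proof -
    obtain k where "i = axis k 1" using i by (auto simp: Basis_vec_def)
    then have "0 \<le> i $ 2" by (simp add: axis_def)
    then show ?thesis using V(2) T(2) d by (auto simp: half_plane_def)
  qed
  ultimately have "z + d *\<^sub>R i \<in> V" using T r by blast
  then show "\<exists>d. 0 < \<bar>d\<bar> \<and> \<bar>d\<bar> < e \<and> z + d *\<^sub>R i \<in> V" using d by (intro exI[of _ d]) auto
qed

lemma half_plane_frechet_derivative:
  fixes f :: "real^2 \<Rightarrow> 'b::real_normed_vector"
  assumes "openin (top_of_set half_plane) V" "z \<in> V" "(f has_derivative D) (at z within V)"
  shows "frechet_derivative f (at z within V) = D"
proof (rule half_plane_derivative_unique[OF assms(1,2) _ assms(3)])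
  have "f differentiable (at z within V)" using assms(3) by (rule differentiableI)
  then show "(f has_derivative frechet_derivative f (at z within V)) (at z within V)"
    by (simp only: frechet_derivative_works)
qed

text \<open>Calculus up to the boundary is reduced to an open set: a smooth function on a relatively
  open set has a smooth extension, and the derivative of the extension does not depend on its
  choice.\<close>

lemma half_plane_smooth_extension:
  fixes f :: "real^2 \<Rightarrow> 'b::real_normed_vector"
  assumes V: "openin (top_of_set half_plane) V" and f: "smooth_on V f"
  obtains W F where "C1_map_on W F (\<lambda>x. frechet_derivative F (at x))" "\<forall>k. C_k_on k F W" "V \<subseteq> W" "\<forall>x\<in>V. F x = f x"
    "\<forall>z\<in>V. (f has_derivative frechet_derivative F (at z)) (at z within V)"
    "\<forall>z\<in>V. frechet_derivative f (at z within V) = frechet_derivative F (at z)"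
proof -
  obtain W F where W: "open W" "V \<subseteq> W" "\<forall>k. C_k_on k F W" "\<forall>x\<in>V. F x = f x"
    using f unfolding smooth_on_def by blast
  have C: "C1_map_on W F (\<lambda>x. frechet_derivative F (at x))"
    by (rule C_k_on_imp_C1_map[OF W(1), of 0]) (use W(3) in blast)
  have d: "(f has_derivative frechet_derivative F (at z)) (at z within V)" if z: "z \<in> V" for z
  proof (rule has_derivative_transform[OF z])
    show "(F has_derivative frechet_derivative F (at z)) (at z within V)"
      by (rule has_derivative_at_withinI[OF C1_map_onD(2)[OF C subsetD[OF W(2) z]]])
  qed (use W(4) in simp)
  then have "\<forall>z\<in>V. frechet_derivative f (at z within V) = frechet_derivative F (at z)"
    using half_plane_frechet_derivative[OF V _ d] by blast
  then show ?thesis using that[OF C W(3,2,4)] d by simp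
qed

lemma half_plane_differentiable:
  fixes f :: "real^2 \<Rightarrow> 'b::real_normed_vector"
  assumes V: "openin (top_of_set half_plane) V" and f: "smooth_on V f" and z: "z \<in> V"
  shows "(f has_derivative frechet_derivative f (at z within V)) (at z within V)"
  by (rule half_plane_smooth_extension[OF V f]) (use z in simp)

lemma half_plane_relopen_borel: "openin (top_of_set half_plane) V \<Longrightarrow> V \<in> sets borel"
  using closed_half_plane by (auto simp: openin_open)

lemma half_plane_relopen_sigma_compact:
  assumes "openin (top_of_set half_plane) V"
  obtains K :: "nat \<Rightarrow> (real^2) set" where "V = (\<Union>n. K n)" "\<And>n. compact (K n)"
proof -
  obtain T where T: "open T" "V = T \<inter> half_plane" using half_plane_relopenE[OF assms] .
  show ?thesis
  proof (rule open_Union_compact_subsets[OF T(1)])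
    fix C :: "nat \<Rightarrow> (real^2) set"
    assume C: "\<And>n. compact (C n)" "\<Union>(range C) = T"
    have "V = (\<Union>n. C n \<inter> half_plane)" using T(2) C(2) by blast
    then show ?thesis using C(1) closed_half_plane by (intro that[of "\<lambda>n. C n \<inter> half_plane"]) (auto intro: compact_Int_closed)
  qed
qed

text \<open>Inner regularity. The area formula wants \<open>\<sigma>\<close>-compact sets, while the
  regular part of \<open>M\<close> is merely Borel; the difference is a null set.\<close>

lemma borel_almost_sigma_compact:
  fixes P :: "'a::euclidean_space set"
  assumes P: "P \<in> sets borel"
  obtains Q K where "Q = (\<Union>n::nat. K n)" "\<And>n. compact (K n)" "Q \<subseteq> P" "P - Q \<in> null_sets lborel"
proof -
  have "P \<in> sets lebesgue" using P by simp
  then have "\<exists>T. closed T \<and> T \<subseteq> P \<and> (P - T) \<in> lmeasurable \<and> emeasure lebesgue (P - T) < ennreal (1 / real (Suc n))" for n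
    using sets_lebesgue_inner_closed[of P "1 / real (Suc n)"] by (metis of_nat_0_less_iff zero_less_Suc zero_less_divide_1_iff)
  then obtain T where T: "\<And>n. closed (T n)" "\<And>n. T n \<subseteq> P" "\<And>n. emeasure lebesgue (P - T n) < ennreal (1 / real (Suc n))"
    by metis
  define K where "K k = T (fst (prod_decode k)) \<inter> cball 0 (real (snd (prod_decode k)))" for k
  have comp: "compact (K k)" for k unfolding K_def using T(1) by (intro closed_Int_compact) auto
  have sub: "(\<Union>k. K k) \<subseteq> P" using T(2) by (auto simp: K_def)
  have Tsub: "T n \<subseteq> (\<Union>k. K k)" for n
  proof
    fix x assume x: "x \<in> T n"
    obtain m where "norm x \<le> real m" using real_arch_simple by blast
    then have "x \<in> K (prod_encode (n, m))" using x by (simp add: K_def)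
    then show "x \<in> (\<Union>k. K k)" by blast
  qed
  have bQ: "(\<Union>k. K k) \<in> sets borel" using comp by (auto intro: borel_compact)
  have "emeasure lborel (P - (\<Union>k. K k)) \<le> ennreal (1 / real (Suc n))" for n
  proof -
    have "emeasure lborel (P - (\<Union>k. K k)) \<le> emeasure lborel (P - T n)"
      using Tsub[of n] P T(1) by (intro emeasure_mono) auto
    also have "\<dots> = emeasure lebesgue (P - T n)" using P T(1) by simp
    finally show ?thesis using T(3)[of n] by simp
  qed
  moreover have "(\<lambda>n. ennreal (1 / real (Suc n))) \<longlonglongrightarrow> ennreal 0"
    by (intro tendsto_ennrealI LIMSEQ_Suc lim_1_over_n)
  ultimately have "emeasure lborel (P - (\<Union>k. K k)) \<le> ennreal 0"
    by (intro LIMSEQ_le_const[where X = "\<lambda>n. ennreal (1 / real (Suc n))"]) auto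
  then have "P - (\<Union>k. K k) \<in> null_sets lborel" using P bQ by (simp add: null_sets_def)
  then show ?thesis using that[OF refl comp sub] by blast
qed

definition chart_image :: "'a chart \<Rightarrow> (real^2) set" where
  "chart_image c = snd c ` fst c"

definition chart_inv :: "'a chart \<Rightarrow> real^2 \<Rightarrow> 'a" where
  "chart_inv c = inv_into (fst c) (snd c)"

locale riemannian_surface =
  fixes M :: "'a topology" and A :: "'a chart set" and g :: "'a chart \<Rightarrow> real^2 \<Rightarrow> real^2^2"
  assumes surface: "smooth_surface M A" and compact: "compact_space M" and metric: "riemannian_metric A g"
begin

definition borel_sets :: "'a set set" where
  "borel_sets = sigma_sets (topspace M) {U. openin M U}"

definition borel_M :: "'a measure" where
  "borel_M = sigma (topspace M) {U. openin M U}"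

lemma opens_Pow: "{U. openin M U} \<subseteq> Pow (topspace M)"
  using openin_subset by blast

lemma borel_M [simp]: "space borel_M = topspace M" "sets borel_M = borel_sets"
  unfolding borel_M_def borel_sets_def by (auto simp: space_measure_of[OF opens_Pow] sets_measure_of[OF opens_Pow])

lemma openin_borel_sets: "openin M U \<Longrightarrow> U \<in> borel_sets"
  unfolding borel_sets_def by blast

lemma chart_facts:
  assumes "c \<in> A"
  shows "openin M (fst c)" "fst c \<subseteq> topspace M" "openin (top_of_set half_plane) (chart_image c)"
    "homeomorphic_map (subtopology M (fst c)) (top_of_set (chart_image c)) (snd c)" "inj_on (snd c) (fst c)"
proof -
  have "surface_chart M c" using surface assms unfolding smooth_surface_def by blast
  then show 1: "openin M (fst c)" "openin (top_of_set half_plane) (chart_image c)"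
    "homeomorphic_map (subtopology M (fst c)) (top_of_set (chart_image c)) (snd c)"
    unfolding surface_chart_def chart_image_def by (auto simp: case_prod_unfold)
  then show sub: "fst c \<subseteq> topspace M" by (simp add: openin_subset)
  show "inj_on (snd c) (fst c)" using homeomorphic_imp_injective_map[OF 1(3)] sub by (simp add: Int_absorb1)
qed

lemma chart_cover: "(\<Union>c\<in>A. fst c) = topspace M"
  using surface unfolding smooth_surface_def by blast

lemma chart_inv [simp]:
  assumes "c \<in> A"
  shows "p \<in> fst c \<Longrightarrow> chart_inv c (snd c p) = p"
    "z \<in> chart_image c \<Longrightarrow> chart_inv c z \<in> fst c" "z \<in> chart_image c \<Longrightarrow> snd c (chart_inv c z) = z"
  using chart_facts(5)[OF assms] unfolding chart_inv_def chart_image_def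
  by (auto simp: inv_into_f_f inv_into_into f_inv_into_f)

lemma chart_image_I: "p \<in> fst c \<Longrightarrow> snd c p \<in> chart_image c"
  by (simp add: chart_image_def)

lemma chart_image_eq_vimage:
  assumes "c \<in> A" "B \<subseteq> fst c"
  shows "snd c ` B = chart_image c \<inter> chart_inv c -` B"
  using assms chart_facts(5)[OF assms(1)] by (force simp: chart_image_def chart_inv_def)

lemma chart_continuous:
  assumes "c \<in> A"
  shows "continuous_map (subtopology M (fst c)) euclidean (snd c)"
    "continuous_map (top_of_set (chart_image c)) M (chart_inv c)"
proof -
  note h = chart_facts(4)[OF assms]
  show "continuous_map (subtopology M (fst c)) euclidean (snd c)"
    using homeomorphic_imp_continuous_map[OF h] continuous_map_into_fulltopology by blast
  obtain f where f: "homeomorphic_maps (subtopology M (fst c)) (top_of_set (chart_image c)) (snd c) f"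
    using h homeomorphic_map_maps by blast
  then have "continuous_map (top_of_set (chart_image c)) (subtopology M (fst c)) f" by (simp add: homeomorphic_maps_def)
  moreover have "f z = chart_inv c z" if zV: "z \<in> chart_image c" for z
  proof -
    obtain p where p: "p \<in> fst c" "z = snd c p" using zV by (auto simp: chart_image_def)
    then have "f (snd c p) = p" using f chart_facts(2)[OF assms] by (auto simp: homeomorphic_maps_def)
    then show ?thesis using p assms by simp
  qed
  ultimately have "continuous_map (top_of_set (chart_image c)) (subtopology M (fst c)) (chart_inv c)"
    by (rule continuous_map_eq[of _ _ f]) auto
  then show "continuous_map (top_of_set (chart_image c)) M (chart_inv c)"
    using continuous_map_into_fulltopology by blast
qed

lemma chart_image_open:
  assumes "c \<in> A" "openin M B" "B \<subseteq> fst c"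
  shows "openin (top_of_set half_plane) (snd c ` B)"
proof -
  have "openin (top_of_set (chart_image c)) {z \<in> topspace (top_of_set (chart_image c)). chart_inv c z \<in> B}"
    by (rule openin_continuous_map_preimage[OF chart_continuous(2)[OF assms(1)] assms(2)])
  moreover have "{z \<in> topspace (top_of_set (chart_image c)). chart_inv c z \<in> B} = snd c ` B"
    unfolding chart_image_eq_vimage[OF assms(1,3)] by auto
  ultimately show ?thesis using openin_trans[OF _ chart_facts(3)[OF assms(1)]] by simp
qed

lemma chart_inv_measurable:
  assumes "c \<in> A"
  shows "chart_inv c \<in> measurable (restrict_space borel (chart_image c)) borel_M"
  unfolding borel_M_def
proof (rule measurable_measure_of[OF opens_Pow])
  show "chart_inv c \<in> space (restrict_space borel (chart_image c)) \<rightarrow> topspace M"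
    using assms chart_facts(2)[OF assms] by (auto simp: space_restrict_space)
  fix B assume "B \<in> {U. openin M U}"
  then have "openin (top_of_set (chart_image c)) {z \<in> topspace (top_of_set (chart_image c)). chart_inv c z \<in> B}"
    by (intro openin_continuous_map_preimage[OF chart_continuous(2)[OF assms]]) auto
  then have "openin (top_of_set half_plane) {z \<in> chart_image c. chart_inv c z \<in> B}"
    using openin_trans[OF _ chart_facts(3)[OF assms]] by simp
  then have "{z \<in> chart_image c. chart_inv c z \<in> B} \<in> sets borel" by (rule half_plane_relopen_borel)
  then show "chart_inv c -` B \<inter> space (restrict_space borel (chart_image c)) \<in> sets (restrict_space borel (chart_image c))"
    using half_plane_relopen_borel[OF chart_facts(3)[OF assms]]
    by (simp add: space_restrict_space sets_restrict_space_iff vimage_def Int_def conj_commute)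
qed

lemma chart_image_borel:
  assumes "c \<in> A" "B \<in> borel_sets" "B \<subseteq> fst c"
  shows "snd c ` B \<in> sets borel"
proof -
  have "chart_inv c -` B \<inter> space (restrict_space borel (chart_image c)) \<in> sets (restrict_space borel (chart_image c))"
    by (rule measurable_sets[OF chart_inv_measurable[OF assms(1)]]) (use assms(2) in simp)
  then show ?thesis using half_plane_relopen_borel[OF chart_facts(3)[OF assms(1)]]
    unfolding chart_image_eq_vimage[OF assms(1,3)]
    by (simp add: space_restrict_space sets_restrict_space_iff Int_commute)
qed

lemma chart_vimage_borel:
  assumes "c \<in> A" "C \<in> sets borel"
  shows "fst c \<inter> snd c -` C \<in> borel_sets"
proof -
  have U: "fst c \<inter> space borel_M \<in> sets borel_M"
    using openin_borel_sets[OF chart_facts(1)[OF assms(1)]] chart_facts(2)[OF assms(1)] by (simp add: Int_absorb2)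
  have sp: "space (restrict_space borel_M (fst c)) = fst c"
    using chart_facts(2)[OF assms(1)] by (auto simp: space_restrict_space)
  have "snd c \<in> borel_measurable (restrict_space borel_M (fst c))"
  proof (rule borel_measurableI)
    fix S :: "(real^2) set" assume "open S"
    then have "openin (subtopology M (fst c)) {p \<in> topspace (subtopology M (fst c)). snd c p \<in> S}"
      by (intro openin_continuous_map_preimage[OF chart_continuous(1)[OF assms(1)]]) auto
    then have "openin M {p \<in> topspace (subtopology M (fst c)). snd c p \<in> S}"
      using openin_trans_full chart_facts(1)[OF assms(1)] by blast
    moreover have "{p \<in> topspace (subtopology M (fst c)). snd c p \<in> S} = snd c -` S \<inter> fst c"
      using chart_facts(2)[OF assms(1)] by auto
    ultimately have "snd c -` S \<inter> fst c \<in> borel_sets" using openin_borel_sets by simp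
    then show "snd c -` S \<inter> space (restrict_space borel_M (fst c)) \<in> sets (restrict_space borel_M (fst c))"
      by (simp add: sp sets_restrict_space_iff[OF U])
  qed
  from measurable_sets[OF this assms(2)] show ?thesis
    by (simp add: sp sets_restrict_space_iff[OF U] Int_commute)
qed

definition metric_form :: "'a chart \<Rightarrow> 'a \<Rightarrow> real^2 \<Rightarrow> real^2 \<Rightarrow> real" where
  "metric_form c p a b = a \<bullet> (g c (snd c p) *v b)"

definition area_density :: "'a chart \<Rightarrow> real^2 \<Rightarrow> real" where
  "area_density c z = sqrt (det (g c z))"

lemma metric_facts:
  assumes "c \<in> A" "z \<in> chart_image c"
  shows "transpose (g c z) = g c z" "a \<noteq> 0 \<Longrightarrow> 0 < a \<bullet> (g c z *v a)" "0 < det (g c z)" "smooth_on (chart_image c) (g c)"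
proof -
  have *: "case c of (U, x) \<Rightarrow> smooth_on (x ` U) (g (U, x)) \<and> (\<forall>z\<in>x ` U. transpose (g (U, x) z) = g (U, x) z \<and>
           (\<forall>a. a \<noteq> 0 \<longrightarrow> 0 < a \<bullet> (g (U, x) z *v a)))"
    using metric assms(1) unfolding riemannian_metric_def by blast
  then show 1: "transpose (g c z) = g c z" "a \<noteq> 0 \<Longrightarrow> 0 < a \<bullet> (g c z *v a)" "smooth_on (chart_image c) (g c)" for a
    using assms(2) by (auto simp: case_prod_unfold chart_image_def)
  have "0 < form_det (\<lambda>a b. a \<bullet> (g c z *v b))"
    by (rule form_det_pos[OF bilinear_matrix_form matrix_form_symmetric[OF 1(1)] 1(2)])
  then show "0 < det (g c z)" by (simp add: matrix_form_det[OF 1(1)])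
qed

lemma metric_form_facts:
  assumes "c \<in> A" "p \<in> fst c"
  shows "bilinear (metric_form c p)" "metric_form c p a b = metric_form c p b a" "a \<noteq> 0 \<Longrightarrow> 0 < metric_form c p a a"
    "form_det (metric_form c p) = det (g c (snd c p))" "0 < form_det (metric_form c p)"
    "sqrt (form_det (metric_form c p)) = area_density c (snd c p)" "0 < area_density c (snd c p)"
proof -
  note f = metric_facts[OF assms(1) chart_image_I[OF assms(2)]]
  have eq: "metric_form c p = (\<lambda>a b. a \<bullet> (g c (snd c p) *v b))" by (intro ext) (simp add: metric_form_def)
  show "bilinear (metric_form c p)" unfolding eq by (rule bilinear_matrix_form)
  show "metric_form c p a b = metric_form c p b a" unfolding eq by (rule matrix_form_symmetric[OF f(1)])
  show "a \<noteq> 0 \<Longrightarrow> 0 < metric_form c p a a" unfolding eq by (rule f(2))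
  show 1: "form_det (metric_form c p) = det (g c (snd c p))" unfolding eq by (rule matrix_form_det[OF f(1)])
  show "0 < form_det (metric_form c p)" unfolding 1 by (rule f(3))
  show "sqrt (form_det (metric_form c p)) = area_density c (snd c p)" "0 < area_density c (snd c p)"
    using f(3) by (auto simp: 1 area_density_def)
qed

lemma area_density_continuous: "c \<in> A \<Longrightarrow> continuous_on (chart_image c) (area_density c)"
proof (cases "chart_image c = {}")
  case False
  assume c: "c \<in> A"
  obtain z where "z \<in> chart_image c" using False by blast
  from metric_facts(4)[OF c this] obtain W F where "open W" "chart_image c \<subseteq> W" "\<forall>k. C_k_on k F W" "\<forall>x\<in>chart_image c. F x = g c x"
    unfolding smooth_on_def by blast
  then have "continuous_on (chart_image c) F" using C_k_on_continuous continuous_on_subset by blast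
  then have "continuous_on (chart_image c) (g c)" using \<open>\<forall>x\<in>chart_image c. F x = g c x\<close> by (simp cong: continuous_on_cong)
  then have "continuous_on (chart_image c) (\<lambda>z. sqrt (g c z $ 1 $ 1 * g c z $ 2 $ 2 - g c z $ 1 $ 2 * g c z $ 2 $ 1))"
    by (intro continuous_intros)
  then show ?thesis by (simp add: area_density_def[abs_def] det_2)
qed simp

text \<open>The derivative of the change of charts, as a map between the coordinate planes that
  represent the tangent space at \<open>p\<close>.\<close>

definition transition :: "'a chart \<Rightarrow> 'a chart \<Rightarrow> 'a \<Rightarrow> real^2 \<Rightarrow> real^2" where
  "transition c d p = frechet_derivative (snd d \<circ> chart_inv c) (at (snd c p) within snd c ` (fst c \<inter> fst d))"

lemma overlap_open:
  assumes "c \<in> A" "d \<in> A"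
  shows "openin (top_of_set half_plane) (snd c ` (fst c \<inter> fst d))"
  by (rule chart_image_open[OF assms(1) openin_Int[OF chart_facts(1)[OF assms(1)] chart_facts(1)[OF assms(2)]]]) simp

lemma transition_smooth:
  assumes "c \<in> A" "d \<in> A"
  shows "smooth_on (snd c ` (fst c \<inter> fst d)) (snd d \<circ> chart_inv c)"
  using surface assms unfolding smooth_surface_def chart_inv_def by (fastforce simp: case_prod_unfold)

lemma transition_facts:
  assumes "c \<in> A" "d \<in> A" "p \<in> fst c" "p \<in> fst d"
  shows "((snd d \<circ> chart_inv c) has_derivative transition c d p) (at (snd c p) within snd c ` (fst c \<inter> fst d))"
    "linear (transition c d p)" "metric_form c p a b = metric_form d p (transition c d p a) (transition c d p b)"
    "inj (transition c d p)" "area_density c (snd c p) = area_factor (transition c d p) * area_density d (snd d p)"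
proof -
  have "snd c p \<in> snd c ` (fst c \<inter> fst d)" using assms(3,4) by blast
  then show der: "((snd d \<circ> chart_inv c) has_derivative transition c d p) (at (snd c p) within snd c ` (fst c \<inter> fst d))"
    unfolding transition_def
    by (rule half_plane_differentiable[OF overlap_open[OF assms(1,2)] transition_smooth[OF assms(1,2)]])
  then show lin: "linear (transition c d p)" by (rule has_derivative_linear)
  show eq: "metric_form c p a b = metric_form d p (transition c d p a) (transition c d p b)" for a b
  proof -
    have "\<forall>(U, x)\<in>A. \<forall>(V, y)\<in>A. \<forall>p\<in>U \<inter> V. \<forall>a b.
        (let D = frechet_derivative (y \<circ> inv_into U x) (at (x p) within x ` (U \<inter> V))
         in a \<bullet> (g (U, x) (x p) *v b) = D a \<bullet> (g (V, y) (y p) *v D b))"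
      using metric unfolding riemannian_metric_def by (rule conjunct2)
    note law = this[unfolded case_prod_unfold Let_def prod.collapse]
    from law[THEN bspec, OF assms(1), THEN bspec, OF assms(2), THEN bspec, OF IntI[OF assms(3,4)], THEN spec, THEN spec, of a b]
    show ?thesis unfolding metric_form_def transition_def chart_inv_def .
  qed
  show "inj (transition c d p)"
  proof (rule linear_injective_0[OF lin, THEN iffD2], intro allI impI)
    fix a assume "transition c d p a = 0"
    then have "metric_form c p a a = metric_form d p 0 0" using eq by simp
    also have "\<dots> = 0" by (simp add: metric_form_def)
    finally show "a = 0" using metric_form_facts(3)[OF assms(1,3), of a] by (metis less_irrefl)
  qed
  have "form_det (metric_form c p) = form_det (\<lambda>a b. metric_form d p (transition c d p a) (transition c d p b))"
    by (intro arg_cong[where f = form_det] ext) (rule eq)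
  also have "\<dots> = (area_factor (transition c d p))\<^sup>2 * form_det (metric_form d p)"
    by (rule form_det_compose[OF lin metric_form_facts(1,2)[OF assms(2,4)]])
  finally show "area_density c (snd c p) = area_factor (transition c d p) * area_density d (snd d p)"
    unfolding metric_form_facts(6)[OF assms(1,3), symmetric] metric_form_facts(6)[OF assms(2,4), symmetric]
    by (simp add: real_sqrt_mult)
qed

definition chart_area :: "'a chart \<Rightarrow> 'a set \<Rightarrow> ennreal" where
  "chart_area c B = (\<integral>\<^sup>+z\<in>snd c ` B. ennreal (area_density c z) \<partial>lborel)"

lemma area_density_indicator_measurable:
  assumes "c \<in> A" "C \<in> sets borel" "C \<subseteq> chart_image c"
  shows "(\<lambda>z. ennreal (area_density c z) * indicator C z) \<in> borel_measurable borel"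
proof -
  have eq: "(\<lambda>z. ennreal (area_density c z) * indicator C z) = (\<lambda>z. ennreal (indicator C z *\<^sub>R area_density c z))"
    by (auto simp: indicator_def)
  have "(\<lambda>z. indicator C z *\<^sub>R area_density c z) \<in> borel_measurable borel"
    by (rule borel_measurable_continuous_on_indicator[OF assms(2) continuous_on_subset[OF area_density_continuous[OF assms(1)] assms(3)]])
  then show ?thesis unfolding eq by (rule measurable_compose[OF _ measurable_ennreal])
qed

text \<open>The area formula for the change of charts, together with the transformation law of the
  metric.\<close>

lemma chart_area_change:
  assumes cd: "c \<in> A" "d \<in> A" and B: "B \<in> borel_sets" "B \<subseteq> fst c" "B \<subseteq> fst d"
  shows "chart_area d B = chart_area c B"
proof -
  define Q where "Q = snd c ` (fst c \<inter> fst d)"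
  have Q: "openin (top_of_set half_plane) Q" unfolding Q_def by (rule overlap_open[OF cd])
  define T where "T = snd d \<circ> chart_inv c"
  obtain W F where WF: "C1_map_on W F (\<lambda>x. frechet_derivative F (at x))" "\<forall>k. C_k_on k F W" "Q \<subseteq> W" "\<forall>x\<in>Q. F x = T x"
    "\<forall>z\<in>Q. (T has_derivative frechet_derivative F (at z)) (at z within Q)"
    "\<forall>z\<in>Q. frechet_derivative T (at z within Q) = frechet_derivative F (at z)"
    by (rule half_plane_smooth_extension[OF Q transition_smooth[OF cd, folded Q_def T_def]])
  note F = WF(1,3) WF(4)[rule_format] WF(6)[rule_format]
  obtain K where K: "Q = (\<Union>n::nat. K n)" "\<And>n. compact (K n)" using half_plane_relopen_sigma_compact[OF Q] by blast
  have FQ: "F z = snd d (chart_inv c z)" "frechet_derivative F (at z) = transition c d (chart_inv c z)"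
    "chart_inv c z \<in> fst c" "chart_inv c z \<in> fst d" "snd c (chart_inv c z) = z" if zQ: "z \<in> Q" for z
  proof -
    obtain p where p: "p \<in> fst c" "p \<in> fst d" "z = snd c p" using zQ by (auto simp: Q_def)
    show "F z = snd d (chart_inv c z)" "frechet_derivative F (at z) = transition c d (chart_inv c z)"
      using F(3,4)[OF zQ] p cd by (auto simp: T_def transition_def Q_def)
    show "chart_inv c z \<in> fst c" "chart_inv c z \<in> fst d" "snd c (chart_inv c z) = z" using p cd by auto
  qed
  have inj: "inj_on F Q"
  proof (rule inj_onI)
    fix y z assume yz: "y \<in> Q" "z \<in> Q" "F y = F z"
    then have "chart_inv c y = chart_inv c z" using FQ inj_onD[OF chart_facts(5)[OF cd(2)]] by metis
    then show "y = z" using FQ(5) yz by metis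
  qed
  define \<phi> where "\<phi> z = ennreal (area_density d z) * indicator (snd d ` B) z" for z
  have dB: "snd d ` B \<in> sets borel" by (rule chart_image_borel[OF cd(2) B(1,3)])
  have \<phi>: "\<phi> \<in> borel_measurable borel"
    unfolding \<phi>_def by (rule area_density_indicator_measurable[OF cd(2) dB]) (use B(3) in \<open>auto simp: chart_image_def\<close>)
  have FQim: "F ` Q = snd d ` (fst c \<inter> fst d)"
    using FQ(1) cd by (auto simp: Q_def image_iff)
  \<comment> \<open>in the plane the Hausdorff measure in the area formula is Lebesgue
    measure\<close>
  have "(\<integral>\<^sup>+q\<in>F ` Q. \<phi> q \<partial>hausdorff2) = (\<integral>\<^sup>+z\<in>Q. (\<phi> (F z) * ennreal (area_factor (frechet_derivative F (at z)))) \<partial>lborel)"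
    by (rule area_formula_integral[OF F(1) inj _ K F(2) \<phi>]) (use FQ cd transition_facts(4) in auto)
  moreover have "(\<integral>\<^sup>+q\<in>F ` Q. \<phi> q \<partial>hausdorff2) = chart_area d B"
    unfolding hausdorff2_plane chart_area_def
    by (intro nn_integral_cong) (use B in \<open>auto simp: FQim \<phi>_def indicator_def\<close>)
  moreover have "(\<integral>\<^sup>+z\<in>Q. (\<phi> (F z) * ennreal (area_factor (frechet_derivative F (at z)))) \<partial>lborel) = chart_area c B"
    unfolding chart_area_def
  proof (intro nn_integral_cong)
    fix z :: "real^2"
    show "\<phi> (F z) * ennreal (area_factor (frechet_derivative F (at z))) * indicator Q z = ennreal (area_density c z) * indicator (snd c ` B) z"
    proof (cases "z \<in> Q")
      case True
      note z = FQ[OF True]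
      have "area_density c z = area_factor (transition c d (chart_inv c z)) * area_density d (F z)"
        using transition_facts(5)[OF cd z(3,4)] z(1,5) by simp
      moreover have "F z \<in> snd d ` B \<longleftrightarrow> z \<in> snd c ` B"
      proof
        assume "F z \<in> snd d ` B"
        then obtain p where "p \<in> B" "snd d (chart_inv c z) = snd d p" using z(1) by auto
        then have "chart_inv c z = p" using inj_onD[OF chart_facts(5)[OF cd(2)]] z(4) B(3) by blast
        then show "z \<in> snd c ` B" using z(5) \<open>p \<in> B\<close> by (metis imageI)
      next
        assume "z \<in> snd c ` B"
        then show "F z \<in> snd d ` B" using z(1) cd B by auto
      qed
      moreover have "0 \<le> area_density d (F z)" using metric_form_facts(7)[OF cd(2) z(4)] z(1) by simp
      ultimately show ?thesis using True z(2) by (auto simp: \<phi>_def indicator_def ennreal_mult mult.commute)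
    next
      case False
      then have "z \<notin> snd c ` B" using B by (auto simp: Q_def)
      then show ?thesis using False by simp
    qed
  qed
  ultimately show ?thesis by simp
qed

lemma chart_area_suminf:
  assumes c: "c \<in> A" and B: "\<And>n::nat. B n \<in> borel_sets" "\<And>n. B n \<subseteq> fst c" "disjoint_family B"
  shows "chart_area c (\<Union>n. B n) = (\<Sum>n. chart_area c (B n))"
proof -
  have dis: "disjoint_family (\<lambda>n. snd c ` B n)"
    unfolding disjoint_family_on_def
  proof (intro ballI impI)
    fix m n :: nat assume "m \<noteq> n"
    then have "B m \<inter> B n = {}" using B(3) by (auto simp: disjoint_family_on_def)
    then show "snd c ` B m \<inter> snd c ` B n = {}"
      using inj_on_image_Int[OF chart_facts(5)[OF c] B(2)[of m] B(2)[of n]] by simp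
  qed
  have "chart_area c (\<Union>n. B n) = (\<integral>\<^sup>+z. (\<Sum>n. ennreal (area_density c z) * indicator (snd c ` B n) z) \<partial>lborel)"
    unfolding chart_area_def
  proof (rule nn_integral_cong)
    fix z
    show "ennreal (area_density c z) * indicator (snd c ` (\<Union>n. B n)) z = (\<Sum>n. ennreal (area_density c z) * indicator (snd c ` B n) z)"
      unfolding ennreal_suminf_cmult suminf_indicator[OF dis] image_UN ..
  qed
  also have "\<dots> = (\<Sum>n. chart_area c (B n))"
    unfolding chart_area_def
  proof (rule nn_integral_suminf)
    fix n
    show "(\<lambda>z. ennreal (area_density c z) * indicator (snd c ` B n) z) \<in> borel_measurable lborel"
      unfolding measurable_lborel2
      by (rule area_density_indicator_measurable[OF c chart_image_borel[OF c B(1,2)]]) (use B(2) in \<open>auto simp: chart_image_def\<close>)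
  qed
  finally show ?thesis .
qed

lemma finite_atlas:
  obtains cs where "set cs \<subseteq> A" "(\<Union>c\<in>set cs. fst c) = topspace M"
proof -
  have "\<exists>F. finite F \<and> F \<subseteq> fst ` A \<and> topspace M \<subseteq> \<Union>F"
    using compact chart_cover chart_facts(1) unfolding compact_space_def compactin_def by auto
  then obtain F where F: "finite F" "F \<subseteq> fst ` A" "topspace M \<subseteq> \<Union>F" by blast
  then obtain C where C: "finite C" "C \<subseteq> A" "F = fst ` C" using finite_subset_image by metis
  obtain cs where "set cs = C" using finite_list[OF C(1)] by blast
  moreover have "(\<Union>c\<in>C. fst c) = topspace M" using F(3) C chart_facts(2) by blast
  ultimately show ?thesis using that C by blast
qed

text \<open>The condition that characterises the Riemannian area, which is given by a definite
  description, so that existence and uniqueness have to be proved before anything is known about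
  it.\<close>

definition is_area :: "'a measure \<Rightarrow> bool" where
  "is_area \<mu> \<longleftrightarrow> space \<mu> = topspace M \<and> sets \<mu> = borel_sets \<and>
     (\<forall>c\<in>A. \<forall>B\<in>borel_sets. B \<subseteq> fst c \<longrightarrow> emeasure \<mu> B = chart_area c B)"

text \<open>A finite atlas cut into disjoint pieces, each inside one chart.\<close>

definition piece :: "'a chart list \<Rightarrow> nat \<Rightarrow> 'a set" where
  "piece cs i = fst (cs ! i) - (\<Union>j<i. fst (cs ! j))"

lemma piece_facts:
  assumes "set cs \<subseteq> A" "(\<Union>c\<in>set cs. fst c) = topspace M"
  shows "i < length cs \<Longrightarrow> piece cs i \<in> borel_sets" "piece cs i \<subseteq> fst (cs ! i)"
    "disjoint_family (piece cs)" "(\<Union>i<length cs. piece cs i) = topspace M"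
proof -
  have b: "fst (cs ! i) \<in> sets borel_M" if "i < length cs" for i
  proof -
    have "cs ! i \<in> A" using assms(1) that by auto
    then show ?thesis using openin_borel_sets[OF chart_facts(1)] by simp
  qed
  show "piece cs i \<in> borel_sets" if "i < length cs"
  proof -
    have "piece cs i \<in> sets borel_M" unfolding piece_def by (intro sets.Diff sets.finite_UN b) (use that in auto)
    then show ?thesis by simp
  qed
  show "piece cs i \<subseteq> fst (cs ! i)" by (auto simp: piece_def)
  show "disjoint_family (piece cs)"
    unfolding disjoint_family_on_def piece_def
  proof (intro ballI impI)
    fix m n :: nat assume "m \<noteq> n"
    then consider "m < n" | "n < m" by linarith
    then show "(fst (cs ! m) - (\<Union>j<m. fst (cs ! j))) \<inter> (fst (cs ! n) - (\<Union>j<n. fst (cs ! j))) = {}" by cases auto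
  qed
  show "(\<Union>i<length cs. piece cs i) = topspace M"
  proof (intro equalityI subsetI)
    fix p assume "p \<in> (\<Union>i<length cs. piece cs i)"
    then show "p \<in> topspace M" using assms chart_facts(2) by (auto simp: piece_def)
  next
    fix p assume "p \<in> topspace M"
    then obtain c where "c \<in> set cs" "p \<in> fst c" using assms(2) by blast
    then obtain i where i: "i < length cs" "p \<in> fst (cs ! i)" by (metis in_set_conv_nth)
    define k where "k = (LEAST i. p \<in> fst (cs ! i))"
    have "p \<in> fst (cs ! k)" unfolding k_def by (rule LeastI[of _ i]) (rule i)
    moreover have "k \<le> i" unfolding k_def by (rule Least_le) (rule i)
    moreover have "p \<notin> fst (cs ! j)" if "j < k" for j using not_less_Least that unfolding k_def by blast
    ultimately have "p \<in> piece cs k" "k < length cs" using i by (auto simp: piece_def)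
    then show "p \<in> (\<Union>i<length cs. piece cs i)" by blast
  qed
qed

lemma is_area_unique:
  assumes "is_area \<mu>" "is_area \<nu>"
  shows "\<mu> = \<nu>"
proof (rule measure_eqI)
  show "sets \<mu> = sets \<nu>" using assms by (simp add: is_area_def)
  fix B assume "B \<in> sets \<mu>"
  then have B: "B \<in> borel_sets" using assms by (simp add: is_area_def)
  obtain cs where cs: "set cs \<subseteq> A" "(\<Union>c\<in>set cs. fst c) = topspace M" by (rule finite_atlas)
  note P = piece_facts[OF cs]
  have Bp: "B \<inter> piece cs i \<in> borel_sets" if "i < length cs" for i
    using sets.Int[of B borel_M "piece cs i"] B P(1)[OF that] by simp
  have *: "emeasure \<kappa> B = (\<Sum>i<length cs. chart_area (cs ! i) (B \<inter> piece cs i))" if k: "is_area \<kappa>" for \<kappa>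
  proof -
    have "B \<subseteq> topspace M" using B sets.sets_into_space[of B borel_M] by simp
    then have "B = (\<Union>i<length cs. B \<inter> piece cs i)" using P(4) by blast
    then have "emeasure \<kappa> B = emeasure \<kappa> (\<Union>i<length cs. B \<inter> piece cs i)" by simp
    also have "\<dots> = (\<Sum>i<length cs. emeasure \<kappa> (B \<inter> piece cs i))"
    proof (rule sum_emeasure[symmetric])
      show "(\<lambda>i. B \<inter> piece cs i) ` {..<length cs} \<subseteq> sets \<kappa>" using Bp k by (auto simp: is_area_def)
      show "disjoint_family_on (\<lambda>i. B \<inter> piece cs i) {..<length cs}"
        using P(3) by (auto simp: disjoint_family_on_def)
    qed simp
    also have "\<dots> = (\<Sum>i<length cs. chart_area (cs ! i) (B \<inter> piece cs i))"
    proof (rule sum.cong)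
      fix i assume "i \<in> {..<length cs}"
      then have "cs ! i \<in> A" "B \<inter> piece cs i \<in> borel_sets" "B \<inter> piece cs i \<subseteq> fst (cs ! i)" using cs(1) Bp P(2) by auto
      then show "emeasure \<kappa> (B \<inter> piece cs i) = chart_area (cs ! i) (B \<inter> piece cs i)" using k by (simp add: is_area_def)
    qed simp
    finally show ?thesis .
  qed
  show "emeasure \<mu> B = emeasure \<nu> B" using *[OF assms(1)] *[OF assms(2)] by simp
qed

text \<open>Add the chart integrals over the pieces of a finite atlas. For a set inside an arbitrary
  chart the result is the integral in that chart, because chart integrals agree on overlaps.\<close>

lemma is_area_exists: "\<exists>\<mu>. is_area \<mu>"
proof -
  obtain cs where cs: "set cs \<subseteq> A" "(\<Union>c\<in>set cs. fst c) = topspace M" by (rule finite_atlas)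
  note P = piece_facts[OF cs]
  have csA: "cs ! i \<in> A" if "i < length cs" for i using cs(1) that by auto
  have Bp: "B \<inter> piece cs i \<in> borel_sets" if "B \<in> borel_sets" "i < length cs" for i B
    using sets.Int[of B borel_M "piece cs i"] that(1) P(1)[OF that(2)] by simp
  define m where "m B = (\<Sum>i<length cs. chart_area (cs ! i) (B \<inter> piece cs i))" for B
  define \<mu> where "\<mu> = measure_of (topspace M) {U. openin M U} m"
  have sets: "space \<mu> = topspace M" "sets \<mu> = borel_sets"
    unfolding \<mu>_def borel_sets_def by (auto simp: space_measure_of[OF opens_Pow] sets_measure_of[OF opens_Pow])
  have pos: "positive (sets \<mu>) m" by (simp add: positive_def m_def chart_area_def)
  have ca: "countably_additive (sets \<mu>) m"
    unfolding sets
  proof (rule countably_additiveI)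
    fix B :: "nat \<Rightarrow> 'a set" assume B: "range B \<subseteq> borel_sets" "disjoint_family B"
    have "(\<Sum>n. m (B n)) = (\<Sum>i<length cs. \<Sum>n. chart_area (cs ! i) (B n \<inter> piece cs i))"
      unfolding m_def by (rule suminf_sum) simp
    also have "\<dots> = (\<Sum>i<length cs. chart_area (cs ! i) (\<Union>n. B n \<inter> piece cs i))"
    proof (rule sum.cong)
      fix i assume i: "i \<in> {..<length cs}"
      have Bn: "B n \<in> borel_sets" for n using B(1) by blast
      show "(\<Sum>n. chart_area (cs ! i) (B n \<inter> piece cs i)) = chart_area (cs ! i) (\<Union>n. B n \<inter> piece cs i)"
        by (rule chart_area_suminf[symmetric]) (use i B(2) Bn csA Bp P(2)[of i] in \<open>auto simp: disjoint_family_on_def\<close>)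
    qed simp
    also have "\<dots> = m (\<Union>n. B n)" unfolding m_def by (simp add: Int_UN_distrib2)
    finally show "(\<Sum>n. m (B n)) = m (\<Union>n. B n)" .
  qed
  have em: "emeasure \<mu> B = m B" if "B \<in> borel_sets" for B
    by (rule emeasure_measure_of[OF \<mu>_def opens_Pow pos ca]) (use that sets in simp)
  have "emeasure \<mu> B = chart_area c B" if c: "c \<in> A" and B: "B \<in> borel_sets" "B \<subseteq> fst c" for c B
  proof -
    define E where "E n = (if n < length cs then B \<inter> piece cs n else {})" for n
    have empty: "{} \<in> borel_sets" using sets.empty_sets[of borel_M] by simp
    have "B \<subseteq> topspace M" using B chart_facts(2)[OF c] by blast
    then have "B = (\<Union>n. E n)" using P(4) by (auto simp: E_def split: if_splits) 
    then have "chart_area c B = chart_area c (\<Union>n. E n)" by simp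
    also have "\<dots> = (\<Sum>n. chart_area c (E n))"
    proof (rule chart_area_suminf[OF c])
      show "disjoint_family E" unfolding disjoint_family_on_def
      proof (intro ballI impI)
        fix m n :: nat assume "m \<noteq> n"
        then have "piece cs m \<inter> piece cs n = {}" using P(3) by (simp add: disjoint_family_on_def)
        then show "E m \<inter> E n = {}" unfolding E_def by auto
      qed
    qed (use B Bp empty in \<open>auto simp: E_def\<close>)
    also have "\<dots> = (\<Sum>n<length cs. chart_area c (E n))"
      by (rule suminf_finite) (auto simp: E_def chart_area_def)
    also have "\<dots> = (\<Sum>n<length cs. chart_area (cs ! n) (B \<inter> piece cs n))"
    proof (rule sum.cong)
      fix n assume n: "n \<in> {..<length cs}"
      then have "chart_area c (B \<inter> piece cs n) = chart_area (cs ! n) (B \<inter> piece cs n)"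
        using B Bp P(2)[of n] by (intro chart_area_change csA c) auto
      then show "chart_area c (E n) = chart_area (cs ! n) (B \<inter> piece cs n)" using n by (simp add: E_def)
    qed simp
    finally show ?thesis using em[OF B(1)] by (simp add: m_def)
  qed
  then have "is_area \<mu>" using sets by (simp add: is_area_def)
  then show ?thesis by blast
qed

abbreviation area :: "'a measure" where "area \<equiv> riemannian_area M A g"

lemma is_area_riemannian_area: "is_area area"
proof -
  have "is_area \<mu> \<longleftrightarrow> space \<mu> = topspace M \<and> sets \<mu> = sigma_sets (topspace M) {U. openin M U} \<and>
     (\<forall>(U, x)\<in>A. \<forall>B\<in>sets \<mu>. B \<subseteq> U \<longrightarrow>
        emeasure \<mu> B = (\<integral>\<^sup>+z\<in>x ` B. ennreal (sqrt (det (g (U, x) z))) \<partial>lborel))" for \<mu>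
    unfolding is_area_def borel_sets_def chart_area_def area_density_def by (auto simp: case_prod_unfold)
  then have "area = (THE \<mu>. is_area \<mu>)" unfolding riemannian_area_def by simp
  moreover have "is_area (THE \<mu>. is_area \<mu>)" using is_area_exists is_area_unique by (metis theI)
  ultimately show ?thesis by simp
qed

lemma area_space [simp]: "space area = topspace M" and area_sets [simp]: "sets area = borel_sets"
  and emeasure_area: "c \<in> A \<Longrightarrow> B \<in> borel_sets \<Longrightarrow> B \<subseteq> fst c \<Longrightarrow> emeasure area B = chart_area c B"
  using is_area_riemannian_area by (auto simp: is_area_def)

text \<open>The defining property for sets, extended to integrands by comparing image
  measures.\<close>

theorem nn_integral_chart:
  assumes c: "c \<in> A" and \<phi> [measurable]: "\<phi> \<in> borel_measurable borel"
  shows "(\<integral>\<^sup>+p\<in>fst c. \<phi> (snd c p) \<partial>area) = (\<integral>\<^sup>+z\<in>chart_image c. (\<phi> z * ennreal (area_density c z)) \<partial>lborel)"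
proof -
  \<comment> \<open>the coordinate map, extended by 0 to a function on all of
    \<open>M\<close>\<close>
  define X where "X p = (if p \<in> fst c then snd c p else 0)" for p
  have U [measurable]: "fst c \<in> sets area" using openin_borel_sets[OF chart_facts(1)[OF c]] by simp
  have V [measurable]: "chart_image c \<in> sets borel" by (rule half_plane_relopen_borel[OF chart_facts(3)[OF c]])
  have X [measurable]: "X \<in> borel_measurable area"
  proof (rule measurableI)
    fix C :: "(real^2) set" assume C: "C \<in> sets borel"
    have "X -` C \<inter> space area = (fst c \<inter> snd c -` C) \<union> (if 0 \<in> C then space area - fst c else {})"
      using chart_facts(2)[OF c] by (auto simp: X_def split: if_splits)
    moreover have "fst c \<inter> snd c -` C \<in> sets area" using chart_vimage_borel[OF c C] by simp
    moreover have "space area - fst c \<in> sets area" using U by (rule sets.compl_sets)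
    ultimately show "X -` C \<inter> space area \<in> sets area" by (simp only: sets.Un sets.empty_sets split: if_split) simp
  qed simp
  then have X' [measurable]: "X \<in> measurable (density area (indicator (fst c))) borel" by simp
  define w where "w z = ennreal (area_density c z) * indicator (chart_image c) z" for z
  have w [measurable]: "w \<in> borel_measurable borel"
    unfolding w_def by (rule area_density_indicator_measurable[OF c V order_refl])
  have "distr (density area (indicator (fst c))) borel X = density lborel w"
  proof (rule measure_eqI)
    fix C assume "C \<in> sets (distr (density area (indicator (fst c))) borel X)"
    then have C [measurable]: "C \<in> sets borel" by simp
    have pre: "X -` C \<inter> topspace M \<in> sets area" using measurable_sets[OF X C] by simp
    have "emeasure (distr (density area (indicator (fst c))) borel X) C = emeasure (density area (indicator (fst c))) (X -` C \<inter> topspace M)"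
      by (subst emeasure_distr[OF X' C]) simp
    also have "\<dots> = (\<integral>\<^sup>+p. indicator (fst c) p * indicator (X -` C \<inter> topspace M) p \<partial>area)"
      using pre by (intro emeasure_density) auto
    also have "\<dots> = (\<integral>\<^sup>+p. indicator (fst c \<inter> snd c -` C) p \<partial>area)"
      using chart_facts(2)[OF c] by (intro nn_integral_cong) (auto simp: X_def indicator_def)
    also have "\<dots> = chart_area c (fst c \<inter> snd c -` C)"
      using chart_vimage_borel[OF c C] by (simp add: emeasure_area[OF c])
    also have "\<dots> = (\<integral>\<^sup>+z. w z * indicator C z \<partial>lborel)"
      unfolding chart_area_def w_def
      by (intro nn_integral_cong) (auto simp: indicator_def chart_image_def)
    also have "\<dots> = emeasure (density lborel w) C" by (rule emeasure_density[symmetric]) auto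
    finally show "emeasure (distr (density area (indicator (fst c))) borel X) C = emeasure (density lborel w) C" .
  qed simp
  then have "(\<integral>\<^sup>+z. \<phi> z \<partial>distr (density area (indicator (fst c))) borel X) = (\<integral>\<^sup>+z. \<phi> z \<partial>density lborel w)" by simp
  also have "\<dots> = (\<integral>\<^sup>+z. w z * \<phi> z \<partial>lborel)" by (rule nn_integral_density) auto
  also have "\<dots> = (\<integral>\<^sup>+z\<in>chart_image c. (\<phi> z * ennreal (area_density c z)) \<partial>lborel)"
    by (intro nn_integral_cong) (auto simp: w_def indicator_def mult.commute)
  also have "(\<integral>\<^sup>+z. \<phi> z \<partial>distr (density area (indicator (fst c))) borel X) = (\<integral>\<^sup>+p. indicator (fst c) p * \<phi> (X p) \<partial>area)"
    by (subst nn_integral_distr[OF X'], simp, subst nn_integral_density) auto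
  also have "\<dots> = (\<integral>\<^sup>+p\<in>fst c. \<phi> (snd c p) \<partial>area)"
    by (intro nn_integral_cong) (auto simp: X_def indicator_def)
  finally show ?thesis .
qed

end

section \<open>Smooth maps of a surface into Euclidean space\<close>

lemma hausdorff2_raw_null_UN:
  fixes S :: "nat \<Rightarrow> 'b::metric_space set"
  assumes "\<And>i. hausdorff2_raw (S i) = 0"
  shows "hausdorff2_raw (\<Union>i. S i) = 0"
proof -
  have "hausdorff2_raw (\<Union>i. S i) \<le> (\<Sum>i. hausdorff2_raw (S i))" by (rule hausdorff2_raw_subadditive)
  also have "\<dots> = 0" by (simp add: assms)
  finally show ?thesis by simp
qed

text \<open>The setting for the change of variables; smoothness includes the boundary.\<close>

locale smooth_map_surface = riemannian_surface M A g
  for M :: "'a topology" and A g +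
  fixes h :: "'a \<Rightarrow> real^'n"
  assumes h_smooth: "c \<in> A \<Longrightarrow> smooth_on (chart_image c) (h \<circ> chart_inv c)"
begin

text \<open>The differential in an arbitrary chart, whereas \<open>differential\<close> refers to
  the chart chosen at the point. Continuity and measurability of the pointwise quantities can be
  seen only in a fixed chart.\<close>

definition dh :: "'a chart \<Rightarrow> 'a \<Rightarrow> real^2 \<Rightarrow> real^'n" where
  "dh c p = frechet_derivative (h \<circ> chart_inv c) (at (snd c p) within chart_image c)"

lemma dh_derivative:
  assumes "c \<in> A" "p \<in> fst c"
  shows "((h \<circ> chart_inv c) has_derivative dh c p) (at (snd c p) within chart_image c)" "linear (dh c p)"
proof -
  show "((h \<circ> chart_inv c) has_derivative dh c p) (at (snd c p) within chart_image c)"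
    unfolding dh_def by (rule half_plane_differentiable[OF chart_facts(3)[OF assms(1)] h_smooth[OF assms(1)] chart_image_I[OF assms(2)]])
  then show "linear (dh c p)" by (rule has_derivative_linear)
qed

lemma dh_transition:
  assumes "c \<in> A" "d \<in> A" "p \<in> fst c" "p \<in> fst d"
  shows "dh c p v = dh d p (transition c d p v)"
proof -
  let ?O = "snd c ` (fst c \<inter> fst d)"
  have z: "snd c p \<in> ?O" using assms by blast
  have sub: "?O \<subseteq> chart_image c" by (auto simp: chart_image_def)
  have T: "(snd d \<circ> chart_inv c) (snd c p) = snd d p" using assms by simp
  have im: "(snd d \<circ> chart_inv c) ` ?O \<subseteq> chart_image d" using assms(1) by (auto simp: chart_image_def)
  have 1: "((h \<circ> chart_inv c) has_derivative dh c p) (at (snd c p) within ?O)"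
    by (rule has_derivative_subset[OF dh_derivative(1)[OF assms(1,3)] sub])
  have "((h \<circ> chart_inv d) has_derivative dh d p) (at ((snd d \<circ> chart_inv c) (snd c p)) within (snd d \<circ> chart_inv c) ` ?O)"
    unfolding T by (rule has_derivative_subset[OF dh_derivative(1)[OF assms(2,4)] im])
  from diff_chain_within[OF transition_facts(1)[OF assms] this]
  have "((h \<circ> chart_inv d \<circ> (snd d \<circ> chart_inv c)) has_derivative (dh d p \<circ> transition c d p)) (at (snd c p) within ?O)" .
  then have 2: "((h \<circ> chart_inv c) has_derivative (dh d p \<circ> transition c d p)) (at (snd c p) within ?O)"
    by (rule has_derivative_transform[OF z, rotated]) (use assms in auto)
  have "dh c p = dh d p \<circ> transition c d p"
    by (rule half_plane_derivative_unique[OF overlap_open[OF assms(1,2)] z 1 2])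
  then show ?thesis by simp
qed

lemma chart_at_facts:
  assumes "p \<in> topspace M"
  shows "chart_at A p \<in> A" "p \<in> fst (chart_at A p)"
proof -
  have "\<exists>c. c \<in> A \<and> p \<in> fst c" using assms chart_cover by blast
  from someI_ex[OF this] show "chart_at A p \<in> A" "p \<in> fst (chart_at A p)" unfolding chart_at_def by auto
qed

lemma differential_eq_dh: "differential A h p = dh (chart_at A p) p"
  unfolding differential_def dh_def chart_inv_def chart_image_def by (simp add: Let_def case_prod_unfold)

lemma metric_inner_eq_form: "metric_inner A g p = metric_form (chart_at A p) p"
  by (intro ext) (simp add: metric_inner_def metric_matrix_def metric_form_def)

text \<open>The Jacobian of \<open>h\<close>: the factor by which it scales area.\<close>

definition stretch :: "'a \<Rightarrow> real" where
  "stretch p = area_factor (differential A h p) / sqrt (form_det (metric_inner A g p))"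

definition pullback_energy :: "'a chart \<Rightarrow> 'a \<Rightarrow> real" where
  "pullback_energy c p = form_trace (metric_form c p) (\<lambda>a b. dh c p a \<bullet> dh c p b) / form_det (metric_form c p)"

lemma form_trace_transition:
  fixes Q :: "real^2 \<Rightarrow> real^2 \<Rightarrow> 'b::real_inner"
  assumes "c \<in> A" "d \<in> A" "p \<in> fst c" "p \<in> fst d" "bilinear Q"
  shows "form_trace (metric_form c p) (\<lambda>a b. Q (transition c d p a) (transition c d p b))
    = (area_factor (transition c d p))\<^sup>2 *\<^sub>R form_trace (metric_form d p) Q"
    "form_det (metric_form c p) = (area_factor (transition c d p))\<^sup>2 * form_det (metric_form d p)"
    "0 < area_factor (transition c d p)"
proof -
  note T = transition_facts[OF assms(1-4)]
  have eq: "metric_form c p = (\<lambda>a b. metric_form d p (transition c d p a) (transition c d p b))"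
    by (intro ext) (rule T(3))
  show "form_trace (metric_form c p) (\<lambda>a b. Q (transition c d p a) (transition c d p b))
    = (area_factor (transition c d p))\<^sup>2 *\<^sub>R form_trace (metric_form d p) Q"
    unfolding eq by (rule form_trace_compose[OF T(2) metric_form_facts(1,2)[OF assms(2,4)] assms(5)])
  show "form_det (metric_form c p) = (area_factor (transition c d p))\<^sup>2 * form_det (metric_form d p)"
    unfolding eq by (rule form_det_compose[OF T(2) metric_form_facts(1,2)[OF assms(2,4)]])
  show "0 < area_factor (transition c d p)" by (rule area_factor_pos[OF T(2,4)])
qed

text \<open>The energy density is a trace, so it can be computed in any chart; likewise for the
  Jacobian in \<open>stretch_chart\<close>.\<close>

lemma energy_density_chart:
  assumes "c \<in> A" "p \<in> fst c"
  shows "energy_density A g h p = pullback_energy c p"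
proof -
  have p: "p \<in> topspace M" using chart_facts(2) assms by blast
  define d where "d = chart_at A p"
  have d: "d \<in> A" "p \<in> fst d" using chart_at_facts[OF p] by (auto simp: d_def)
  let ?G = "g d (snd d p)"
  note G = metric_facts[OF d(1) chart_image_I[OF d(2)]]
  have "energy_density A g h p = (\<Sum>i\<in>UNIV. \<Sum>j\<in>UNIV. matrix_inv ?G $ i $ j *\<^sub>R (dh d p (axis i 1) \<bullet> dh d p (axis j 1)))"
    by (simp add: energy_density_def metric_matrix_def differential_eq_dh d_def)
  also have "\<dots> = (1 / det ?G) *\<^sub>R form_trace (\<lambda>a b. a \<bullet> (?G *v b)) (\<lambda>a b. dh d p a \<bullet> dh d p b)"
    by (rule matrix_inv_form_trace) (use G in auto)
  also have "(\<lambda>a b. a \<bullet> (?G *v b)) = metric_form d p" by (intro ext) (simp add: metric_form_def)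
  also have "det ?G = form_det (metric_form d p)" using metric_form_facts(4)[OF d] by simp
  finally have 1: "energy_density A g h p = pullback_energy d p" by (simp add: pullback_energy_def)
  have 2: "(\<lambda>a b. dh c p a \<bullet> dh c p b) = (\<lambda>a b. dh d p (transition c d p a) \<bullet> dh d p (transition c d p b))"
    by (intro ext) (simp add: dh_transition[OF assms(1) d(1) assms(2) d(2)])
  note T = form_trace_transition[OF assms(1) d(1) assms(2) d(2) bilinear_inner_linear[OF dh_derivative(2)[OF d]]]
  show ?thesis unfolding 1 unfolding pullback_energy_def[of c] 2 T(1,2) using T(3)
    by (simp add: pullback_energy_def)
qed

lemma stretch_chart:
  assumes "c \<in> A" "p \<in> fst c"
  shows "stretch p = area_factor (dh c p) / area_density c (snd c p)"
proof -
  have p: "p \<in> topspace M" using chart_facts(2) assms by blast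
  define d where "d = chart_at A p"
  have d: "d \<in> A" "p \<in> fst d" using chart_at_facts[OF p] by (auto simp: d_def)
  note T = transition_facts[OF assms(1) d(1) assms(2) d(2)]
  have "dh c p = (\<lambda>v. dh d p (transition c d p v))"
    by (intro ext) (simp add: dh_transition[OF assms(1) d(1) assms(2) d(2)])
  then have "area_factor (dh c p) = area_factor (transition c d p) * area_factor (dh d p)"
    using area_factor_compose[OF T(2) dh_derivative(2)[OF d]] by simp
  then have "area_factor (dh c p) / area_density c (snd c p) = area_factor (dh d p) / area_density d (snd d p)"
    using T(5) area_factor_pos[OF T(2,4)] by simp
  then show ?thesis unfolding stretch_def differential_eq_dh metric_inner_eq_form d_def[symmetric] metric_form_facts(6)[OF d] by simp
qed

lemma differential_inj_chart:
  assumes "c \<in> A" "p \<in> fst c"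
  shows "inj (differential A h p) \<longleftrightarrow> inj (dh c p)"
proof -
  have p: "p \<in> topspace M" using chart_facts(2) assms by blast
  note d = chart_at_facts[OF p]
  have *: "inj (dh c p)" if "c \<in> A" "d \<in> A" "p \<in> fst c" "p \<in> fst d" "inj (dh d p)" for c d
  proof -
    have "dh c p = dh d p \<circ> transition c d p" by (intro ext) (simp add: dh_transition[OF that(1-4)])
    then show ?thesis using that(5) transition_facts(4)[OF that(1-4)] by (simp add: inj_compose)
  qed
  show ?thesis unfolding differential_eq_dh using *[OF d(1) assms(1) d(2) assms(2)] *[OF assms(1) d(1) assms(2) d(2)] by blast
qed

lemma chart_extension:
  assumes "c \<in> A"
  obtains W F where "C1_map_on W F (\<lambda>x. frechet_derivative F (at x))" "\<forall>k. C_k_on k F W" "chart_image c \<subseteq> W"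
    "\<forall>z\<in>chart_image c. F z = h (chart_inv c z)"
    "\<forall>z\<in>chart_image c. frechet_derivative F (at z) = dh c (chart_inv c z)"
proof -
  obtain W F where F: "C1_map_on W F (\<lambda>x. frechet_derivative F (at x))" "\<forall>k. C_k_on k F W" "chart_image c \<subseteq> W"
    "\<forall>x\<in>chart_image c. F x = (h \<circ> chart_inv c) x"
    "\<forall>z\<in>chart_image c. ((h \<circ> chart_inv c) has_derivative frechet_derivative F (at z)) (at z within chart_image c)"
    "\<forall>z\<in>chart_image c. frechet_derivative (h \<circ> chart_inv c) (at z within chart_image c) = frechet_derivative F (at z)"
    by (rule half_plane_smooth_extension[OF chart_facts(3)[OF assms] h_smooth[OF assms]])
  show ?thesis by (rule that[OF F(1,2,3)]) (use F(4,6) assms in \<open>simp_all add: dh_def\<close>)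
qed

lemma chart_quantities_continuous:
  assumes c: "c \<in> A"
  shows "continuous_on (chart_image c) (\<lambda>z. energy_density A g h (chart_inv c z))"
    "continuous_on (chart_image c) (\<lambda>z. stretch (chart_inv c z))"
    "continuous_on (chart_image c) (\<lambda>z. h (chart_inv c z))"
proof -
  obtain W F where F: "C1_map_on W F (\<lambda>x. frechet_derivative F (at x))" "\<forall>k. C_k_on k F W" "chart_image c \<subseteq> W"
    "\<forall>z\<in>chart_image c. F z = h (chart_inv c z)"
    "\<forall>z\<in>chart_image c. frechet_derivative F (at z) = dh c (chart_inv c z)"
    by (rule chart_extension[OF c])
  have "continuous_on (chart_image c) F" using C1_map_onD(5)[OF F(1)] F(3) continuous_on_subset by blast
  then show "continuous_on (chart_image c) (\<lambda>z. h (chart_inv c z))" by (rule continuous_on_eq) (use F(4) in simp)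
  have cd: "continuous_on (chart_image c) (\<lambda>z. dh c (chart_inv c z) v)" for v
    by (rule continuous_on_eq[OF continuous_on_subset[OF C1_map_onD(4)[OF F(1), of v] F(3)]]) (use F(5) in simp)
  have cw: "continuous_on (chart_image c) (area_density c)" by (rule area_density_continuous[OF c])
  have cg: "continuous_on (chart_image c) (g c)"
  proof (cases "chart_image c = {}")
    case False
    then obtain z where "z \<in> chart_image c" by blast
    from metric_facts(4)[OF c this] obtain W G where G: "open W" "chart_image c \<subseteq> W" "\<forall>k. C_k_on k G W" "\<forall>x\<in>chart_image c. G x = g c x"
      unfolding smooth_on_def by blast
    then have "continuous_on (chart_image c) G" using C_k_on_continuous continuous_on_subset by blast
    then show ?thesis by (rule continuous_on_eq) (use G(4) in simp)
  qed simp
  have w: "area_density c z \<noteq> 0" if "z \<in> chart_image c" for z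
    using metric_form_facts(7)[OF c, of "chart_inv c z"] c that by simp
  show "continuous_on (chart_image c) (\<lambda>z. stretch (chart_inv c z))"
  proof (rule continuous_on_eq)
    show "continuous_on (chart_image c) (\<lambda>z. area_factor (dh c (chart_inv c z)) / area_density c z)"
      unfolding area_factor_def using w by (intro continuous_intros cd cw) auto
  qed (use c stretch_chart in simp)
  have det: "det (g c z) \<noteq> 0" if "z \<in> chart_image c" for z using metric_facts(3)[OF c that] by simp
  show "continuous_on (chart_image c) (\<lambda>z. energy_density A g h (chart_inv c z))"
  proof (rule continuous_on_eq)
    show "continuous_on (chart_image c) (\<lambda>z. (g c z $ 2 $ 2 * (dh c (chart_inv c z) (axis 1 1) \<bullet> dh c (chart_inv c z) (axis 1 1))
       - g c z $ 1 $ 2 * (dh c (chart_inv c z) (axis 1 1) \<bullet> dh c (chart_inv c z) (axis 2 1) + dh c (chart_inv c z) (axis 2 1) \<bullet> dh c (chart_inv c z) (axis 1 1))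
       + g c z $ 1 $ 1 * (dh c (chart_inv c z) (axis 2 1) \<bullet> dh c (chart_inv c z) (axis 2 1))) /
         (g c z $ 1 $ 1 * g c z $ 2 $ 2 - g c z $ 1 $ 2 * g c z $ 2 $ 1))"
      using det by (intro continuous_intros cd cg) (auto simp: det_2)
    fix z assume z: "z \<in> chart_image c"
    then have p: "chart_inv c z \<in> fst c" "snd c (chart_inv c z) = z" using c by auto
    have ax: "metric_form c (chart_inv c z) (axis i 1) (axis j 1) = g c z $ i $ j" for i j
      unfolding metric_form_def p(2) by (rule matrix_form_axis)
    have "form_det (metric_form c (chart_inv c z)) = det (g c z)" using metric_form_facts(4)[OF c p(1)] p(2) by simp
    then show "(g c z $ 2 $ 2 * (dh c (chart_inv c z) (axis 1 1) \<bullet> dh c (chart_inv c z) (axis 1 1))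
       - g c z $ 1 $ 2 * (dh c (chart_inv c z) (axis 1 1) \<bullet> dh c (chart_inv c z) (axis 2 1) + dh c (chart_inv c z) (axis 2 1) \<bullet> dh c (chart_inv c z) (axis 1 1))
       + g c z $ 1 $ 1 * (dh c (chart_inv c z) (axis 2 1) \<bullet> dh c (chart_inv c z) (axis 2 1))) /
         (g c z $ 1 $ 1 * g c z $ 2 $ 2 - g c z $ 1 $ 2 * g c z $ 2 $ 1) = energy_density A g h (chart_inv c z)"
      unfolding energy_density_chart[OF c p(1)] pullback_energy_def form_trace_def ax by (simp add: det_2)
  qed
qed

lemma energy_density_nonneg:
  assumes "p \<in> topspace M" "inj (differential A h p)"
  shows "0 \<le> energy_density A g h p" "0 < stretch p"
proof -
  note d = chart_at_facts[OF assms(1)]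
  let ?d = "chart_at A p"
  note m = metric_form_facts[OF d]
  have D: "linear (dh ?d p)" by (rule dh_derivative(2)[OF d])
  show "0 < stretch p" unfolding stretch_chart[OF d]
    using area_factor_pos[OF D] assms(2) m(7) by (simp add: differential_eq_dh)
  text \<open>Cauchy-Schwarz on both\<close>
  let ?\<beta> = "metric_form ?d p" and ?a = "axis 1 1 :: real^2" and ?b = "axis 2 1 :: real^2"
  define u v where "u = dh ?d p ?a" and "v = dh ?d p ?b"
  define E G Fm where "E = ?\<beta> ?a ?a" and "G = ?\<beta> ?b ?b" and "Fm = ?\<beta> ?a ?b"
  have pos: "0 < E" "0 < G" unfolding E_def G_def by (auto intro!: m(3) simp: axis_eq_0_iff)
  have det: "0 < E * G - Fm\<^sup>2" using m(5) by (simp add: form_det_def E_def G_def Fm_def)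
  have "E * (G * (u \<bullet> u) - Fm * (u \<bullet> v + v \<bullet> u) + E * (v \<bullet> v))
      = (E *\<^sub>R v - Fm *\<^sub>R u) \<bullet> (E *\<^sub>R v - Fm *\<^sub>R u) + (E * G - Fm\<^sup>2) * (u \<bullet> u)"
    by (simp add: inner_diff_left inner_diff_right inner_commute power2_eq_square algebra_simps)
  also have "\<dots> \<ge> 0" using det by (intro add_nonneg_nonneg mult_nonneg_nonneg) auto
  finally have "0 \<le> G * (u \<bullet> u) - Fm * (u \<bullet> v + v \<bullet> u) + E * (v \<bullet> v)"
    using pos(1) by (simp add: zero_le_mult_iff)
  then have "0 \<le> form_trace ?\<beta> (\<lambda>a b. dh ?d p a \<bullet> dh ?d p b)"
    by (simp add: form_trace_def E_def G_def Fm_def u_def v_def)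
  then show "0 \<le> energy_density A g h p"
    unfolding energy_density_chart[OF d] pullback_energy_def using m(5) by simp
qed

definition chart_continuous_fun :: "('a \<Rightarrow> 'b::real_normed_vector) \<Rightarrow> bool" where
  "chart_continuous_fun \<psi> \<longleftrightarrow> (\<forall>c\<in>A. continuous_on (chart_image c) (\<lambda>z. \<psi> (chart_inv c z)))"

lemma chart_continuous_fun_open:
  assumes "chart_continuous_fun \<psi>" "open S"
  shows "openin M {p \<in> topspace M. \<psi> p \<in> S}"
proof -
  have "openin M {p \<in> fst c. \<psi> p \<in> S}" if c: "c \<in> A" for c
  proof -
    have "openin (top_of_set (chart_image c)) (chart_image c \<inter> (\<lambda>z. \<psi> (chart_inv c z)) -` S)"
      using assms c by (intro continuous_openin_preimage_gen) (auto simp: chart_continuous_fun_def)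
    moreover have "continuous_map (subtopology M (fst c)) (top_of_set (chart_image c)) (snd c)"
      by (rule homeomorphic_imp_continuous_map[OF chart_facts(4)[OF c]])
    ultimately have "openin (subtopology M (fst c)) {p \<in> topspace (subtopology M (fst c)). snd c p \<in> chart_image c \<inter> (\<lambda>z. \<psi> (chart_inv c z)) -` S}"
      by (intro openin_continuous_map_preimage)
    moreover have "{p \<in> topspace (subtopology M (fst c)). snd c p \<in> chart_image c \<inter> (\<lambda>z. \<psi> (chart_inv c z)) -` S} = {p \<in> fst c. \<psi> p \<in> S}"
      using chart_facts(2)[OF c] c chart_image_I[where c = c] by auto
    ultimately show ?thesis using openin_trans_full chart_facts(1)[OF c] by metis
  qed
  then have "openin M (\<Union>c\<in>A. {p \<in> fst c. \<psi> p \<in> S})" by blast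
  moreover have "(\<Union>c\<in>A. {p \<in> fst c. \<psi> p \<in> S}) = {p \<in> topspace M. \<psi> p \<in> S}" using chart_cover by blast
  ultimately show ?thesis by simp
qed

lemma chart_continuous_fun_measurable:
  assumes "chart_continuous_fun \<psi>"
  shows "\<psi> \<in> borel_measurable area"
proof (rule borel_measurableI)
  fix S :: "'b set" assume "open S"
  then have "openin M {p \<in> topspace M. \<psi> p \<in> S}" by (rule chart_continuous_fun_open[OF assms])
  moreover have "{p \<in> topspace M. \<psi> p \<in> S} = \<psi> -` S \<inter> space area" by auto
  ultimately show "\<psi> -` S \<inter> space area \<in> sets area" using openin_borel_sets by simp
qed

lemma chart_continuous_fun_local_integral:
  fixes \<psi> :: "'a \<Rightarrow> real"
  assumes "chart_continuous_fun \<psi>" "p \<in> topspace M"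
  obtains N where "openin M N" "p \<in> N" "(\<integral>\<^sup>+p\<in>N. ennreal (\<psi> p) \<partial>area) < \<infinity>"
proof -
  obtain c where c: "c \<in> A" "p \<in> fst c" using assms(2) chart_cover by blast
  define z where "z = snd c p"
  obtain T where T: "open T" "chart_image c = T \<inter> half_plane" using half_plane_relopenE[OF chart_facts(3)[OF c(1)]] .
  have z: "z \<in> T" "z \<in> half_plane" using chart_image_I[OF c(2)] T(2) by (auto simp: z_def)
  obtain r where r: "0 < r" "cball z r \<subseteq> T" using T(1) z(1) open_contains_cball by blast
  define K where "K = cball z r \<inter> half_plane"
  have K: "compact K" "K \<subseteq> chart_image c" "K \<in> sets borel"
    unfolding K_def using closed_half_plane r T by (auto intro: compact_Int_closed borel_closed)
  have cont: "continuous_on K (\<lambda>z. \<psi> (chart_inv c z))" "continuous_on K (area_density c)"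
    using assms(1) c(1) K(2) area_density_continuous[OF c(1)] by (auto simp: chart_continuous_fun_def intro: continuous_on_subset)
  define N where "N = fst c \<inter> snd c -` ball z r"
  define \<phi> where "\<phi> z = ennreal (indicator K z *\<^sub>R \<psi> (chart_inv c z))" for z
  have \<phi>: "\<phi> \<in> borel_measurable borel"
    unfolding \<phi>_def by (intro measurable_compose[OF _ measurable_ennreal] borel_measurable_continuous_on_indicator[OF K(3) cont(1)])
  have "compact ((\<lambda>z. \<psi> (chart_inv c z) * area_density c z) ` K)"
    by (intro compact_continuous_image continuous_intros cont K)
  then obtain B where B: "0 < B" "\<forall>y\<in>(\<lambda>z. \<psi> (chart_inv c z) * area_density c z) ` K. norm y \<le> B"
    using compact_imp_bounded bounded_pos by metis
  have "openin M N"
  proof -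
    have "openin (subtopology M (fst c)) {p \<in> topspace (subtopology M (fst c)). snd c p \<in> ball z r}"
      by (intro openin_continuous_map_preimage[OF chart_continuous(1)[OF c(1)]]) auto
    then have "openin M {p \<in> topspace (subtopology M (fst c)). snd c p \<in> ball z r}"
      using openin_trans_full chart_facts(1)[OF c(1)] by blast
    moreover have "{p \<in> topspace (subtopology M (fst c)). snd c p \<in> ball z r} = N"
      using chart_facts(2)[OF c(1)] by (auto simp: N_def)
    ultimately show ?thesis by simp
  qed
  moreover have "p \<in> N" using c r by (simp add: N_def z_def)
  moreover have "(\<integral>\<^sup>+p\<in>N. ennreal (\<psi> p) \<partial>area) < \<infinity>"
  proof -
    have "(\<integral>\<^sup>+p\<in>N. ennreal (\<psi> p) \<partial>area) \<le> (\<integral>\<^sup>+p\<in>fst c. \<phi> (snd c p) \<partial>area)"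
    proof (rule nn_integral_mono)
      fix p
      show "ennreal (\<psi> p) * indicator N p \<le> \<phi> (snd c p) * indicator (fst c) p"
      proof (cases "p \<in> N")
        case True
        then have "p \<in> fst c" "snd c p \<in> ball z r" by (auto simp: N_def)
        then have "p \<in> fst c" "snd c p \<in> K" using chart_image_I[of p c] T(2) by (auto simp: K_def)
        then show ?thesis using c(1) by (simp add: \<phi>_def indicator_def)
      qed simp
    qed
    also have "\<dots> = (\<integral>\<^sup>+z\<in>chart_image c. (\<phi> z * ennreal (area_density c z)) \<partial>lborel)"
      by (rule nn_integral_chart[OF c(1) \<phi>])
    also have "\<dots> \<le> (\<integral>\<^sup>+z. ennreal B * indicator K z \<partial>lborel)"
    proof (rule nn_integral_mono)
      fix y
      show "\<phi> y * ennreal (area_density c y) * indicator (chart_image c) y \<le> ennreal B * indicator K y"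
      proof (cases "y \<in> K")
        case True
        then have y: "chart_inv c y \<in> fst c" "snd c (chart_inv c y) = y" using K(2) c(1) by auto
        have "0 \<le> area_density c y" using metric_form_facts(7)[OF c(1) y(1)] y(2) by simp
        then have "\<phi> y * ennreal (area_density c y) = ennreal (\<psi> (chart_inv c y) * area_density c y)"
          using True by (cases "0 \<le> \<psi> (chart_inv c y)") (simp_all add: \<phi>_def ennreal_mult'' ennreal_neg mult_nonpos_nonneg)
        also have "\<dots> \<le> ennreal B" using B(2) True by (intro ennreal_leI) (auto simp: abs_le_iff)
        finally show ?thesis using True K(2) by (auto simp: indicator_def)
      qed (simp add: \<phi>_def)
    qed
    also have "\<dots> = ennreal B * emeasure lborel K" using K(3) by (simp add: nn_integral_cmult_indicator)
    also have "\<dots> < \<infinity>" using emeasure_bounded_finite[OF compact_imp_bounded[OF K(1)]] by (simp add: ennreal_mult_less_top)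
    finally show ?thesis .
  qed
  ultimately show ?thesis by (rule that)
qed

lemma chart_continuous_fun_integral_finite:
  fixes \<psi> :: "'a \<Rightarrow> real"
  assumes \<psi>: "chart_continuous_fun \<psi>"
  shows "(\<integral>\<^sup>+p. ennreal (\<psi> p) \<partial>area) < \<infinity>"
proof -
  define \<N> where "\<N> = {N. openin M N \<and> (\<integral>\<^sup>+p\<in>N. ennreal (\<psi> p) \<partial>area) < \<infinity>}"
  have "topspace M \<subseteq> \<Union>\<N>"
  proof
    fix p assume "p \<in> topspace M"
    then obtain N where "openin M N" "p \<in> N" "(\<integral>\<^sup>+p\<in>N. ennreal (\<psi> p) \<partial>area) < \<infinity>"
      by (rule chart_continuous_fun_local_integral[OF \<psi>])
    then show "p \<in> \<Union>\<N>" by (auto simp: \<N>_def)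
  qed
  then obtain F where F: "finite F" "F \<subseteq> \<N>" "topspace M \<subseteq> \<Union>F"
    using compact unfolding compact_space_def compactin_def \<N>_def
    by (metis (no_types, lifting) mem_Collect_eq)
  have [measurable]: "\<psi> \<in> borel_measurable area" by (rule chart_continuous_fun_measurable[OF \<psi>])
  have FM: "N \<in> sets area" if "N \<in> F" for N using F(2) that openin_borel_sets by (auto simp: \<N>_def)
  have "(\<integral>\<^sup>+p. ennreal (\<psi> p) \<partial>area) \<le> (\<integral>\<^sup>+p. (\<Sum>N\<in>F. ennreal (\<psi> p) * indicator N p) \<partial>area)"
  proof (rule nn_integral_mono)
    fix p assume "p \<in> space area"
    then obtain N where N: "N \<in> F" "p \<in> N" using F(3) by auto
    have "ennreal (\<psi> p) = ennreal (\<psi> p) * indicator N p" using N by simp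
    also have "\<dots> \<le> (\<Sum>N\<in>F. ennreal (\<psi> p) * indicator N p)" by (rule member_le_sum[OF N(1)]) (use F in auto)
    finally show "ennreal (\<psi> p) \<le> (\<Sum>N\<in>F. ennreal (\<psi> p) * indicator N p)" .
  qed
  also have "\<dots> = (\<Sum>N\<in>F. \<integral>\<^sup>+p\<in>N. ennreal (\<psi> p) \<partial>area)"
    by (rule nn_integral_sum) (use FM in measurable)
  also have "\<dots> < \<infinity>" using F(1,2) by (auto simp: \<N>_def less_top)
  finally show ?thesis .
qed

lemma chart_continuous_quantities:
  "chart_continuous_fun (energy_density A g h)" "chart_continuous_fun stretch" "chart_continuous_fun h"
  using chart_quantities_continuous by (auto simp: chart_continuous_fun_def)

text \<open>The energy density is continuous on a compact surface. Finiteness is used in the case of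
  equality.\<close>

lemma Energy_finite: "Energy M A g h < \<infinity>"
  unfolding Energy_def by (rule chart_continuous_fun_integral_finite[OF chart_continuous_quantities(1)])

lemma null_set_chart_image:
  assumes c: "c \<in> A" and B: "B \<in> null_sets area" "B \<subseteq> fst c"
  shows "snd c ` B \<in> null_sets lborel"
proof -
  have b: "B \<in> borel_sets" "emeasure area B = 0" using B by (auto simp: null_sets_def)
  have xB: "snd c ` B \<in> sets borel" by (rule chart_image_borel[OF c b(1) B(2)])
  have m: "(\<lambda>z. ennreal (area_density c z) * indicator (snd c ` B) z) \<in> borel_measurable lborel"
    unfolding measurable_lborel2 by (rule area_density_indicator_measurable[OF c xB]) (use B(2) in \<open>auto simp: chart_image_def\<close>)
  have "(\<integral>\<^sup>+z\<in>snd c ` B. ennreal (area_density c z) \<partial>lborel) = 0"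
    using emeasure_area[OF c b(1) B(2)] b(2) by (simp add: chart_area_def)
  then have "AE z in lborel. ennreal (area_density c z) * indicator (snd c ` B) z = 0"
    using nn_integral_0_iff_AE[OF m] by simp
  then have "AE z in lborel. z \<notin> snd c ` B"
  proof eventually_elim
    case (elim z)
    show ?case
    proof
      assume z: "z \<in> snd c ` B"
      then have "0 < area_density c z" using metric_form_facts(7)[OF c] B(2) by auto
      then show False using elim z by simp
    qed
  qed
  then show ?thesis using xB AE_iff_null_sets by (metis sets_lborel)
qed

lemma null_set_chart_preimage:
  assumes c: "c \<in> A" and Z: "Z \<in> null_sets lborel"
  shows "fst c \<inter> snd c -` Z \<in> null_sets area"
proof -
  have bZ: "Z \<in> sets borel" using Z by (simp add: null_sets_def)
  have "emeasure area (fst c \<inter> snd c -` Z) = (\<integral>\<^sup>+z\<in>snd c ` (fst c \<inter> snd c -` Z). ennreal (area_density c z) \<partial>lborel)"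
    using emeasure_area[OF c chart_vimage_borel[OF c bZ]] by (simp add: chart_area_def)
  also have "\<dots> = (\<integral>\<^sup>+z. 0 \<partial>(lborel :: (real^2) measure))"
  proof (rule nn_integral_cong_AE)
    show "AE z in lborel. ennreal (area_density c z) * indicator (snd c ` (fst c \<inter> snd c -` Z)) z = 0"
      using AE_not_in[OF Z] by eventually_elim (auto simp: indicator_def)
  qed
  finally show ?thesis using chart_vimage_borel[OF c bZ] by (simp add: null_sets_def)
qed

text \<open>A null set lies in finitely many charts, in each of which \<open>h\<close> extends to a
  continuously differentiable map.\<close>

lemma image_null_set:
  assumes N: "N \<in> null_sets area"
  shows "hausdorff2_raw (h ` N) = 0"
proof -
  obtain cs where cs: "set cs \<subseteq> A" "(\<Union>c\<in>set cs. fst c) = topspace M" by (rule finite_atlas)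
  have bN: "N \<in> borel_sets" "N \<subseteq> topspace M" using N sets.sets_into_space[of N area] by (auto simp: null_sets_def)
  define S where "S i = (if i < length cs then h ` (N \<inter> fst (cs ! i)) else {})" for i
  have "hausdorff2_raw (S i) = 0" for i
  proof (cases "i < length cs")
    case True
    define c where "c = cs ! i"
    have c: "c \<in> A" using cs(1) True by (auto simp: c_def)
    have "N \<inter> fst c \<in> null_sets area" using N openin_borel_sets[OF chart_facts(1)[OF c]] by (intro null_set_Int2) auto
    then have n: "snd c ` (N \<inter> fst c) \<in> null_sets lborel" by (rule null_set_chart_image[OF c]) simp
    obtain W F where F: "C1_map_on W F (\<lambda>x. frechet_derivative F (at x))" "\<forall>k. C_k_on k F W" "chart_image c \<subseteq> W"
      "\<forall>z\<in>chart_image c. F z = h (chart_inv c z)"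
      "\<forall>z\<in>chart_image c. frechet_derivative F (at z) = dh c (chart_inv c z)"
      by (rule chart_extension[OF c])
    have sub: "snd c ` (N \<inter> fst c) \<subseteq> chart_image c" by (auto simp: chart_image_def)
    have "hausdorff2_raw (F ` snd c ` (N \<inter> fst c)) = 0"
      by (rule hausdorff2_raw_C1_image_null[OF F(1) order_trans[OF sub F(3)] order_refl n])
    moreover have "F ` snd c ` (N \<inter> fst c) = h ` (N \<inter> fst c)"
      unfolding image_image using F(4) c by (intro image_cong) (auto simp: chart_image_def)
    ultimately show ?thesis using True by (simp add: S_def c_def)
  qed (simp add: S_def)
  then have "hausdorff2_raw (\<Union>i. S i) = 0" by (rule hausdorff2_raw_null_UN)
  moreover have "h ` N \<subseteq> (\<Union>i. S i)"
  proof
    fix q assume "q \<in> h ` N"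
    then obtain p where p: "p \<in> N" "q = h p" by blast
    then obtain c where "c \<in> set cs" "p \<in> fst c" using cs(2) bN(2) by blast
    then obtain i where "i < length cs" "p \<in> fst (cs ! i)" by (metis in_set_conv_nth)
    then have "q \<in> S i" using p by (simp add: S_def)
    then show "q \<in> (\<Union>i. S i)" by blast
  qed
  ultimately show ?thesis using hausdorff2_raw_mono by (metis le_zero_eq)
qed

end

section \<open>Rewriting the energy as an integral over the image\<close>

context smooth_map_surface
begin

text \<open>The energy per unit of image area, an upper bound for the curvature integrand.\<close>

definition map_dilation :: "'a \<Rightarrow> real" where
  "map_dilation p = energy_density A g h p / stretch p"

text \<open>On the part \<open>P\<close> of \<open>M\<close>, the map \<open>h\<close> can be used
  as a change of variables: \<open>\<Psi>\<close> is the dilation regarded as a function on the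
  image, extended by 0, with the energy of \<open>P\<close> as its integral; and null sets of the
  image have null preimages in \<open>P\<close>.\<close>

definition dilation_transfer :: "'a set \<Rightarrow> (real^'n \<Rightarrow> ennreal) \<Rightarrow> bool" where
  "dilation_transfer P \<Psi> \<longleftrightarrow> P \<in> borel_sets \<and> h ` P \<in> sets borel \<and> \<Psi> \<in> borel_measurable borel \<and>
     (\<forall>p\<in>P. \<Psi> (h p) = ennreal (map_dilation p)) \<and> (\<forall>q. q \<notin> h ` P \<longrightarrow> \<Psi> q = 0) \<and>
     (\<integral>\<^sup>+q. \<Psi> q \<partial>hausdorff2) = (\<integral>\<^sup>+p\<in>P. ennreal (energy_density A g h p) \<partial>area) \<and>
     (\<forall>Z\<in>null_sets hausdorff2. {p \<in> P. h p \<in> Z} \<in> null_sets area)"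

text \<open>Up to a null set, the coordinate image of \<open>P\<close> is a
  \<open>\<sigma>\<close>-compact set \<open>Q\<close> on which the area formula applies to
  \<open>h\<close> read in the chart. The weight of the Riemannian area and the area factor combine
  to the Jacobian, and dilation times Jacobian is the energy density.\<close>

lemma chart_piece_transfer:
  assumes c: "c \<in> A" and P: "P \<in> borel_sets" "P \<subseteq> fst c" "inj_on h P" "\<And>p. p \<in> P \<Longrightarrow> inj (differential A h p)"
  obtains P' \<Psi> where "P' \<subseteq> P" "P - P' \<in> null_sets area" "dilation_transfer P' \<Psi>"
proof -
  obtain W F where F: "C1_map_on W F (\<lambda>x. frechet_derivative F (at x))" "\<forall>k. C_k_on k F W" "chart_image c \<subseteq> W"
    "\<forall>z\<in>chart_image c. F z = h (chart_inv c z)"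
    "\<forall>z\<in>chart_image c. frechet_derivative F (at z) = dh c (chart_inv c z)"
    by (rule chart_extension[OF c])
  have xP: "snd c ` P \<in> sets borel" by (rule chart_image_borel[OF c P(1,2)])
  obtain Q K where Q: "Q = (\<Union>n::nat. K n)" "\<And>n. compact (K n)" "Q \<subseteq> snd c ` P" "snd c ` P - Q \<in> null_sets lborel"
    using borel_almost_sigma_compact[OF xP] by metis
  define P' where "P' = fst c \<inter> snd c -` Q"
  have bQ: "Q \<in> sets borel" unfolding Q(1) using Q(2) by (auto intro: borel_compact)
  have xPsub: "snd c ` P \<subseteq> chart_image c" using P(2) by (auto simp: chart_image_def)
  have QV: "Q \<subseteq> chart_image c" using Q(3) xPsub by blast
  have QW: "Q \<subseteq> W" using QV F(3) by blast
  have inj_x: "inj_on (snd c) (fst c)" by (rule chart_facts(5)[OF c])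
  have P'P: "P' \<subseteq> P"
  proof
    fix p assume p: "p \<in> P'"
    then obtain p' where "p' \<in> P" "snd c p = snd c p'" using Q(3) by (auto simp: P'_def)
    then show "p \<in> P" using inj_onD[OF inj_x] p P(2) by (metis IntD1 P'_def subsetD)
  qed
  have xP': "snd c ` P' = Q" using QV by (auto simp: P'_def chart_image_def)
  have bP': "P' \<in> borel_sets" unfolding P'_def by (rule chart_vimage_borel[OF c bQ])
  have inv_Q: "chart_inv c z \<in> P'" "F z = h (chart_inv c z)" "frechet_derivative F (at z) = dh c (chart_inv c z)" "snd c (chart_inv c z) = z"
    if "z \<in> Q" for z using that QV F(4,5) c by (auto simp: P'_def)
  have nullP: "P - P' \<in> null_sets area"
  proof (rule null_sets_subset[OF null_set_chart_preimage[OF c Q(4)]])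
    show "P - P' \<in> sets area" using sets.Diff[of P area P'] P(1) bP' by simp
    show "P - P' \<subseteq> fst c \<inter> snd c -` (snd c ` P - Q)" using P(2) by (auto simp: P'_def)
  qed
  have dinj: "inj (dh c p)" if "p \<in> P" for p using P(4)[OF that] differential_inj_chart[OF c] P(2) that by blast
  have injF: "inj_on F Q"
  proof (rule inj_onI)
    fix y z assume "y \<in> Q" "z \<in> Q" "F y = F z"
    then have "chart_inv c y = chart_inv c z" using inv_Q(1,2) P'P inj_onD[OF P(3)] by (metis subsetD)
    then show "y = z" using inv_Q(4) \<open>y \<in> Q\<close> \<open>z \<in> Q\<close> by metis
  qed
  have dinjF: "inj (frechet_derivative F (at z))" if "z \<in> Q" for z
    using inv_Q(1,3)[OF that] dinj P'P by auto
  have FQ: "F ` Q = h ` P'"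
  proof
    show "F ` Q \<subseteq> h ` P'" using inv_Q by auto
    show "h ` P' \<subseteq> F ` Q"
    proof
      fix q assume "q \<in> h ` P'"
      then obtain p where p: "p \<in> P'" "q = h p" by blast
      then have "q = F (snd c p)" using inv_Q(2)[of "snd c p"] c by (simp add: P'_def)
      then show "q \<in> F ` Q" using p(1) by (auto simp: P'_def)
    qed
  qed
  have cF: "continuous_on Q F" using C1_map_onD(5)[OF F(1)] QW continuous_on_subset by blast
  have bFQ: "F ` Q \<in> sets borel" by (rule injective_image_sigma_compact_borel[OF cF injF Q(1,2) bQ order_refl])
  \<comment> \<open>a Borel inverse of \<open>F\<close>, needed to regard functions on
    \<open>M\<close> as functions on the image\<close>
  define G where "G q = (if q \<in> F ` Q then the_inv_into Q F q else 0)" for q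
  have GF: "G (F z) = z" if "z \<in> Q" for z using that the_inv_into_f_f[OF injF] by (simp add: G_def)
  have mG: "G \<in> borel_measurable borel"
  proof (rule measurableI)
    fix B :: "(real^2) set" assume B: "B \<in> sets borel"
    have "F ` (B \<inter> Q) \<in> sets borel" by (rule injective_image_sigma_compact_borel[OF cF injF Q(1,2)]) (use B bQ in auto)
    moreover have "G -` B \<inter> space borel = F ` (B \<inter> Q) \<union> (if 0 \<in> B then - F ` Q else {})"
    proof -
      have "q \<in> G -` B \<longleftrightarrow> q \<in> F ` (B \<inter> Q) \<union> (if 0 \<in> B then - F ` Q else {})" for q
      proof (cases "q \<in> F ` Q")
        case True
        then obtain z where "z \<in> Q" "q = F z" by blast
        then show ?thesis using GF injF by (auto dest: inj_onD)
      qed (auto simp: G_def)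
      then show ?thesis by auto
    qed
    ultimately show "G -` B \<inter> space borel \<in> sets borel" using bFQ by auto
  qed simp
  have st: "0 < stretch p" "0 \<le> energy_density A g h p" if "p \<in> P" for p
    using energy_density_nonneg[OF _ P(4)[OF that]] that P(2) chart_facts(2)[OF c] by blast+
  have cd: "continuous_on Q (\<lambda>z. map_dilation (chart_inv c z))"
    unfolding map_dilation_def
  proof (intro continuous_on_divide continuous_on_subset[OF chart_quantities_continuous(1)[OF c] QV]
      continuous_on_subset[OF chart_quantities_continuous(2)[OF c] QV] ballI)
    fix z assume "z \<in> Q"
    then show "stretch (chart_inv c z) \<noteq> 0" using st(1)[of "chart_inv c z"] inv_Q(1) P'P by fastforce
  qed
  define D where "D z = indicator Q z *\<^sub>R map_dilation (chart_inv c z)" for z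
  have mD: "D \<in> borel_measurable borel" unfolding D_def by (rule borel_measurable_continuous_on_indicator[OF bQ cd])
  define \<Psi> where "\<Psi> q = ennreal (D (G q)) * indicator (F ` Q) q" for q
  have m\<Psi>: "\<Psi> \<in> borel_measurable borel"
    unfolding \<Psi>_def using bFQ measurable_compose[OF mG measurable_compose[OF mD measurable_ennreal]] by simp
  have \<Psi>h: "\<Psi> (h p) = ennreal (map_dilation p)" if p: "p \<in> P'" for p
  proof -
    have z: "snd c p \<in> Q" "p \<in> fst c" using p by (auto simp: P'_def)
    then have "h p = F (snd c p)" using inv_Q(2)[OF z(1)] c by simp
    then show ?thesis using z GF[OF z(1)] c by (auto simp: \<Psi>_def D_def)
  qed
  have pull: "(\<integral>\<^sup>+q. \<phi> q * indicator (F ` Q) q \<partial>hausdorff2) = (\<integral>\<^sup>+z\<in>Q. (\<phi> (F z) * ennreal (area_factor (frechet_derivative F (at z)))) \<partial>lborel)"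
    if "\<phi> \<in> borel_measurable borel" for \<phi>
    by (rule area_formula_integral[OF F(1) injF dinjF Q(1,2) QW that])
  have af: "area_factor (frechet_derivative F (at z)) = stretch (chart_inv c z) * area_density c z" "0 < area_density c z" if "z \<in> Q" for z
  proof -
    have p: "chart_inv c z \<in> fst c" using that QV c by auto
    show 1: "0 < area_density c z" using metric_form_facts(7)[OF c p] inv_Q(4)[OF that] by simp
    show "area_factor (frechet_derivative F (at z)) = stretch (chart_inv c z) * area_density c z"
      using stretch_chart[OF c p] inv_Q(3,4)[OF that] 1 by simp
  qed
  have int: "(\<integral>\<^sup>+q. \<Psi> q \<partial>hausdorff2) = (\<integral>\<^sup>+p\<in>P'. ennreal (energy_density A g h p) \<partial>area)"
  proof -
    have "(\<integral>\<^sup>+q. \<Psi> q \<partial>hausdorff2) = (\<integral>\<^sup>+q. \<Psi> q * indicator (F ` Q) q \<partial>hausdorff2)"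
      by (intro nn_integral_cong) (auto simp: \<Psi>_def indicator_def)
    also have "\<dots> = (\<integral>\<^sup>+z\<in>Q. (\<Psi> (F z) * ennreal (area_factor (frechet_derivative F (at z)))) \<partial>lborel)" by (rule pull[OF m\<Psi>])
    also have "\<dots> = (\<integral>\<^sup>+z\<in>chart_image c. (ennreal (indicator Q z *\<^sub>R energy_density A g h (chart_inv c z)) * ennreal (area_density c z)) \<partial>lborel)"
    proof (rule nn_integral_cong)
      fix z
      show "\<Psi> (F z) * ennreal (area_factor (frechet_derivative F (at z))) * indicator Q z
        = ennreal (indicator Q z *\<^sub>R energy_density A g h (chart_inv c z)) * ennreal (area_density c z) * indicator (chart_image c) z"
      proof (cases "z \<in> Q")
        case True
        have p: "chart_inv c z \<in> P'" by (rule inv_Q(1)[OF True])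
        have s: "0 < stretch (chart_inv c z)" "0 \<le> energy_density A g h (chart_inv c z)" using st p P'P by auto
        have "\<Psi> (F z) = ennreal (map_dilation (chart_inv c z))" using \<Psi>h[OF p] inv_Q(2)[OF True] by simp
        then have "\<Psi> (F z) * ennreal (area_factor (frechet_derivative F (at z))) = ennreal (map_dilation (chart_inv c z)) * ennreal (stretch (chart_inv c z) * area_density c z)"
          using af(1)[OF True] by simp
        also have "\<dots> = ennreal (map_dilation (chart_inv c z) * (stretch (chart_inv c z) * area_density c z))"
          using s by (intro ennreal_mult'[symmetric]) (simp add: map_dilation_def)
        also have "map_dilation (chart_inv c z) * (stretch (chart_inv c z) * area_density c z) = energy_density A g h (chart_inv c z) * area_density c z"
          using s(1) by (simp add: map_dilation_def)
        also have "ennreal (energy_density A g h (chart_inv c z) * area_density c z) = ennreal (energy_density A g h (chart_inv c z)) * ennreal (area_density c z)"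
          using s(2) by (rule ennreal_mult')
        finally show ?thesis using True QV by auto
      qed simp
    qed
    also have "\<dots> = (\<integral>\<^sup>+p\<in>fst c. ennreal (indicator Q (snd c p) *\<^sub>R energy_density A g h (chart_inv c (snd c p))) \<partial>area)"
      by (rule nn_integral_chart[OF c, symmetric])
         (intro measurable_compose[OF _ measurable_ennreal] borel_measurable_continuous_on_indicator[OF bQ continuous_on_subset[OF chart_quantities_continuous(1)[OF c] QV]])
    also have "\<dots> = (\<integral>\<^sup>+p\<in>P'. ennreal (energy_density A g h p) \<partial>area)"
      by (intro nn_integral_cong) (use c in \<open>auto simp: P'_def indicator_def\<close>)
    finally show ?thesis .
  qed
  have nullpull: "{p \<in> P'. h p \<in> Z} \<in> null_sets area" if Z: "Z \<in> null_sets hausdorff2" for Z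
  proof -
    have bZ: "Z \<in> sets borel" using Z by (auto simp: null_sets_def)
    have "(\<integral>\<^sup>+z\<in>Q. (indicator Z (F z) * ennreal (area_factor (frechet_derivative F (at z)))) \<partial>lborel) = (\<integral>\<^sup>+q. indicator Z q * indicator (F ` Q) q \<partial>hausdorff2)"
      by (rule pull[symmetric]) (use bZ in simp)
    also have "\<dots> = (\<integral>\<^sup>+q. 0 \<partial>(hausdorff2 :: (real^'n) measure))"
    proof (rule nn_integral_cong_AE)
      show "AE q in hausdorff2. indicator Z q * indicator (F ` Q) q = (0::ennreal)"
        using AE_not_in[OF Z] by eventually_elim simp
    qed
    finally have 0: "(\<integral>\<^sup>+z\<in>Q. (indicator Z (F z) * ennreal (area_factor (frechet_derivative F (at z)))) \<partial>lborel) = 0" by simp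
    define E where "E = Q \<inter> F -` Z"
    have eqE: "E = (\<lambda>z. indicator Q z *\<^sub>R F z) -` Z \<inter> Q" by (auto simp: E_def)
    have "(\<lambda>z. indicator Q z *\<^sub>R F z) -` Z \<inter> space borel \<in> sets borel"
      by (rule measurable_sets[OF borel_measurable_continuous_on_indicator[OF bQ cF] bZ])
    then have bE: "E \<in> sets borel" unfolding eqE using bQ by auto
    have EQ: "E \<subseteq> Q" by (auto simp: E_def)
    have "(\<integral>\<^sup>+z\<in>E. ennreal (area_factor (frechet_derivative F (at z))) \<partial>lborel) = (\<integral>\<^sup>+z\<in>Q. (indicator Z (F z) * ennreal (area_factor (frechet_derivative F (at z)))) \<partial>lborel)"
      by (intro nn_integral_cong) (auto simp: E_def indicator_def)
    then have "(\<integral>\<^sup>+z\<in>E. ennreal (area_factor (frechet_derivative F (at z))) \<partial>lborel) = 0" using 0 by simp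
    then have "AE z in lborel. ennreal (area_factor (frechet_derivative F (at z))) * indicator E z = 0"
      using nn_integral_0_iff_AE[OF area_factor_indicator_measurable[OF F(1) bE order_trans[OF EQ QW]]] by simp
    then have "AE z in lborel. z \<notin> E"
    proof eventually_elim
      case (elim z)
      show ?case
      proof
        assume z: "z \<in> E"
        then have zQ: "z \<in> Q" using EQ by blast
        have "linear (frechet_derivative F (at z))" using C1_map_onD(3)[OF F(1)] zQ QW by blast
        then have "0 < area_factor (frechet_derivative F (at z))" using area_factor_pos dinjF[OF zQ] by blast
        then show False using elim z by simp
      qed
    qed
    then have "E \<in> null_sets lborel" using bE AE_iff_null_sets by (metis sets_lborel)
    then have "fst c \<inter> snd c -` E \<in> null_sets area" by (rule null_set_chart_preimage[OF c])
    moreover have "fst c \<inter> snd c -` E = {p \<in> P'. h p \<in> Z}"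
      using inv_Q(2) c by (auto simp: E_def P'_def)
    ultimately show ?thesis by simp
  qed
  have \<Psi>0: "\<Psi> q = 0" if "q \<notin> h ` P'" for q using that by (simp add: \<Psi>_def FQ)
  have "dilation_transfer P' \<Psi>"
    unfolding dilation_transfer_def
    using bP' bFQ[unfolded FQ] m\<Psi> \<Psi>h \<Psi>0 int nullpull by blast
  then show ?thesis using that P'P nullP by blast
qed

lemma dilation_transfer_union:
  assumes 1: "dilation_transfer P1 \<Psi>1" and 2: "dilation_transfer P2 \<Psi>2" and dis: "h ` P1 \<inter> h ` P2 = {}"
  shows "dilation_transfer (P1 \<union> P2) (\<lambda>q. \<Psi>1 q + \<Psi>2 q)"
proof -
  note d1 = 1[unfolded dilation_transfer_def] and d2 = 2[unfolded dilation_transfer_def]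
  have [measurable]: "\<Psi>1 \<in> borel_measurable borel" "\<Psi>2 \<in> borel_measurable borel" using d1 d2 by auto
  have b: "P1 \<in> sets area" "P2 \<in> sets area" using d1 d2 by auto
  have P12: "P1 \<inter> P2 = {}" using dis by blast
  have [measurable]: "energy_density A g h \<in> borel_measurable area"
    by (rule chart_continuous_fun_measurable[OF chart_continuous_quantities(1)])
  have "(\<integral>\<^sup>+q. \<Psi>1 q + \<Psi>2 q \<partial>hausdorff2) = (\<integral>\<^sup>+q. \<Psi>1 q \<partial>hausdorff2) + (\<integral>\<^sup>+q. \<Psi>2 q \<partial>hausdorff2)"
    by (rule nn_integral_add) auto
  also have "\<dots> = (\<integral>\<^sup>+p\<in>P1. ennreal (energy_density A g h p) \<partial>area) + (\<integral>\<^sup>+p\<in>P2. ennreal (energy_density A g h p) \<partial>area)"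
    using d1 d2 by simp
  also have "\<dots> = (\<integral>\<^sup>+p. ennreal (energy_density A g h p) * indicator P1 p + ennreal (energy_density A g h p) * indicator P2 p \<partial>area)"
    by (rule nn_integral_add[symmetric]) (use b in measurable)
  also have "\<dots> = (\<integral>\<^sup>+p\<in>P1 \<union> P2. ennreal (energy_density A g h p) \<partial>area)"
    by (intro nn_integral_cong) (use P12 in \<open>auto simp: indicator_def\<close>)
  finally have int: "(\<integral>\<^sup>+q. \<Psi>1 q + \<Psi>2 q \<partial>hausdorff2) = (\<integral>\<^sup>+p\<in>P1 \<union> P2. ennreal (energy_density A g h p) \<partial>area)" .
  have null: "{p \<in> P1 \<union> P2. h p \<in> Z} \<in> null_sets area" if "Z \<in> null_sets hausdorff2" for Z
  proof -
    have "{p \<in> P1. h p \<in> Z} \<union> {p \<in> P2. h p \<in> Z} \<in> null_sets area" using d1 d2 that by (intro null_sets.Un) auto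
    moreover have "{p \<in> P1 \<union> P2. h p \<in> Z} = {p \<in> P1. h p \<in> Z} \<union> {p \<in> P2. h p \<in> Z}" by blast
    ultimately show ?thesis by simp
  qed
  have bU: "P1 \<union> P2 \<in> borel_sets" using sets.Un[OF b] by simp
  have bI: "h ` (P1 \<union> P2) \<in> sets borel" unfolding image_Un using d1 d2 by (intro sets.Un) auto
  have m: "(\<lambda>q. \<Psi>1 q + \<Psi>2 q) \<in> borel_measurable borel" by measurable
  have v1: "\<Psi>1 (h p) + \<Psi>2 (h p) = ennreal (map_dilation p)" if "p \<in> P1 \<union> P2" for p
  proof (cases "p \<in> P1")
    case True
    then have "h p \<notin> h ` P2" using dis by blast
    then show ?thesis using d1 d2 True by simp
  next
    case False
    then have p: "p \<in> P2" using that by blast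
    then have "h p \<notin> h ` P1" using dis by blast
    then show ?thesis using d1 d2 p by simp
  qed
  have v2: "\<Psi>1 q + \<Psi>2 q = 0" if "q \<notin> h ` (P1 \<union> P2)" for q
    using d1 d2 that by (simp add: image_Un)
  show ?thesis unfolding dilation_transfer_def using bU bI m v1 v2 int null by blast
qed

lemma dilation_transfer_empty: "dilation_transfer {} (\<lambda>_. 0)"
proof -
  have "{} \<in> borel_sets" using sets.empty_sets[of area] by simp
  then show ?thesis by (simp add: dilation_transfer_def)
qed

text \<open>Induction over the pieces of a finite atlas. Injectivity off \<open>N\<close> makes the
  images of different pieces disjoint, so the functions \<open>\<Psi>\<close> can be added.\<close>

theorem dilation_transfer_exists:
  assumes N: "N \<in> null_sets area" "inj_on h (topspace M - N)" "\<And>p. p \<in> topspace M - N \<Longrightarrow> inj (differential A h p)"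
  obtains P \<Psi> where "P \<subseteq> topspace M - N" "topspace M - P \<in> null_sets area" "dilation_transfer P \<Psi>"
proof -
  obtain cs where cs: "set cs \<subseteq> A" "(\<Union>c\<in>set cs. fst c) = topspace M" by (rule finite_atlas)
  note pc = piece_facts[OF cs]
  have "\<exists>P \<Psi>. P \<subseteq> (\<Union>i<m. piece cs i) - N \<and> (\<Union>i<m. piece cs i) - P \<in> null_sets area \<and> dilation_transfer P \<Psi>"
    if "m \<le> length cs" for m
    using that
  proof (induction m)
    case 0
    show ?case by (intro exI[of _ "{}"] exI[of _ "\<lambda>_. 0"]) (simp add: dilation_transfer_empty)
  next
    case (Suc m)
    then obtain P \<Psi> where IH: "P \<subseteq> (\<Union>i<m. piece cs i) - N" "(\<Union>i<m. piece cs i) - P \<in> null_sets area" "dilation_transfer P \<Psi>"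
      by auto
    have m: "m < length cs" using Suc.prems by simp
    have c: "cs ! m \<in> A" using cs(1) m by auto
    have sub: "piece cs i \<subseteq> topspace M" if "i < length cs" for i using pc(4) that by blast
    have R: "piece cs m - N \<in> borel_sets" using sets.Diff[of "piece cs m" area N] pc(1)[OF m] N(1) by (simp add: null_sets_def)
    have "piece cs m - N \<subseteq> fst (cs ! m)" using pc(2)[of m] by blast
    moreover have "inj_on h (piece cs m - N)" by (rule inj_on_subset[OF N(2)]) (use sub[OF m] in blast)
    moreover have "\<And>p. p \<in> piece cs m - N \<Longrightarrow> inj (differential A h p)" using N(3) sub[OF m] by blast
    ultimately obtain P' \<Psi>' where P': "P' \<subseteq> piece cs m - N" "(piece cs m - N) - P' \<in> null_sets area" "dilation_transfer P' \<Psi>'"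
      using chart_piece_transfer[OF c R] by blast
    have dis: "h ` P \<inter> h ` P' = {}"
    proof -
      have "P \<inter> P' = {}"
      proof -
        have "piece cs i \<inter> piece cs m = {}" if "i < m" for i using pc(3) that by (auto simp: disjoint_family_on_def)
        then show ?thesis using IH(1) P'(1) by blast
      qed
      moreover have "(\<Union>i<m. piece cs i) \<subseteq> topspace M" using sub m less_trans by blast
      then have "P \<subseteq> topspace M - N" "P' \<subseteq> topspace M - N" using IH(1) P'(1) sub[OF m] by blast+
      ultimately show ?thesis using inj_on_image_Int[OF N(2), of P P'] by simp
    qed
    have null: "(\<Union>i<Suc m. piece cs i) - (P \<union> P') \<in> null_sets area"
    proof (rule null_sets_subset)
      show "((\<Union>i<m. piece cs i) - P) \<union> ((piece cs m - N) - P') \<union> N \<in> null_sets area"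
        using IH(2) P'(2) N(1) by (intro null_sets.Un)
      have "(\<Union>i<Suc m. piece cs i) \<in> sets area" using pc(1) Suc.prems by (intro sets.finite_UN) auto
      moreover have "P \<union> P' \<in> sets area" using IH(3) P'(3) by (intro sets.Un) (auto simp: dilation_transfer_def)
      ultimately show "(\<Union>i<Suc m. piece cs i) - (P \<union> P') \<in> sets area" by (rule sets.Diff)
      show "(\<Union>i<Suc m. piece cs i) - (P \<union> P') \<subseteq> ((\<Union>i<m. piece cs i) - P) \<union> ((piece cs m - N) - P') \<union> N"
        by (auto simp: lessThan_Suc)
    qed
    have "P \<union> P' \<subseteq> (\<Union>i<Suc m. piece cs i) - N" using IH(1) P'(1) by (auto simp: lessThan_Suc)
    then show ?case using null dilation_transfer_union[OF IH(3) P'(3) dis] by blast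
  qed
  from this[of "length cs"] show ?thesis using that unfolding pc(4) by auto
qed

end

text \<open>The integral of a function \<open>f\<close>, measurable or not, is a supremum over the
  simple functions below it. The supremum \<open>m\<close> of a maximising sequence of such
  functions is measurable, lies below \<open>f\<close> and hence below \<open>\<Psi>\<close>, and
  has the same integral as \<open>\<Psi>\<close>. Therefore \<open>m = \<Psi>\<close> almost
  everywhere, and \<open>f\<close> lies in between.\<close>

lemma AE_eq_if_nn_integral_eq:
  fixes f \<Psi> :: "'a \<Rightarrow> ennreal"
  assumes \<Psi>: "\<Psi> \<in> borel_measurable M" and le: "AE x in M. f x \<le> \<Psi> x"
    and eq: "(\<integral>\<^sup>+x. f x \<partial>M) = (\<integral>\<^sup>+x. \<Psi> x \<partial>M)" and fin: "(\<integral>\<^sup>+x. \<Psi> x \<partial>M) < \<infinity>"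
  shows "AE x in M. f x = \<Psi> x"
proof -
  have "\<exists>s. simple_function M s \<and> s \<le> f \<and> (\<integral>\<^sup>+x. \<Psi> x \<partial>M) \<le> integral\<^sup>S M s + ennreal (1 / real (Suc n))" for n
  proof (cases "(\<integral>\<^sup>+x. \<Psi> x \<partial>M) = 0")
    case True
    then show ?thesis by (intro exI[of _ "\<lambda>_. 0"]) (auto simp: le_fun_def)
  next
    case False
    let ?I = "\<integral>\<^sup>+x. \<Psi> x \<partial>M"
    have "?I - ennreal (1 / real (Suc n)) < ?I" using False fin by (intro ennreal_between) (auto simp: less_top zero_less_iff_neq_zero)
    then have "?I - ennreal (1 / real (Suc n)) < (SUP s\<in>{s. simple_function M s \<and> s \<le> f}. integral\<^sup>S M s)"
      using eq unfolding nn_integral_def by simp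
    then obtain s where s: "simple_function M s" "s \<le> f" "?I - ennreal (1 / real (Suc n)) < integral\<^sup>S M s"
      unfolding less_SUP_iff by auto
    then have "?I \<le> integral\<^sup>S M s + ennreal (1 / real (Suc n))"
    proof (cases "ennreal (1 / real (Suc n)) \<le> ?I")
      case True
      then have "?I = ?I - ennreal (1 / real (Suc n)) + ennreal (1 / real (Suc n))" using diff_add_cancel_ennreal by simp
      also have "\<dots> \<le> integral\<^sup>S M s + ennreal (1 / real (Suc n))" using s(3) by (intro add_right_mono less_imp_le)
      finally show ?thesis .
    next
      case False
      then show ?thesis by (meson add_increasing linear zero_le)
    qed
    then show ?thesis using s by blast
  qed
  then obtain s where s: "\<And>n. simple_function M (s n)" "\<And>n. s n \<le> f"
    "\<And>n. (\<integral>\<^sup>+x. \<Psi> x \<partial>M) \<le> integral\<^sup>S M (s n) + ennreal (1 / real (Suc n))" by metis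
  have sm [measurable]: "s n \<in> borel_measurable M" for n by (rule borel_measurable_simple_function[OF s(1)])
  define m where "m x = (SUP n. s n x)" for x
  have m [measurable]: "m \<in> borel_measurable M" unfolding m_def by measurable
  note [measurable] = \<Psi>
  have mf: "m x \<le> f x" for x unfolding m_def using s(2) by (intro SUP_least) (auto simp: le_fun_def)
  have m\<Psi>: "AE x in M. m x \<le> \<Psi> x" using le by eventually_elim (use mf order_trans in blast)
  have "(\<integral>\<^sup>+x. \<Psi> x \<partial>M) \<le> (\<integral>\<^sup>+x. m x \<partial>M) + ennreal (1 / real (Suc n))" for n
  proof -
    have "integral\<^sup>S M (s n) = (\<integral>\<^sup>+x. s n x \<partial>M)" by (rule nn_integral_eq_simple_integral[OF s(1), symmetric])
    also have "\<dots> \<le> (\<integral>\<^sup>+x. m x \<partial>M)" unfolding m_def by (intro nn_integral_mono SUP_upper) simp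
    finally show ?thesis using s(3)[of n] by (meson add_right_mono order_trans)
  qed
  moreover have "(\<lambda>n. (\<integral>\<^sup>+x. m x \<partial>M) + ennreal (1 / real (Suc n))) \<longlonglongrightarrow> (\<integral>\<^sup>+x. m x \<partial>M) + ennreal 0"
    by (intro tendsto_add tendsto_const tendsto_ennrealI LIMSEQ_Suc lim_1_over_n)
  ultimately have ge: "(\<integral>\<^sup>+x. \<Psi> x \<partial>M) \<le> (\<integral>\<^sup>+x. m x \<partial>M)"
    using LIMSEQ_le_const[of _ "(\<integral>\<^sup>+x. m x \<partial>M) + ennreal 0" "\<integral>\<^sup>+x. \<Psi> x \<partial>M"] by auto
  moreover have "(\<integral>\<^sup>+x. m x \<partial>M) \<le> (\<integral>\<^sup>+x. \<Psi> x \<partial>M)" by (rule nn_integral_mono_AE[OF m\<Psi>])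
  ultimately have ieq: "(\<integral>\<^sup>+x. m x \<partial>M) = (\<integral>\<^sup>+x. \<Psi> x \<partial>M)" by (rule antisym[rotated])
  have "(\<integral>\<^sup>+x. \<Psi> x - m x \<partial>M) = (\<integral>\<^sup>+x. \<Psi> x \<partial>M) - (\<integral>\<^sup>+x. m x \<partial>M)"
    by (rule nn_integral_diff) (use ieq fin m\<Psi> in auto)
  also have "\<dots> = 0" using ieq fin by simp
  finally have "AE x in M. \<Psi> x - m x = 0" by (subst (asm) nn_integral_0_iff_AE) auto
  then show ?thesis using le
  proof eventually_elim
    case (elim x)
    then have "\<Psi> x \<le> m x" by (simp add: diff_eq_0_iff_ennreal)
    then show ?case using elim(2) mf[of x] by (meson antisym order_trans)
  qed
qed

section \<open>Harmonic maps\<close>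

lemma C_k_on_componentwise:
  fixes F :: "'a::euclidean_space \<Rightarrow> real^'n"
  assumes "open W" "\<And>i. C_k_on k (\<lambda>x. F x $ i) W"
  shows "C_k_on k F W"
  using assms(2)
proof (induction k arbitrary: F)
  case 0
  then have "continuous_on W (\<lambda>x. \<chi> i. F x $ i)" by (intro continuous_on_vec_lambda) simp
  then show ?case by simp
next
  case (Suc k)
  have d: "(F has_derivative (\<lambda>v. \<chi> i. frechet_derivative (\<lambda>x. F x $ i) (at x) v)) (at x)" if x: "x \<in> W" for x
  proof -
    have "((\<lambda>x. F x \<bullet> b) has_derivative (\<lambda>v. (\<chi> i. frechet_derivative (\<lambda>x. F x $ i) (at x) v) \<bullet> b)) (at x within UNIV)"
      if bB: "b \<in> Basis" for b :: "real^'n"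
    proof -
      obtain i where b: "b = axis i 1" using bB by (auto simp: Basis_vec_def)
      show ?thesis using C_k_on_SucD(1)[OF Suc.prems x, of i] by (simp add: b inner_axis)
    qed
    then show ?thesis by (subst has_derivative_componentwise_within) simp
  qed
  have "F differentiable (at x)" if "x \<in> W" for x using d[OF that] by (rule differentiableI)
  moreover have "C_k_on k (\<lambda>x. frechet_derivative F (at x) b) W" if b: "b \<in> Basis" for b
  proof (rule C_k_on_transform[OF assms(1) order_refl, of k "\<lambda>x. \<chi> i. frechet_derivative (\<lambda>x. F x $ i) (at x) b"])
    show "C_k_on k (\<lambda>x. \<chi> i. frechet_derivative (\<lambda>x. F x $ i) (at x) b) W"
      by (rule Suc.IH) (use Suc.prems b in simp)
    show "(\<chi> i. frechet_derivative (\<lambda>x. F x $ i) (at x) b) = frechet_derivative F (at x) b" if "x \<in> W" for x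
      using frechet_derivative_at[OF d[OF that]] by metis
  qed
  ultimately show ?case by simp
qed

lemma smooth_on_componentwise:
  fixes f :: "'a::euclidean_space \<Rightarrow> real^'n"
  assumes "\<And>i. smooth_on V (\<lambda>x. f x $ i)"
  shows "smooth_on V f"
proof -
  have "\<forall>i. \<exists>W F. open W \<and> V \<subseteq> W \<and> (\<forall>k. C_k_on k F W) \<and> (\<forall>x\<in>V. F x = f x $ i)"
    using assms unfolding smooth_on_def by blast
  then obtain W F where W: "\<And>i. open (W i)" "\<And>i. V \<subseteq> W i" "\<And>i k. C_k_on k (F i) (W i)" "\<And>i x. x \<in> V \<Longrightarrow> F i x = f x $ i"
    by metis
  define U where "U = (\<Inter>i. W i)"
  define G where "G x = (\<chi> i. F i x)" for x
  have U: "open U" "V \<subseteq> U" using W(1,2) unfolding U_def by (auto intro: open_INT)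
  have "C_k_on k G U" for k
  proof (rule C_k_on_componentwise[OF U(1)])
    fix i
    show "C_k_on k (\<lambda>x. G x $ i) U"
      by (rule C_k_on_transform[OF U(1) _ W(3)[of k i]]) (auto simp: U_def G_def)
  qed
  moreover have "G x = f x" if "x \<in> V" for x using W(4)[OF that] by (simp add: G_def vec_eq_iff)
  ultimately show ?thesis unfolding smooth_on_def using U by blast
qed

lemma has_derivative_vec_nth_matrix:
  fixes G :: "'a::real_normed_vector \<Rightarrow> real^'n^'m"
  assumes "(G has_derivative G') (at x)"
  shows "((\<lambda>y. G y $ i $ j) has_derivative (\<lambda>v. G' v $ i $ j)) (at x)"
  by (intro bounded_linear.has_derivative[OF bounded_linear_vec_nth] assms)

text \<open>The coefficients of the Laplace-Beltrami operator. The entries of the inverse matrix are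
  taken from the cofactor formula near \<open>z\<close>.\<close>

lemma weighted_inverse_differentiable:
  fixes G :: "real^2 \<Rightarrow> real^2^2"
  assumes O: "open O'" "z \<in> O'" and G: "G differentiable (at z)" "\<And>y. y \<in> O' \<Longrightarrow> 0 < det (G y)"
  shows "(\<lambda>y. sqrt (det (G y)) * matrix_inv (G y) $ i $ j) differentiable (at z)"
proof -
  obtain G' where G': "(G has_derivative G') (at z)" using G(1) by (auto simp: differentiable_def)
  have e: "(\<lambda>y. G y $ k $ l) differentiable (at z)" for k l
    by (rule differentiableI[OF has_derivative_vec_nth_matrix[OF G']])
  have d: "(\<lambda>y. det (G y)) differentiable (at z)" unfolding det_2
    by (intro differentiable_diff differentiable_mult e)
  then obtain d' where "((\<lambda>y. det (G y)) has_derivative d') (at z)" by (auto simp: differentiable_def)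
  from has_derivative_real_sqrt[OF _ this] have s: "(\<lambda>y. sqrt (det (G y))) differentiable (at z)"
    using G(2)[OF O(2)] by (auto simp: differentiable_def)
  have "\<exists>c. c differentiable (at z) \<and> (\<forall>y\<in>O'. c y / det (G y) = matrix_inv (G y) $ i $ j)"
  proof -
    have nz: "det (G y) \<noteq> 0" if "y \<in> O'" for y using G(2)[OF that] by simp
    have neg: "(\<lambda>y. - G y $ k $ l) differentiable (at z)" for k l by (intro differentiable_minus e)
    consider "i = 1 \<and> j = 1" | "i = 1 \<and> j = 2" | "i = 2 \<and> j = 1" | "i = 2 \<and> j = 2" using exhaust_2 by metis
    then show ?thesis
    proof cases
      case 1 then show ?thesis using e[of 2 2] matrix_inv_2(1)[OF nz] by (intro exI[of _ "\<lambda>y. G y $ 2 $ 2"]) simp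
    next
      case 2 then show ?thesis using neg[of 1 2] matrix_inv_2(2)[OF nz] by (intro exI[of _ "\<lambda>y. - G y $ 1 $ 2"]) simp
    next
      case 3 then show ?thesis using neg[of 2 1] matrix_inv_2(3)[OF nz] by (intro exI[of _ "\<lambda>y. - G y $ 2 $ 1"]) simp
    next
      case 4 then show ?thesis using e[of 1 1] matrix_inv_2(4)[OF nz] by (intro exI[of _ "\<lambda>y. G y $ 1 $ 1"]) simp
    qed
  qed
  then obtain c where c: "c differentiable (at z)" "\<And>y. y \<in> O' \<Longrightarrow> c y / det (G y) = matrix_inv (G y) $ i $ j" by blast
  have "(\<lambda>y. sqrt (det (G y)) * (c y / det (G y))) differentiable (at z)"
    using G(2)[OF O(2)] by (intro differentiable_mult differentiable_divide s c d) auto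
  then obtain D where "((\<lambda>y. sqrt (det (G y)) * (c y / det (G y))) has_derivative D) (at z)" by (auto simp: differentiable_def)
  then have "((\<lambda>y. sqrt (det (G y)) * matrix_inv (G y) $ i $ j) has_derivative D) (at z)"
    by (rule has_derivative_transform_within_open[OF _ O]) (simp add: c(2))
  then show ?thesis by (rule differentiableI)
qed

text \<open>Expanding the divergence by the product rule splits the operator into the trace of the
  second derivative and a first order part, which is the derivative of \<open>F\<close> along a
  vector \<open>w\<close>. The same \<open>w\<close> serves all components of \<open>F\<close>; this
  makes the trace tangent to the image.\<close>

lemma laplace_beltrami_second_order:
  fixes F :: "real^2 \<Rightarrow> real^'n" and G :: "real^2 \<Rightarrow> real^2^2"
  assumes O: "open O'" "z \<in> O'" and F: "C_k_on (Suc (Suc k)) F O'" and G: "G differentiable (at z)" "\<And>y. y \<in> O' \<Longrightarrow> 0 < det (G y)"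
    and sym: "transpose (G z) = G z"
    and harm: "\<And>i. laplace_beltrami G (\<lambda>y. F y $ i) z = 0"
  shows "\<exists>w. form_trace (\<lambda>a b. a \<bullet> (G z *v b)) (second_derivative F z) = frechet_derivative F (at z) w"
proof -
  define L where "L = frechet_derivative F (at z)"
  define S where "S = second_derivative F z"
  have linL: "linear L" unfolding L_def by (rule C_k_on_SucD(2)[OF F O(2)])
  define a where "a i j y = sqrt (det (G y)) * matrix_inv (G y) $ i $ j" for i j y
  have "\<exists>D. (a i j has_derivative D) (at z)" for i j
    using weighted_inverse_differentiable[OF O G, of i j] unfolding a_def[abs_def] differentiable_def by blast
  then obtain a' where a': "\<And>i j. (a i j has_derivative a' i j) (at z)" by metis
  \<comment> \<open>minus the derivative of the coefficient matrix, contracted: the first order part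
    of the operator\<close>
  define w where "w = (\<chi> j. - (\<Sum>i\<in>UNIV. a' i j (axis i 1)))"
  have comp: "frechet_derivative (\<lambda>y. F y $ m) (at y) v = frechet_derivative F (at y) v $ m" if "y \<in> O'" for y v m
    using frechet_derivative_at[OF bounded_linear.has_derivative[OF bounded_linear_vec_nth C_k_on_SucD(1)[OF F that]], of m] by metis
  have main: "(\<Sum>i\<in>UNIV. \<Sum>j\<in>UNIV. a' i j (axis i 1) * L (axis j 1) $ m + a i j z * S (axis j 1) (axis i 1) $ m) = 0" for m
  proof -
    have dF: "((\<lambda>y. frechet_derivative F (at y) (axis j 1) $ m) has_derivative (\<lambda>v. S (axis j 1) v $ m)) (at z)" for j
      unfolding S_def by (intro bounded_linear.has_derivative[OF bounded_linear_vec_nth] second_derivative_works[OF O(1) F O(2)])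
    have D: "((\<lambda>y. sqrt (det (G y)) * (\<Sum>j\<in>UNIV. matrix_inv (G y) $ i $ j * frechet_derivative (\<lambda>y. F y $ m) (at y) (axis j 1)))
       has_derivative (\<lambda>v. \<Sum>j\<in>UNIV. a i j z * S (axis j 1) v $ m + a' i j v * L (axis j 1) $ m)) (at z)" for i
    proof (rule has_derivative_transform_within_open[OF _ O])
      show "((\<lambda>y. \<Sum>j\<in>UNIV. a i j y * frechet_derivative F (at y) (axis j 1) $ m)
         has_derivative (\<lambda>v. \<Sum>j\<in>UNIV. a i j z * S (axis j 1) v $ m + a' i j v * L (axis j 1) $ m)) (at z)"
        unfolding L_def by (intro has_derivative_sum has_derivative_mult a' dF)
      show "(\<Sum>j\<in>UNIV. a i j y * frechet_derivative F (at y) (axis j 1) $ m) =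
        sqrt (det (G y)) * (\<Sum>j\<in>UNIV. matrix_inv (G y) $ i $ j * frechet_derivative (\<lambda>y. F y $ m) (at y) (axis j 1))"
        if "y \<in> O'" for y
        unfolding comp[OF that] a_def by (simp add: sum_distrib_left mult.assoc)
    qed
    have "laplace_beltrami G (\<lambda>y. F y $ m) z = 1 / sqrt (det (G z)) *
      (\<Sum>i\<in>UNIV. \<Sum>j\<in>UNIV. a i j z * S (axis j 1) (axis i 1) $ m + a' i j (axis i 1) * L (axis j 1) $ m)"
      unfolding laplace_beltrami_def frechet_derivative_at[OF D, symmetric] ..
    then show ?thesis using harm[of m] G(2)[OF O(2)] by (simp add: add.commute)
  qed
  have det: "0 < det (G z)" by (rule G(2)[OF O(2)])
  have "(\<Sum>i\<in>UNIV. \<Sum>j\<in>UNIV. a i j z *\<^sub>R S (axis i 1) (axis j 1)) = L w"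
  proof (rule vec_eq_iff[THEN iffD2], rule allI)
    fix m
    have Lw: "L w = (\<Sum>j\<in>UNIV. w $ j *\<^sub>R L (axis j 1))"
      unfolding sum_2 by (rule linear_axis_2[OF linL])
    have "(\<Sum>i\<in>UNIV. \<Sum>j\<in>UNIV. a i j z * S (axis j 1) (axis i 1) $ m) = - (\<Sum>i\<in>UNIV. \<Sum>j\<in>UNIV. a' i j (axis i 1) * L (axis j 1) $ m)"
      using main[of m] by (simp add: sum.distrib)
    also have "\<dots> = L w $ m" unfolding Lw by (simp add: w_def sum_2 algebra_simps)
    also have "(\<Sum>i\<in>UNIV. \<Sum>j\<in>UNIV. a i j z * S (axis j 1) (axis i 1) $ m) = (\<Sum>i\<in>UNIV. \<Sum>j\<in>UNIV. a i j z *\<^sub>R S (axis i 1) (axis j 1)) $ m"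
    proof -
      have "a i j z * S (axis j 1) (axis i 1) $ m = (a i j z *\<^sub>R S (axis i 1) (axis j 1)) $ m" for i j
        using second_derivative_symmetric[OF O(1) F O(2), of "axis j 1" "axis i 1"] by (simp add: S_def)
      then show ?thesis by (simp only: sum_component)
    qed
    finally show "(\<Sum>i\<in>UNIV. \<Sum>j\<in>UNIV. a i j z *\<^sub>R S (axis i 1) (axis j 1)) $ m = L w $ m" .
  qed
  moreover have "(\<Sum>i\<in>UNIV. \<Sum>j\<in>UNIV. a i j z *\<^sub>R S (axis i 1) (axis j 1)) =
    sqrt (det (G z)) *\<^sub>R ((1 / det (G z)) *\<^sub>R form_trace (\<lambda>a b. a \<bullet> (G z *v b)) S)"
    unfolding matrix_inv_form_trace[OF sym less_imp_neq[OF det, symmetric], symmetric]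
    by (simp add: a_def scaleR_sum_right)
  ultimately have eq: "(sqrt (det (G z)) / det (G z)) *\<^sub>R form_trace (\<lambda>a b. a \<bullet> (G z *v b)) S = L w" by simp
  have one: "sqrt (det (G z)) * (sqrt (det (G z)) / det (G z)) = 1"
  proof -
    have "sqrt (det (G z)) * sqrt (det (G z)) = det (G z)" using det by simp
    then have "sqrt (det (G z)) * sqrt (det (G z)) / det (G z) = 1" using det by (simp only:) simp
    then show ?thesis unfolding times_divide_eq_right .
  qed
  have "form_trace (\<lambda>a b. a \<bullet> (G z *v b)) S = sqrt (det (G z)) *\<^sub>R ((sqrt (det (G z)) / det (G z)) *\<^sub>R form_trace (\<lambda>a b. a \<bullet> (G z *v b)) S)"
    unfolding scaleR_scaleR one by simp
  also have "\<dots> = L (sqrt (det (G z)) *\<^sub>R w)" unfolding eq linear_scale[OF linL] ..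
  finally show ?thesis unfolding L_def S_def by blast
qed

context smooth_map_surface
begin

text \<open>Harmonicity is an equation at interior points only, where \<open>h\<close> in a chart is
  smooth on an open set.\<close>

lemma interior_chart:
  assumes c: "c \<in> A" and p: "p \<in> fst c" "0 < snd c p $ 2"
  obtains O' F where "open O'" "snd c p \<in> O'" "O' \<subseteq> chart_image c" "\<forall>z\<in>O'. 0 < z $ 2" "\<forall>k. C_k_on k F O'" "\<forall>z\<in>O'. F z = h (chart_inv c z)"
    "frechet_derivative F (at (snd c p)) = dh c p"
proof -
  obtain T where T: "open T" "chart_image c = T \<inter> half_plane" using half_plane_relopenE[OF chart_facts(3)[OF c]] .
  obtain W F where F: "C1_map_on W F (\<lambda>x. frechet_derivative F (at x))" "\<forall>k. C_k_on k F W" "chart_image c \<subseteq> W"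
    "\<forall>z\<in>chart_image c. F z = h (chart_inv c z)"
    "\<forall>z\<in>chart_image c. frechet_derivative F (at z) = dh c (chart_inv c z)"
    by (rule chart_extension[OF c])
  define O' where "O' = T \<inter> {z. 0 < z $ 2}"
  have "open {z :: real^2. 0 < z $ 2}" using open_halfspace_component_gt_cart[of 0 2] by simp
  then have O: "open O'" using T(1) unfolding O'_def by (simp add: open_Int)
  have O2: "O' \<subseteq> chart_image c" unfolding T(2) O'_def half_plane_def by auto
  have zO: "snd c p \<in> O'" using chart_image_I[OF p(1)] p(2) T(2) by (auto simp: O'_def)
  show ?thesis
  proof (rule that[OF O zO O2])
    have "C_k_on k F O'" for k
      by (rule C_k_on_transform[OF O order_trans[OF O2 F(3)] F(2)[rule_format]]) simp
    then show "\<forall>k. C_k_on k F O'" by blast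
    show "frechet_derivative F (at (snd c p)) = dh c p" using F(5) chart_image_I[OF p(1)] p(1) c by simp
    show "\<forall>z\<in>O'. 0 < z $ 2" by (auto simp: O'_def)
    show "\<forall>z\<in>O'. F z = h (chart_inv c z)" using O2 F(4) by blast
  qed
qed

text \<open>The last claim is the geometric content of harmonicity: by
  \<open>laplace_beltrami_second_order\<close> the trace of the second derivative of
  \<open>h\<close> is tangent to the image, so its normal part, which is the trace of the second
  fundamental form, vanishes.\<close>

lemma second_fundamental_form_chart:
  assumes c: "c \<in> A" "p \<in> fst c" "0 < snd c p $ 2" and patch: "regular_patch (h ` topspace M) (h p) \<phi> U z0"
    and harm: "harmonic_map A g h"
  shows "dh c p a \<in> tangent_plane (h ` topspace M) (h p)"
    "bilinear (\<lambda>a b. second_fundamental_form (h ` topspace M) (h p) (dh c p a) (dh c p b))"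
    "second_fundamental_form (h ` topspace M) (h p) (dh c p a) (dh c p b) = second_fundamental_form (h ` topspace M) (h p) (dh c p b) (dh c p a)"
    "form_trace (metric_form c p) (\<lambda>a b. second_fundamental_form (h ` topspace M) (h p) (dh c p a) (dh c p b)) = 0"
proof -
  let ?S = "h ` topspace M" and ?q = "h p" and ?z = "snd c p"
  obtain O' F where O: "open O'" "?z \<in> O'" "O' \<subseteq> chart_image c" "\<forall>z\<in>O'. 0 < z $ 2" "\<forall>k. C_k_on k F O'" "\<forall>z\<in>O'. F z = h (chart_inv c z)"
    "frechet_derivative F (at ?z) = dh c p"
    by (rule interior_chart[OF c])
  note O = O(1-3) O(4)[rule_format] O(5)[rule_format] O(6)[rule_format] O(7)
  have Fz: "F ?z = ?q" using O(6)[OF O(2)] c by simp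
  have FS: "F ` O' \<subseteq> ?S"
  proof
    fix q assume "q \<in> F ` O'"
    then obtain y where "y \<in> O'" "q = h (chart_inv c y)" using O(6) by auto
    then show "q \<in> ?S" using O(3) c(1) chart_facts(2)[OF c(1)] chart_inv(2)[OF c(1)] by blast
  qed
  note C2 = O(5)[of "Suc (Suc 0)"]
  note sff = second_fundamental_form_map[OF patch O(1) C2 O(2) Fz FS, unfolded O(7)]
  show "dh c p a \<in> tangent_plane ?S ?q" by (rule sff(1))
  have linN: "linear (normal_part (tangent_plane ?S ?q))" by (rule linear_normal_part[OF subspace_tangent_plane[OF patch]])
  show "bilinear (\<lambda>a b. second_fundamental_form ?S ?q (dh c p a) (dh c p b))"
    unfolding sff(2) bilinear_def
    using second_derivative_linear_left[OF O(1) C2 O(2)] second_derivative_linear_right[OF O(1) C2 O(2)] linear_compose[OF _ linN, unfolded o_def] by blast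
  show "second_fundamental_form ?S ?q (dh c p a) (dh c p b) = second_fundamental_form ?S ?q (dh c p b) (dh c p a)"
    unfolding sff(2) using second_derivative_symmetric[OF O(1) C2 O(2)] by metis
  have gd: "g c differentiable (at ?z)"
  proof -
    obtain W G where G: "open W" "chart_image c \<subseteq> W" "\<forall>k. C_k_on k G W" "\<forall>x\<in>chart_image c. G x = g c x"
      using metric_facts(4)[OF c(1) chart_image_I[OF c(2)]] unfolding smooth_on_def by blast
    have "?z \<in> W" using O(2,3) G(2) by blast
    then have "(G has_derivative frechet_derivative G (at ?z)) (at ?z)" using C_k_on_SucD(1)[OF G(3)[rule_format]] by blast
    then have "(g c has_derivative frechet_derivative G (at ?z)) (at ?z)"
      by (rule has_derivative_transform_within_open[OF _ O(1,2)]) (use O(3) G(4) in auto)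
    then show ?thesis by (rule differentiableI)
  qed
  \<comment> \<open>harmonicity refers to \<open>h\<close> composed with the inverse chart, which
    agrees with the smooth extension \<open>F\<close> on an open set only; the operator is
    local\<close>
  have lap: "laplace_beltrami (g c) (\<lambda>y. F y $ i) ?z = 0" for i
  proof -
    have "laplace_beltrami (g c) ((\<lambda>p. h p $ i) \<circ> inv_into (fst c) (snd c)) ?z = 0"
      using harm c chart_image_I[OF c(2)] unfolding harmonic_map_def harmonic_function_def chart_image_def
      by (auto simp: case_prod_unfold)
    moreover have "laplace_beltrami (g c) (\<lambda>y. F y $ i) ?z = laplace_beltrami (g c) ((\<lambda>p. h p $ i) \<circ> inv_into (fst c) (snd c)) ?z"
    proof -
      let ?f = "(\<lambda>p. h p $ i) \<circ> inv_into (fst c) (snd c)"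
      have Fd: "((\<lambda>y. F y $ i) has_derivative (\<lambda>v. frechet_derivative F (at y) v $ i)) (at y)" if "y \<in> O'" for y
        by (intro bounded_linear.has_derivative[OF bounded_linear_vec_nth] C_k_on_SucD(1)[OF C2 that])
      have fr: "frechet_derivative (\<lambda>y. F y $ i) (at y) = frechet_derivative ?f (at y)" if y: "y \<in> O'" for y
        by (rule frechet_derivative_transform_within_open[OF differentiableI[OF Fd[OF y]] O(1) y])
           (simp add: O(6) chart_inv_def)
      define u where "u f i y = sqrt (det (g c y)) * (\<Sum>j\<in>UNIV. matrix_inv (g c y) $ i $ j * frechet_derivative f (at y) (axis j 1))" for f :: "real^2 \<Rightarrow> real" and i y
      have "u (\<lambda>y. F y $ i) m differentiable (at ?z)" for m
      proof -
        have "(\<lambda>y. \<Sum>j\<in>UNIV. (sqrt (det (g c y)) * matrix_inv (g c y) $ m $ j) * frechet_derivative F (at y) (axis j 1) $ i) differentiable (at ?z)"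
        proof -
          have 1: "(\<lambda>y. sqrt (det (g c y)) * matrix_inv (g c y) $ m $ j) differentiable (at ?z)" for j
            by (rule weighted_inverse_differentiable[OF O(1,2) gd]) (use metric_facts(3)[OF c(1)] O(3) in blast)
          have 2: "(\<lambda>y. frechet_derivative F (at y) (axis j 1) $ i) differentiable (at ?z)" for j
            by (rule differentiableI[OF bounded_linear.has_derivative[OF bounded_linear_vec_nth second_derivative_works[OF O(1) C2 O(2)]]])
          show ?thesis unfolding sum_2 by (intro differentiable_add differentiable_mult 1 2)
        qed
        then obtain D where "((\<lambda>y. \<Sum>j\<in>UNIV. (sqrt (det (g c y)) * matrix_inv (g c y) $ m $ j) * frechet_derivative F (at y) (axis j 1) $ i) has_derivative D) (at ?z)"
          by (auto simp: differentiable_def)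
        then have "(u (\<lambda>y. F y $ i) m has_derivative D) (at ?z)"
        proof (rule has_derivative_transform_within_open[OF _ O(1,2)])
          fix y assume y: "y \<in> O'"
          show "(\<Sum>j\<in>UNIV. (sqrt (det (g c y)) * matrix_inv (g c y) $ m $ j) * frechet_derivative F (at y) (axis j 1) $ i) = u (\<lambda>y. F y $ i) m y"
            unfolding u_def frechet_derivative_at[OF Fd[OF y], symmetric] by (simp add: sum_distrib_left mult.assoc)
        qed
        then show ?thesis by (rule differentiableI)
      qed
      then have "frechet_derivative (u (\<lambda>y. F y $ i) m) (at ?z) = frechet_derivative (u ?f m) (at ?z)" for m
        by (rule frechet_derivative_transform_within_open[OF _ O(1,2)]) (simp add: u_def fr)
      then show ?thesis unfolding laplace_beltrami_def u_def by simp
    qed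
    ultimately show ?thesis by simp
  qed
  obtain w where w: "form_trace (\<lambda>a b. a \<bullet> (g c ?z *v b)) (second_derivative F ?z) = frechet_derivative F (at ?z) w"
    using laplace_beltrami_second_order[OF O(1,2) C2 gd _ metric_facts(1)[OF c(1) chart_image_I[OF c(2)]] lap]
      metric_facts(3)[OF c(1)] O(3) by blast
  have mf: "(\<lambda>a b. a \<bullet> (g c ?z *v b)) = metric_form c p" by (intro ext) (simp add: metric_form_def)
  have "form_trace (metric_form c p) (\<lambda>a b. second_fundamental_form ?S ?q (dh c p a) (dh c p b))
     = normal_part (tangent_plane ?S ?q) (form_trace (metric_form c p) (second_derivative F ?z))"
    unfolding sff(2) form_trace_def by (simp add: linear_add[OF linN] linear_diff[OF linN] linear_scale[OF linN])
  also have "\<dots> = normal_part (tangent_plane ?S ?q) (dh c p w)" using w unfolding mf O(7) by simp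
  also have "\<dots> = 0" by (rule normal_part_tangent[OF subspace_tangent_plane[OF patch] sff(1)])
  finally show "form_trace (metric_form c p) (\<lambda>a b. second_fundamental_form ?S ?q (dh c p a) (dh c p b)) = 0" .
qed

lemma principal_regular_patch:
  assumes "principal_directions S q e1 e2"
  obtains \<phi> U z where "regular_patch S q \<phi> U z"
  using assms unfolding principal_directions_def tangent_plane_def by blast

text \<open>Passage from a chart with \<open>p\<close> in its interior to the chart in which
  \<open>differential\<close> is expressed.\<close>

lemma differential_minimal_trace_data:
  assumes p: "p \<in> topspace M" "inj (differential A h p)" "c \<in> A" "p \<in> fst c" "0 < snd c p $ 2"
    and patch: "regular_patch (h ` topspace M) (h p) \<phi> U z" and harm: "harmonic_map A g h"
  shows "minimal_trace_data (metric_inner A g p) (differential A h p) (second_fundamental_form (h ` topspace M) (h p))"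
    "range (differential A h p) = tangent_plane (h ` topspace M) (h p)"
proof -
  let ?S = "h ` topspace M" and ?q = "h p"
  define d where "d = chart_at A p"
  have d: "d \<in> A" "p \<in> fst d" using chart_at_facts[OF p(1)] by (auto simp: d_def)
  define II where "II = second_fundamental_form ?S ?q"
  define L where "L = dh d p"
  have L: "differential A h p = L" by (simp add: differential_eq_dh L_def d_def)
  have \<beta>: "metric_inner A g p = metric_form d p" by (simp add: metric_inner_eq_form d_def)
  note sff = second_fundamental_form_chart[OF p(3,4,5) patch harm, folded II_def]
  define T where "T = transition d c p"
  have LT: "L a = dh c p (T a)" for a unfolding L_def T_def by (rule dh_transition[OF d(1) p(3) d(2) p(4)])
  have linT: "linear T" unfolding T_def by (rule transition_facts(2)[OF d(1) p(3) d(2) p(4)])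
  have linL: "linear L" unfolding L_def by (rule dh_derivative(2)[OF d])
  have injL: "inj L" using p(2) L by simp
  show "range (differential A h p) = tangent_plane ?S ?q" unfolding L
    by (rule tangent_plane_eq_range_immersion[OF patch linL injL]) (use sff(1) LT in auto)
  show "minimal_trace_data (metric_inner A g p) (differential A h p) (second_fundamental_form ?S ?q)"
    unfolding L \<beta> II_def[symmetric]
  proof (rule minimal_trace_data.intro)
    show "bilinear (metric_form d p)" by (rule metric_form_facts(1)[OF d])
    show "metric_form d p a b = metric_form d p b a" for a b by (rule metric_form_facts(2)[OF d])
    show "a \<noteq> 0 \<Longrightarrow> 0 < metric_form d p a a" for a by (rule metric_form_facts(3)[OF d])
    show "linear L" "inj L" by (rule linL, rule injL)
    have 1: "linear (\<lambda>a. II (dh c p a) (dh c p b))" "linear (\<lambda>b. II (dh c p a) (dh c p b))" for a b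
      using sff(2) by (auto simp: bilinear_def)
    show "bilinear (\<lambda>a b. II (L a) (L b))"
      unfolding bilinear_def LT using linear_compose[OF linT 1(1)] linear_compose[OF linT 1(2)] by (simp add: o_def)
    show "II (L a) (L b) = II (L b) (L a)" for a b unfolding LT by (rule sff(3))
    show "form_trace (metric_form d p) (\<lambda>a b. II (L a) (L b)) = 0"
      using form_trace_transition(1)[OF d(1) p(3) d(2) p(4) sff(2)] sff(4) unfolding LT T_def by simp
  qed
qed

text \<open>All claims of the theorem at one point. Boundary points and points where
  \<open>h\<close> is not an immersion are excluded; they form null sets.\<close>

theorem harmonic_pointwise:
  assumes p: "p \<in> topspace M" "inj (differential A h p)" "c \<in> A" "p \<in> fst c" "0 < snd c p $ 2"
    and ex: "\<exists>e1 e2. principal_directions (h ` topspace M) (h p) e1 e2" and harm: "harmonic_map A g h"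
  shows "2 \<le> curvature_integrand (h ` topspace M) (h p)"
    "curvature_integrand (h ` topspace M) (h p) \<le> ennreal (map_dilation p)"
    "curvature_integrand (h ` topspace M) (h p) = ennreal (map_dilation p) \<longleftrightarrow>
      (\<forall>e1 e2. principal_directions (h ` topspace M) (h p) e1 e2 \<longrightarrow>
       (\<exists>a b. differential A h p a = e1 \<and> differential A h p b = e2 \<and> metric_inner A g p a b = 0))"
proof -
  let ?S = "h ` topspace M" and ?q = "h p"
  obtain \<phi> U z where patch: "regular_patch ?S ?q \<phi> U z" using ex principal_regular_patch by metis
  define d where "d = chart_at A p"
  have d: "d \<in> A" "p \<in> fst d" using chart_at_facts[OF p(1)] by (auto simp: d_def)
  define II where "II = second_fundamental_form ?S ?q"
  define L where "L = dh d p"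
  have L: "differential A h p = L" by (simp add: differential_eq_dh L_def d_def)
  have \<beta>: "metric_inner A g p = metric_form d p" by (simp add: metric_inner_eq_form d_def)
  interpret data: minimal_trace_data "metric_form d p" L II
    using differential_minimal_trace_data(1)[OF p patch harm] unfolding L \<beta> II_def .
  have range: "range L = tangent_plane ?S ?q" using differential_minimal_trace_data(2)[OF p patch harm] unfolding L .
  have prin: "data.principal e1 e2 \<longleftrightarrow> principal_directions ?S ?q e1 e2" for e1 e2
    unfolding data.principal_def principal_directions_def range unfolding II_def ..
  have ex': "\<exists>e1 e2. data.principal e1 e2" using ex prin by blast
  have val: "curvature_integrand ?S ?q = data.curvature_value"
    unfolding curvature_integrand_def data.curvature_value_def prin principal_curvature_def by (simp add: Let_def II_def)
  have e: "energy_density A g h p = form_trace (metric_form d p) (\<lambda>a b. L a \<bullet> L b) / form_det (metric_form d p)"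
    unfolding energy_density_chart[OF d] pullback_energy_def L_def ..
  have s: "stretch p = area_factor L / sqrt (form_det (metric_form d p))" unfolding stretch_def L \<beta> ..
  have map_dilation: "map_dilation p = data.dilation" unfolding map_dilation_def data.dilation_def e s ..
  show "2 \<le> curvature_integrand ?S ?q" unfolding val by (rule data.curvature_value_ge_2[OF ex'])
  show "curvature_integrand ?S ?q \<le> ennreal (map_dilation p)" unfolding val map_dilation by (rule data.curvature_value_le_dilation[OF ex'])
  show "curvature_integrand ?S ?q = ennreal (map_dilation p) \<longleftrightarrow>
      (\<forall>e1 e2. principal_directions ?S ?q e1 e2 \<longrightarrow>
       (\<exists>a b. differential A h p a = e1 \<and> differential A h p b = e2 \<and> metric_inner A g p a b = 0))"
    unfolding val map_dilation L \<beta> using data.equality_iff_orthogonal[OF ex'] unfolding prin .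
qed

end

section \<open>The energy inequalities\<close>

lemma AE_null_cover:
  assumes "AE x in M. P x"
  shows "\<exists>N\<in>null_sets M. {x \<in> space M. \<not> P x} \<subseteq> N"
  using assms unfolding eventually_ae_filter by blast

lemma hyperplane_null: "{z :: real^2. z $ 2 = 0} \<in> null_sets lborel"
proof -
  have "closed {z :: real^2. z $ 2 = 0}"
    by (intro closed_Collect_eq continuous_intros)
  then have b: "{z :: real^2. z $ 2 = 0} \<in> sets lborel" by simp
  have "negligible {z :: real^2. z $ 2 = 0}" by (rule negligible_standard_hyperplane_cart)
  then have "{z :: real^2. z $ 2 = 0} \<in> null_sets lebesgue" by (simp add: negligible_iff_null_sets)
  then show ?thesis using b by (simp add: null_sets_completion_iff)
qed

locale degree_one_surface = smooth_map_surface M A g h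
  for M :: "'a topology" and A g and h :: "'a \<Rightarrow> real^'n" +
  assumes degree: "degree_one M A g h"
begin

abbreviation image :: "(real^'n) set" where "image \<equiv> h ` topspace M"

text \<open>The boundary of \<open>M\<close> lies on the boundary line of the half plane in each of
  finitely many charts.\<close>

lemma AE_interior: "AE p in area. \<exists>c\<in>A. p \<in> fst c \<and> 0 < snd c p $ 2"
proof -
  obtain cs where cs: "set cs \<subseteq> A" "(\<Union>c\<in>set cs. fst c) = topspace M" by (rule finite_atlas)
  have "AE p in area. \<forall>c\<in>set cs. p \<in> fst c \<longrightarrow> 0 < snd c p $ 2"
  proof (rule AE_finite_allI)
    fix c assume "c \<in> set cs"
    then have c: "c \<in> A" using cs(1) by blast
    show "AE p in area. p \<in> fst c \<longrightarrow> 0 < snd c p $ 2"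
      using AE_not_in[OF null_set_chart_preimage[OF c hyperplane_null]]
    proof eventually_elim
      case (elim p)
      show ?case
      proof
        assume p: "p \<in> fst c"
        have "snd c p \<in> half_plane" using chart_image_I[OF p] chart_facts(3)[OF c] openin_imp_subset by blast
        then show "0 < snd c p $ 2" using elim p by (auto simp: half_plane_def less_le)
      qed
    qed
  qed simp
  then show ?thesis using AE_space
  proof eventually_elim
    case (elim p)
    have "p \<in> (\<Union>c\<in>set cs. fst c)" using elim(2) cs(2) by simp
    then obtain c where "c \<in> set cs" "p \<in> fst c" by blast
    then show ?case using elim(1) cs(1) by blast
  qed
qed

text \<open>Images of null sets are null: almost every point of the image has a preimage at which
  \<open>R\<close> holds.\<close>

lemma AE_image:
  assumes "AE p in area. R p"
  shows "AE q in hausdorff2. q \<in> image \<longrightarrow> (\<exists>p\<in>topspace M. R p \<and> h p = q)"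
proof -
  obtain N where N: "{p \<in> space area. \<not> R p} \<subseteq> N" "N \<in> null_sets area"
    using AE_null_cover[OF assms] by blast
  obtain Z where Z: "Z \<in> null_sets hausdorff2" "h ` N \<subseteq> Z"
    by (rule hausdorff2_raw_null_cover[OF image_null_set[OF N(2)]])
  show ?thesis using AE_not_in[OF Z(1)]
  proof eventually_elim
    case (elim q)
    show ?case
    proof
      assume "q \<in> image"
      then obtain p where p: "p \<in> topspace M" "q = h p" by blast
      then have "p \<notin> N" using Z(2) elim by blast
      then show "\<exists>p\<in>topspace M. R p \<and> h p = q" using N(1) p by auto
    qed
  qed
qed

lemma degree_one_transfer:
  obtains P \<Psi> where "dilation_transfer P \<Psi>" "topspace M - P \<in> null_sets area"
    "\<forall>p\<in>P. inj (differential A h p)" "P \<subseteq> topspace M"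
proof -
  obtain N where N: "N \<in> null_sets area" "inj_on h (topspace M - N)" "\<forall>p\<in>topspace M - N. inj (differential A h p)"
    using degree unfolding degree_one_def by blast
  obtain P \<Psi> where "P \<subseteq> topspace M - N" "topspace M - P \<in> null_sets area" "dilation_transfer P \<Psi>"
    using dilation_transfer_exists[OF N(1,2)] N(3) by blast
  then show ?thesis using that[of P \<Psi>] N(3) by blast
qed

text \<open>The converse transfer uses that \<open>h\<close> is an immersion almost everywhere, as
  preimages of null sets need not be null otherwise.\<close>

lemma AE_preimage:
  assumes "AE q in hausdorff2. q \<in> image \<longrightarrow> R q"
  shows "AE p in area. R (h p)"
proof -
  obtain P \<Psi> where P: "dilation_transfer P \<Psi>" "topspace M - P \<in> null_sets area" "\<forall>p\<in>P. inj (differential A h p)" "P \<subseteq> topspace M"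
    by (rule degree_one_transfer)
  obtain Z where Z: "{q \<in> space hausdorff2. \<not> (q \<in> image \<longrightarrow> R q)} \<subseteq> Z" "Z \<in> null_sets hausdorff2"
    using AE_null_cover[OF assms] by blast
  have "{p \<in> P. h p \<in> Z} \<in> null_sets area" using P(1) Z(2) by (simp add: dilation_transfer_def)
  from AE_not_in[OF this] AE_not_in[OF P(2)] AE_space show ?thesis
  proof eventually_elim
    case (elim p)
    then have "p \<in> P" "h p \<notin> Z" by auto
    then show ?case using Z(1) P(4) by auto
  qed
qed

lemma AE_immersion: "AE p in area. inj (differential A h p)"
proof -
  obtain P \<Psi> where P: "dilation_transfer P \<Psi>" "topspace M - P \<in> null_sets area" "\<forall>p\<in>P. inj (differential A h p)" "P \<subseteq> topspace M"
    by (rule degree_one_transfer)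
  from AE_not_in[OF P(2)] AE_space show ?thesis by eventually_elim (use P(3) in auto)
qed

lemma image_borel: "image \<in> sets borel"
proof -
  have "continuous_map M euclidean h"
    unfolding continuous_map_def using chart_continuous_fun_open[OF chart_continuous_quantities(3)] by auto
  then have "compactin euclidean (h ` topspace M)"
    using compact image_compactin unfolding compact_space_def by blast
  then show ?thesis by (simp add: borel_compact)
qed

text \<open>The energy is the integral of the dilation \<open>\<Psi>\<close> over the image, and
  \<open>harmonic_pointwise\<close> compares \<open>\<Psi>\<close> with the curvature integrand at
  almost every point.\<close>

theorem energy_inequalities:
  assumes harm: "harmonic_map A g h" and int: "integrand_defined image"
  shows "(\<integral>\<^sup>+q\<in>image. curvature_integrand image q \<partial>hausdorff2) \<le> Energy M A g h"
    "2 * emeasure hausdorff2 image \<le> (\<integral>\<^sup>+q\<in>image. curvature_integrand image q \<partial>hausdorff2)"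
    "Energy M A g h = (\<integral>\<^sup>+q\<in>image. curvature_integrand image q \<partial>hausdorff2) \<longleftrightarrow> pullbacks_orthogonal M A g h"
proof -
  obtain P \<Psi> where data: "dilation_transfer P \<Psi>" and P: "topspace M - P \<in> null_sets area"
    "\<forall>p\<in>P. inj (differential A h p)" "P \<subseteq> topspace M"
    by (rule degree_one_transfer)
  note d = data[unfolded dilation_transfer_def]
  let ?f = "curvature_integrand image"
  define good where "good p \<longleftrightarrow> p \<in> P \<and> (\<exists>c\<in>A. p \<in> fst c \<and> 0 < snd c p $ 2) \<and> (\<exists>e1 e2. principal_directions image (h p) e1 e2)" for p
  define orth where "orth p \<longleftrightarrow> (\<forall>e1 e2. principal_directions image (h p) e1 e2 \<longrightarrow>
       (\<exists>a b. differential A h p a = e1 \<and> differential A h p b = e2 \<and> metric_inner A g p a b = 0))" for p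
  have AE_good: "AE p in area. good p"
    using AE_not_in[OF P(1)] AE_space AE_interior AE_preimage[OF int[unfolded integrand_defined_def]]
    by eventually_elim (auto simp: good_def)
  have \<Psi>h: "\<Psi> (h p) = ennreal (map_dilation p)" if "good p" for p using d that by (simp add: good_def)
  have pw: "2 \<le> ?f (h p)" "?f (h p) \<le> \<Psi> (h p)" "?f (h p) = \<Psi> (h p) \<longleftrightarrow> orth p" if "good p" for p
  proof -
    obtain c where c: "c \<in> A" "p \<in> fst c" "0 < snd c p $ 2" using \<open>good p\<close> unfolding good_def by blast
    have p: "p \<in> topspace M" "inj (differential A h p)" "\<exists>e1 e2. principal_directions image (h p) e1 e2"
      using \<open>good p\<close> P(2,3) unfolding good_def by blast+
    note H = harmonic_pointwise[OF p(1,2) c p(3) harm]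
    show "2 \<le> ?f (h p)" by (rule H(1))
    show "?f (h p) \<le> \<Psi> (h p)" unfolding \<Psi>h[OF \<open>good p\<close>] by (rule H(2))
    show "?f (h p) = \<Psi> (h p) \<longleftrightarrow> orth p" unfolding \<Psi>h[OF \<open>good p\<close>] orth_def by (rule H(3))
  qed
  have "borel_measurable hausdorff2 = (borel_measurable borel :: (real^'n \<Rightarrow> ennreal) set)"
    by (rule measurable_cong_sets) simp_all
  then have m\<Psi>: "\<Psi> \<in> borel_measurable hausdorff2" using d by blast
  have \<Psi>0: "\<Psi> q = 0" if "q \<notin> image" for q using d P(3) that by blast
  have E\<Psi>: "(\<integral>\<^sup>+q. \<Psi> q \<partial>hausdorff2) = Energy M A g h"
  proof -
    have "(\<integral>\<^sup>+q. \<Psi> q \<partial>hausdorff2) = (\<integral>\<^sup>+p\<in>P. ennreal (energy_density A g h p) \<partial>area)" using d by simp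
    also have "\<dots> = (\<integral>\<^sup>+p. ennreal (energy_density A g h p) \<partial>area)"
    proof (rule nn_integral_cong_AE)
      show "AE p in area. ennreal (energy_density A g h p) * indicator P p = ennreal (energy_density A g h p)"
        using AE_not_in[OF P(1)] AE_space by eventually_elim auto
    qed
    finally show ?thesis by (simp add: Energy_def)
  qed
  have le: "AE q in hausdorff2. ?f q * indicator image q \<le> \<Psi> q"
    using AE_image[OF AE_good]
  proof eventually_elim
    case (elim q)
    show ?case
    proof (cases "q \<in> image")
      case True
      then obtain p where "good p" "h p = q" using elim by blast
      then show ?thesis using True pw(2)[of p] by simp
    qed simp
  qed
  show "(\<integral>\<^sup>+q\<in>image. ?f q \<partial>hausdorff2) \<le> Energy M A g h"
    unfolding E\<Psi>[symmetric] by (rule nn_integral_mono_AE[OF le])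
  have "2 * emeasure hausdorff2 image = (\<integral>\<^sup>+q\<in>image. 2 \<partial>hausdorff2)"
    using image_borel by (simp add: nn_integral_cmult_indicator)
  also have "\<dots> \<le> (\<integral>\<^sup>+q\<in>image. ?f q \<partial>hausdorff2)"
  proof (rule nn_integral_mono_AE)
    show "AE q in hausdorff2. 2 * indicator image q \<le> ?f q * indicator image q"
      using AE_image[OF AE_good]
    proof eventually_elim
      case (elim q)
      show ?case
    proof (cases "q \<in> image")
      case True
      then obtain p where "good p" "h p = q" using elim by blast
      then show ?thesis using True pw(1)[of p] by simp
    qed simp
    qed
  qed
  finally show "2 * emeasure hausdorff2 image \<le> (\<integral>\<^sup>+q\<in>image. ?f q \<partial>hausdorff2)" .
  have orth_def': "pullbacks_orthogonal M A g h \<longleftrightarrow> (AE p in area. orth p)"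
    unfolding pullbacks_orthogonal_def orth_def ..
  show "Energy M A g h = (\<integral>\<^sup>+q\<in>image. ?f q \<partial>hausdorff2) \<longleftrightarrow> pullbacks_orthogonal M A g h"
    unfolding orth_def'
  proof
    assume eq: "Energy M A g h = (\<integral>\<^sup>+q\<in>image. ?f q \<partial>hausdorff2)"
    have "AE q in hausdorff2. ?f q * indicator image q = \<Psi> q"
      by (rule AE_eq_if_nn_integral_eq[OF m\<Psi> le]) (use eq E\<Psi> Energy_finite in auto)
    then have "AE q in hausdorff2. q \<in> image \<longrightarrow> ?f q = \<Psi> q" by eventually_elim (auto simp: indicator_def split: if_splits)
    from AE_preimage[OF this] AE_good show "AE p in area. orth p"
      by eventually_elim (use pw(3) in blast)
  next
    assume "AE p in area. orth p"
    then have "AE p in area. good p \<and> orth p" using AE_good by eventually_elim blast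
    from AE_image[OF this] have "AE q in hausdorff2. ?f q * indicator image q = \<Psi> q"
    proof eventually_elim
      case (elim q)
      show ?case
    proof (cases "q \<in> image")
      case True
      then obtain p where "good p" "orth p" "h p = q" using elim by blast
      then show ?thesis using True pw(3)[of p] by simp
    qed (simp add: \<Psi>0)
    qed
    then show "Energy M A g h = (\<integral>\<^sup>+q\<in>image. ?f q \<partial>hausdorff2)"
      unfolding E\<Psi>[symmetric] by (rule nn_integral_cong_AE[symmetric])
  qed
qed

end

section \<open>Surfaces of revolution\<close>

lemma C_k_on_decrease: "C_k_on (Suc k) f W \<Longrightarrow> C_k_on k f W"
proof (induction k arbitrary: f)
  case 0 then show ?case
    by (auto intro!: continuous_at_imp_continuous_on differentiable_imp_continuous_within)
next
  case (Suc k)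
  show ?case unfolding C_k_on.simps(2)[of k f]
    using Suc.IH Suc.prems unfolding C_k_on.simps(2)[of "Suc k" f] by blast
qed

text \<open>Closure of \<open>C_k_on\<close> under an operation follows by induction on
  \<open>k\<close> from the formula for the derivative.\<close>

lemma C_k_on_has_derivative_step:
  fixes f :: "'a::euclidean_space \<Rightarrow> 'b::real_normed_vector"
  assumes "open W" "\<And>x. x \<in> W \<Longrightarrow> (f has_derivative f' x) (at x)" "\<And>b. b \<in> Basis \<Longrightarrow> C_k_on k (\<lambda>x. f' x b) W"
  shows "C_k_on (Suc k) f W"
proof -
  have "f differentiable (at x)" if "x \<in> W" for x using assms(2)[OF that] by (rule differentiableI)
  moreover have "C_k_on k (\<lambda>x. frechet_derivative f (at x) b) W" if "b \<in> Basis" for b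
    by (rule C_k_on_transform[OF assms(1) order_refl assms(3)[OF that]])
       (simp add: frechet_derivative_at[OF assms(2), symmetric])
  ultimately show ?thesis by simp
qed

lemma C_k_on_const: "open W \<Longrightarrow> C_k_on k (\<lambda>x :: 'a::euclidean_space. c :: 'b::real_normed_vector) W"
proof (induction k arbitrary: c)
  case (Suc k)
  show ?case by (rule C_k_on_has_derivative_step[where f' = "\<lambda>x h. 0"]) (use Suc in auto)
qed simp

lemma C_k_on_linear:
  fixes f :: "'a::euclidean_space \<Rightarrow> 'b::real_normed_vector"
  assumes "open W" "bounded_linear f"
  shows "C_k_on k f W"
proof (cases k)
  case 0 then show ?thesis using assms by (simp add: linear_continuous_on)
next
  case (Suc m)
  show ?thesis unfolding Suc
    by (rule C_k_on_has_derivative_step[where f' = "\<lambda>x. f"])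
       (simp_all add: assms bounded_linear_imp_has_derivative C_k_on_const[OF assms(1)])
qed

lemma C_k_on_add:
  fixes f g :: "'a::euclidean_space \<Rightarrow> 'b::real_normed_vector"
  shows "open W \<Longrightarrow> C_k_on k f W \<Longrightarrow> C_k_on k g W \<Longrightarrow> C_k_on k (\<lambda>x. f x + g x) W"
proof (induction k arbitrary: f g)
  case 0 then show ?case by (simp add: continuous_on_add)
next
  case (Suc k)
  show ?case
  proof (rule C_k_on_has_derivative_step[OF Suc.prems(1)])
    show "((\<lambda>x. f x + g x) has_derivative (\<lambda>h. frechet_derivative f (at x) h + frechet_derivative g (at x) h)) (at x)" if "x \<in> W" for x
      by (intro has_derivative_add C_k_on_SucD(1)[OF Suc.prems(2) that] C_k_on_SucD(1)[OF Suc.prems(3) that])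
    show "C_k_on k (\<lambda>x. frechet_derivative f (at x) b + frechet_derivative g (at x) b) W" if "b \<in> Basis" for b
      by (rule Suc.IH[OF Suc.prems(1)]) (use Suc.prems that in auto)
  qed
qed

lemma C_k_on_scaleR:
  fixes f :: "'a::euclidean_space \<Rightarrow> real" and g :: "'a \<Rightarrow> 'b::real_normed_vector"
  shows "open W \<Longrightarrow> C_k_on k f W \<Longrightarrow> C_k_on k g W \<Longrightarrow> C_k_on k (\<lambda>x. f x *\<^sub>R g x) W"
proof (induction k arbitrary: f g)
  case 0 then show ?case by (simp add: continuous_on_scaleR)
next
  case (Suc k)
  show ?case
  proof (rule C_k_on_has_derivative_step[OF Suc.prems(1)])
    show "((\<lambda>x. f x *\<^sub>R g x) has_derivative (\<lambda>h. f x *\<^sub>R frechet_derivative g (at x) h + frechet_derivative f (at x) h *\<^sub>R g x)) (at x)" if "x \<in> W" for x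
      by (intro has_derivative_scaleR C_k_on_SucD(1)[OF Suc.prems(2) that] C_k_on_SucD(1)[OF Suc.prems(3) that])
    show "C_k_on k (\<lambda>x. f x *\<^sub>R frechet_derivative g (at x) b + frechet_derivative f (at x) b *\<^sub>R g x) W" if "b \<in> Basis" for b
      by (intro C_k_on_add[OF Suc.prems(1)] Suc.IH[OF Suc.prems(1)] C_k_on_decrease[OF Suc.prems(2)] C_k_on_decrease[OF Suc.prems(3)])
         (use Suc.prems that in auto)
  qed
qed

lemma C_k_on_compose_real:
  fixes g :: "'a::euclidean_space \<Rightarrow> real" and f :: "real \<Rightarrow> 'b::real_normed_vector"
  shows "open W \<Longrightarrow> C_k_on k f J \<Longrightarrow> C_k_on k g W \<Longrightarrow> g ` W \<subseteq> J \<Longrightarrow> C_k_on k (\<lambda>x. f (g x)) W"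
proof (induction k arbitrary: f)
  case 0 then show ?case using continuous_on_compose2[of J f W g] by simp
next
  case (Suc k)
  show ?case
  proof (rule C_k_on_has_derivative_step[OF Suc.prems(1)])
    show "((\<lambda>x. f (g x)) has_derivative (\<lambda>h. frechet_derivative g (at x) h *\<^sub>R frechet_derivative f (at (g x)) 1)) (at x)" if "x \<in> W" for x
    proof -
      have gx: "g x \<in> J" using Suc.prems(4) that by blast
      have lin: "linear (frechet_derivative f (at (g x)))" by (rule C_k_on_SucD(2)[OF Suc.prems(2) gx])
      have eq: "frechet_derivative f (at (g x)) y = y *\<^sub>R frechet_derivative f (at (g x)) 1" for y
        using linear_scale[OF lin, of y 1] by simp
      have "((\<lambda>x. f (g x)) has_derivative (\<lambda>h. frechet_derivative f (at (g x)) (frechet_derivative g (at x) h))) (at x)"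
        by (rule has_derivative_compose[OF C_k_on_SucD(1)[OF Suc.prems(3) that] C_k_on_SucD(1)[OF Suc.prems(2) gx]])
      then show ?thesis by (rule has_derivative_eq_rhs) (rule ext, rule eq)
    qed
    show "C_k_on k (\<lambda>x. frechet_derivative g (at x) b *\<^sub>R frechet_derivative f (at (g x)) 1) W" if "b \<in> Basis" for b
    proof (rule C_k_on_scaleR[OF Suc.prems(1)])
      show "C_k_on k (\<lambda>x. frechet_derivative g (at x) b) W" using Suc.prems(3) that by simp
      show "C_k_on k (\<lambda>x. frechet_derivative f (at (g x)) 1) W"
        by (rule Suc.IH[OF Suc.prems(1) _ C_k_on_decrease[OF Suc.prems(3)] Suc.prems(4)]) (use Suc.prems(2) in simp)
    qed
  qed
qed

lemma C_k_on_sin_cos: "C_k_on k (sin :: real \<Rightarrow> real) UNIV \<and> C_k_on k (cos :: real \<Rightarrow> real) UNIV"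
proof (induction k)
  case 0 then show ?case by (auto intro: continuous_intros)
next
  case (Suc k)
  have s: "C_k_on (Suc k) (sin :: real \<Rightarrow> real) UNIV"
  proof (rule C_k_on_has_derivative_step[where f' = "\<lambda>x h. h * cos x"])
    show "(sin has_derivative (\<lambda>h. h * cos x)) (at x)" for x :: real
      by (rule has_derivative_eq_rhs[OF DERIV_sin[unfolded has_field_derivative_def]]) (simp add: fun_eq_iff)
  qed (use Suc in auto)
  have "C_k_on k (\<lambda>x :: real. (- 1) *\<^sub>R sin x) UNIV"
    by (rule C_k_on_scaleR[OF open_UNIV C_k_on_const[OF open_UNIV] conjunct1[OF Suc]])
  then have c: "C_k_on (Suc k) (cos :: real \<Rightarrow> real) UNIV"
  proof (intro C_k_on_has_derivative_step[where f' = "\<lambda>x h. h * (- sin x)"])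
    show "(cos has_derivative (\<lambda>h. h * (- sin x))) (at x)" for x :: real
      by (rule has_derivative_eq_rhs[OF DERIV_cos[unfolded has_field_derivative_def]]) (simp add: fun_eq_iff)
  qed auto
  show ?case using s c by blast
qed

lemma real_derivative_scale:
  fixes f :: "real \<Rightarrow> 'b::real_normed_vector"
  assumes "C_k_on (Suc k) f J" "t \<in> J"
  shows "(f has_derivative (\<lambda>h. h *\<^sub>R frechet_derivative f (at t) 1)) (at t)"
proof -
  have "frechet_derivative f (at t) = (\<lambda>h. h *\<^sub>R frechet_derivative f (at t) 1)"
  proof
    fix h show "frechet_derivative f (at t) h = h *\<^sub>R frechet_derivative f (at t) 1"
      using linear_scale[OF C_k_on_SucD(2)[OF assms], of h 1] by simp
  qed
  then show ?thesis using C_k_on_SucD(1)[OF assms] by (rule has_derivative_eq_rhs[rotated])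
qed

text \<open>The parametrisation \<open>E\<close> by meridian and angle. The derivative in the angle
  is \<open>\<sigma>\<close> times a vector that does not depend on the position along the meridian;
  differentiating along the meridian changes only the factor \<open>\<sigma>\<close>, so the mixed
  derivative is tangent to the parallel circle. Multiplication by \<open>\<sigma>\<close> in the
  last claim avoids a division at the poles.\<close>

lemma surface_of_revolution_facts:
  fixes D :: "(real \<times> real) set" and \<gamma> :: "real \<Rightarrow> 'b::euclidean_space" and \<sigma> R \<Phi> :: "real \<Rightarrow> real" and w1 w2 c :: 'b
  defines "u \<equiv> \<lambda>t. cos (\<Phi> t) *\<^sub>R w1 + sin (\<Phi> t) *\<^sub>R w2"
  defines "E \<equiv> \<lambda>z. c + \<gamma> (R (fst z)) + \<sigma> (R (fst z)) *\<^sub>R u (snd z)"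
  assumes D: "open D" and J: "open J" "\<forall>k. C_k_on k \<gamma> J" "\<forall>k. C_k_on k \<sigma> J"
    and R: "\<forall>k. C_k_on k R (fst ` D)" "R ` fst ` D \<subseteq> J" and \<Phi>: "\<forall>k. C_k_on k \<Phi> (snd ` D)"
    and w: "norm w1 = 1" "norm w2 = 1" "w1 \<bullet> w2 = 0" and orth: "\<forall>s\<in>J. \<gamma> s \<bullet> w1 = 0 \<and> \<gamma> s \<bullet> w2 = 0"
    and z: "z \<in> D"
  shows "C_k_on k E D"
    "frechet_derivative E (at z) (1, 0) \<bullet> frechet_derivative E (at z) (0, 1) = 0"
    "\<sigma> (R (fst z)) \<noteq> 0 \<or> frechet_derivative E (at z) (0, 1) = 0"
    "\<exists>l. \<sigma> (R (fst z)) *\<^sub>R second_derivative E z (0, 1) (1, 0) = l *\<^sub>R frechet_derivative E (at z) (0, 1)"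
proof -
  have oF: "open (fst ` D)" and oS: "open (snd ` D)" by (rule open_image_fst[OF D], rule open_image_snd[OF D])
  have Ck: "C_k_on k E D" for k
  proof -
    have RF: "C_k_on k (\<lambda>z. R (fst z)) D" for k
      by (rule C_k_on_compose_real[OF D R(1)[rule_format] C_k_on_linear[OF D bounded_linear_fst]]) simp
    have PS: "C_k_on k (\<lambda>z. \<Phi> (snd z)) D" for k
      by (rule C_k_on_compose_real[OF D \<Phi>[rule_format] C_k_on_linear[OF D bounded_linear_snd]]) simp
    have sub: "(\<lambda>z. R (fst z)) ` D \<subseteq> J" using R(2) by auto
    have g: "C_k_on k (\<lambda>z. \<gamma> (R (fst z))) D" and s: "C_k_on k (\<lambda>z. \<sigma> (R (fst z))) D"
      using C_k_on_compose_real[OF D J(2)[rule_format] RF sub] C_k_on_compose_real[OF D J(3)[rule_format] RF sub] by auto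
    have cs: "C_k_on k (\<lambda>z. cos (\<Phi> (snd z))) D" "C_k_on k (\<lambda>z. sin (\<Phi> (snd z))) D"
      using C_k_on_compose_real[OF D conjunct2[OF C_k_on_sin_cos] PS] C_k_on_compose_real[OF D conjunct1[OF C_k_on_sin_cos] PS] by auto
    show ?thesis unfolding E_def u_def
      by (rule C_k_on_add[OF D C_k_on_add[OF D C_k_on_const[OF D] g]
            C_k_on_scaleR[OF D s C_k_on_add[OF D C_k_on_scaleR[OF D cs(1) C_k_on_const[OF D]]
              C_k_on_scaleR[OF D cs(2) C_k_on_const[OF D]]]]])
  qed
  show "C_k_on k E D" by (rule Ck)
  \<comment> \<open>the derivative of the unit vector \<open>u\<close>, orthogonal to it in the
    plane of rotation\<close>
  define v where "v t = frechet_derivative \<Phi> (at t) 1 *\<^sub>R (cos (\<Phi> t) *\<^sub>R w2 - sin (\<Phi> t) *\<^sub>R w1)" for t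
  have du: "(u has_derivative (\<lambda>h. h *\<^sub>R v t)) (at t)" if t: "t \<in> snd ` D" for t
  proof -
    have P: "(\<Phi> has_derivative (\<lambda>h. h *\<^sub>R frechet_derivative \<Phi> (at t) 1)) (at t)"
      by (rule real_derivative_scale[OF \<Phi>[rule_format] t])
    note P = has_derivative_add[OF has_derivative_scaleR_left[OF has_derivative_cos[OF P], of w1]
        has_derivative_scaleR_left[OF has_derivative_sin[OF P], of w2]]
    show ?thesis unfolding u_def by (rule has_derivative_eq_rhs[OF P]) (auto simp: v_def algebra_simps)
  qed
  define G where "G s = frechet_derivative \<gamma> (at (R s)) 1" for s
  define S where "S s = frechet_derivative \<sigma> (at (R s)) 1" for s
  define Q where "Q s = frechet_derivative R (at s) 1" for s
  have dR: "((\<lambda>s. \<gamma> (R s)) has_derivative (\<lambda>h. (h * Q s) *\<^sub>R G s)) (at s)"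
    "((\<lambda>s. \<sigma> (R s)) has_derivative (\<lambda>h. h * Q s * S s)) (at s)" if s: "s \<in> fst ` D" for s
  proof -
    have Rs: "R s \<in> J" using R(2) s by blast
    have r: "(R has_derivative (\<lambda>h. h * Q s)) (at s)" using real_derivative_scale[OF R(1)[rule_format] s] by (simp add: Q_def)
    show "((\<lambda>s. \<gamma> (R s)) has_derivative (\<lambda>h. (h * Q s) *\<^sub>R G s)) (at s)"
      using has_derivative_compose[OF r real_derivative_scale[OF J(2)[rule_format] Rs]] by (simp add: G_def)
    show "((\<lambda>s. \<sigma> (R s)) has_derivative (\<lambda>h. h * Q s * S s)) (at s)"
      using has_derivative_compose[OF r real_derivative_scale[OF J(3)[rule_format] Rs]] by (simp add: S_def)
  qed
  have dE: "(E has_derivative (\<lambda>h. (fst h * Q (fst y)) *\<^sub>R G (fst y) + (\<sigma> (R (fst y)) *\<^sub>R (snd h *\<^sub>R v (snd y)) + (fst h * Q (fst y) * S (fst y)) *\<^sub>R u (snd y)))) (at y)"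
    if y: "y \<in> D" for y
  proof -
    have f: "fst y \<in> fst ` D" "snd y \<in> snd ` D" using y by auto
    have F: "(fst has_derivative fst) (at y)" and N: "(snd has_derivative snd) (at y)"
      by (auto intro: bounded_linear_imp_has_derivative bounded_linear_fst bounded_linear_snd)
    have 1: "((\<lambda>z. \<gamma> (R (fst z))) has_derivative (\<lambda>h. (fst h * Q (fst y)) *\<^sub>R G (fst y))) (at y)"
      by (rule has_derivative_compose[OF F dR(1)[OF f(1)]])
    have 2: "((\<lambda>z. \<sigma> (R (fst z))) has_derivative (\<lambda>h. fst h * Q (fst y) * S (fst y))) (at y)"
      by (rule has_derivative_compose[OF F dR(2)[OF f(1)]])
    have 3: "((\<lambda>z. u (snd z)) has_derivative (\<lambda>h. snd h *\<^sub>R v (snd y))) (at y)"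
      by (rule has_derivative_compose[OF N du[OF f(2)]])
    have "(E has_derivative (\<lambda>h. 0 + (fst h * Q (fst y)) *\<^sub>R G (fst y) + (\<sigma> (R (fst y)) *\<^sub>R (snd h *\<^sub>R v (snd y)) + (fst h * Q (fst y) * S (fst y)) *\<^sub>R u (snd y)))) (at y)"
      unfolding E_def by (intro has_derivative_add has_derivative_const has_derivative_scaleR 1 2 3)
    then show ?thesis by simp
  qed
  have E1: "frechet_derivative E (at y) (1, 0) = Q (fst y) *\<^sub>R (G (fst y) + S (fst y) *\<^sub>R u (snd y))"
    and E2: "frechet_derivative E (at y) (0, 1) = \<sigma> (R (fst y)) *\<^sub>R v (snd y)" if "y \<in> D" for y
    unfolding frechet_derivative_at[OF dE[OF that], symmetric] by (simp_all add: algebra_simps)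
  show "\<sigma> (R (fst z)) \<noteq> 0 \<or> frechet_derivative E (at z) (0, 1) = 0" using E2[OF z] by auto
  have fz: "fst z \<in> fst ` D" "R (fst z) \<in> J" using z R(2) by auto
  have Gw: "G (fst z) \<bullet> w = 0" if "w = w1 \<or> w = w2" for w
  proof -
    have "((\<lambda>s. \<gamma> s \<bullet> w) has_derivative (\<lambda>h. (h *\<^sub>R G (fst z)) \<bullet> w)) (at (R (fst z)))"
      unfolding G_def by (intro has_derivative_inner_left real_derivative_scale[OF J(2)[rule_format] fz(2)])
    then have "((\<lambda>s. 0) has_derivative (\<lambda>h. (h *\<^sub>R G (fst z)) \<bullet> w)) (at (R (fst z)))"
      by (rule has_derivative_transform_within_open[OF _ J(1) fz(2)]) (use orth that in auto)
    then have "(\<lambda>h. (h *\<^sub>R G (fst z)) \<bullet> w) = (\<lambda>h. 0)" by (rule has_derivative_unique[OF _ has_derivative_const])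
    from fun_cong[OF this, of 1] show ?thesis by simp
  qed
  have ww: "w1 \<bullet> w1 = 1" "w2 \<bullet> w2 = 1" "w1 \<bullet> w2 = 0" "w2 \<bullet> w1 = 0" using w by (auto simp: norm_eq_1 inner_commute)
  show "frechet_derivative E (at z) (1, 0) \<bullet> frechet_derivative E (at z) (0, 1) = 0"
    unfolding E1[OF z] E2[OF z] v_def u_def
    by (simp add: inner_add_left inner_add_right inner_diff_right Gw ww algebra_simps)
  have "second_derivative E z (0, 1) (1, 0) = (Q (fst z) * S (fst z)) *\<^sub>R v (snd z)"
  proof -
    \<comment> \<open>restrict to the line along the meridian, on which only the factor
      \<open>\<sigma>\<close> varies\<close>
    define \<alpha> where "\<alpha> t = (fst z + t, snd z)" for t :: real
    have d\<alpha>: "(\<alpha> has_derivative (\<lambda>t. t *\<^sub>R (1, 0))) (at 0)"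
      unfolding \<alpha>_def by (auto intro!: derivative_eq_intros simp: zero_prod_def)
    have a0: "\<alpha> 0 = z" by (simp add: \<alpha>_def)
    have lin: "linear (second_derivative E z (0, 1))" by (rule second_derivative_linear_right[OF D Ck z])
    have "((\<lambda>y. frechet_derivative E (at y) (0, 1)) has_derivative second_derivative E z (0, 1)) (at (\<alpha> 0))"
      unfolding a0 by (rule second_derivative_works[OF D Ck z])
    from has_derivative_compose[OF d\<alpha> this]
    have 1: "((\<lambda>t. frechet_derivative E (at (\<alpha> t)) (0, 1)) has_derivative (\<lambda>t. second_derivative E z (0, 1) (t *\<^sub>R (1, 0)))) (at 0)" .
    have "continuous (at 0) \<alpha>" using d\<alpha> has_derivative_continuous by blast
    then have op: "\<exists>T. open T \<and> 0 \<in> T \<and> (\<forall>t\<in>T. \<alpha> t \<in> D)"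
      using D z a0 unfolding continuous_at_open by metis
    then obtain T where T: "open T" "0 \<in> T" "\<forall>t\<in>T. \<alpha> t \<in> D" by blast
    from has_derivative_transform_within_open[OF 1 T(1,2), of "\<lambda>t. \<sigma> (R (fst z + t)) *\<^sub>R v (snd z)"]
    have 2: "((\<lambda>t. \<sigma> (R (fst z + t)) *\<^sub>R v (snd z)) has_derivative (\<lambda>t. second_derivative E z (0, 1) (t *\<^sub>R (1, 0)))) (at 0)"
      using T(3) E2 by (simp add: \<alpha>_def)
    have "((\<lambda>t. fst z + t) has_derivative (\<lambda>t. t)) (at 0)" by (auto intro!: derivative_eq_intros)
    then have "((\<lambda>t. \<sigma> (R (fst z + t))) has_derivative (\<lambda>h. h * Q (fst z) * S (fst z))) (at 0)"
      using has_derivative_compose[of "\<lambda>t. fst z + t" "\<lambda>t. t" 0 UNIV "\<lambda>s. \<sigma> (R s)"] dR(2)[OF fz(1)] by simp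
    then have 3: "((\<lambda>t. \<sigma> (R (fst z + t)) *\<^sub>R v (snd z)) has_derivative (\<lambda>h. (h * Q (fst z) * S (fst z)) *\<^sub>R v (snd z))) (at 0)"
      by (rule has_derivative_scaleR_left)
    from fun_cong[OF has_derivative_unique[OF 2 3], of 1] show ?thesis by simp
  qed
  then have "\<sigma> (R (fst z)) *\<^sub>R second_derivative E z (0, 1) (1, 0) = (Q (fst z) * S (fst z)) *\<^sub>R frechet_derivative E (at z) (0, 1)"
    unfolding E2[OF z] by simp
  then show "\<exists>l. \<sigma> (R (fst z)) *\<^sub>R second_derivative E z (0, 1) (1, 0) = l *\<^sub>R frechet_derivative E (at z) (0, 1)" by blast
qed

section \<open>Radially symmetric maps\<close>

lemma orthonormal_pair_in_signed_frame:
  fixes e1 e2 f1 f2 :: "'b::real_inner"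
  assumes "norm e1 = 1" "norm e2 = 1" "e1 \<bullet> e2 = 0" "f1 \<bullet> f2 = 0"
    "f1 \<in> {e1, - e1, e2, - e2}" "f2 \<in> {e1, - e1, e2, - e2}"
  shows "(f1 \<in> {e1, - e1} \<and> f2 \<in> {e2, - e2}) \<or> (f1 \<in> {e2, - e2} \<and> f2 \<in> {e1, - e1})"
proof -
  have "e1 \<bullet> e1 = 1" "e2 \<bullet> e2 = 1" using assms(1,2) by (auto simp: norm_eq_1)
  then have "\<not> (f1 \<in> {e1, - e1} \<and> f2 \<in> {e1, - e1})" "\<not> (f1 \<in> {e2, - e2} \<and> f2 \<in> {e2, - e2})"
    using assms(4) by auto
  then show ?thesis using assms(5,6) by blast
qed

context smooth_map_surface
begin

text \<open>The definition of principal directions is not visibly symmetric; symmetry comes from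
  that of the second fundamental form.\<close>

lemma principal_directions_swap:
  assumes p: "p \<in> topspace M" "inj (differential A h p)" "c \<in> A" "p \<in> fst c" "0 < snd c p $ 2"
    and harm: "harmonic_map A g h" and e: "principal_directions (h ` topspace M) (h p) e1 e2"
  shows "principal_directions (h ` topspace M) (h p) e2 e1"
proof -
  obtain \<phi> U z where patch: "regular_patch (h ` topspace M) (h p) \<phi> U z" using principal_regular_patch[OF e] .
  interpret data: minimal_trace_data "metric_inner A g p" "differential A h p" "second_fundamental_form (h ` topspace M) (h p)"
    by (rule differential_minimal_trace_data(1)[OF p patch harm])
  have "e1 \<in> range (differential A h p)" "e2 \<in> range (differential A h p)"
    using e differential_minimal_trace_data(2)[OF p patch harm] by (auto simp: principal_directions_def)
  then have "second_fundamental_form (h ` topspace M) (h p) e2 e1 = second_fundamental_form (h ` topspace M) (h p) e1 e2"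
    using data.II_sym by blast
  then show ?thesis using e by (auto simp: principal_directions_def inner_commute)
qed

text \<open>Where the principal directions are determined, one principal pair with orthogonal
  pullbacks is enough, since every other pair arises from it by order and signs.\<close>

lemma determined_pullbacks_orthogonal:
  assumes p: "p \<in> topspace M" "inj (differential A h p)" "c \<in> A" "p \<in> fst c" "0 < snd c p $ 2"
    and harm: "harmonic_map A g h"
    and det: "\<exists>e1 e2. principal_directions (h ` topspace M) (h p) e1 e2 \<and>
        (\<forall>f1 f2. principal_directions (h ` topspace M) (h p) f1 f2 \<longrightarrow> f1 \<in> {e1, - e1, e2, - e2})"
    and ab: "principal_directions (h ` topspace M) (h p) (differential A h p a) (differential A h p b)" "metric_inner A g p a b = 0"
    and e: "principal_directions (h ` topspace M) (h p) e1 e2"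
  shows "\<exists>a b. differential A h p a = e1 \<and> differential A h p b = e2 \<and> metric_inner A g p a b = 0"
proof -
  let ?P = "principal_directions (h ` topspace M) (h p)" and ?L = "differential A h p" and ?\<beta> = "metric_inner A g p"
  have c: "chart_at A p \<in> A" "p \<in> fst (chart_at A p)" by (rule chart_at_facts[OF p(1)])+
  note swap = principal_directions_swap[OF p harm]
  have P: "norm u = 1" "norm v = 1" "u \<bullet> v = 0" if "?P u v" for u v using that by (auto simp: principal_directions_def)
  obtain u v where uv: "?P u v" "\<And>f1 f2. ?P f1 f2 \<Longrightarrow> f1 \<in> {u, - u, v, - v}" using det by blast
  note frame = orthonormal_pair_in_signed_frame[OF P[OF uv(1)] P(3) uv(2) uv(2)[OF swap]]
  have signed_eq: "{x, - x} = {y, - y}" if "x \<in> {y, - y}" for x y :: "real^'n" using that by auto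
  from frame[OF ab(1) ab(1) ab(1)]
  have "({?L a, - ?L a} = {u, - u} \<and> {?L b, - ?L b} = {v, - v}) \<or> ({?L a, - ?L a} = {v, - v} \<and> {?L b, - ?L b} = {u, - u})"
    using signed_eq by (elim disjE conjE) blast+
  then have in_frame: "(e1 \<in> {?L a, - ?L a} \<and> e2 \<in> {?L b, - ?L b}) \<or> (e1 \<in> {?L b, - ?L b} \<and> e2 \<in> {?L a, - ?L a})"
    using frame[OF e e e] by (elim disjE conjE; simp only: simp_thms)
  have lin: "linear ?L" unfolding differential_eq_dh by (rule dh_derivative(2)[OF c])
  have signed: "\<exists>u'. (u' = u \<or> u' = - u) \<and> ?L u' = e" if "e \<in> {?L u, - ?L u}" for u e
    using that linear_neg[OF lin, of u] by (elim insertE emptyE) auto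
  have bil: "bilinear ?\<beta>" unfolding metric_inner_eq_form by (rule metric_form_facts(1)[OF c])
  have sym: "?\<beta> b a = ?\<beta> a b" unfolding metric_inner_eq_form by (rule metric_form_facts(2)[OF c])
  have orth: "?\<beta> x y = 0" if "x = u \<or> x = - u" "y = v \<or> y = - v" "?\<beta> u v = 0" for x y u v
    using that by (elim disjE) (simp_all add: bilinear_lneg[OF bil] bilinear_rneg[OF bil])
  from in_frame show ?thesis
  proof (elim disjE conjE)
    assume 1: "e1 \<in> {?L a, - ?L a}" and 2: "e2 \<in> {?L b, - ?L b}"
    from signed[OF 1] obtain x where x: "x = a \<or> x = - a" "?L x = e1" by blast
    from signed[OF 2] obtain y where y: "y = b \<or> y = - b" "?L y = e2" by blast
    have "?\<beta> x y = 0" by (rule orth[OF x(1) y(1)]) (simp add: ab(2))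
    then show ?thesis using x(2) y(2) by blast
  next
    assume 1: "e1 \<in> {?L b, - ?L b}" and 2: "e2 \<in> {?L a, - ?L a}"
    from signed[OF 1] obtain x where x: "x = b \<or> x = - b" "?L x = e1" by blast
    from signed[OF 2] obtain y where y: "y = a \<or> y = - a" "?L y = e2" by blast
    have "?\<beta> x y = 0" by (rule orth[OF x(1) y(1)]) (simp add: ab(2) sym)
    then show ?thesis using x(2) y(2) by blast
  qed
qed

text \<open>The chain rule for \<open>E = h \<circ> \<psi>\<close>, through the chart chosen at
  \<open>\<psi> z\<close>.\<close>

lemma differential_chain:
  assumes D: "open D" "continuous_map (top_of_set D) M \<psi>" "\<forall>(U, x)\<in>A. smooth_on (D \<inter> \<psi> -` U) (x \<circ> \<psi>)" "z \<in> D"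
    and E: "\<forall>y\<in>D. h (\<psi> y) = E y"
  shows "frechet_derivative E (at z) v = differential A h (\<psi> z) (frechet_derivative (snd (chart_at A (\<psi> z)) \<circ> \<psi>) (at z) v)"
proof -
  define k where "k = chart_at A (\<psi> z)"
  have "\<psi> z \<in> topspace M" using D(2,4) by (auto simp: continuous_map_def)
  then have k: "k \<in> A" "\<psi> z \<in> fst k" using chart_at_facts by (auto simp: k_def)
  define V where "V = D \<inter> \<psi> -` fst k"
  have "openin (top_of_set D) {x \<in> topspace (top_of_set D). \<psi> x \<in> fst k}"
    by (rule openin_continuous_map_preimage[OF D(2) chart_facts(1)[OF k(1)]])
  moreover have "{x \<in> topspace (top_of_set D). \<psi> x \<in> fst k} = V" by (auto simp: V_def)
  ultimately have V: "open V" "z \<in> V" using D(1,4) k(2) by (auto simp: openin_open_eq V_def)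
  have "smooth_on V (snd k \<circ> \<psi>)" using D(3) k(1) unfolding V_def by (auto simp: case_prod_unfold)
  then have C: "C_k_on (Suc 0) (snd k \<circ> \<psi>) V" by (rule smooth_on_open_C_k[OF V(1)])
  define d where "d = frechet_derivative (snd k \<circ> \<psi>) (at z)"
  have d: "((snd k \<circ> \<psi>) has_derivative d) (at z within V)"
    unfolding d_def by (rule has_derivative_at_withinI[OF C_k_on_SucD(1)[OF C V(2)]])
  have "(snd k \<circ> \<psi>) ` V \<subseteq> chart_image k" by (auto simp: V_def chart_image_def)
  then have "((h \<circ> chart_inv k) has_derivative dh k (\<psi> z)) (at ((snd k \<circ> \<psi>) z) within (snd k \<circ> \<psi>) ` V)"
    using has_derivative_subset[OF dh_derivative(1)[OF k]] by simp
  from diff_chain_within[OF d this]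
  have "((h \<circ> chart_inv k \<circ> (snd k \<circ> \<psi>)) has_derivative (dh k (\<psi> z) \<circ> d)) (at z)"
    unfolding at_within_open[OF V(2,1)] .
  then have "(E has_derivative (dh k (\<psi> z) \<circ> d)) (at z)"
    by (rule has_derivative_transform_within_open[OF _ V]) (use k E in \<open>auto simp: V_def\<close>)
  from fun_cong[OF frechet_derivative_at[OF this], of v]
  show "frechet_derivative E (at z) v = differential A h (\<psi> z) (frechet_derivative (snd (chart_at A (\<psi> z)) \<circ> \<psi>) (at z) v)"
    unfolding differential_eq_dh k_def[symmetric] d_def[symmetric] comp_apply by (rule sym)
qed

text \<open>Orthogonal coordinate directions with tangential mixed derivative diagonalise the second
  fundamental form.\<close>

lemma orthogonal_coordinates_principal:
  assumes p: "p \<in> topspace M" "inj (differential A h p)" "c \<in> A" "p \<in> fst c" "0 < snd c p $ 2"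
    and harm: "harmonic_map A g h" and patch: "regular_patch (h ` topspace M) (h p) \<phi> U z0"
    and D: "open D" "C_k_on (Suc (Suc k)) E D" "z \<in> D" "E z = h p" "E ` D \<subseteq> h ` topspace M"
    and L: "frechet_derivative E (at z) v = differential A h p a" "frechet_derivative E (at z) w = differential A h p b"
    and ab: "a \<noteq> 0" "b \<noteq> 0" "differential A h p a \<bullet> differential A h p b = 0"
    and mixed: "second_derivative E z w v = l *\<^sub>R frechet_derivative E (at z) w"
  shows "principal_directions (h ` topspace M) (h p)
      (differential A h p (a /\<^sub>R norm (differential A h p a))) (differential A h p (b /\<^sub>R norm (differential A h p b)))"
proof -
  let ?S = "h ` topspace M" and ?L = "differential A h p"
  define II where "II = second_fundamental_form ?S (h p)"
  interpret data: minimal_trace_data "metric_inner A g p" "differential A h p" II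
    unfolding II_def by (rule differential_minimal_trace_data(1)[OF p patch harm])
  have T: "subspace (tangent_plane ?S (h p))" by (rule subspace_tangent_plane[OF patch])
  have nz: "?L a \<noteq> 0" "?L b \<noteq> 0" using ab(1,2) data.L_inj unfolding linear_injective_0[OF data.L_linear] by blast+
  have "II (?L a) (?L b) = normal_part (tangent_plane ?S (h p)) (second_derivative E z v w)"
    unfolding II_def L[symmetric] by (rule second_fundamental_form_map(2)[OF patch D])
  also have "second_derivative E z v w = l *\<^sub>R frechet_derivative E (at z) w"
    using second_derivative_symmetric[OF D(1-3), of v w] mixed by simp
  also have "normal_part (tangent_plane ?S (h p)) \<dots> = 0"
    by (intro normal_part_tangent[OF T] subspace_scale[OF T] second_fundamental_form_map(1)[OF patch D])
  finally have II0: "II (?L a) (?L b) = 0" .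
  have "II (?L (r *\<^sub>R a)) (?L (s *\<^sub>R b)) = 0" for r s
    using II0 bilinear_lmul[OF data.II_bilinear] bilinear_rmul[OF data.II_bilinear] by simp
  then have "II (?L (a /\<^sub>R norm (?L a))) (?L (b /\<^sub>R norm (?L b))) = 0" .
  moreover have "?L v \<in> tangent_plane ?S (h p)" for v using differential_minimal_trace_data(2)[OF p patch harm] by blast
  moreover have "norm (?L (a /\<^sub>R norm (?L a))) = 1" "norm (?L (b /\<^sub>R norm (?L b))) = 1"
    "?L (a /\<^sub>R norm (?L a)) \<bullet> ?L (b /\<^sub>R norm (?L b)) = 0"
    using nz ab(3) by (simp_all add: linear_scale[OF data.L_linear])
  ultimately show ?thesis unfolding principal_directions_def II_def by blast
qed

end

context degree_one_surface
begin

text \<open>The coordinate vectors \<open>a\<close> and \<open>b\<close> of the polar coordinates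
  are orthogonal in \<open>M\<close> and are mapped to the meridian and parallel directions. At an
  immersed point the parallel has positive radius, so that \<open>\<sigma>\<close> can be divided
  out of the mixed derivative.\<close>

theorem radial_pullbacks_orthogonal:
  assumes harm: "harmonic_map A g h" and rad: "radially_symmetric M A g h" and det: "directions_determined image"
  shows "pullbacks_orthogonal M A g h"
proof -
  obtain D \<psi> c0 w1 w2 \<gamma> \<sigma> R \<Phi> and J :: "real set" where polar: "polar_coordinates M A g D \<psi>"
    and w: "norm w1 = 1" "norm w2 = 1" "w1 \<bullet> w2 = 0"
    and J: "open J" "smooth_on J \<gamma>" "smooth_on J \<sigma>" "\<forall>s\<in>J. \<gamma> s \<bullet> w1 = 0 \<and> \<gamma> s \<bullet> w2 = 0"
    and R: "smooth_on (fst ` D) R" "smooth_on (snd ` D) \<Phi>" "R ` fst ` D \<subseteq> J"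
    and hE: "\<forall>(r, \<phi>)\<in>D. h (\<psi> (r, \<phi>)) = c0 + \<gamma> (R r) + \<sigma> (R r) *\<^sub>R (cos (\<Phi> \<phi>) *\<^sub>R w1 + sin (\<Phi> \<phi>) *\<^sub>R w2)"
    using rad unfolding radially_symmetric_def by (elim exE conjE) (rule that)
  note polar = polar[unfolded polar_coordinates_def]
  note D = polar[THEN conjunct1] polar[THEN conjunct2, THEN conjunct2, THEN conjunct1]
    polar[THEN conjunct2, THEN conjunct2, THEN conjunct2, THEN conjunct2, THEN conjunct2, THEN conjunct1]
  define E where "E z = c0 + \<gamma> (R (fst z)) + \<sigma> (R (fst z)) *\<^sub>R (cos (\<Phi> (snd z)) *\<^sub>R w1 + sin (\<Phi> (snd z)) *\<^sub>R w2)" for z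
  have hE: "\<forall>z\<in>D. h (\<psi> z) = E z" using hE by (auto simp: E_def case_prod_unfold)
  have oD: "open (fst ` D)" "open (snd ` D)" by (rule open_image_fst[OF D(1)], rule open_image_snd[OF D(1)])
  have Ck: "\<forall>k. C_k_on k \<gamma> J" "\<forall>k. C_k_on k \<sigma> J" "\<forall>k. C_k_on k R (fst ` D)" "\<forall>k. C_k_on k \<Phi> (snd ` D)"
    using smooth_on_open_C_k[OF J(1,2)] smooth_on_open_C_k[OF J(1,3)] smooth_on_open_C_k[OF oD(1) R(1)] smooth_on_open_C_k[OF oD(2) R(2)]
    by simp_all
  have rev: "C_k_on k E D"
    "frechet_derivative E (at z) (1, 0) \<bullet> frechet_derivative E (at z) (0, 1) = 0"
    "\<sigma> (R (fst z)) \<noteq> 0 \<or> frechet_derivative E (at z) (0, 1) = 0"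
    "\<exists>l. \<sigma> (R (fst z)) *\<^sub>R second_derivative E z (0, 1) (1, 0) = l *\<^sub>R frechet_derivative E (at z) (0, 1)"
    if z: "z \<in> D" for z k
    unfolding E_def[abs_def]
    by (rule surface_of_revolution_facts[OF D(1) J(1) Ck(1,2,3) R(3) Ck(4) w J(4) z])+
  have E_image: "E ` D \<subseteq> image"
  proof
    fix q assume "q \<in> E ` D"
    then obtain z where "z \<in> D" "q = h (\<psi> z)" using hE by auto
    then show "q \<in> image" using D(2) by (auto simp: continuous_map_def)
  qed
  have null: "topspace M - \<psi> ` D \<in> null_sets area" using polar by (elim conjE)
  show ?thesis unfolding pullbacks_orthogonal_def
    using AE_not_in[OF null] AE_space AE_interior AE_immersion AE_preimage[OF det[unfolded directions_determined_def]]
  proof eventually_elim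
    case (elim p)
    let ?L = "differential A h p" and ?\<beta> = "metric_inner A g p"
    have p: "p \<in> topspace M" using elim(2) by simp
    then obtain z where z: "z \<in> D" "p = \<psi> z" using elim(1) by blast
    obtain c where c: "c \<in> A" "p \<in> fst c" "0 < snd c p $ 2" using elim(3) by blast
    note p = p elim(4) c
    define d where "d = frechet_derivative (snd (chart_at A p) \<circ> \<psi>) (at z)"
    note chain = differential_chain[OF D z(1) hE, folded z(2), folded d_def]
    have k: "chart_at A p \<in> A" "p \<in> fst (chart_at A p)" by (rule chart_at_facts[OF p(1)])+
    have bil: "bilinear ?\<beta>" unfolding metric_inner_eq_form by (rule metric_form_facts(1)[OF k])
    define a b where "a = d (1, 0)" and "b = d (0, 1)"
    have \<beta>: "?\<beta> a a = 1" "?\<beta> a b = 0" "0 < ?\<beta> b b"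
      using polar z unfolding a_def b_def d_def by (auto simp: Let_def)
    have "a \<noteq> 0" using \<beta>(1) bilinear_lzero[OF bil] by force
    have "b \<noteq> 0" using \<beta>(3) bilinear_lzero[OF bil] by force
    have L: "frechet_derivative E (at z) (1, 0) = ?L a" "frechet_derivative E (at z) (0, 1) = ?L b"
      using chain by (simp_all add: a_def b_def)
    have linL: "linear ?L" unfolding differential_eq_dh by (rule dh_derivative(2)[OF k])
    have "?L b \<noteq> 0" using \<open>b \<noteq> 0\<close> p(2) unfolding linear_injective_0[OF linL] by blast
    then have \<sigma>: "\<sigma> (R (fst z)) \<noteq> 0" using rev(3)[OF z(1)] L by simp
    obtain l where "\<sigma> (R (fst z)) *\<^sub>R second_derivative E z (0, 1) (1, 0) = l *\<^sub>R frechet_derivative E (at z) (0, 1)"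
      using rev(4)[OF z(1)] by blast
    then have "inverse (\<sigma> (R (fst z))) *\<^sub>R (\<sigma> (R (fst z)) *\<^sub>R second_derivative E z (0, 1) (1, 0))
        = (inverse (\<sigma> (R (fst z))) * l) *\<^sub>R frechet_derivative E (at z) (0, 1)" by simp
    then have mixed: "second_derivative E z (0, 1) (1, 0) = (inverse (\<sigma> (R (fst z))) * l) *\<^sub>R frechet_derivative E (at z) (0, 1)"
      using \<sigma> by simp
    have det: "\<exists>e1 e2. principal_directions image (h p) e1 e2 \<and>
        (\<forall>f1 f2. principal_directions image (h p) f1 f2 \<longrightarrow> f1 \<in> {e1, - e1, e2, - e2})"
      using elim(5) .
    then obtain \<phi> U z0 where patch: "regular_patch image (h p) \<phi> U z0"
      by (elim exE conjE principal_regular_patch)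
    have hp: "E z = h p" using hE z by simp
    have "?L a \<bullet> ?L b = 0" using rev(2)[OF z(1)] unfolding L .
    note prin = orthogonal_coordinates_principal[OF p harm patch D(1) rev(1)[OF z(1)] z(1) hp E_image L \<open>a \<noteq> 0\<close> \<open>b \<noteq> 0\<close> this mixed]
    have "?\<beta> (r *\<^sub>R a) (s *\<^sub>R b) = 0" for r s using \<beta>(2) by (simp add: bilinear_lmul[OF bil] bilinear_rmul[OF bil])
    then show ?case
      by (intro allI impI determined_pullbacks_orthogonal[OF p harm det prin])
  qed
qed

end

section \<open>The energy of a harmonic map and the curvature of its image\<close>

theorem theorem1:
  fixes M :: "'a topology" and A :: "'a chart set"
    and g :: "'a chart \<Rightarrow> real^2 \<Rightarrow> real^2^2" and h :: "'a \<Rightarrow> real^'n"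
  assumes "smooth_surface M A" and "compact_space M" and "riemannian_metric A g"
    and "harmonic_map A g h" and "degree_one M A g h"
    and "integrand_defined (h ` topspace M)"
  shows "Energy M A g h
        \<ge> (\<integral>\<^sup>+q\<in>h ` topspace M. curvature_integrand (h ` topspace M) q \<partial>hausdorff2)
    \<and> (\<integral>\<^sup>+q\<in>h ` topspace M. curvature_integrand (h ` topspace M) q \<partial>hausdorff2)
        \<ge> 2 * emeasure hausdorff2 (h ` topspace M)
    \<and> (Energy M A g h
          = (\<integral>\<^sup>+q\<in>h ` topspace M. curvature_integrand (h ` topspace M) q \<partial>hausdorff2)
        \<longleftrightarrow> pullbacks_orthogonal M A g h)
    \<and> (radially_symmetric M A g h \<and> directions_determined (h ` topspace M) \<longrightarrow>
        pullbacks_orthogonal M A g h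
        \<and> Energy M A g h
          = (\<integral>\<^sup>+q\<in>h ` topspace M. curvature_integrand (h ` topspace M) q \<partial>hausdorff2))"
proof -
  interpret riemannian_surface M A g
    by (rule riemannian_surface.intro[OF assms(1-3)])
  interpret degree_one_surface M A g h
  proof
    fix c assume c: "c \<in> A"
    show "smooth_on (chart_image c) (h \<circ> chart_inv c)"
    proof (rule smooth_on_componentwise)
      fix i
      have "smooth_function A (\<lambda>p. h p $ i)"
        using assms(4) unfolding harmonic_map_def harmonic_function_def by blast
      then show "smooth_on (chart_image c) (\<lambda>z. (h \<circ> chart_inv c) z $ i)"
        using c unfolding smooth_function_def chart_image_def chart_inv_def o_def by (auto simp: case_prod_unfold)
    qed
  qed (rule assms(5))
  have orth: "radially_symmetric M A g h \<and> directions_determined image \<longrightarrow> pullbacks_orthogonal M A g h"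
    using radial_pullbacks_orthogonal[OF assms(4)] by blast
  show ?thesis
    using energy_inequalities[OF assms(4,6)] orth by simp
qed

end
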